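(* Let $p\ge0$ and let $n$ and $\bar n$ be two weak solutions (as defined in the context, with this exponent $p$) of the model initial-value problem with nonnegative initial data $n^{\rm in}$, $\bar n^{\rm in}$ respectively, where $x^p n^{\rm in},\,x^p\bar n^{\rm in}\in L^1((0,1])$. With $c_p=p(p+3)$, $$\int_0^1 x^p|n(x,t)-\bar n(x,t)|\,dx\le e^{c_pt}\int_0^1x^p|n^{\rm in}-\bar n^{\rm in}|\,dx\qquad\text{for a.e. }t>0 .$$ For each nonnegative initial datum $n^{\rm in}$ satisfying $x^pn^{\rm in}\in L^1(0,1)$ for some $p\ge0$, there exists at most one weak solution of the model initial-value problem.
   Context: Notation: $Q=(0,1]\times(0,\infty)$ (compact subsets of $Q$ may touch $x=1$ but stay away from $x=0$ and $t=0$). Model initial-value problem: with flux $J=x^2\partial_x n+n^2-2xn$, $$\partial_t n-\partial_x J=0\ (0<x<1,\ t>0),\qquad J(1,t)=0\ (t>0),\qquad n(x,0)=n^{\rm in}(x)\ (0<x<1),$$ with no boundary condition imposed at $x=0$. Weak solution: given $n^{\rm in}\ge 0$ with $x^p n^{\rm in}\in L^1((0,1])$ for some $p\ge 0$, a function $n$ is a weak solution of this problem if (1) $n\ge0$ and $n,\ \partial_x n\in L^2_{\rm loc}(Q)$; (2) $x^p n\in L^1((0,1]\times(0,T))$ for every $T>0$; (3) $n(\cdot,t)\to n^{\rm in}$ in $L^1_{\rm loc}((0,1])$ as $t\to0^+$; (4) $\int_Q (n\,\partial_t\psi-J\,\partial_x\psi)\,dx\,dt=0$ for every $C^1$ test function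 $\psi$ with compact support in $Q$. *)

theory Defs
  imports "HOL-Analysis.Analysis"
begin

text \<open>Points of the space-time plane are pairs \<open>z = (x, t)\<close>.  Solutions and data represent classes modulo
  Lebesgue null sets; every condition on them is invariant under modification on a null set.\<close>

definition Q :: "(real \<times> real) set" where
  "Q = {0<..1} \<times> {0<..}"

text \<open>For non-open \<open>S\<close>, such as \<open>Q\<close>, the compact sets \<open>K\<close> may touch the part of the boundary
  that belongs to \<open>S\<close>.\<close>

definition Lloc :: "nat \<Rightarrow> 'a::euclidean_space set \<Rightarrow> ('a \<Rightarrow> real) \<Rightarrow> bool" where
  "Lloc q S f \<longleftrightarrow> set_borel_measurable lebesgue S f \<and>
     (\<forall>K. compact K \<and> K \<subseteq> S \<longrightarrow> set_integrable lebesgue K (\<lambda>z. \<bar>f z\<bar> ^ q))"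

text \<open>\<open>\<psi>\<close> is a \<open>C\<^sup>1\<close> function on \<open>S\<close> with compact support in \<open>S\<close> and partial derivatives
  \<open>\<psi>x\<close>, \<open>\<psi>t\<close>.  Derivatives are taken within \<open>S\<close>, hence are one-sided at \<open>x = 1\<close> when \<open>S = Q\<close>;
  there \<open>\<psi>\<close> need not vanish.\<close>

definition C1_test ::
  "(real \<times> real) set \<Rightarrow> (real \<times> real \<Rightarrow> real) \<Rightarrow> (real \<times> real \<Rightarrow> real) \<Rightarrow> (real \<times> real \<Rightarrow> real) \<Rightarrow> bool"
where
  "C1_test S \<psi> \<psi>x \<psi>t \<longleftrightarrow>
     continuous_on S \<psi>x \<and> continuous_on S \<psi>t \<and>
     (\<forall>z\<in>S. (\<psi> has_derivative (\<lambda>h. \<psi>x z * fst h + \<psi>t z * snd h)) (at z within S)) \<and>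
     (\<exists>K. compact K \<and> K \<subseteq> S \<and> (\<forall>z\<in>S - K. \<psi> z = 0))"

text \<open>\<open>g\<close> is the weak (distributional) derivative of \<open>f\<close> with respect to \<open>x\<close> on the open set \<open>U\<close>.\<close>

definition weak_dx ::
  "(real \<times> real) set \<Rightarrow> (real \<times> real \<Rightarrow> real) \<Rightarrow> (real \<times> real \<Rightarrow> real) \<Rightarrow> bool"
where
  "weak_dx U f g \<longleftrightarrow> Lloc 1 U f \<and> Lloc 1 U g \<and>
     (\<forall>\<phi> \<phi>x \<phi>t. C1_test U \<phi> \<phi>x \<phi>t \<longrightarrow>
        (LINT z:U|lebesgue. f z * \<phi>x z) = - (LINT z:U|lebesgue. g z * \<phi> z))"

text \<open>The flux \<open>J = x\<^sup>2 \<partial>\<^sub>x n + n\<^sup>2 - 2 x n\<close>, with \<open>nx\<close> in the role of \<open>\<partial>\<^sub>x n\<close>.\<close>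

definition flux :: "(real \<times> real \<Rightarrow> real) \<Rightarrow> (real \<times> real \<Rightarrow> real) \<Rightarrow> real \<times> real \<Rightarrow> real" where
  "flux n nx z = (fst z)\<^sup>2 * nx z + (n z)\<^sup>2 - 2 * fst z * n z"

definition initial_datum :: "real \<Rightarrow> (real \<Rightarrow> real) \<Rightarrow> bool" where
  "initial_datum p nin \<longleftrightarrow>
     (AE x in lebesgue. x \<in> {0<..1} \<longrightarrow> 0 \<le> nin x) \<and>
     set_integrable lebesgue {0<..1} (\<lambda>x. x powr p * nin x)"

text \<open>\<open>n(\<cdot>,t) \<rightarrow> nin\<close> in \<open>L\<^sup>1\<^sub>l\<^sub>o\<^sub>c((0,1])\<close> as \<open>t \<rightarrow> 0+\<close>.  As \<open>n\<close> is only determined almost everywhere,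
  its time slices are only determined for almost every \<open>t\<close>, so a null set \<open>N\<close> of times is
  discarded.  The integral is taken in \<open>[0,\<infinity>]\<close>, so no default value for non-integrable slices
  intervenes.\<close>

definition attains_initial :: "(real \<times> real \<Rightarrow> real) \<Rightarrow> (real \<Rightarrow> real) \<Rightarrow> bool" where
  "attains_initial n nin \<longleftrightarrow>
     (\<exists>N. negligible N \<and>
        (\<forall>K. compact K \<and> K \<subseteq> {0<..1} \<longrightarrow>
           ((\<lambda>t. \<integral>\<^sup>+x\<in>K. ennreal \<bar>n (x, t) - nin x\<bar> \<partial>lebesgue) \<longlongrightarrow> 0)
             (at 0 within {0<..} - N)))"

text \<open>Weak solution for a given exponent \<open>p\<close>.  The last integrand is integrable because
  \<open>n\<close> and \<open>nx\<close> are locally square integrable on \<open>Q\<close>.\<close>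

definition weak_solution_exp :: "real \<Rightarrow> (real \<Rightarrow> real) \<Rightarrow> (real \<times> real \<Rightarrow> real) \<Rightarrow> bool" where
  "weak_solution_exp p nin n \<longleftrightarrow>
     (AE z in lebesgue. z \<in> Q \<longrightarrow> 0 \<le> n z) \<and>
     (\<forall>T>0. set_integrable lebesgue ({0<..1} \<times> {0<..<T}) (\<lambda>z. fst z powr p * n z)) \<and>
     attains_initial n nin \<and>
     (\<exists>nx. weak_dx (interior Q) n nx \<and> Lloc 2 Q n \<and> Lloc 2 Q nx \<and>
        (\<forall>\<psi> \<psi>x \<psi>t. C1_test Q \<psi> \<psi>x \<psi>t \<longrightarrow>
           (LINT z:Q|lebesgue. n z * \<psi>t z - flux n nx z * \<psi>x z) = 0))"

text \<open>Weak solution without reference to a particular exponent: some admissible exponent works.\<close>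

definition weak_solution :: "(real \<Rightarrow> real) \<Rightarrow> (real \<times> real \<Rightarrow> real) \<Rightarrow> bool" where
  "weak_solution nin n \<longleftrightarrow> (\<exists>p\<ge>0. initial_datum p nin \<and> weak_solution_exp p nin n)"

end

theory Submission
  imports Defs
begin

text \<open>Let \<open>n\<close> and \<open>m\<close> be two solutions and \<open>w = n - m\<close>.  Formally
\<open>\<partial>\<^sub>t w = \<partial>\<^sub>x (H + F)\<close> with \<open>H = x\<^sup>2 \<partial>\<^sub>x w - 2 x w\<close> and \<open>F = n\<^sup>2 - m\<^sup>2 = (n + m) w\<close>.
Multiply by \<open>\<eta>(x) sgn w\<close> for a nondecreasing weight \<open>\<eta> \<ge> 0\<close> that vanishes, with its derivative,
at some \<open>\<epsilon> > 0\<close>, and integrate over \<open>(\<epsilon>, 1)\<close>.  The flux vanishes at \<open>x = 1\<close> and the weight vanishes at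
\<open>\<epsilon>\<close>.  The second derivative of the modulus is a nonnegative measure concentrated on \<open>w = 0\<close>: it
gives the diffusion a good sign and annihilates the terms in which it multiplies \<open>w\<close>.  The quadratic flux contributes
\<open>- \<eta>' (n + m) |w| \<le> 0\<close> because both solutions are nonnegative, and a last integration by parts of
\<open>- x\<^sup>2 \<eta>' \<partial>\<^sub>x |w|\<close> leaves a boundary term \<open>- \<eta>'(1) |w(1)| \<le> 0\<close>.  What remains is
\<open>d/dt \<integral> \<eta> |w| \<le> \<integral> ((x\<^sup>2 \<eta>')' + 2 x \<eta>') |w|\<close>.  For \<open>\<eta> = x\<^sup>p\<close> the factor on the right is
\<open>p (p + 3) x\<^sup>p\<close>.  The admissible weight \<open>x\<^sup>p (1 - \<epsilon> / x)\<^sup>3\<close> gives \<open>x\<^sup>p\<close> times a bounded continuous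
function of \<open>\<epsilon> / x\<close> with value \<open>p (p + 3)\<close> at \<open>0\<close>; hence \<open>\<epsilon> \<rightarrow> 0\<close> is harmless as soon as
\<open>x\<^sup>p |w|\<close> is integrable, and Gronwall's inequality (\<open>Gronwall_AE\<close>) gives the estimate.

The rigorous argument has to cope with two facts: \<open>\<partial>\<^sub>t w\<close> is only a distribution, and \<open>n\<^sup>2\<close> is only
integrable.  By the du Bois-Reymond lemma a solution has a representative that is absolutely
continuous in \<open>x\<close> and satisfies
\<open>\<integral>\<^sub>x\<^sup>1 n(t) - \<integral>\<^sub>x\<^sup>1 n(t - h) = - \<integral>\<^sub>t\<^sub>-\<^sub>h\<^sup>t J(x, s) ds\<close> (\<open>weak_solution_imp_mild\<close>); the condition
\<open>J(1, t) = 0\<close> is contained in this identity.  Let \<open>\<beta>\<close> be smooth and convex and test with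
\<open>\<zeta> = \<eta> \<beta>'(w(t))\<close>.  Convexity bounds the backward difference of \<open>\<integral> \<eta> \<beta>(w)\<close> by the tested difference
(\<open>discrete_inequality\<close>), in which the flux appears averaged over \<open>[t - h, t]\<close>.  For \<open>h \<rightarrow> 0\<close> the
function \<open>B = \<partial>\<^sub>x \<zeta>\<close>, which is only square integrable, may be paired with averages of \<open>H\<close> but not
with those of \<open>F\<close>; the latter are therefore integrated by parts first, since \<open>\<zeta>\<close> is bounded and \<open>\<partial>\<^sub>x F\<close>
is integrable, and the integration by parts is undone in the limit (\<open>limit_inequality\<close>).  Then
\<open>\<beta>(s) = (s\<^sup>2 + \<delta>\<^sup>2)\<^sup>1\<^sup>/\<^sup>2\<close> with \<open>\<delta> \<rightarrow> 0\<close> produces the modulus (\<open>contraction_cutoff\<close>), the earlier of the two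
times tends to \<open>0\<close> along times that are good for both solutions (\<open>cutoff_estimate\<close>), and
\<open>\<epsilon> \<rightarrow> 0\<close> (\<open>integral_inequality\<close>).

Uniqueness follows from the estimate with equal data.  Two solutions may come with different
exponents, but since \<open>x \<le> 1\<close> both are solutions for the larger one (\<open>weak_solution_exp_mono\<close>).\<close>

section \<open>Averages over short intervals\<close>

text \<open>The averages look backwards, so that an average of the flux over \<open>[t - h, t]\<close> is what drives the
change of a solution from time \<open>t - h\<close> to time \<open>t\<close>.\<close>

definition avg :: "real \<Rightarrow> (real \<Rightarrow> real) \<Rightarrow> real \<Rightarrow> real" where
  "avg h f x = (LINT s:{x - h..x}|lborel. f s) / h"

definition time_avg :: "real \<Rightarrow> (real \<times> real \<Rightarrow> real) \<Rightarrow> real \<times> real \<Rightarrow> real" where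
  "time_avg h A z = avg h (\<lambda>s. A (fst z, s)) (snd z)"

text \<open>A fixed null sequence of interval lengths: countably many exceptional null sets still form a null set, and
the convergence theorems for sequences apply.\<close>

definition step :: "nat \<Rightarrow> real" where
  "step k = 1 / real (Suc k)"

lemma step_pos: "0 < step k"
  by (simp add: step_def)

lemma step_tendsto: "step \<longlonglongrightarrow> 0"
  unfolding step_def using LIMSEQ_inverse_real_of_nat by (simp add: inverse_eq_divide)

lemma measurable_avg_param [measurable]:
  assumes [measurable]: "case_prod A \<in> borel_measurable (M \<Otimes>\<^sub>M lborel)" "X \<in> borel_measurable M"
  shows "(\<lambda>z. avg h (A z) (X z)) \<in> borel_measurable M"
proof -
  have eq: "(\<lambda>z. avg h (A z) (X z)) =
    (\<lambda>z. (LINT s|lborel. (if X z - h \<le> s \<and> s \<le> X z then A z s else 0)) / h)"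
    unfolding avg_def set_lebesgue_integral_def
    by (intro ext arg_cong2[where f="(/)"] Bochner_Integration.integral_cong) (auto simp: indicator_def)
  show ?thesis unfolding eq by measurable
qed

lemma measurable_time_avg [measurable]:
  assumes [measurable]: "A \<in> borel_measurable borel"
  shows "time_avg h A \<in> borel_measurable borel"
proof -
  have "(\<lambda>z. avg h ((\<lambda>z s. A (fst z, s)) z) (snd z)) \<in> borel_measurable (borel :: (real \<times> real) measure)"
    by (rule measurable_avg_param) (auto simp: borel_prod[symmetric] split_beta)
  then show ?thesis by (simp add: time_avg_def[abs_def])
qed

text \<open>Lebesgue's differentiation theorem.  The version for forward cubes is applied to the reflected
function, which turns forward intervals into backward ones.\<close>

lemma avg_tendsto_AE:
  fixes f :: "real \<Rightarrow> real"
  assumes "integrable lborel f"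
  shows "AE x in lborel. (\<lambda>k. avg (step k) f x) \<longlonglongrightarrow> f x"
proof -
  have [measurable]: "f \<in> borel_measurable borel" using assms by auto
  define g where "g = (\<lambda>x. f (- x))"
  have g: "integrable lborel g"
    using lborel_integrable_real_affine[OF assms, of "-1" 0] by (simp add: g_def)
  have gi: "set_integrable lborel S g" if "S \<in> sets borel" for S
    unfolding set_integrable_def using integrable_mult_indicator[OF _ g] that by auto
  have "g integrable_on cbox a b" for a b
    using set_borel_integral_eq_integral(1)[OF gi[of "cbox a b"]] by auto
  from integrable_ccontinuous_explicit[of g, OF this] obtain N where
    N: "negligible N" and
    lim: "\<And>x e. \<lbrakk>x \<notin> N; 0 < e\<rbrakk> \<Longrightarrow> \<exists>d>0. \<forall>h. 0 < h \<and> h < d \<longrightarrow>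
       norm (integral (cbox x (x + h *\<^sub>R One)) g /\<^sub>R h ^ DIM(real) - g x) < e"
    by blast
  have *: "(\<lambda>k. avg (step k) f (-x)) \<longlonglongrightarrow> f (-x)" if x: "x \<notin> N" for x
  proof (rule LIMSEQ_I)
    fix e :: real assume "0 < e"
    then obtain d where d: "d > 0" "\<And>h. 0 < h \<Longrightarrow> h < d \<Longrightarrow> \<bar>integral {x..x + h} g / h - g x\<bar> < e"
      using lim[OF x \<open>0 < e\<close>] by (auto simp: divide_inverse mult.commute)
    obtain k0 where k0: "\<And>k. k \<ge> k0 \<Longrightarrow> \<bar>step k\<bar> < d"
      using LIMSEQ_D[OF step_tendsto d(1)] by auto
    have eq: "avg h f (-x) = integral {x..x+h} g / h" for h
    proof -
      have "{y. - x - h \<le> - y \<and> - y \<le> - x} = {x..x + h}" by auto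
      then show ?thesis
        unfolding avg_def using set_borel_integral_eq_integral(2)[OF gi[of "{x..x+h}"]]
        by (subst set_integral_reflect) (simp add: g_def)
    qed
    have "norm (avg (step k) f (-x) - f (-x)) < e" if "k \<ge> k0" for k
      using d(2)[OF step_pos, of k] k0[OF that] by (simp add: eq g_def)
    then show "\<exists>no. \<forall>n\<ge>no. norm (avg (step n) f (-x) - f (-x)) < e" by blast
  qed
  have "AE x in lebesgue. x \<notin> N"
    using N AE_not_in negligible_iff_null_sets by blast
  then have "AE x in lebesgue. (\<lambda>k. avg (step k) f (-x)) \<longlonglongrightarrow> f (-x)"
    using * by (auto elim!: AE_mp)
  then have AE1: "AE x in lborel. (\<lambda>k. avg (step k) f (-x)) \<longlonglongrightarrow> f (-x)"
    by (simp add: AE_completion_iff)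
  have "AE x in lborel. (\<lambda>k. avg (step k) f (-(0 + (-1) * x))) \<longlonglongrightarrow> f (-(0 + (-1) * x))"
    by (rule AE_borel_affine[OF _ _ AE1]) (auto intro: measurable_limit2)
  then show ?thesis by simp
qed

text \<open>Jensen's inequality for the square: expand the nonnegative integral of \<open>(f - c)\<^sup>2\<close>, where \<open>c\<close> is the average.\<close>

lemma avg_square_le:
  assumes "0 < h" "set_integrable lborel {x - h..x} f" "set_integrable lborel {x - h..x} (\<lambda>s. (f s)\<^sup>2)"
  shows "(avg h f x)\<^sup>2 \<le> avg h (\<lambda>s. (f s)\<^sup>2) x"
proof -
  let ?m = "avg h f x"
  have i: "(LINT s:{x - h..x}|lborel. f s) = h * ?m" using assms(1) by (simp add: avg_def)
  have c: "set_integrable lborel {x - h..x} (\<lambda>s. c::real)" for c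
    unfolding set_integrable_def
    by (intro integrable_scaleR_left integrable_real_indicator) (auto simp: emeasure_lborel_Icc_eq)
  have "0 \<le> (LINT s:{x - h..x}|lborel. (f s - ?m)\<^sup>2)"
    unfolding set_lebesgue_integral_def by (rule Bochner_Integration.integral_nonneg) simp
  also have "\<dots> = (LINT s:{x - h..x}|lborel. (f s)\<^sup>2 - (2 * ?m) * f s + ?m\<^sup>2)"
    by (simp add: power2_diff algebra_simps)
  also have "\<dots> = (LINT s:{x - h..x}|lborel. (f s)\<^sup>2) - (2 * ?m) * (LINT s:{x - h..x}|lborel. f s)
      + (LINT s:{x - h..x}|lborel. ?m\<^sup>2)"
    using assms c by (subst set_integral_add set_integral_diff; simp)+
  also have "(LINT s:{x - h..x}|lborel. ?m\<^sup>2) = h * ?m\<^sup>2"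
    using assms(1) by (simp add: set_lebesgue_integral_def)
  finally have "h * ?m\<^sup>2 \<le> (LINT s:{x - h..x}|lborel. (f s)\<^sup>2)"
    by (simp add: i power2_eq_square)
  then show ?thesis using assms(1) by (simp add: avg_def[of h "\<lambda>s. (f s)\<^sup>2"] field_simps)
qed

lemma abs_avg_le:
  assumes "0 < h"
  shows "\<bar>avg h f x\<bar> \<le> avg h (\<lambda>s. \<bar>f s\<bar>) x"
proof -
  have "\<bar>LINT s:{x - h..x}|lborel. f s\<bar> \<le> (LINT s:{x - h..x}|lborel. \<bar>f s\<bar>)"
    unfolding set_lebesgue_integral_def
    by (rule order_trans[OF integral_abs_bound]) (simp add: abs_mult)
  then show ?thesis using assms by (simp add: avg_def divide_right_mono)
qed

text \<open>Interchange the integrations: each time \<open>s\<close> is covered by the intervals \<open>[t - h, t]\<close> with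
\<open>t \<in> [s, s + h]\<close>, a set of measure \<open>h\<close>.\<close>

lemma nn_integral_time_avg_nonneg_le:
  assumes [measurable]: "A \<in> borel_measurable borel" and "\<And>z. 0 \<le> A z" and h: "0 < h"
  shows "(\<integral>\<^sup>+z. ennreal (time_avg h A z) \<partial>lborel) \<le> (\<integral>\<^sup>+z. ennreal (A z) \<partial>lborel)"
proof -
  have [measurable]: "A \<in> borel_measurable (borel \<Otimes>\<^sub>M borel)" by (simp add: borel_prod)
  have le: "ennreal (time_avg h A (y, t)) \<le>
      (\<integral>\<^sup>+s. ennreal (1 / h) * (indicator {t - h..t} s * ennreal (A (y, s))) \<partial>lborel)" for y t
  proof -
    have "ennreal (time_avg h A (y, t)) =
       ennreal (1 / h) * ennreal (LINT s:{t - h..t}|lborel. A (y, s))"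
      using h by (simp add: time_avg_def avg_def ennreal_mult'[symmetric])
    also have "ennreal (LINT s:{t - h..t}|lborel. A (y, s)) \<le>
       (\<integral>\<^sup>+s. ennreal (indicator {t - h..t} s * A (y, s)) \<partial>lborel)"
    proof (cases "integrable lborel (\<lambda>s. indicator {t - h..t} s * A (y, s))")
      case True
      then show ?thesis unfolding set_lebesgue_integral_def
        by (subst nn_integral_eq_integral) (auto simp: assms)
    next
      case False
      then show ?thesis unfolding set_lebesgue_integral_def by (simp add: not_integrable_integral_eq)
    qed
    also have "\<dots> = (\<integral>\<^sup>+s. indicator {t - h..t} s * ennreal (A (y, s)) \<partial>lborel)"
      by (intro nn_integral_cong) (auto simp: indicator_def)
    finally show ?thesis
      by (subst nn_integral_cmult) (auto simp: mult_left_mono)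
  qed
  have I: "(\<integral>\<^sup>+t. ennreal (1 / h) * (indicator {t - h..t} s * ennreal (A (y, s))) \<partial>lborel)
      = ennreal (A (y, s))" for s y
  proof -
    have "(\<integral>\<^sup>+t. ennreal (1 / h) * (indicator {t - h..t} s * ennreal (A (y, s))) \<partial>lborel)
      = (\<integral>\<^sup>+t. (ennreal (1 / h) * ennreal (A (y, s))) * indicator {s..s + h} t \<partial>lborel)"
      by (intro nn_integral_cong) (auto simp: indicator_def)
    also have "\<dots> = ennreal (1 / h) * ennreal (A (y, s)) * ennreal h"
      using h by (subst nn_integral_cmult_indicator) auto
    also have "\<dots> = ennreal (A (y, s))"
      using h assms(2) by (simp add: ennreal_mult'[symmetric])
    finally show ?thesis .
  qed
  have m[measurable]: "(\<lambda>(t, s). indicator {t - h..t} s :: ennreal) \<in> borel_measurable (borel \<Otimes>\<^sub>M borel)"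
  proof -
    have "(\<lambda>(t, s). indicator {t - h..t} s :: ennreal) = (\<lambda>(t, s). if t - h \<le> s \<and> s \<le> t then 1 else 0)"
      by (auto simp: fun_eq_iff indicator_def)
    then show ?thesis by simp
  qed
  have "(\<integral>\<^sup>+z. ennreal (time_avg h A z) \<partial>lborel) =
        (\<integral>\<^sup>+y. \<integral>\<^sup>+t. ennreal (time_avg h A (y, t)) \<partial>lborel \<partial>lborel)"
    by (subst lborel.nn_integral_fst) (auto simp: lborel_prod)
  also have "\<dots> \<le> (\<integral>\<^sup>+y. \<integral>\<^sup>+t. \<integral>\<^sup>+s. ennreal (1 / h) * (indicator {t - h..t} s * ennreal (A (y, s)))
      \<partial>lborel \<partial>lborel \<partial>lborel)"
    by (intro nn_integral_mono le)
  also have "\<dots> = (\<integral>\<^sup>+y. \<integral>\<^sup>+s. \<integral>\<^sup>+t. ennreal (1 / h) * (indicator {t - h..t} s * ennreal (A (y, s)))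
      \<partial>lborel \<partial>lborel \<partial>lborel)"
    by (intro nn_integral_cong lborel_pair.Fubini') measurable
  also have "\<dots> = (\<integral>\<^sup>+y. \<integral>\<^sup>+s. ennreal (A (y, s)) \<partial>lborel \<partial>lborel)"
    by (simp only: I)
  also have "\<dots> = (\<integral>\<^sup>+z. ennreal (A z) \<partial>lborel)"
    by (subst lborel.nn_integral_fst) (auto simp: lborel_prod)
  finally show ?thesis .
qed

lemma AE_lborel_prodI:
  assumes "AE x in lborel. AE y in lborel. P (x, y)" "Measurable.pred borel P"
  shows "AE z in (lborel :: (real \<times> real) measure). P z"
  unfolding lborel_prod[symmetric]
  by (rule lborel_pair.AE_pair_measure)
     (use assms in \<open>auto simp: pred_def borel_prod[symmetric] space_pair_measure\<close>)

lemma AE_lborel_prodI2: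
  assumes "AE t in lborel. AE x in lborel. P (x, t)" "Measurable.pred borel P"
  shows "AE z in (lborel :: (real \<times> real) measure). P z"
proof (rule AE_lborel_prodI[OF _ assms(2)])
  have "{z \<in> space (lborel \<Otimes>\<^sub>M lborel). P (fst z, snd z)} \<in> sets (lborel \<Otimes>\<^sub>M lborel)"
    unfolding lborel_prod using assms(2) by (simp add: pred_def)
  from lborel_pair.AE_commute[of "\<lambda>x t. P (x, t)", OF this] assms(1)
  show "AE x in lborel. AE t in lborel. P (x, t)" by blast
qed

lemma AE_lborel_prodD2:
  assumes "AE z in (lborel :: (real \<times> real) measure). P z"
  shows "AE y in lborel. AE x in lborel. P (x, y)"
proof -
  have eq: "distr (lborel \<Otimes>\<^sub>M lborel) (lborel \<Otimes>\<^sub>M lborel) (\<lambda>(x, y). (y, x)) =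
      (lborel :: (real \<times> real) measure)"
    using lborel_pair.distr_pair_swap[where 'a=real and 'b=real] by (metis lborel_prod)
  have "AE z in distr (lborel \<Otimes>\<^sub>M lborel) (lborel \<Otimes>\<^sub>M lborel) (\<lambda>(x, y). (y, x)). P z"
    unfolding eq by (rule assms)
  then have "AE z in (lborel \<Otimes>\<^sub>M lborel). P ((\<lambda>(x, y). (y, x)) z)"
    by (rule AE_distrD[rotated]) measurable
  from lborel_pair.AE_pair[OF this] show ?thesis by simp
qed

lemma time_avg_tendsto_AE:
  assumes A: "integrable lborel A"
  shows "AE z in lborel. (\<lambda>k. time_avg (step k) A z) \<longlonglongrightarrow> A z"
proof (rule AE_lborel_prodI)
  have [measurable]: "A \<in> borel_measurable borel" using A by auto
  have "AE y in lborel. integrable lborel (\<lambda>s. A (y, s))"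
    using A unfolding lborel_prod[symmetric] by (rule lborel_pair.AE_integrable_fst')
  then show "AE y in lborel. AE t in lborel. (\<lambda>k. time_avg (step k) A (y, t)) \<longlonglongrightarrow> A (y, t)"
    by (rule AE_mp) (auto simp: time_avg_def intro!: AE_I2 avg_tendsto_AE)
  show "Measurable.pred borel (\<lambda>z. (\<lambda>k. time_avg (step k) A z) \<longlonglongrightarrow> A z)"
    by (rule measurable_limit2) auto
qed

text \<open>Averaging does not increase the norm, so Scheffe's lemma upgrades convergence almost everywhere.\<close>

lemma time_avg_tendsto_L1:
  assumes A: "integrable lborel A"
  shows "(\<lambda>k. \<integral>\<^sup>+z. ennreal \<bar>time_avg (step k) A z - A z\<bar> \<partial>lborel) \<longlonglongrightarrow> 0"
proof -
  have [measurable]: "A \<in> borel_measurable borel" using A by auto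
  have "(\<integral>\<^sup>+z. ennreal \<bar>time_avg (step k) A z\<bar> \<partial>lborel) \<le> (\<integral>\<^sup>+z. ennreal \<bar>A z\<bar> \<partial>lborel)" for k
  proof -
    have "(\<integral>\<^sup>+z. ennreal \<bar>time_avg (step k) A z\<bar> \<partial>lborel)
       \<le> (\<integral>\<^sup>+z. ennreal (time_avg (step k) (\<lambda>z. \<bar>A z\<bar>) z) \<partial>lborel)"
      by (intro nn_integral_mono ennreal_leI) (simp add: time_avg_def abs_avg_le step_pos)
    also have "\<dots> \<le> (\<integral>\<^sup>+z. ennreal \<bar>A z\<bar> \<partial>lborel)"
      by (rule nn_integral_time_avg_nonneg_le) (auto simp: step_pos)
    finally show ?thesis .
  qed
  then show ?thesis
    using Scheffe_lemma2[of "\<lambda>k. time_avg (step k) A" lborel A] time_avg_tendsto_AE[OF A] A by simp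
qed

text \<open>Scheffe's lemma is applied to the signed squares \<open>x |x|\<close>, whose integrals are controlled by Jensen's
inequality; the elementary bound \<open>(a - b)\<^sup>2 \<le> 2 |a |a| - b |b||\<close> returns to the squared difference.\<close>

lemma time_avg_tendsto_L2:
  assumes A: "integrable lborel A" and A2: "integrable lborel (\<lambda>z. (A z)\<^sup>2)"
  shows "(\<lambda>k. \<integral>\<^sup>+z. ennreal ((time_avg (step k) A z - A z)\<^sup>2) \<partial>lborel) \<longlonglongrightarrow> 0"
proof -
  have [measurable]: "A \<in> borel_measurable borel" using A by auto
  let ?s = "\<lambda>x::real. x * \<bar>x\<bar>"
  have a2: "\<bar>?s x\<bar> = x\<^sup>2" for x by (simp add: abs_mult power2_eq_square)
  have AE1: "AE z in lborel. \<forall>k. set_integrable lborel {snd z - step k..snd z} (\<lambda>s. A (fst z, s)) \<and>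
     set_integrable lborel {snd z - step k..snd z} (\<lambda>s. (A (fst z, s))\<^sup>2)"
  proof -
    have "AE y in lborel. integrable lborel (\<lambda>s. A (y, s))"
      using A unfolding lborel_prod[symmetric] by (rule lborel_pair.AE_integrable_fst')
    moreover have "AE y in lborel. integrable lborel (\<lambda>s. (A (y, s))\<^sup>2)"
      using A2 unfolding lborel_prod[symmetric] by (rule lborel_pair.AE_integrable_fst')
    ultimately have "AE y in lborel. integrable lborel (\<lambda>s. A (y, s)) \<and> integrable lborel (\<lambda>s. (A (y, s))\<^sup>2)"
      by auto
    then have "AE y in lborel. AE t in (lborel::real measure).
        integrable lborel (\<lambda>s. A (y, s)) \<and> integrable lborel (\<lambda>s. (A (y, s))\<^sup>2)" by auto
    moreover have "Measurable.pred (borel :: (real \<times> real) measure)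
        (\<lambda>z. integrable lborel (\<lambda>s. A (fst z, s)) \<and> integrable lborel (\<lambda>s. (A (fst z, s))\<^sup>2))"
    proof -
      have [measurable]: "A \<in> borel_measurable (borel \<Otimes>\<^sub>M borel)" by (simp add: borel_prod)
      show ?thesis unfolding borel_prod[symmetric] by measurable
    qed
    ultimately have "AE z in (lborel :: (real \<times> real) measure).
        integrable lborel (\<lambda>s. A (fst z, s)) \<and> integrable lborel (\<lambda>s. (A (fst z, s))\<^sup>2)"
      by (intro AE_lborel_prodI) (simp_all only: fst_conv)
    then show ?thesis
      unfolding set_integrable_def
      by (rule AE_mp) (auto intro!: AE_I2 integrable_mult_indicator simp del: real_scaleR_def)
  qed
  have "(\<integral>\<^sup>+z. ennreal \<bar>?s (time_avg (step k) A z)\<bar> \<partial>lborel) \<le> (\<integral>\<^sup>+z. ennreal \<bar>?s (A z)\<bar> \<partial>lborel)" for k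
  proof -
    have "(\<integral>\<^sup>+z. ennreal \<bar>?s (time_avg (step k) A z)\<bar> \<partial>lborel)
       \<le> (\<integral>\<^sup>+z. ennreal (time_avg (step k) (\<lambda>z. (A z)\<^sup>2) z) \<partial>lborel)"
    proof (rule nn_integral_mono_AE)
      show "AE z in lborel. ennreal \<bar>?s (time_avg (step k) A z)\<bar> \<le>
          ennreal (time_avg (step k) (\<lambda>z. (A z)\<^sup>2) z)"
        using AE1
      proof eventually_elim
        case (elim z)
        then show ?case
          unfolding a2 time_avg_def by (intro ennreal_leI avg_square_le step_pos) auto
      qed
    qed
    also have "\<dots> \<le> (\<integral>\<^sup>+z. ennreal ((A z)\<^sup>2) \<partial>lborel)"
      by (rule nn_integral_time_avg_nonneg_le) (auto simp: step_pos)
    finally show ?thesis by (simp only: a2)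
  qed
  moreover have "AE z in lborel. (\<lambda>k. ?s (time_avg (step k) A z)) \<longlonglongrightarrow> ?s (A z)"
    using time_avg_tendsto_AE[OF A] by (rule AE_mp) (auto intro!: AE_I2 tendsto_intros)
  moreover have "integrable lborel (\<lambda>z. ?s (A z))"
    by (rule Bochner_Integration.integrable_bound[OF A2]) (auto simp: abs_mult power2_eq_square)
  ultimately have *: "(\<lambda>k. \<integral>\<^sup>+z. ennreal \<bar>?s (time_avg (step k) A z) - ?s (A z)\<bar> \<partial>lborel) \<longlonglongrightarrow> 0"
    using Scheffe_lemma2[of "\<lambda>k z. ?s (time_avg (step k) A z)" lborel "\<lambda>z. ?s (A z)"] by simp
  have dbl: "x \<le> 2 * \<bar>y\<bar>" if "x \<le> \<bar>y\<bar>" for x y :: real using that by linarith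
  have le: "(a - b)\<^sup>2 \<le> 2 * \<bar>?s a - ?s b\<bar>" for a b :: real
  proof -
    consider "a \<ge> 0" "b \<ge> 0" | "a \<ge> 0" "b \<le> 0" | "a \<le> 0" "b \<ge> 0" | "a \<le> 0" "b \<le> 0" by linarith
    then show ?thesis
    proof cases
      case 1
      have "(a - b)\<^sup>2 = \<bar>a - b\<bar> * \<bar>a - b\<bar>" by (simp add: power2_eq_square)
      also have "\<dots> \<le> \<bar>a - b\<bar> * \<bar>a + b\<bar>" using 1 by (intro mult_left_mono) auto
      also have "\<dots> = \<bar>a * a - b * b\<bar>" by (simp add: abs_mult[symmetric] algebra_simps)
      finally have "(a - b)\<^sup>2 \<le> 2 * \<bar>a * a - b * b\<bar>" by (rule dbl)
      then show ?thesis using 1 by simp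
    next
      case 2
      have "(a - b)\<^sup>2 \<le> 2 * (a * a + b * b)"
        using sum_squares_ge_zero[of "a + b" 0] by (simp add: power2_eq_square algebra_simps)
      then show ?thesis using 2 by (simp add: abs_of_nonneg)
    next
      case 3
      have "(a - b)\<^sup>2 \<le> 2 * (a * a + b * b)"
        using sum_squares_ge_zero[of "a + b" 0] by (simp add: power2_eq_square algebra_simps)
      moreover have "\<bar>?s a - ?s b\<bar> = a * a + b * b" using 3
        by (subst abs_of_nonpos) (auto simp: algebra_simps intro: order_trans[of _ 0])
      ultimately show ?thesis by simp
    next
      case 4
      have "(a - b)\<^sup>2 = \<bar>a - b\<bar> * \<bar>a - b\<bar>" by (simp add: power2_eq_square)
      also have "\<dots> \<le> \<bar>a - b\<bar> * \<bar>a + b\<bar>" using 4 by (intro mult_left_mono) auto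
      also have "\<dots> = \<bar>a * a - b * b\<bar>" by (simp add: abs_mult[symmetric] algebra_simps)
      also have "\<dots> = \<bar>?s a - ?s b\<bar>" using 4 by (simp add: abs_minus_commute)
      finally show ?thesis by (rule dbl)
    qed
  qed
  have "(\<lambda>k. 2 * (\<integral>\<^sup>+z. ennreal \<bar>?s (time_avg (step k) A z) - ?s (A z)\<bar> \<partial>lborel)) \<longlonglongrightarrow> 2 * 0"
    by (intro ennreal_tendsto_cmult *) auto
  then have lim0: "(\<lambda>k. 2 * (\<integral>\<^sup>+z. ennreal \<bar>?s (time_avg (step k) A z) - ?s (A z)\<bar> \<partial>lborel)) \<longlonglongrightarrow> 0"
    by simp
  show ?thesis
  proof (rule tendsto_sandwich[OF _ _ tendsto_const lim0])
    show "\<forall>\<^sub>F k in sequentially. (\<integral>\<^sup>+z. ennreal ((time_avg (step k) A z - A z)\<^sup>2) \<partial>lborel)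
       \<le> 2 * (\<integral>\<^sup>+z. ennreal \<bar>?s (time_avg (step k) A z) - ?s (A z)\<bar> \<partial>lborel)"
    proof (intro always_eventually allI)
      fix k
      have "(\<integral>\<^sup>+z. ennreal ((time_avg (step k) A z - A z)\<^sup>2) \<partial>lborel)
        \<le> (\<integral>\<^sup>+z. 2 * ennreal \<bar>?s (time_avg (step k) A z) - ?s (A z)\<bar> \<partial>lborel)"
        by (intro nn_integral_mono) (use le in \<open>simp add: ennreal_mult'[symmetric] ennreal_leI flip: ennreal_numeral\<close>)
      then show "(\<integral>\<^sup>+z. ennreal ((time_avg (step k) A z - A z)\<^sup>2) \<partial>lborel)
       \<le> 2 * (\<integral>\<^sup>+z. ennreal \<bar>?s (time_avg (step k) A z) - ?s (A z)\<bar> \<partial>lborel)"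
        by (subst (asm) nn_integral_cmult) auto
    qed
  qed simp
qed

section \<open>Absolutely continuous functions on an interval\<close>

text \<open>Absolute continuity on \<open>[a, b]\<close>, with the density \<open>u'\<close> carried along: the density of a solution is
its given weak derivative, and only the increments of \<open>u\<close> enter the argument.\<close>

definition AC :: "real \<Rightarrow> real \<Rightarrow> (real \<Rightarrow> real) \<Rightarrow> (real \<Rightarrow> real) \<Rightarrow> bool" where
  "AC a b u u' \<longleftrightarrow> set_integrable lborel {a..b} u' \<and>
     (\<forall>x\<in>{a..b}. u x = u a + (LINT s:{a..x}|lborel. u' s))"

lemma set_integral_Icc_split:
  fixes f :: "real \<Rightarrow> real"
  assumes "set_integrable lborel {a..b} f" "a \<le> x" "x \<le> b"
  shows "(LINT s:{a..b}|lborel. f s) = (LINT s:{a..x}|lborel. f s) + (LINT s:{x..b}|lborel. f s)"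
proof -
  have U: "{a..b} = {a..x} \<union> {x..b}" using assms by auto
  have i: "set_integrable lborel {a..x} f" "set_integrable lborel {x..b} f"
    by (rule set_integrable_subset[OF assms(1)]; use assms in auto)+
  show ?thesis
    unfolding U
    by (rule set_integral_Un_AE) (use i AE_lborel_singleton[of x] in \<open>auto elim!: eventually_mono\<close>)
qed

lemma set_integral_singleton [simp]: "(LINT s:{x}|lborel. f s) = (0::real)" for x :: real
proof -
  have "AE s in lborel. indicator {x} s *\<^sub>R f s = 0"
    using AE_lborel_singleton[of x] by eventually_elim auto
  then show ?thesis unfolding set_lebesgue_integral_def by (rule integral_eq_zero_AE)
qed

lemma continuous_on_indefinite_integral:
  fixes f :: "real \<Rightarrow> real"
  assumes "set_integrable lborel {a..b} f"
  shows "continuous_on {a..b} (\<lambda>x. LINT s:{a..x}|lborel. f s)"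
proof -
  have "f integrable_on {a..b}" using set_borel_integral_eq_integral(1)[OF assms] .
  then have c: "continuous_on {a..b} (\<lambda>x. integral {a..x} f)"
    by (rule indefinite_integral_continuous_1)
  show ?thesis
  proof (rule continuous_on_eq[OF c])
    fix x assume "x \<in> {a..b}"
    then have "set_integrable lborel {a..x} f" by (intro set_integrable_subset[OF assms]) auto
    then show "integral {a..x} f = (LINT s:{a..x}|lborel. f s)"
      by (simp add: set_borel_integral_eq_integral(2))
  qed
qed

lemma set_integrable_mult_continuous:
  fixes f g :: "real \<Rightarrow> real"
  assumes f: "set_integrable lborel {a..b} f" and g: "continuous_on {a..b} g"
  shows "set_integrable lborel {a..b} (\<lambda>x. f x * g x)"
proof -
  have "bounded (g ` {a..b})" using compact_continuous_image[OF g] compact_imp_bounded by blast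
  then obtain C where "\<forall>x\<in>{a..b}. \<bar>g x\<bar> \<le> C" by (auto simp: bounded_iff)
  then have C: "\<And>x. x \<in> {a..b} \<Longrightarrow> \<bar>g x\<bar> \<le> C" by blast
  have m: "(\<lambda>x. indicator {a..b} x *\<^sub>R g x) \<in> borel_measurable borel"
    using g by (intro borel_measurable_continuous_on_indicator) auto
  have mf: "(\<lambda>x. indicator {a..b} x *\<^sub>R f x) \<in> borel_measurable lborel"
    using f by (auto simp: set_integrable_def)
  have "integrable lborel (\<lambda>x. C * \<bar>indicator {a..b} x *\<^sub>R f x\<bar>)"
    using f unfolding set_integrable_def by (intro integrable_mult_right integrable_abs)
  moreover have "(\<lambda>x. (indicator {a..b} x *\<^sub>R f x) * (indicator {a..b} x *\<^sub>R g x)) \<in> borel_measurable lborel"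
    using m mf by measurable
  ultimately have "integrable lborel (\<lambda>x. (indicator {a..b} x *\<^sub>R f x) * (indicator {a..b} x *\<^sub>R g x))"
  proof (rule Bochner_Integration.integrable_bound, intro AE_I2)
    fix x
    show "norm ((indicator {a..b} x *\<^sub>R f x) * (indicator {a..b} x *\<^sub>R g x)) \<le> norm (C * \<bar>indicator {a..b} x *\<^sub>R f x\<bar>)"
    proof (cases "x \<in> {a..b}")
      case True
      then have "\<bar>g x\<bar> \<le> \<bar>C\<bar>" using C[OF True] by linarith
      then have "\<bar>g x\<bar> * \<bar>f x\<bar> \<le> \<bar>C\<bar> * \<bar>f x\<bar>" by (rule mult_right_mono) simp
      then show ?thesis using True by (simp add: abs_mult mult.commute)
    qed auto
  qed
  also have "(\<lambda>x. (indicator {a..b} x *\<^sub>R f x) * (indicator {a..b} x *\<^sub>R g x)) = (\<lambda>x. indicator {a..b} x *\<^sub>R (f x * g x))"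
    by (auto simp: indicator_def)
  finally show ?thesis unfolding set_integrable_def .
qed

lemma set_integrable_continuous_mult:
  fixes f g :: "real \<Rightarrow> real"
  assumes "set_integrable lborel {a..b} f" "continuous_on {a..b} g"
  shows "set_integrable lborel {a..b} (\<lambda>x. g x * f x)"
proof -
  have "(\<lambda>x. g x * f x) = (\<lambda>x. f x * g x)" by (rule ext) (rule mult.commute)
  then show ?thesis using set_integrable_mult_continuous[OF assms] by (simp only:)
qed

text \<open>The two-dimensional statement, applied to a function that depends on the first variable only through
the indicator of an interval of length one.\<close>

lemma avg_tendsto_L1:
  fixes f :: "real \<Rightarrow> real"
  assumes f: "integrable lborel f"
  shows "(\<lambda>k. \<integral>\<^sup>+x. ennreal \<bar>avg (step k) f x - f x\<bar> \<partial>lborel) \<longlonglongrightarrow> 0"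
proof -
  have [measurable]: "f \<in> borel_measurable borel" using f by auto
  define A where "A = (\<lambda>z. indicator {0..1::real} (fst z) * f (snd z))"
  have A: "integrable lborel A"
  proof -
    have "integrable (lborel \<Otimes>\<^sub>M lborel) (\<lambda>(x, y). indicator {0..1::real} x * f y)"
    proof (rule lborel_pair.Fubini_integrable)
      show "integrable lborel (\<lambda>x. LINT y|lborel. norm (case (x, y) of (x, y) \<Rightarrow> indicator {0..1::real} x * f y))"
        by (simp add: abs_mult)
      show "AE x in lborel. integrable lborel (\<lambda>y. case (x, y) of (x, y) \<Rightarrow> indicator {0..1::real} x * f y)"
        using f by auto
    qed auto
    moreover have "A = (\<lambda>(x, y). indicator {0..1::real} x * f y)" by (auto simp: A_def fun_eq_iff)
    ultimately show ?thesis by (simp only: lborel_prod)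
  qed
  have av: "time_avg h A (y, t) = indicator {0..1} y * avg h f t" for h y t
    by (simp add: time_avg_def avg_def A_def)
  have Ae: "A (y, t) = indicator {0..1} y * f t" for y t by (simp add: A_def)
  have [measurable]: "avg h f \<in> borel_measurable borel" for h
  proof -
    have "(\<lambda>x. avg h ((\<lambda>_. f) x) ((\<lambda>x. x) x)) \<in> borel_measurable (borel :: real measure)"
      by (rule measurable_avg_param) measurable
    then show ?thesis by simp
  qed
  have "(\<integral>\<^sup>+z. ennreal \<bar>time_avg (step k) A z - A z\<bar> \<partial>lborel) =
        (\<integral>\<^sup>+x. ennreal \<bar>avg (step k) f x - f x\<bar> \<partial>lborel)" for k
  proof -
    have "(\<integral>\<^sup>+z. ennreal \<bar>time_avg (step k) A z - A z\<bar> \<partial>lborel) =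
      (\<integral>\<^sup>+z. indicator {0..1::real} (fst z) * ennreal \<bar>avg (step k) f (snd z) - f (snd z)\<bar> \<partial>(lborel \<Otimes>\<^sub>M lborel))"
      unfolding lborel_prod
      by (intro nn_integral_cong) (auto simp: av Ae indicator_def)
    also have "\<dots> = (\<integral>\<^sup>+y. \<integral>\<^sup>+x. indicator {0..1::real} y * ennreal \<bar>avg (step k) f x - f x\<bar> \<partial>lborel \<partial>lborel)"
      by (subst lborel.nn_integral_fst[symmetric]) auto
    also have "\<dots> = (\<integral>\<^sup>+x. ennreal \<bar>avg (step k) f x - f x\<bar> \<partial>lborel)"
      by (simp add: nn_integral_cmult nn_integral_multc)
    finally show ?thesis .
  qed
  then show ?thesis using time_avg_tendsto_L1[OF A] by simp
qed

lemma continuous_on_avg: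
  fixes f :: "real \<Rightarrow> real"
  assumes f: "integrable lborel f" and "0 < h"
  shows "continuous_on {a..b} (avg h f)"
proof -
  have i: "set_integrable lborel {c..d} f" for c d
    unfolding set_integrable_def by (rule integrable_mult_indicator[OF _ f]) auto
  let ?F = "\<lambda>x. LINT s:{a - h..x}|lborel. f s"
  have F: "continuous_on {a - h..b} ?F" by (rule continuous_on_indefinite_integral[OF i])
  have c: "continuous_on {a..b} (\<lambda>x. (?F x - ?F (x - h)) / h)"
    using \<open>0 < h\<close>
  proof (intro continuous_intros)
    show "continuous_on {a..b} ?F" by (rule continuous_on_subset[OF F]) (use \<open>0 < h\<close> in auto)
    show "continuous_on {a..b} (\<lambda>x. ?F (x - h))"
      by (rule continuous_on_compose2[OF F, of _ "\<lambda>x. x - h"]) (use \<open>0 < h\<close> in \<open>auto intro!: continuous_intros\<close>)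
  qed auto
  show ?thesis
  proof (rule continuous_on_eq[OF c])
    fix x assume "x \<in> {a..b}"
    then show "(?F x - ?F (x - h)) / h = avg h f x"
      using set_integral_Icc_split[OF i, of "a - h" "x - h" x] \<open>0 < h\<close> by (simp add: avg_def)
  qed
qed

lemma AC_integrable: "AC a b u u' \<Longrightarrow> set_integrable lborel {a..b} u'"
  by (simp add: AC_def)

lemma AC_eq: "AC a b u u' \<Longrightarrow> x \<in> {a..b} \<Longrightarrow> u x = u a + (LINT s:{a..x}|lborel. u' s)"
  unfolding AC_def by blast

lemma AC_endpoints:
  assumes "AC a b u u'" "a \<le> b"
  shows "(LINT s:{a..b}|lborel. u' s) = u b - u a"
proof -
  have "b \<in> {a..b}" using assms(2) by simp
  then have "u b = u a + (LINT s:{a..b}|lborel. u' s)" using assms(1) unfolding AC_def by blast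
  then show ?thesis by simp
qed

lemma AC_increment:
  assumes "AC a b u u'" "a \<le> x" "x \<le> y" "y \<le> b"
  shows "(LINT s:{x..y}|lborel. u' s) = u y - u x"
proof -
  have "set_integrable lborel {a..y} u'"
    by (rule set_integrable_subset[OF AC_integrable[OF assms(1)]]) (use assms in auto)
  from set_integral_Icc_split[OF this assms(2,3)]
  have "(LINT s:{x..y}|lborel. u' s) = (LINT s:{a..y}|lborel. u' s) - (LINT s:{a..x}|lborel. u' s)" by simp
  moreover have "u y = u a + (LINT s:{a..y}|lborel. u' s)" "u x = u a + (LINT s:{a..x}|lborel. u' s)"
    by (rule AC_eq[OF assms(1)]; use assms in simp)+
  ultimately show ?thesis by linarith
qed

lemma AC_continuous_on:
  assumes "AC a b u u'"
  shows "continuous_on {a..b} u"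
proof (rule continuous_on_eq[of _ "\<lambda>x. u a + (LINT s:{a..x}|lborel. u' s)"])
  show "continuous_on {a..b} (\<lambda>x. u a + (LINT s:{a..x}|lborel. u' s))"
    by (rule continuous_on_add[OF continuous_on_const continuous_on_indefinite_integral[OF AC_integrable[OF assms]]])
qed (rule AC_eq[OF assms, symmetric])

lemma AC_C1:
  assumes "\<And>x. x \<in> {a..b} \<Longrightarrow> (u has_real_derivative u' x) (at x within {a..b})" "continuous_on {a..b} u'"
  shows "AC a b u u'"
  unfolding AC_def
proof (intro conjI ballI)
  show "set_integrable lborel {a..b} u'" by (rule borel_integrable_atLeastAtMost'[OF assms(2)])
  fix x assume x: "x \<in> {a..b}"
  have "integral\<^sup>L lborel (\<lambda>s. indicator {a..x} s *\<^sub>R u' s) = u x - u a"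
  proof (rule integral_FTC_atLeastAtMost)
    show "continuous_on {a..x} u'" by (rule continuous_on_subset[OF assms(2)]) (use x in auto)
    fix s assume "a \<le> s" "s \<le> x"
    then have "(u has_real_derivative u' s) (at s within {a..x})"
      using x by (intro DERIV_subset[OF assms(1)]) auto
    then show "(u has_vector_derivative u' s) (at s within {a..x})"
      by (simp add: has_real_derivative_iff_has_vector_derivative)
  qed (use x in auto)
  then show "u x = u a + (LINT s:{a..x}|lborel. u' s)" by (simp add: set_lebesgue_integral_def)
qed

text \<open>The density can be integrated from the right end, where the trace of a solution at \<open>x = 1\<close> sits.\<close>

lemma AC_from_right:
  assumes "set_integrable lborel {a..b} u'" "a \<le> b"
    and "\<And>x. x \<in> {a..b} \<Longrightarrow> u x = u b - (LINT s:{x..b}|lborel. u' s)"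
  shows "AC a b u u'"
  unfolding AC_def
proof (intro conjI ballI assms)
  fix x assume x: "x \<in> {a..b}"
  then have "a \<in> {a..b}" by simp
  then have "u x = u b - (LINT s:{x..b}|lborel. u' s)" "u a = u b - (LINT s:{a..b}|lborel. u' s)"
    using assms(3)[OF x] assms(3)[of a] by blast+
  moreover have "(LINT s:{a..b}|lborel. u' s) = (LINT s:{a..x}|lborel. u' s) + (LINT s:{x..b}|lborel. u' s)"
    by (rule set_integral_Icc_split[OF assms(1)]) (use x in auto)
  ultimately show "u x = u a + (LINT s:{a..x}|lborel. u' s)" by linarith
qed

lemma AC_cong:
  assumes "AC a b u u'" "\<And>x. x \<in> {a..b} \<Longrightarrow> u x = v x" "\<And>x. x \<in> {a..b} \<Longrightarrow> u' x = v' x"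
  shows "AC a b v v'"
  unfolding AC_def
proof (intro conjI ballI)
  have "set_integrable lborel {a..b} v' = set_integrable lborel {a..b} u'"
    by (rule set_integrable_cong) (use assms(3) in auto)
  then show "set_integrable lborel {a..b} v'" using AC_integrable[OF assms(1)] by simp
  fix x assume x: "x \<in> {a..b}"
  then have a: "a \<in> {a..b}" by simp
  have "(LINT s:{a..x}|lborel. v' s) = (LINT s:{a..x}|lborel. u' s)"
    by (rule set_lebesgue_integral_cong) (use assms(3) x in auto)
  then show "v x = v a + (LINT s:{a..x}|lborel. v' s)"
    using AC_eq[OF assms(1) x] assms(2)[OF x] assms(2)[OF a] by linarith
qed

lemma AC_add:
  assumes "AC a b u u'" "AC a b v v'"
  shows "AC a b (\<lambda>x. u x + v x) (\<lambda>x. u' x + v' x)"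
  unfolding AC_def
proof (intro conjI ballI)
  show "set_integrable lborel {a..b} (\<lambda>x. u' x + v' x)"
    by (intro set_integral_add(1) AC_integrable[OF assms(1)] AC_integrable[OF assms(2)])
  fix x assume x: "x \<in> {a..b}"
  have "set_integrable lborel {a..x} u'" "set_integrable lborel {a..x} v'"
    by (rule set_integrable_subset[OF AC_integrable]; use assms x in auto)+
  then have "(LINT s:{a..x}|lborel. u' s + v' s) = (LINT s:{a..x}|lborel. u' s) + (LINT s:{a..x}|lborel. v' s)"
    by (rule set_integral_add(2))
  then show "u x + v x = u a + v a + (LINT s:{a..x}|lborel. u' s + v' s)"
    using AC_eq[OF assms(1) x] AC_eq[OF assms(2) x] by linarith
qed

lemma AC_cmult:
  assumes "AC a b u u'"
  shows "AC a b (\<lambda>x. c * u x) (\<lambda>x. c * u' x)"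
  unfolding AC_def
proof (intro conjI ballI)
  show "set_integrable lborel {a..b} (\<lambda>x. c * u' x)"
    by (intro set_integrable_mult_right AC_integrable[OF assms])
  fix x assume "x \<in> {a..b}"
  then have "c * u x = c * (u a + (LINT s:{a..x}|lborel. u' s))"
    by (intro arg_cong[of _ _ "(*) c"] AC_eq[OF assms])
  then show "c * u x = c * u a + (LINT s:{a..x}|lborel. c * u' s)" by (simp only: set_integral_mult_right distrib_left)
qed

lemma AC_diff:
  assumes "AC a b u u'" "AC a b v v'"
  shows "AC a b (\<lambda>x. u x - v x) (\<lambda>x. u' x - v' x)"
  using AC_add[OF assms(1) AC_cmult[OF assms(2), of "-1"]] by simp

text \<open>The chain rule.  Replace the density by its continuous averages \<open>g\<^sub>k\<close>, which converge in \<open>L\<^sup>1\<close>; the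
primitives \<open>v\<^sub>k\<close> are continuously differentiable and converge uniformly, and the classical chain rule passes to
the limit.\<close>

lemma AC_compose:
  assumes u: "AC a b u u'"
    and phi: "\<And>y. (\<phi> has_real_derivative \<phi>' y) (at y)" and phi': "continuous_on UNIV \<phi>'"
  shows "AC a b (\<lambda>x. \<phi> (u x)) (\<lambda>x. \<phi>' (u x) * u' x)"
proof -
  have cu: "continuous_on {a..b} u" by (rule AC_continuous_on[OF u])
  have iu: "set_integrable lborel {a..b} u'" by (rule AC_integrable[OF u])
  have cpu: "continuous_on {a..b} (\<lambda>x. \<phi>' (u x))"
    by (rule continuous_on_compose2[OF phi' cu]) simp
  have int: "set_integrable lborel {a..b} (\<lambda>x. \<phi>' (u x) * u' x)"
    by (rule set_integrable_continuous_mult[OF iu cpu])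
  define f where "f = (\<lambda>x. indicator {a..b} x * u' x)"
  have f: "integrable lborel f" using iu by (simp add: set_integrable_def f_def)
  have [measurable]: "f \<in> borel_measurable borel" using f by auto
  define g where "g = (\<lambda>k. avg (step k) f)"
  have gc: "continuous_on {c..d} (g k)" for k c d
    unfolding g_def by (rule continuous_on_avg[OF f step_pos])
  have gcU: "continuous_on UNIV (g k)" for k
    unfolding continuous_on_eq_continuous_at[OF open_UNIV]
  proof
    fix x
    have "continuous_on {x - 1<..<x + 1} (g k)" by (rule continuous_on_subset[OF gc[of "x - 1" "x + 1"]]) auto
    then show "isCont (g k) x" by (simp add: continuous_on_eq_continuous_at)
  qed
  have [measurable]: "g k \<in> borel_measurable borel" for k
    by (rule borel_measurable_continuous_onI[OF gcU])
  have L1: "(\<lambda>k. \<integral>\<^sup>+x. ennreal \<bar>g k x - f x\<bar> \<partial>lborel) \<longlonglongrightarrow> 0"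
    unfolding g_def by (rule avg_tendsto_L1[OF f])
  \<comment> \<open>The \<open>L\<^sup>1\<close> error of the densities bounds the uniform error of the primitives.\<close>
  define e where "e = (\<lambda>k. LINT x:{a..b}|lborel. \<bar>g k x - f x\<bar>)"
  have fi: "set_integrable lborel {a..b} f"
    unfolding set_integrable_def by (rule integrable_mult_indicator[OF _ f]) auto
  have gi: "set_integrable lborel {a..b} (g k)" for k by (rule borel_integrable_atLeastAtMost'[OF gc])
  have di: "set_integrable lborel {a..b} (\<lambda>x. \<bar>g k x - f x\<bar>)" for k
    by (intro set_integrable_abs set_integral_diff(1) fi gi)
  have e0: "e \<longlonglongrightarrow> 0"
  proof -
    have le: "ennreal (e k) \<le> (\<integral>\<^sup>+x. ennreal \<bar>g k x - f x\<bar> \<partial>lborel)" for k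
    proof -
      have "ennreal (e k) = (\<integral>\<^sup>+x. ennreal (indicator {a..b} x * \<bar>g k x - f x\<bar>) \<partial>lborel)"
        unfolding e_def set_lebesgue_integral_def using di[of k]
        by (subst nn_integral_eq_integral) (auto simp: set_integrable_def)
      also have "\<dots> \<le> (\<integral>\<^sup>+x. ennreal \<bar>g k x - f x\<bar> \<partial>lborel)"
        by (intro nn_integral_mono) (auto simp: indicator_def)
      finally show ?thesis .
    qed
    have "(\<lambda>k. ennreal (e k)) \<longlonglongrightarrow> 0"
      by (rule tendsto_sandwich[OF _ _ tendsto_const L1]) (auto simp: le)
    moreover have "0 \<le> e k" for k
      unfolding e_def set_lebesgue_integral_def by (rule Bochner_Integration.integral_nonneg) simp
    ultimately show ?thesis using tendsto_ennreal_iff[of e sequentially 0] by simp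
  qed
  have fu: "(LINT s:{a..x}|lborel. f s) = (LINT s:{a..x}|lborel. u' s)" if "x \<le> b" for x
    by (rule set_lebesgue_integral_cong) (use that in \<open>auto simp: f_def\<close>)
  have sub: "set_integrable lborel {a..x} F" if "set_integrable lborel {a..b} F" "x \<le> b" for F :: "real \<Rightarrow> real" and x
    by (rule set_integrable_subset[OF that(1)]) (use that in auto)
  define v where "v = (\<lambda>k x. u a + (LINT s:{a..x}|lborel. g k s))"
  have vu: "\<bar>v k x - u x\<bar> \<le> e k" if x: "x \<in> {a..b}" for k x
  proof -
    have xb: "x \<le> b" using x by simp
    have "v k x - u x = (LINT s:{a..x}|lborel. g k s - f s)"
      using set_integral_diff(2)[OF sub[OF gi[of k] xb] sub[OF fi xb]] AC_eq[OF u x] fu[OF xb]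
      unfolding v_def by linarith
    also have "\<bar>\<dots>\<bar> \<le> (LINT s:{a..x}|lborel. \<bar>g k s - f s\<bar>)"
      unfolding set_lebesgue_integral_def by (rule order_trans[OF integral_abs_bound]) (simp add: abs_mult)
    also have "\<dots> \<le> e k"
      unfolding e_def set_lebesgue_integral_def using di[of k] sub[OF di[of k] xb] x
      by (intro integral_mono) (auto simp: set_integrable_def indicator_def)
    finally show ?thesis .
  qed
  have vd: "(v k has_real_derivative g k x) (at x within {a..b})" if "x \<in> {a..b}" for k x
  proof -
    have "((\<lambda>x. integral {a..x} (g k)) has_real_derivative g k x) (at x within {a..b})"
      by (rule integral_has_real_derivative[OF gc that])
    then have d: "((\<lambda>x. u a + integral {a..x} (g k)) has_real_derivative g k x) (at x within {a..b})"
      using DERIV_add[OF DERIV_const] by fastforce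
    show ?thesis
    proof (rule has_field_derivative_transform_within[OF d, of 1])
      fix y assume "y \<in> {a..b}"
      then show "u a + integral {a..y} (g k) = v k y"
        unfolding v_def by (subst set_borel_integral_eq_integral(2)[OF sub[OF gi]]) auto
    qed (use that in auto)
  qed
  have cv: "continuous_on {a..b} (v k)" for k
    using vd by (intro DERIV_continuous_on) auto
  have cpv: "continuous_on {a..b} (\<lambda>x. \<phi>' (v k x))" for k
    by (rule continuous_on_compose2[OF phi' cv]) simp
  have ACk: "AC a b (\<lambda>x. \<phi> (v k x)) (\<lambda>x. \<phi>' (v k x) * g k x)" for k
  proof (rule AC_C1)
    fix x assume "x \<in> {a..b}"
    show "((\<lambda>x. \<phi> (v k x)) has_real_derivative \<phi>' (v k x) * g k x) (at x within {a..b})"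
      using DERIV_chain2[OF phi vd[OF \<open>x \<in> {a..b}\<close>, of k]] by simp
  next
    show "continuous_on {a..b} (\<lambda>x. \<phi>' (v k x) * g k x)"
      by (intro continuous_intros cpv gc)
  qed
  \<comment> \<open>All \<open>v\<^sub>k\<close> take values in one compact interval, on which \<open>\<phi>'\<close> is bounded by \<open>C\<close>.\<close>
  obtain M where "\<forall>x\<in>{a..b}. \<bar>u x\<bar> \<le> M"
    using compact_imp_bounded[OF compact_continuous_image[OF cu compact_Icc]] by (auto simp: bounded_iff)
  then have M: "\<And>x. x \<in> {a..b} \<Longrightarrow> \<bar>u x\<bar> \<le> M" by blast
  obtain E where E: "\<And>k. \<bar>e k\<bar> \<le> E"
    using convergent_imp_Bseq[of e] e0 by (auto simp: convergent_def Bseq_def)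
  have "compact (\<phi>' ` {-(M + E)..M + E})"
    by (intro compact_continuous_image continuous_on_subset[OF phi']) auto
  then have "bounded (\<phi>' ` {-(M + E)..M + E})" by (rule compact_imp_bounded)
  then obtain C where "\<forall>y\<in>{-(M + E)..M + E}. \<bar>\<phi>' y\<bar> \<le> C" by (auto simp: bounded_iff)
  then have C: "\<And>y. \<bar>y\<bar> \<le> M + E \<Longrightarrow> \<bar>\<phi>' y\<bar> \<le> C" by (auto simp: abs_le_iff)
  have Cv: "\<bar>\<phi>' (v k x)\<bar> \<le> C" and Cu: "\<bar>\<phi>' (u x)\<bar> \<le> C" if "x \<in> {a..b}" for k x
  proof -
    have "\<bar>e k\<bar> \<le> E" "\<bar>v k x - u x\<bar> \<le> e k" "\<bar>u x\<bar> \<le> M" using E vu[OF that] M[OF that] by auto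
    then show "\<bar>\<phi>' (v k x)\<bar> \<le> C" "\<bar>\<phi>' (u x)\<bar> \<le> C" by (auto intro!: C)
  qed
  have vlim: "(\<lambda>k. v k x) \<longlonglongrightarrow> u x" if "x \<in> {a..b}" for x
  proof -
    have "(\<lambda>k. \<bar>v k x - u x\<bar>) \<longlonglongrightarrow> 0"
      by (rule tendsto_sandwich[OF _ _ tendsto_const e0]) (use vu[OF that] in auto)
    then show ?thesis using LIM_zero_cancel tendsto_rabs_zero_iff by blast
  qed
  show ?thesis
    unfolding AC_def
  proof (intro conjI ballI int)
    fix x assume x: "x \<in> {a..b}"
    then have xb: "x \<le> b" by simp
    have sc: "continuous_on {a..x} F" if "continuous_on {a..b} F" for F :: "real \<Rightarrow> real"
      by (rule continuous_on_subset[OF that]) (use xb in auto)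
    have I1: "set_integrable lborel {a..x} (\<lambda>s. \<phi>' (v k s) * (g k s - f s))" for k
      by (rule set_integrable_continuous_mult[OF sub[OF set_integral_diff(1)[OF gi[of k] fi] xb] sc[OF cpv]])
    have I2: "set_integrable lborel {a..x} (\<lambda>s. (\<phi>' (v k s) - \<phi>' (u s)) * f s)" for k
      by (rule set_integrable_continuous_mult[OF sub[OF fi xb] continuous_on_diff[OF sc[OF cpv] sc[OF cpu]]])
    have I3: "set_integrable lborel {a..x} (\<lambda>s. \<phi>' (u s) * f s)"
      by (rule set_integrable_continuous_mult[OF sub[OF fi xb] sc[OF cpu]])
    \<comment> \<open>Split \<open>\<phi>'(v\<^sub>k) g\<^sub>k\<close> into \<open>\<phi>'(v\<^sub>k) (g\<^sub>k - f) + (\<phi>'(v\<^sub>k) - \<phi>'(u)) f + \<phi>'(u) f\<close>.\<close>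
    have l1: "(\<lambda>k. LINT s:{a..x}|lborel. \<phi>' (v k s) * (g k s - f s)) \<longlonglongrightarrow> 0"
    proof (rule tendsto_rabs_zero_cancel, rule tendsto_sandwich[OF _ _ tendsto_const])
      show "(\<lambda>k. C * e k) \<longlonglongrightarrow> 0" using tendsto_mult_left[OF e0, of C] by simp
      show "\<forall>\<^sub>F k in sequentially. \<bar>LINT s:{a..x}|lborel. \<phi>' (v k s) * (g k s - f s)\<bar> \<le> C * e k"
      proof (intro always_eventually allI)
        fix k
        have "\<bar>LINT s:{a..x}|lborel. \<phi>' (v k s) * (g k s - f s)\<bar>
          \<le> (LINT s:{a..x}|lborel. \<bar>\<phi>' (v k s) * (g k s - f s)\<bar>)"
          unfolding set_lebesgue_integral_def by (rule order_trans[OF integral_abs_bound]) (simp add: abs_mult)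
        also have "\<dots> \<le> (LINT s:{a..b}|lborel. C * \<bar>g k s - f s\<bar>)"
        proof -
          have "set_integrable lborel {a..x} (\<lambda>s. \<bar>\<phi>' (v k s) * (g k s - f s)\<bar>)"
            by (intro set_integrable_abs I1)
          moreover have "set_integrable lborel {a..b} (\<lambda>s. C * \<bar>g k s - f s\<bar>)" using di by simp
          moreover have "indicator {a..x} s * \<bar>\<phi>' (v k s) * (g k s - f s)\<bar> \<le> indicator {a..b} s * (C * \<bar>g k s - f s\<bar>)" for s
            using Cv[of s k] xb order_trans[OF abs_ge_zero Cv[of s k]] by (auto simp: indicator_def abs_mult mult_right_mono)
          ultimately show ?thesis
            unfolding set_lebesgue_integral_def set_integrable_def by (intro integral_mono) auto
        qed
        also have "\<dots> = C * e k" by (simp add: e_def)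
        finally show "\<bar>LINT s:{a..x}|lborel. \<phi>' (v k s) * (g k s - f s)\<bar> \<le> C * e k" .
      qed
    qed auto
    have l2: "(\<lambda>k. LINT s:{a..x}|lborel. (\<phi>' (v k s) - \<phi>' (u s)) * f s) \<longlonglongrightarrow> (LINT s:{a..x}|lborel. 0)"
      unfolding set_lebesgue_integral_def
    proof (rule integral_dominated_convergence[where w="\<lambda>s. 2 * C * \<bar>f s\<bar>"])
      show "integrable lborel (\<lambda>s. 2 * C * \<bar>f s\<bar>)" using f by auto
      show "(\<lambda>s. indicator {a..x} s *\<^sub>R ((\<phi>' (v k s) - \<phi>' (u s)) * f s)) \<in> borel_measurable lborel" for k
        using I2[of k] by (auto simp: set_integrable_def)
      show "AE s in lborel. (\<lambda>k. indicator {a..x} s *\<^sub>R ((\<phi>' (v k s) - \<phi>' (u s)) * f s)) \<longlonglongrightarrow> indicator {a..x} s *\<^sub>R 0"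
      proof (intro AE_I2)
        fix s
        show "(\<lambda>k. indicator {a..x} s *\<^sub>R ((\<phi>' (v k s) - \<phi>' (u s)) * f s)) \<longlonglongrightarrow> indicator {a..x} s *\<^sub>R 0"
        proof (cases "s \<in> {a..x}")
          case True
          then have "(\<lambda>k. \<phi>' (v k s)) \<longlonglongrightarrow> \<phi>' (u s)"
            using vlim[of s] xb phi' by (intro continuous_on_tendsto_compose[OF phi']) auto
          then have "(\<lambda>k. (\<phi>' (v k s) - \<phi>' (u s)) * f s) \<longlonglongrightarrow> (\<phi>' (u s) - \<phi>' (u s)) * f s"
            by (intro tendsto_intros)
          then show ?thesis using True by simp
        qed auto
      qed
      show "AE s in lborel. norm (indicator {a..x} s *\<^sub>R ((\<phi>' (v k s) - \<phi>' (u s)) * f s)) \<le> 2 * C * \<bar>f s\<bar>" for k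
      proof (intro AE_I2)
        fix s
        have "\<bar>(\<phi>' (v k s) - \<phi>' (u s)) * f s\<bar> \<le> 2 * C * \<bar>f s\<bar>" if "s \<in> {a..x}"
          unfolding abs_mult using Cv[of s k] Cu[of s] that xb by (intro mult_right_mono) auto
        moreover have "0 \<le> C" using order_trans[OF abs_ge_zero Cu[OF x]] .
        ultimately show "norm (indicator {a..x} s *\<^sub>R ((\<phi>' (v k s) - \<phi>' (u s)) * f s)) \<le> 2 * C * \<bar>f s\<bar>"
          by (auto simp: indicator_def)
      qed
    qed auto
    have dec: "(LINT s:{a..x}|lborel. \<phi>' (v k s) * g k s) =
       (LINT s:{a..x}|lborel. \<phi>' (v k s) * (g k s - f s)) + (LINT s:{a..x}|lborel. (\<phi>' (v k s) - \<phi>' (u s)) * f s)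
       + (LINT s:{a..x}|lborel. \<phi>' (u s) * f s)" for k
      unfolding set_integral_add(2)[OF I1 I2, symmetric] set_integral_add(2)[OF set_integral_add(1)[OF I1 I2] I3, symmetric]
      by (rule arg_cong[where f="set_lebesgue_integral lborel {a..x}"]) (simp add: fun_eq_iff algebra_simps)
    have "(\<lambda>k. LINT s:{a..x}|lborel. \<phi>' (v k s) * g k s) \<longlonglongrightarrow> 0 + 0 + (LINT s:{a..x}|lborel. \<phi>' (u s) * f s)"
      unfolding dec using l1 l2 by (intro tendsto_intros) simp_all
    then have "(\<lambda>k. \<phi> (v k a) + (LINT s:{a..x}|lborel. \<phi>' (v k s) * g k s)) \<longlonglongrightarrow>
        \<phi> (u a) + (LINT s:{a..x}|lborel. \<phi>' (u s) * f s)"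
      by (intro tendsto_add) (simp_all add: v_def)
    moreover have "\<phi> (v k a) + (LINT s:{a..x}|lborel. \<phi>' (v k s) * g k s) = \<phi> (v k x)" for k
      using AC_eq[OF ACk[of k] x] by simp
    ultimately have "(\<lambda>k. \<phi> (v k x)) \<longlonglongrightarrow> \<phi> (u a) + (LINT s:{a..x}|lborel. \<phi>' (u s) * f s)" by simp
    moreover have "(\<lambda>k. \<phi> (v k x)) \<longlonglongrightarrow> \<phi> (u x)"
      using vlim[OF x] DERIV_isCont[OF phi] by (rule isCont_tendsto_compose[rotated])
    ultimately have "\<phi> (u x) = \<phi> (u a) + (LINT s:{a..x}|lborel. \<phi>' (u s) * f s)"
      using LIMSEQ_unique by blast
    also have "(LINT s:{a..x}|lborel. \<phi>' (u s) * f s) = (LINT s:{a..x}|lborel. \<phi>' (u s) * u' s)"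
      by (rule set_lebesgue_integral_cong) (use xb in \<open>auto simp: f_def\<close>)
    finally show "\<phi> (u x) = \<phi> (u a) + (LINT s:{a..x}|lborel. \<phi>' (u s) * u' s)" .
  qed
qed

text \<open>Polarisation reduces products to squares, that is, to the chain rule.\<close>

lemma AC_mult:
  assumes "AC a b u u'" "AC a b v v'"
  shows "AC a b (\<lambda>x. u x * v x) (\<lambda>x. u' x * v x + u x * v' x)"
proof -
  have sq: "AC a b (\<lambda>x. (f x)\<^sup>2) (\<lambda>x. 2 * f x * f' x)" if "AC a b f f'" for f f'
    by (rule AC_compose[OF that, of "\<lambda>y. y\<^sup>2" "\<lambda>y. 2 * y"]) (auto intro!: derivative_eq_intros continuous_intros)
  have "AC a b (\<lambda>x. (1/2) * ((u x + v x)\<^sup>2 - (u x)\<^sup>2 - (v x)\<^sup>2))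
     (\<lambda>x. (1/2) * (2 * (u x + v x) * (u' x + v' x) - 2 * u x * u' x - 2 * v x * v' x))"
    by (intro AC_cmult AC_diff sq AC_add assms)
  then show ?thesis
    by (rule AC_cong) (auto simp: power2_eq_square algebra_simps)
qed

lemma AC_parts:
  assumes "AC a b u u'" "AC a b v v'" "a \<le> b"
  shows "(LINT x:{a..b}|lborel. u' x * v x) + (LINT x:{a..b}|lborel. u x * v' x) = u b * v b - u a * v a"
proof -
  have "set_integrable lborel {a..b} (\<lambda>x. u' x * v x)"
    by (rule set_integrable_mult_continuous[OF AC_integrable[OF assms(1)] AC_continuous_on[OF assms(2)]])
  moreover have "set_integrable lborel {a..b} (\<lambda>x. v' x * u x)"
    by (rule set_integrable_mult_continuous[OF AC_integrable[OF assms(2)] AC_continuous_on[OF assms(1)]])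
  ultimately show ?thesis
    using AC_endpoints[OF AC_mult[OF assms(1,2)] assms(3)] by (simp add: mult.commute set_integral_add)
qed

section \<open>Products with short time averages\<close>

lemma nn_integral_abs_time_avg_le:
  assumes [measurable]: "A \<in> borel_measurable borel" and h: "0 < h"
  shows "(\<integral>\<^sup>+z. ennreal \<bar>time_avg h A z\<bar> \<partial>lborel) \<le> (\<integral>\<^sup>+z. ennreal \<bar>A z\<bar> \<partial>lborel)"
proof -
  have "(\<integral>\<^sup>+z. ennreal \<bar>time_avg h A z\<bar> \<partial>lborel)
     \<le> (\<integral>\<^sup>+z. ennreal (time_avg h (\<lambda>z. \<bar>A z\<bar>) z) \<partial>lborel)"
    by (intro nn_integral_mono ennreal_leI) (simp add: time_avg_def abs_avg_le h)
  also have "\<dots> \<le> (\<integral>\<^sup>+z. ennreal \<bar>A z\<bar> \<partial>lborel)"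
    by (rule nn_integral_time_avg_nonneg_le) (auto simp: h)
  finally show ?thesis .
qed

lemma integrable_time_avg:
  assumes A: "integrable lborel A" and h: "0 < h"
  shows "integrable lborel (time_avg h A)"
proof -
  have [measurable]: "A \<in> borel_measurable borel" using A by auto
  have "(\<integral>\<^sup>+z. ennreal \<bar>A z\<bar> \<partial>lborel) < \<infinity>" using A by (simp add: integrable_iff_bounded)
  with nn_integral_abs_time_avg_le[OF \<open>A \<in> borel_measurable borel\<close> h]
  have "(\<integral>\<^sup>+z. ennreal \<bar>time_avg h A z\<bar> \<partial>lborel) < \<infinity>"
    by (rule le_less_trans)
  then show ?thesis by (simp add: integrable_iff_bounded)
qed

lemma integral_abs_tendsto_0:
  assumes "\<And>k. integrable M (f k)" "(\<lambda>k. \<integral>\<^sup>+z. ennreal \<bar>f k z\<bar> \<partial>M) \<longlonglongrightarrow> 0"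
  shows "(\<lambda>k. \<integral>z. \<bar>f k z\<bar> \<partial>M) \<longlonglongrightarrow> 0"
proof -
  have "(\<lambda>k. ennreal (\<integral>z. \<bar>f k z\<bar> \<partial>M)) \<longlonglongrightarrow> ennreal 0"
    using assms(2) by (subst (asm) nn_integral_eq_integral) (use assms(1) in auto)
  then show ?thesis by (subst (asm) tendsto_ennreal_iff) auto
qed

text \<open>The pairing used for the derivative of the quadratic flux: integrable against bounded.\<close>

lemma time_avg_mult_bounded_tendsto:
  assumes A: "integrable lborel A" and B[measurable]: "B \<in> borel_measurable borel" and C: "\<And>z. \<bar>B z\<bar> \<le> C"
  shows "(\<lambda>k. LINT z|lborel. B z * time_avg (step k) A z) \<longlonglongrightarrow> (LINT z|lborel. B z * A z)"
    and "integrable lborel (\<lambda>z. B z * time_avg (step k) A z)"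
    and "integrable lborel (\<lambda>z. B z * A z)"
proof -
  have [measurable]: "A \<in> borel_measurable borel" using A by auto
  have i: "integrable lborel (\<lambda>z. B z * F z)" if F: "integrable lborel F" for F
  proof (rule Bochner_Integration.integrable_bound[of _ "\<lambda>z. C * \<bar>F z\<bar>"])
    show "integrable lborel (\<lambda>z. C * \<bar>F z\<bar>)" using F by auto
    show "(\<lambda>z. B z * F z) \<in> borel_measurable lborel" using F by auto
    have "0 \<le> C" using C[of undefined] by linarith
    then show "AE z in lborel. norm (B z * F z) \<le> norm (C * \<bar>F z\<bar>)"
      using C by (auto simp: abs_mult intro!: mult_right_mono AE_I2)
  qed
  note iA = integrable_time_avg[OF A step_pos]
  show "integrable lborel (\<lambda>z. B z * time_avg (step k) A z)" by (rule i[OF iA])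
  show "integrable lborel (\<lambda>z. B z * A z)" by (rule i[OF A])
  have 0: "(\<lambda>k. \<integral>z. \<bar>time_avg (step k) A z - A z\<bar> \<partial>lborel) \<longlonglongrightarrow> 0"
    by (rule integral_abs_tendsto_0[OF _ time_avg_tendsto_L1[OF A]]) (intro Bochner_Integration.integrable_diff iA A)
  have "(\<lambda>k. (LINT z|lborel. B z * time_avg (step k) A z) - (LINT z|lborel. B z * A z)) \<longlonglongrightarrow> 0"
  proof (rule tendsto_rabs_zero_cancel, rule tendsto_sandwich[OF _ _ tendsto_const])
    show "(\<lambda>k. C * (\<integral>z. \<bar>time_avg (step k) A z - A z\<bar> \<partial>lborel)) \<longlonglongrightarrow> 0"
      using tendsto_mult_left[OF 0, of C] by simp
    show "\<forall>\<^sub>F k in sequentially. \<bar>(LINT z|lborel. B z * time_avg (step k) A z) - (LINT z|lborel. B z * A z)\<bar>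
        \<le> C * (\<integral>z. \<bar>time_avg (step k) A z - A z\<bar> \<partial>lborel)"
    proof (intro always_eventually allI)
      fix k
      have d: "integrable lborel (\<lambda>z. time_avg (step k) A z - A z)"
        by (intro Bochner_Integration.integrable_diff iA A)
      have "(LINT z|lborel. B z * time_avg (step k) A z) - (LINT z|lborel. B z * A z)
         = (LINT z|lborel. B z * (time_avg (step k) A z - A z))"
        unfolding Bochner_Integration.integral_diff[OF i[OF iA] i[OF A], symmetric]
        by (simp add: right_diff_distrib)
      also have "\<bar>\<dots>\<bar> \<le> (LINT z|lborel. \<bar>B z * (time_avg (step k) A z - A z)\<bar>)"
        by (rule integral_abs_bound)
      also have "\<dots> \<le> (LINT z|lborel. C * \<bar>time_avg (step k) A z - A z\<bar>)"
        by (intro integral_mono integrable_abs i d integrable_mult_right)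
           (use C in \<open>auto simp: abs_mult intro!: mult_right_mono\<close>)
      finally show "\<bar>(LINT z|lborel. B z * time_avg (step k) A z) - (LINT z|lborel. B z * A z)\<bar>
        \<le> C * (\<integral>z. \<bar>time_avg (step k) A z - A z\<bar> \<partial>lborel)" by simp
    qed
  qed auto
  then show "(\<lambda>k. LINT z|lborel. B z * time_avg (step k) A z) \<longlonglongrightarrow> (LINT z|lborel. B z * A z)"
    by (rule LIM_zero_cancel)
qed

lemma integrable_mult_square:
  fixes f g :: "'a \<Rightarrow> real"
  assumes [measurable]: "f \<in> borel_measurable M" "g \<in> borel_measurable M"
    and f2: "integrable M (\<lambda>x. (f x)\<^sup>2)" and g2: "integrable M (\<lambda>x. (g x)\<^sup>2)"
  shows "integrable M (\<lambda>x. f x * g x)"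
proof (rule Bochner_Integration.integrable_bound[OF Bochner_Integration.integrable_add[OF f2 g2]])
  have "\<bar>a * b\<bar> \<le> a\<^sup>2 + b\<^sup>2" for a b :: real
  proof -
    have "0 \<le> (\<bar>a\<bar> - \<bar>b\<bar>)\<^sup>2" by simp
    then have "2 * (\<bar>a\<bar> * \<bar>b\<bar>) \<le> a\<^sup>2 + b\<^sup>2" by (simp add: power2_diff)
    then show ?thesis using mult_nonneg_nonneg[of "\<bar>a\<bar>" "\<bar>b\<bar>"] by (simp only: abs_mult) linarith
  qed
  then show "AE x in M. norm (f x * g x) \<le> norm ((f x)\<^sup>2 + (g x)\<^sup>2)" by auto
qed measurable

text \<open>Young's inequality with a free parameter, which replaces the Cauchy-Schwarz inequality.\<close>

lemma abs_integral_mult_le: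
  fixes f g :: "'a \<Rightarrow> real"
  assumes [measurable]: "f \<in> borel_measurable M" "g \<in> borel_measurable M"
    and f2: "integrable M (\<lambda>x. (f x)\<^sup>2)" and g2: "integrable M (\<lambda>x. (g x)\<^sup>2)" and r: "0 < r"
  shows "\<bar>LINT x|M. f x * g x\<bar> \<le> r * (LINT x|M. (f x)\<^sup>2) + (LINT x|M. (g x)\<^sup>2) / r"
proof -
  have y: "\<bar>a * b\<bar> \<le> r * a\<^sup>2 + b\<^sup>2 / r" for a b :: real
  proof -
    have "0 \<le> (r * \<bar>a\<bar> - \<bar>b\<bar>)\<^sup>2 / r" using r by simp
    also have "\<dots> = r * a\<^sup>2 - 2 * (\<bar>a\<bar> * \<bar>b\<bar>) + b\<^sup>2 / r"
      using r by (simp add: power2_diff field_simps power2_eq_square)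
    finally show ?thesis using mult_nonneg_nonneg[of "\<bar>a\<bar>" "\<bar>b\<bar>"] by (simp only: abs_mult) linarith
  qed
  have "\<bar>LINT x|M. f x * g x\<bar> \<le> (LINT x|M. \<bar>f x * g x\<bar>)" by (rule integral_abs_bound)
  also have "\<dots> \<le> (LINT x|M. r * (f x)\<^sup>2 + (g x)\<^sup>2 / r)"
    by (intro integral_mono integrable_abs integrable_mult_square Bochner_Integration.integrable_add
          integrable_mult_right integrable_divide f2 g2 y assms(1,2))
  also have "\<dots> = r * (LINT x|M. (f x)\<^sup>2) + (LINT x|M. (g x)\<^sup>2) / r"
    using f2 g2 by simp
  finally show ?thesis .
qed

text \<open>The pairing used for the linear part of the flux: both factors square integrable.\<close>

lemma time_avg_mult_square_tendsto:
  assumes A: "integrable lborel A" and A2: "integrable lborel (\<lambda>z. (A z)\<^sup>2)"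
    and B[measurable]: "B \<in> borel_measurable borel" and B2: "integrable lborel (\<lambda>z. (B z)\<^sup>2)"
  shows "(\<lambda>k. LINT z|lborel. B z * time_avg (step k) A z) \<longlonglongrightarrow> (LINT z|lborel. B z * A z)"
    and "\<forall>\<^sub>F k in sequentially. integrable lborel (\<lambda>z. B z * time_avg (step k) A z)"
    and "integrable lborel (\<lambda>z. B z * A z)"
proof -
  have [measurable]: "A \<in> borel_measurable borel" using A by auto
  let ?D = "\<lambda>k z. time_avg (step k) A z - A z"
  have ev: "\<forall>\<^sub>F k in sequentially. (\<integral>\<^sup>+z. ennreal ((?D k z)\<^sup>2) \<partial>lborel) < \<infinity>"
  proof -
    have "\<forall>\<^sub>F k in sequentially. (\<integral>\<^sup>+z. ennreal ((?D k z)\<^sup>2) \<partial>lborel) < 1"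
      by (rule order_tendstoD(2)[OF time_avg_tendsto_L2[OF A A2]]) simp
    then show ?thesis by eventually_elim (auto intro: less_trans[OF _ ennreal_one_less_top])
  qed
  have iD: "\<forall>\<^sub>F k in sequentially. integrable lborel (\<lambda>z. (?D k z)\<^sup>2)"
    using ev by eventually_elim (simp add: integrable_iff_bounded)
  show iBA: "integrable lborel (\<lambda>z. B z * A z)" by (intro integrable_mult_square B2 A2) auto
  have iBD: "\<forall>\<^sub>F k in sequentially. integrable lborel (\<lambda>z. B z * ?D k z)"
    using iD by eventually_elim (intro integrable_mult_square B2; auto)
  show "\<forall>\<^sub>F k in sequentially. integrable lborel (\<lambda>z. B z * time_avg (step k) A z)"
    using iBD
  proof eventually_elim
    case (elim k)
    from Bochner_Integration.integrable_add[OF this iBA] show ?case by (simp add: algebra_simps)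
  qed
  have D0: "(\<lambda>k. LINT z|lborel. (?D k z)\<^sup>2) \<longlonglongrightarrow> 0"
  proof -
    have "\<forall>\<^sub>F k in sequentially. (\<integral>\<^sup>+z. ennreal ((?D k z)\<^sup>2) \<partial>lborel) = ennreal (LINT z|lborel. (?D k z)\<^sup>2)"
      using iD by eventually_elim (rule nn_integral_eq_integral, auto)
    then have "(\<lambda>k. ennreal (LINT z|lborel. (?D k z)\<^sup>2)) \<longlonglongrightarrow> ennreal 0"
      using Lim_transform_eventually[OF time_avg_tendsto_L2[OF A A2]] by simp
    then show ?thesis by (subst (asm) tendsto_ennreal_iff) auto
  qed
  have "(\<lambda>k. LINT z|lborel. B z * ?D k z) \<longlonglongrightarrow> 0"
  proof (rule LIMSEQ_I)
    fix e :: real assume e: "0 < e"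
    define K where "K = (LINT z|lborel. (B z)\<^sup>2)"
    \<comment> \<open>With this parameter the fixed term of Young's inequality is at most \<open>e / 2\<close>.\<close>
    define r where "r = e / (2 * (1 + K))"
    have K: "0 \<le> K" by (simp add: K_def)
    have r: "0 < r" using e K by (simp add: r_def)
    have rI: "r * K \<le> e / 2"
    proof -
      have "r * K \<le> r * (1 + K)" using r by simp
      also have "\<dots> = e / 2" using K by (simp add: r_def field_simps)
      finally show ?thesis .
    qed
    have "\<forall>\<^sub>F k in sequentially. (LINT z|lborel. (?D k z)\<^sup>2) < r * (e / 2)"
      by (rule order_tendstoD(2)[OF D0]) (use e r in simp)
    then have "\<forall>\<^sub>F k in sequentially. norm ((LINT z|lborel. B z * ?D k z) - 0) < e"
      using iD
    proof eventually_elim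
      case (elim k)
      have "\<bar>LINT z|lborel. B z * ?D k z\<bar> \<le> r * K + (LINT z|lborel. (?D k z)\<^sup>2) / r"
        unfolding K_def by (rule abs_integral_mult_le) (use elim B2 r in auto)
      also have "\<dots> < e / 2 + e / 2"
        using elim(1) r by (intro add_le_less_mono rI) (simp add: field_simps)
      finally show ?case by simp
    qed
    then show "\<exists>no. \<forall>n\<ge>no. norm ((LINT z|lborel. B z * ?D n z) - 0) < e"
      by (simp add: eventually_sequentially)
  qed
  then have "(\<lambda>k. (LINT z|lborel. B z * ?D k z) + (LINT z|lborel. B z * A z)) \<longlonglongrightarrow> 0 + (LINT z|lborel. B z * A z)"
    by (intro tendsto_intros)
  moreover have "\<forall>\<^sub>F k in sequentially. (LINT z|lborel. B z * ?D k z) + (LINT z|lborel. B z * A z)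
      = (LINT z|lborel. B z * time_avg (step k) A z)"
    using iBD
  proof eventually_elim
    case (elim k)
    from Bochner_Integration.integral_add[OF this iBA] show ?case by (simp add: algebra_simps)
  qed
  ultimately show "(\<lambda>k. LINT z|lborel. B z * time_avg (step k) A z) \<longlonglongrightarrow> (LINT z|lborel. B z * A z)"
    using Lim_transform_eventually by fastforce
qed

section \<open>The fundamental lemma for product test functions\<close>

lemma DERIV_pos_part_square: "((\<lambda>y::real. (max 0 y)\<^sup>2) has_real_derivative 2 * max 0 y) (at y)"
proof (cases y "0::real" rule: linorder_cases)
  case less
  have "((\<lambda>y::real. 0) has_real_derivative 0) (at y)" by simp
  then have "((\<lambda>y::real. (max 0 y)\<^sup>2) has_real_derivative 0) (at y)"
    by (rule DERIV_cong_ev[THEN iffD1, rotated -1])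
       (use less in \<open>auto simp: eventually_nhds intro!: exI[of _ "{..<0}"]\<close>)
  then show ?thesis using less by simp
next
  case equal
  have "(\<lambda>h::real. (max 0 h)\<^sup>2 / h) \<midarrow>0\<rightarrow> 0"
  proof (rule tendsto_rabs_zero_cancel, rule tendsto_sandwich[OF _ _ tendsto_const])
    show "((\<lambda>h::real. \<bar>h\<bar>) \<longlongrightarrow> 0) (at 0)" by (auto intro!: tendsto_eq_intros)
    have "\<bar>(max 0 h)\<^sup>2 / h\<bar> \<le> \<bar>h\<bar>" for h :: real
      by (cases "h \<le> 0") (auto simp: power2_eq_square max_def)
    then show "\<forall>\<^sub>F h in at 0. \<bar>(max 0 h)\<^sup>2 / h\<bar> \<le> \<bar>h::real\<bar>" by simp
  qed auto
  then show ?thesis using equal by (simp add: DERIV_def)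
next
  case greater
  have "((\<lambda>y::real. y\<^sup>2) has_real_derivative 2 * y) (at y)" by (auto intro!: derivative_eq_intros)
  then have "((\<lambda>y::real. (max 0 y)\<^sup>2) has_real_derivative 2 * y) (at y)"
    by (rule DERIV_cong_ev[THEN iffD1, rotated -1])
       (use greater in \<open>auto simp: eventually_nhds intro!: exI[of _ "{0<..}"]\<close>)
  then show ?thesis using greater by simp
qed

text \<open>Continuously differentiable functions on the line that vanish outside \<open>[a, b]\<close>, together with their
derivative.  For \<open>b = 1\<close> such a function also vanishes at the right end of the domain.\<close>

definition C1_supp :: "real \<Rightarrow> real \<Rightarrow> (real \<Rightarrow> real) \<Rightarrow> (real \<Rightarrow> real) \<Rightarrow> bool" where
  "C1_supp a b g g' \<longleftrightarrow> (\<forall>x. (g has_real_derivative g' x) (at x)) \<and> continuous_on UNIV g' \<and>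
     (\<forall>x. x \<notin> {a..b} \<longrightarrow> g x = 0)"

text \<open>Smoothed indicators: the square makes the positive part continuously differentiable, and as \<open>k\<close> grows
the values increase to the indicator of the open interval.\<close>

definition bump :: "nat \<Rightarrow> real \<Rightarrow> real \<Rightarrow> real \<Rightarrow> real" where
  "bump k a b t = (let q = real k * (max 0 ((t - a) * (b - t)))\<^sup>2 in q / (1 + q))"

lemma bump_bounds: "0 \<le> bump k a b t" "bump k a b t \<le> 1"
  by (auto simp: bump_def Let_def divide_le_eq_1 add_pos_nonneg)

lemma bump_outside: "t \<notin> {a<..<b} \<Longrightarrow> a \<le> b \<Longrightarrow> bump k a b t = 0"
proof -
  assume "t \<notin> {a<..<b}" "a \<le> b"
  then have "(t - a) * (b - t) \<le> 0"
    by (cases "t \<le> a") (auto intro: mult_nonneg_nonpos mult_nonpos_nonneg)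
  then show ?thesis by (simp add: bump_def)
qed

lemma bump_tendsto:
  assumes "a \<le> b"
  shows "(\<lambda>k. bump k a b t) \<longlonglongrightarrow> indicator {a<..<b} t"
proof (cases "t \<in> {a<..<b}")
  case True
  define c where "c = (max 0 ((t - a) * (b - t)))\<^sup>2"
  have c: "0 < c" using True by (simp add: c_def)
  have "(\<lambda>k. 1 - 1 / (1 + real k * c)) \<longlonglongrightarrow> 1 - 0"
  proof (intro tendsto_intros)
    have "filterlim (\<lambda>k. 1 + real k * c) at_top sequentially"
      by (intro filterlim_tendsto_add_at_top[OF tendsto_const]
          filterlim_at_top_mult_tendsto_pos[OF tendsto_const c] filterlim_real_sequentially)
    then show "(\<lambda>k. 1 / (1 + real k * c)) \<longlonglongrightarrow> 0"
      by (intro tendsto_divide_0[OF tendsto_const]) (rule filterlim_at_top_imp_at_infinity)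
  qed
  moreover have "1 - 1 / (1 + real k * c) = bump k a b t" for k
  proof -
    have "1 + real k * c \<noteq> 0" using c by (smt (verit) mult_nonneg_nonneg of_nat_0_le_iff)
    then have "1 - 1 / (1 + real k * c) = real k * c / (1 + real k * c)" by (simp add: field_simps)
    then show ?thesis by (simp add: bump_def Let_def c_def)
  qed
  ultimately show ?thesis using True by simp
next
  case False
  then show ?thesis using bump_outside[OF False assms] by simp
qed

lemma C1_supp_bump:
  assumes "a \<le> b" "{a..b} \<subseteq> {a0..b0}"
  shows "\<exists>g'. C1_supp a0 b0 (bump k a b) g'"
proof -
  define q where "q = (\<lambda>t. real k * (max 0 ((t - a) * (b - t)))\<^sup>2)"
  define q' where "q' = (\<lambda>t. real k * (2 * max 0 ((t - a) * (b - t)) * (a + b - 2 * t)))"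
  have dq: "(q has_real_derivative q' t) (at t)" for t
  proof -
    have "((\<lambda>t. (t - a) * (b - t)) has_real_derivative (a + b - 2 * t)) (at t)"
      by (auto intro!: derivative_eq_intros)
    from DERIV_chain2[OF DERIV_pos_part_square this]
    show ?thesis unfolding q_def q'_def by (rule DERIV_cmult)
  qed
  have q0: "0 \<le> q t" for t by (simp add: q_def)
  have q1: "1 + q t \<noteq> 0" for t using q0[of t] by linarith
  have cq: "continuous_on UNIV q" unfolding q_def by (intro continuous_intros)
  have cq': "continuous_on UNIV q'" unfolding q'_def by (intro continuous_intros)
  have b: "bump k a b = (\<lambda>t. q t / (1 + q t))" by (simp add: fun_eq_iff bump_def q_def Let_def)
  have "C1_supp a0 b0 (bump k a b) (\<lambda>t. q' t / (1 + q t)\<^sup>2)"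
    unfolding C1_supp_def
  proof (intro conjI allI impI)
    fix x
    show "(bump k a b has_real_derivative q' x / (1 + q x)\<^sup>2) (at x)"
      unfolding b using q1[of x]
      by (auto intro!: derivative_eq_intros dq simp: power2_eq_square field_simps)
    assume "x \<notin> {a0..b0}"
    then have "x \<notin> {a<..<b}" using assms by auto
    then show "bump k a b x = 0" using bump_outside assms by blast
  next
    show "continuous_on UNIV (\<lambda>t. q' t / (1 + q t)\<^sup>2)"
      using q1 by (intro continuous_intros cq cq') auto
  qed
  then show ?thesis by blast
qed

text \<open>Lebesgue's differentiation theorem in the plane: the averages over small boxes are all zero.\<close>

lemma AE_zero_of_box_integrals:
  fixes P :: "real \<times> real \<Rightarrow> real"
  assumes P: "integrable lborel P"
    and 0: "\<And>a b c d. (LINT z:{a..b}\<times>{c..d}|lborel. P z) = 0"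
  shows "AE z in lborel. P z = 0"
proof -
  have cb: "cbox (a, c) (b, d) = {a..b} \<times> {c..d}" for a b c d :: real by (simp add: cbox_Pair_eq)
  have si: "set_integrable lborel (cbox x y) P" for x y
    unfolding set_integrable_def by (rule integrable_mult_indicator[OF _ P]) auto
  have i0: "integral (cbox x y) P = 0" for x y :: "real \<times> real"
    using set_borel_integral_eq_integral(2)[OF si[of x y]] 0[of "fst x" "fst y" "snd x" "snd y"]
    by (cases x; cases y) (simp add: cb)
  have "P integrable_on cbox x y" for x y
    by (rule set_borel_integral_eq_integral(1)[OF si])
  from integrable_ccontinuous_explicit[of P, OF this] obtain N where N: "negligible N"
    and lim: "\<And>x e. \<lbrakk>x \<notin> N; 0 < e\<rbrakk> \<Longrightarrow> \<exists>d>0. \<forall>h. 0 < h \<and> h < d \<longrightarrow>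
       norm (integral (cbox x (x + h *\<^sub>R One)) P /\<^sub>R h ^ DIM(real \<times> real) - P x) < e"
    by blast
  have "P x = 0" if "x \<notin> N" for x
  proof (rule ccontr)
    assume "P x \<noteq> 0"
    then have "0 < \<bar>P x\<bar>" by simp
    from lim[OF that this] obtain d where "d > 0" and d: "\<And>h. 0 < h \<Longrightarrow> h < d \<Longrightarrow>
       norm (integral (cbox x (x + h *\<^sub>R One)) P /\<^sub>R h ^ DIM(real \<times> real) - P x) < \<bar>P x\<bar>"
      by blast
    from d[of "d / 2"] \<open>d > 0\<close> show False by (simp add: i0)
  qed
  moreover have "AE x in lebesgue. x \<notin> N" using N AE_not_in negligible_iff_null_sets by blast
  ultimately have "AE x in lebesgue. P x = 0" by (auto elim!: AE_mp)
  then show ?thesis by (simp add: AE_completion_iff)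
qed

text \<open>Products of smoothed indicators approximate indicators of boxes, whose integrals determine the function.\<close>

lemma fundamental_lemma_product:
  fixes P :: "real \<times> real \<Rightarrow> real" and a0 b0 c0 d0 :: real
  defines "R \<equiv> {a0..b0} \<times> {c0..d0}"
  assumes P: "set_integrable lborel R P"
    and test: "\<And>g g' c c'. C1_supp a0 b0 g g' \<Longrightarrow> C1_supp c0 d0 c c' \<Longrightarrow>
      (LINT z:R|lborel. P z * (g (fst z) * c (snd z))) = 0"
  shows "AE z in lborel. z \<in> R \<longrightarrow> P z = 0"
proof -
  let ?P = "\<lambda>z. indicator R z * P z"
  have P': "integrable lborel ?P" using P by (simp add: set_integrable_def)
  have box: "(LINT z:{a..b}\<times>{c..d}|lborel. ?P z) = 0" for a b c d
  proof (cases "max a a0 \<le> min b b0 \<and> max c c0 \<le> min d d0")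
    case False
    then have "indicator ({a..b}\<times>{c..d}) z *\<^sub>R ?P z = 0" for z by (auto simp: R_def indicator_def)
    then show ?thesis by (simp only: set_lebesgue_integral_def Bochner_Integration.integral_zero)
  next
    case True
    \<comment> \<open>Only the part of the box inside \<open>R\<close> matters; its sides are null sets, so the open box suffices.\<close>
    define a1 b1 c1 d1 where "a1 = max a a0" and "b1 = min b b0" and "c1 = max c c0" and "d1 = min d d0"
    have ab: "a1 \<le> b1" "c1 \<le> d1" using True by (auto simp: a1_def b1_def c1_def d1_def)
    have "(\<lambda>k. LINT z|lborel. ?P z * (bump k a1 b1 (fst z) * bump k c1 d1 (snd z))) \<longlonglongrightarrow>
       (LINT z|lborel. ?P z * (indicator {a1<..<b1} (fst z) * indicator {c1<..<d1} (snd z)))"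
    proof (rule integral_dominated_convergence[where w="\<lambda>z. \<bar>?P z\<bar>"])
      have [measurable]: "?P \<in> borel_measurable lborel" using P' by auto
      have [measurable]: "bump k u v \<in> borel_measurable borel" for k u v
        unfolding bump_def[abs_def] Let_def by measurable
      show "(\<lambda>z. ?P z * (bump k a1 b1 (fst z) * bump k c1 d1 (snd z))) \<in> borel_measurable lborel" for k
        by (intro borel_measurable_times \<open>?P \<in> borel_measurable lborel\<close>)
           (simp_all add: borel_prod[symmetric])
      show "(\<lambda>z. ?P z * (indicator {a1<..<b1} (fst z) * indicator {c1<..<d1} (snd z))) \<in> borel_measurable lborel"
        by (intro borel_measurable_times \<open>?P \<in> borel_measurable lborel\<close>)
           (simp_all add: borel_prod[symmetric])
      show "integrable lborel (\<lambda>z. \<bar>?P z\<bar>)" using P' by (rule integrable_abs)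
      show "AE z in lborel. (\<lambda>k. ?P z * (bump k a1 b1 (fst z) * bump k c1 d1 (snd z))) \<longlonglongrightarrow>
          ?P z * (indicator {a1<..<b1} (fst z) * indicator {c1<..<d1} (snd z))"
        by (intro AE_I2 tendsto_intros bump_tendsto ab)
      show "AE z in lborel. norm (?P z * (bump k a1 b1 (fst z) * bump k c1 d1 (snd z))) \<le> \<bar>?P z\<bar>" for k
      proof (intro AE_I2)
        fix z :: "real \<times> real"
        have "\<bar>bump k a1 b1 (fst z) * bump k c1 d1 (snd z)\<bar> \<le> 1"
          by (simp add: bump_bounds mult_le_one)
        then show "norm (?P z * (bump k a1 b1 (fst z) * bump k c1 d1 (snd z))) \<le> \<bar>?P z\<bar>"
          unfolding real_norm_def abs_mult[of "?P z"] by (rule mult_left_le) simp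
      qed
    qed
    moreover have "(LINT z|lborel. ?P z * (bump k a1 b1 (fst z) * bump k c1 d1 (snd z))) = 0" for k
    proof -
      obtain g' where "C1_supp a0 b0 (bump k a1 b1) g'"
        using C1_supp_bump[OF ab(1)] by (force simp: a1_def b1_def)
      moreover obtain c' where "C1_supp c0 d0 (bump k c1 d1) c'"
        using C1_supp_bump[OF ab(2)] by (force simp: c1_def d1_def)
      ultimately show ?thesis using test by (simp add: set_lebesgue_integral_def mult.assoc)
    qed
    ultimately have "(LINT z|lborel. ?P z * (indicator {a1<..<b1} (fst z) * indicator {c1<..<d1} (snd z))) = 0"
      using LIMSEQ_unique[OF _ tendsto_const] by fastforce
    also have "(LINT z|lborel. ?P z * (indicator {a1<..<b1} (fst z) * indicator {c1<..<d1} (snd z))) =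
        (LINT z:{a..b}\<times>{c..d}|lborel. ?P z)"
      unfolding set_lebesgue_integral_def
    proof (rule integral_cong_AE)
      have [measurable]: "?P \<in> borel_measurable lborel" using P' by auto
      show "(\<lambda>z. ?P z * (indicator {a1<..<b1} (fst z) * indicator {c1<..<d1} (snd z))) \<in> borel_measurable lborel"
        by (intro borel_measurable_times \<open>?P \<in> borel_measurable lborel\<close>)
           (simp_all add: borel_prod[symmetric])
      show "(\<lambda>z. indicat_real ({a..b} \<times> {c..d}) z *\<^sub>R (indicator R z * P z)) \<in> borel_measurable lborel"
        by (intro borel_measurable_scaleR \<open>?P \<in> borel_measurable lborel\<close> borel_measurable_indicator)
           (simp flip: cbox_Pair_eq[of a c b d, simplified])
      have ne: "AE z in (lborel :: (real \<times> real) measure). fst z \<noteq> u \<and> snd z \<noteq> v" for u v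
      proof (rule AE_lborel_prodI)
        show "AE x in lborel. AE y in lborel. fst (x, y) \<noteq> u \<and> snd (x, y) \<noteq> v"
          using AE_lborel_singleton[of u]
        proof eventually_elim
          case (elim x)
          then show ?case using AE_lborel_singleton[of v] by simp
        qed
      qed (simp add: borel_prod[symmetric])
      show "AE z in lborel. ?P z * (indicator {a1<..<b1} (fst z) * indicator {c1<..<d1} (snd z)) =
          indicat_real ({a..b} \<times> {c..d}) z *\<^sub>R (indicator R z * P z)"
        using ne[of a1 c1] ne[of b1 d1]
        by eventually_elim
          (auto simp: R_def a1_def b1_def c1_def d1_def indicator_def)
    qed
    finally show ?thesis .
  qed
  have "AE z in lborel. ?P z = 0" by (rule AE_zero_of_box_integrals[OF P' box])
  then show ?thesis by eventually_elim (auto simp: indicator_def)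
qed

section \<open>Iterated integrals over rectangles\<close>

lemma rect_sets [simp, measurable]: "{a..b::real} \<times> {c..d::real} \<in> sets borel"
  by (metis borel_closed closed_Times closed_atLeastAtMost)

lemma indicator_rect: "indicator ({a..b::real} \<times> {c..d::real}) (x, t) = (indicator {a..b} x * indicator {c..d} t :: real)"
  by (simp add: indicator_def)

lemma lborel_swap_integrable:
  fixes f :: "real \<times> real \<Rightarrow> real"
  assumes "integrable lborel f"
  shows "integrable lborel (\<lambda>z. f (snd z, fst z))"
proof -
  have "integrable (lborel \<Otimes>\<^sub>M lborel) f" using assms by (simp only: lborel_prod)
  from lborel_pair.integrable_product_swap[OF this] show ?thesis
    by (simp only: lborel_prod split_beta')
qed

lemma lborel_swap_integral:
  fixes f :: "real \<times> real \<Rightarrow> real"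
  assumes "integrable lborel f"
  shows "(LINT z|lborel. f (snd z, fst z)) = (LINT z|lborel. f z)"
proof -
  have "f \<in> borel_measurable (lborel \<Otimes>\<^sub>M lborel)" using assms by (simp only: lborel_prod) auto
  from lborel_pair.integral_product_swap[OF this] show ?thesis
    by (simp only: lborel_prod split_beta')
qed

lemma set_integrable_swap:
  fixes f :: "real \<times> real \<Rightarrow> real"
  assumes "set_integrable lborel ({a..b} \<times> {c..d}) f"
  shows "set_integrable lborel ({c..d} \<times> {a..b}) (\<lambda>z. f (snd z, fst z))"
  using lborel_swap_integrable[OF assms[unfolded set_integrable_def]]
  by (simp add: set_integrable_def indicator_def conj_commute mem_Times_iff)

lemma set_integral_swap:
  fixes f :: "real \<times> real \<Rightarrow> real"
  assumes "set_integrable lborel ({a..b} \<times> {c..d}) f"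
  shows "(LINT z:{c..d} \<times> {a..b}|lborel. f (snd z, fst z)) = (LINT z:{a..b} \<times> {c..d}|lborel. f z)"
  using lborel_swap_integral[OF assms[unfolded set_integrable_def]]
  by (simp add: set_lebesgue_integral_def indicator_def conj_commute mem_Times_iff)

context
  fixes f :: "real \<times> real \<Rightarrow> real" and a b c d :: real
  assumes f: "set_integrable lborel ({a..b} \<times> {c..d}) f"
begin

private lemma f2: "integrable (lborel \<Otimes>\<^sub>M lborel) (\<lambda>z. indicator ({a..b} \<times> {c..d}) z *\<^sub>R f z)"
  using f by (simp only: lborel_prod set_integrable_def)

lemma rect_slice_fst: "AE x in lborel. x \<in> {a..b} \<longrightarrow> set_integrable lborel {c..d} (\<lambda>t. f (x, t))"
  using lborel_pair.AE_integrable_fst'[OF f2]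
  by eventually_elim (auto simp: set_integrable_def indicator_rect)

lemma rect_integrable_fst: "set_integrable lborel {a..b} (\<lambda>x. LINT t:{c..d}|lborel. f (x, t))"
proof -
  have "integrable lborel (\<lambda>x. LINT t|lborel. indicator ({a..b} \<times> {c..d}) (x, t) *\<^sub>R f (x, t))"
    by (rule lborel_pair.integrable_fst'[OF f2])
  then show ?thesis
    by (simp add: set_integrable_def set_lebesgue_integral_def indicator_rect mult.assoc)
qed

lemma rect_integral_fst:
  "(LINT x:{a..b}|lborel. LINT t:{c..d}|lborel. f (x, t)) = (LINT z:{a..b} \<times> {c..d}|lborel. f z)"
  using lborel_pair.integral_fst'[OF f2]
  by (simp only: lborel_prod) (simp add: set_lebesgue_integral_def indicator_rect mult.assoc)

end

context
  fixes f :: "real \<times> real \<Rightarrow> real" and a b c d :: real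
  assumes f: "set_integrable lborel ({a..b} \<times> {c..d}) f"
begin

lemma rect_slice_snd: "AE t in lborel. t \<in> {c..d} \<longrightarrow> set_integrable lborel {a..b} (\<lambda>x. f (x, t))"
  using rect_slice_fst[OF set_integrable_swap[OF f]] by simp

lemma rect_integrable_snd: "set_integrable lborel {c..d} (\<lambda>t. LINT x:{a..b}|lborel. f (x, t))"
  using rect_integrable_fst[OF set_integrable_swap[OF f]] by simp

lemma rect_integral_snd:
  "(LINT t:{c..d}|lborel. LINT x:{a..b}|lborel. f (x, t)) = (LINT z:{a..b} \<times> {c..d}|lborel. f z)"
  using rect_integral_fst[OF set_integrable_swap[OF f]] set_integral_swap[OF f] by simp

end

lemma set_integrable_bounded_mult:
  fixes f g :: "'a \<Rightarrow> real"
  assumes f: "set_integrable M S f" and g[measurable]: "g \<in> borel_measurable M"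
    and C: "\<And>x. x \<in> S \<Longrightarrow> \<bar>g x\<bar> \<le> C"
  shows "set_integrable M S (\<lambda>x. g x * f x)"
proof -
  let ?f = "\<lambda>x. indicator S x *\<^sub>R f x"
  have fi: "integrable M ?f" using f by (simp add: set_integrable_def)
  have "integrable M (\<lambda>x. g x * ?f x)"
  proof (rule Bochner_Integration.integrable_bound[of _ "\<lambda>x. \<bar>C\<bar> * \<bar>?f x\<bar>"])
    show "integrable M (\<lambda>x. \<bar>C\<bar> * \<bar>?f x\<bar>)" by (intro integrable_mult_right integrable_abs fi)
    show "(\<lambda>x. g x * ?f x) \<in> borel_measurable M"
      using fi by (intro borel_measurable_times g) auto
    show "AE x in M. norm (g x * ?f x) \<le> norm (\<bar>C\<bar> * \<bar>?f x\<bar>)"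
    proof (intro AE_I2)
      fix x
      show "norm (g x * ?f x) \<le> norm (\<bar>C\<bar> * \<bar>?f x\<bar>)"
      proof (cases "x \<in> S")
        case True
        then have "\<bar>g x\<bar> \<le> \<bar>C\<bar>" using C[OF True] by linarith
        then have "\<bar>g x\<bar> * \<bar>f x\<bar> \<le> \<bar>C\<bar> * \<bar>f x\<bar>" by (rule mult_right_mono) simp
        then show ?thesis using True by (simp add: abs_mult)
      qed simp
    qed
  qed
  moreover have "(\<lambda>x. g x * ?f x) = (\<lambda>x. indicator S x *\<^sub>R (g x * f x))"
    by (simp add: fun_eq_iff)
  ultimately show ?thesis by (simp add: set_integrable_def)
qed

lemma set_integrable_dominated:
  fixes f g :: "'a \<Rightarrow> real"
  assumes g: "set_integrable M S g" and f: "f \<in> borel_measurable M" and S: "S \<in> sets M"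
    and le: "AE x in M. x \<in> S \<longrightarrow> \<bar>f x\<bar> \<le> g x"
  shows "set_integrable M S f"
  by (rule set_integrable_bound[OF g]) (use f S le in \<open>auto simp: set_borel_measurable_def elim!: eventually_mono\<close>)

lemma rect_integrable_of_snd:
  fixes h :: "real \<Rightarrow> real" and a b c d :: real
  assumes "set_integrable lborel {c..d} h" and [measurable]: "h \<in> borel_measurable borel"
  shows "set_integrable lborel ({a..b} \<times> {c..d}) (\<lambda>z. h (snd z))"
proof -
  let ?h = "\<lambda>t. indicator {c..d} t * h t"
  have "integrable (lborel \<Otimes>\<^sub>M lborel) (\<lambda>z. indicator {a..b} (fst z) * ?h (snd z))"
  proof (rule lborel_pair.Fubini_integrable)
    show "integrable lborel (\<lambda>x. LINT t|lborel. norm (indicator {a..b} (fst (x, t)) * ?h (snd (x, t))))"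
      by (simp add: abs_mult) (auto intro!: disjI2 integrable_real_indicator simp: emeasure_lborel_Icc_eq)
    show "AE x in lborel. integrable lborel (\<lambda>t. indicator {a..b} (fst (x, t)) * ?h (snd (x, t)))"
      using assms(1) by (auto simp: set_integrable_def)
  qed simp
  moreover have "(\<lambda>z. indicator {a..b} (fst z) * ?h (snd z)) = (\<lambda>z. indicator ({a..b} \<times> {c..d}) z *\<^sub>R h (snd z))"
    by (auto simp: fun_eq_iff indicator_def)
  ultimately show ?thesis by (simp only: lborel_prod set_integrable_def)
qed

lemma measurable_integral_snd [measurable]:
  fixes f :: "real \<times> real \<Rightarrow> real"
  assumes f: "f \<in> borel_measurable borel"
  shows "(\<lambda>t. LINT x:{a..b}|lborel. f (x, t)) \<in> borel_measurable (borel :: real measure)"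
proof -
  have [measurable]: "f \<in> borel_measurable (borel \<Otimes>\<^sub>M borel)" using f by (simp add: borel_prod)
  show ?thesis unfolding set_lebesgue_integral_def by measurable
qed

lemma measurable_integral_tail [measurable]:
  fixes f :: "real \<times> real \<Rightarrow> real"
  assumes f: "f \<in> borel_measurable borel"
  shows "(\<lambda>z. LINT y:{fst z..b}|lborel. f (y, snd z)) \<in> borel_measurable (borel :: (real \<times> real) measure)"
proof -
  have [measurable]: "f \<in> borel_measurable (borel \<Otimes>\<^sub>M borel)" using f by (simp add: borel_prod)
  have eq: "(\<lambda>z. LINT y:{fst z..b}|lborel. f (y, snd z)) =
      (\<lambda>z. LINT y|lborel. (if fst z \<le> y \<and> y \<le> b then f (y, snd z) else 0))"
    unfolding set_lebesgue_integral_def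
    by (intro ext Bochner_Integration.integral_cong) (auto simp: indicator_def)
  show ?thesis unfolding eq borel_prod[symmetric] by measurable
qed

lemma measurable_integral_time [measurable]:
  fixes f :: "real \<times> real \<Rightarrow> real"
  assumes f: "f \<in> borel_measurable borel"
  shows "(\<lambda>z. LINT s:{c..snd z}|lborel. f (fst z, s)) \<in> borel_measurable (borel :: (real \<times> real) measure)"
proof -
  have [measurable]: "f \<in> borel_measurable (borel \<Otimes>\<^sub>M borel)" using f by (simp add: borel_prod)
  have eq: "(\<lambda>z. LINT s:{c..snd z}|lborel. f (fst z, s)) =
      (\<lambda>z. LINT s|lborel. (if c \<le> s \<and> s \<le> snd z then f (fst z, s) else 0))"
    unfolding set_lebesgue_integral_def
    by (intro ext Bochner_Integration.integral_cong) (auto simp: indicator_def)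
  show ?thesis unfolding eq borel_prod[symmetric] by measurable
qed

lemma abs_set_integral_le:
  fixes f :: "'a \<Rightarrow> real"
  assumes "set_integrable M T f" "S \<subseteq> T" "S \<in> sets M"
  shows "\<bar>LINT x:S|M. f x\<bar> \<le> (LINT x:T|M. \<bar>f x\<bar>)"
proof -
  have "\<bar>LINT x:S|M. f x\<bar> \<le> (LINT x:S|M. \<bar>f x\<bar>)"
    unfolding set_lebesgue_integral_def by (rule order_trans[OF integral_abs_bound]) (simp add: abs_mult)
  also have "\<dots> \<le> (LINT x:T|M. \<bar>f x\<bar>)"
    unfolding set_lebesgue_integral_def
  proof (rule integral_mono)
    show "integrable M (\<lambda>x. indicator S x *\<^sub>R \<bar>f x\<bar>)" "integrable M (\<lambda>x. indicator T x *\<^sub>R \<bar>f x\<bar>)"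
      using set_integrable_abs[OF assms(1)] set_integrable_abs[OF set_integrable_subset[OF assms(1,3,2)]]
      by (simp_all add: set_integrable_def)
  qed (use assms(2) in \<open>auto simp: indicator_def\<close>)
  finally show ?thesis .
qed

text \<open>The tail at any \<open>x\<close> is bounded by the integral of \<open>|f|\<close> over the whole slice, a function of \<open>t\<close> alone.\<close>

lemma rect_integrable_tail:
  fixes f :: "real \<times> real \<Rightarrow> real"
  assumes f: "set_integrable lborel ({a..b} \<times> {c..d}) f" and fm: "f \<in> borel_measurable borel"
  shows "set_integrable lborel ({a..b} \<times> {c..d}) (\<lambda>z. LINT y:{fst z..b}|lborel. f (y, snd z))"
proof (rule set_integrable_dominated)
  let ?g = "\<lambda>t. LINT y:{a..b}|lborel. \<bar>f (y, t)\<bar>"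
  have gm: "?g \<in> borel_measurable borel"
    using measurable_integral_snd[of "\<lambda>z. \<bar>f z\<bar>" a b] fm by simp
  show fm': "(\<lambda>z. LINT y:{fst z..b}|lborel. f (y, snd z)) \<in> borel_measurable lborel"
    using measurable_integral_tail[OF fm] by simp
  have "set_integrable lborel {c..d} ?g"
    by (rule rect_integrable_snd[OF set_integrable_abs[OF f]])
  then show "set_integrable lborel ({a..b} \<times> {c..d}) (\<lambda>z. ?g (snd z))"
    by (rule rect_integrable_of_snd) (rule gm)
  show "AE z in lborel. z \<in> {a..b} \<times> {c..d} \<longrightarrow>
      \<bar>LINT y:{fst z..b}|lborel. f (y, snd z)\<bar> \<le> ?g (snd z)"
  proof (rule AE_lborel_prodI)
    have "AE t in lborel. t \<in> {c..d} \<longrightarrow> set_integrable lborel {a..b} (\<lambda>x. f (x, t))"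
      by (rule rect_slice_snd[OF f])
    then have "AE t in lborel. (x, t) \<in> {a..b} \<times> {c..d} \<longrightarrow>
      \<bar>LINT y:{fst (x, t)..b}|lborel. f (y, snd (x, t))\<bar> \<le> ?g (snd (x, t))" for x
      by eventually_elim (auto intro!: abs_set_integral_le)
    then show "AE x in lborel. AE t in lborel. (x, t) \<in> {a..b} \<times> {c..d} \<longrightarrow>
      \<bar>LINT y:{fst (x, t)..b}|lborel. f (y, snd (x, t))\<bar> \<le> ?g (snd (x, t))"
      by simp
    note fm'[measurable]
    have [measurable]: "(\<lambda>z. ?g (snd z)) \<in> borel_measurable (borel :: (real \<times> real) measure)"
      by (rule measurable_compose[OF _ gm]) (auto simp: borel_prod[symmetric])
    show "Measurable.pred borel (\<lambda>z. z \<in> {a..b} \<times> {c..d} \<longrightarrow>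
      \<bar>LINT y:{fst z..b}|lborel. f (y, snd z)\<bar> \<le> ?g (snd z))"
      by measurable
  qed
qed auto

lemma rect_integrable_time:
  fixes f :: "real \<times> real \<Rightarrow> real"
  assumes f: "set_integrable lborel ({a..b} \<times> {c..d}) f" and fm: "f \<in> borel_measurable borel"
  shows "set_integrable lborel ({a..b} \<times> {c..d}) (\<lambda>z. LINT s:{c..snd z}|lborel. f (fst z, s))"
proof (rule set_integrable_dominated)
  let ?g = "\<lambda>x. LINT s:{c..d}|lborel. \<bar>f (x, s)\<bar>"
  have [measurable]: "(\<lambda>z. \<bar>f (snd z, fst z)\<bar>) \<in> borel_measurable borel"
  proof -
    have [measurable]: "f \<in> borel_measurable (borel \<Otimes>\<^sub>M borel)" using fm by (simp add: borel_prod)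
    show ?thesis unfolding borel_prod[symmetric] by measurable
  qed
  show fm'[measurable]: "(\<lambda>z. LINT s:{c..snd z}|lborel. f (fst z, s)) \<in> borel_measurable lborel"
    using measurable_integral_time[OF fm] by simp
  have gm[measurable]: "?g \<in> borel_measurable borel"
    using measurable_integral_snd[of "\<lambda>z. \<bar>f (snd z, fst z)\<bar>" c d] by simp
  have "set_integrable lborel {a..b} ?g"
    by (rule rect_integrable_fst[OF set_integrable_abs[OF f]])
  from set_integrable_swap[OF rect_integrable_of_snd[OF this gm]]
  show "set_integrable lborel ({a..b} \<times> {c..d}) (\<lambda>z. ?g (fst z))" by simp
  show "AE z in lborel. z \<in> {a..b} \<times> {c..d} \<longrightarrow>
      \<bar>LINT s:{c..snd z}|lborel. f (fst z, s)\<bar> \<le> ?g (fst z)"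
  proof (rule AE_lborel_prodI)
    show "AE x in lborel. AE t in lborel. (x, t) \<in> {a..b} \<times> {c..d} \<longrightarrow>
      \<bar>LINT s:{c..snd (x, t)}|lborel. f (fst (x, t), s)\<bar> \<le> ?g (fst (x, t))"
      using rect_slice_fst[OF f]
      by (elim eventually_mono) (auto intro!: AE_I2 abs_set_integral_le)
    have [measurable]: "(\<lambda>z. ?g (fst z)) \<in> borel_measurable (borel :: (real \<times> real) measure)"
      by (rule measurable_compose[OF _ gm]) (auto simp: borel_prod[symmetric])
    show "Measurable.pred borel (\<lambda>z. z \<in> {a..b} \<times> {c..d} \<longrightarrow>
      \<bar>LINT s:{c..snd z}|lborel. f (fst z, s)\<bar> \<le> ?g (fst z))"
      by measurable
  qed
qed auto

section \<open>The du Bois-Reymond lemma\<close>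

text \<open>The base point \<open>0\<close> lies to the left of all supports in question.\<close>

definition primitive :: "(real \<Rightarrow> real) \<Rightarrow> real \<Rightarrow> real" where
  "primitive g x = integral {0..x} g"

lemma primitive_zero:
  assumes "\<And>x. x < a \<Longrightarrow> g x = 0" "x \<le> a" "continuous_on UNIV g"
  shows "primitive g x = 0"
proof -
  have "\<And>y. y \<le> a \<Longrightarrow> g y = 0"
  proof -
    fix y assume "y \<le> a"
    have "g a = 0"
    proof -
      have "(\<lambda>n. g (a - inverse (real (Suc n)))) \<longlonglongrightarrow> g (a - 0)"
        by (intro continuous_on_tendsto_compose[OF assms(3)] tendsto_diff tendsto_const LIMSEQ_inverse_real_of_nat) auto
      moreover have "g (a - inverse (real (Suc n))) = 0" for n by (rule assms(1)) simp
      ultimately show ?thesis using LIMSEQ_unique[OF _ tendsto_const] by fastforce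
    qed
    then show "g y = 0" using assms(1)[of y] \<open>y \<le> a\<close> by (cases "y = a") auto
  qed
  then have "integral {0..x} g = integral {0..x} (\<lambda>x. 0)"
    using assms(2) by (intro integral_cong) auto
  then show ?thesis by (simp add: primitive_def)
qed

lemma primitive_DERIV:
  assumes "continuous_on UNIV g" "0 < a" "\<And>x. x < a \<Longrightarrow> g x = 0"
  shows "(primitive g has_real_derivative g x) (at x)"
proof (cases "x < a")
  case True
  have "((\<lambda>x. 0::real) has_real_derivative 0) (at x)" by simp
  then have "(primitive g has_real_derivative 0) (at x)" 
  proof (rule has_field_derivative_transform_within_open[of _ _ _ "{..<a}"])
    fix y assume "y \<in> {..<a}"
    then have "y \<le> a" by simp
    show "0 = primitive g y" by (rule primitive_zero[OF assms(3) \<open>y \<le> a\<close> assms(1), symmetric])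
  qed (use True in \<open>simp_all only: open_lessThan lessThan_iff\<close>)
  then show ?thesis by (simp only: assms(3)[OF True])
next
  case False
  then have "0 < x" using assms(2) by linarith
  then have "x \<in> {0..x + 1}" by simp
  have "((\<lambda>x. integral {0..x} g) has_real_derivative g x) (at x within {0..x + 1})"
    by (rule integral_has_real_derivative[OF continuous_on_subset[OF assms(1) subset_UNIV] \<open>x \<in> {0..x + 1}\<close>])
  then have "((\<lambda>x. integral {0..x} g) has_real_derivative g x) (at x within {0<..<x + 1})"
    by (rule DERIV_subset) auto
  moreover have "at x within {0<..<x + 1} = at x" by (rule at_within_open) (use \<open>0 < x\<close> in auto)
  moreover have "primitive g = (\<lambda>x. integral {0..x} g)" by (rule ext) (rule primitive_def)
  ultimately show ?thesis by (simp only:)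
qed

lemma primitive_eq:
  assumes "continuous_on UNIV g" "0 < a" "\<And>x. x < a \<Longrightarrow> g x = 0" "a \<le> x"
  shows "primitive g x = (LINT s:{a..x}|lborel. g s)"
proof -
  have "AC a x (primitive g) g"
    by (rule AC_C1[OF has_field_derivative_at_within[OF primitive_DERIV[OF assms(1-3)]] continuous_on_subset[OF assms(1)]]) auto
  from AC_endpoints[OF this assms(4)] show ?thesis
    using primitive_zero[OF assms(3) order_refl assms(1)] by simp
qed

lemma C1_supp_continuous: "C1_supp a b g g' \<Longrightarrow> continuous_on UNIV g"
  unfolding C1_supp_def by (meson DERIV_isCont continuous_at_imp_continuous_on)

lemma set_integral_cong_superset:
  fixes f :: "'a \<Rightarrow> real"
  assumes "\<And>x. x \<notin> A \<Longrightarrow> f x = 0" "A \<subseteq> B"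
  shows "(LINT x:B|M. f x) = (LINT x:A|M. f x)"
  unfolding set_lebesgue_integral_def
proof (rule Bochner_Integration.integral_cong[OF refl])
  fix x
  show "indicator B x *\<^sub>R f x = indicator A x *\<^sub>R f x"
    using assms(1)[of x] assms(2) by (cases "x \<in> A") (auto simp: indicator_def)
qed

lemma C1_supp_primitive:
  assumes "continuous_on UNIV g" "0 < a" "\<And>x. x \<notin> {a..b} \<Longrightarrow> g x = 0" "(LINT s:{a..b}|lborel. g s) = 0"
  shows "C1_supp a b (primitive g) g"
  unfolding C1_supp_def
proof (intro conjI allI impI assms(1))
  have g0: "g x = 0" if "x < a" for x using assms(3)[of x] that by simp
  show "(primitive g has_real_derivative g x) (at x)" for x
    by (rule primitive_DERIV[OF assms(1,2) g0])
  fix x assume x: "x \<notin> {a..b}"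
  show "primitive g x = 0"
  proof (cases "x \<le> a")
    case True
    show ?thesis by (rule primitive_zero[OF g0 True assms(1)])
  next
    case False
    then have ax: "a \<le> x" "b < x" using x by auto
    have "primitive g x = (LINT s:{a..x}|lborel. g s)" by (rule primitive_eq[OF assms(1,2) g0 ax(1)])
    also have "\<dots> = (LINT s:{a..b}|lborel. g s)"
      by (rule set_integral_cong_superset) (use ax assms(3) in auto)
    finally show ?thesis using assms(4) by simp
  qed
qed

lemma continuous_bounded_on_Icc:
  fixes g :: "real \<Rightarrow> real"
  assumes "continuous_on UNIV g"
  obtains C where "\<And>x. x \<in> {a..b} \<Longrightarrow> \<bar>g x\<bar> \<le> C"
proof -
  have "bounded (g ` {a..b})"
    by (intro compact_imp_bounded compact_continuous_image continuous_on_subset[OF assms]) auto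
  then obtain C where "\<forall>x\<in>{a..b}. \<bar>g x\<bar> \<le> C" by (auto simp: bounded_iff)
  then show ?thesis using that by blast
qed

text \<open>A function whose \<open>x\<close>-derivative vanishes in the weak sense does not depend on \<open>x\<close>.  Given a test
function \<open>g\<close>, the difference \<open>g - (\<integral>g) k\<close> has integral zero, hence it is the derivative of an admissible
test function; so \<open>W\<close> minus its \<open>k\<close>-weighted mean is orthogonal to all products.\<close>

lemma du_Bois_Reymond:
  fixes W :: "real \<times> real \<Rightarrow> real" and a0 b0 c0 d0 :: real
  defines "R \<equiv> {a0..b0} \<times> {c0..d0}"
  assumes W: "set_integrable lborel R W" and Wm[measurable]: "W \<in> borel_measurable borel" and a0: "0 < a0"
    and k: "continuous_on UNIV k" "\<And>x. x \<notin> {a0..b0} \<Longrightarrow> k x = 0" "(LINT x:{a0..b0}|lborel. k x) = 1"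
    and test: "\<And>a a' b b'. C1_supp a0 b0 a a' \<Longrightarrow> C1_supp c0 d0 b b' \<Longrightarrow>
      (LINT z:R|lborel. W z * (a' (fst z) * b (snd z))) = 0"
  shows "AE z in lborel. z \<in> R \<longrightarrow> W z = (LINT x:{a0..b0}|lborel. k x * W (x, snd z))"
proof -
  have [measurable]: "k \<in> borel_measurable borel" by (rule borel_measurable_continuous_onI[OF k(1)])
  obtain K where K: "\<And>x. x \<in> {a0..b0} \<Longrightarrow> \<bar>k x\<bar> \<le> K" using continuous_bounded_on_Icc[OF k(1), of a0 b0] by blast
  have mfst[measurable]: "(\<lambda>z. h (fst z)) \<in> borel_measurable (borel :: (real \<times> real) measure)"
    and msnd[measurable]: "(\<lambda>z. h (snd z)) \<in> borel_measurable (borel :: (real \<times> real) measure)"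
    if "h \<in> borel_measurable borel" for h :: "real \<Rightarrow> real"
    using that by (auto simp: borel_prod[symmetric])
  have kW: "set_integrable lborel R (\<lambda>z. k (fst z) * W z)"
    by (rule set_integrable_bounded_mult[OF W]) (auto simp: R_def intro: K)
  define c where "c = (\<lambda>t. LINT x:{a0..b0}|lborel. k x * W (x, t))"
  have cm[measurable]: "c \<in> borel_measurable borel"
    unfolding c_def using measurable_integral_snd[of "\<lambda>z. k (fst z) * W z" a0 b0] by simp
  have ci: "set_integrable lborel {c0..d0} c"
    unfolding c_def using rect_integrable_snd[OF kW[unfolded R_def]] by simp
  have cR: "set_integrable lborel R (\<lambda>z. c (snd z))"
    unfolding R_def by (rule rect_integrable_of_snd[OF ci cm])
  have "AE z in lborel. z \<in> R \<longrightarrow> W z - c (snd z) = 0"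
    unfolding R_def
  proof (rule fundamental_lemma_product)
    show "set_integrable lborel ({a0..b0} \<times> {c0..d0}) (\<lambda>z. W z - c (snd z))"
      using set_integral_diff(1)[OF W cR] by (simp add: R_def)
    fix g g' b b' assume g: "C1_supp a0 b0 g g'" and b: "C1_supp c0 d0 b b'"
    have gc: "continuous_on UNIV g" and bc: "continuous_on UNIV b" using g b C1_supp_continuous by auto
    have [measurable]: "g \<in> borel_measurable borel" "b \<in> borel_measurable borel"
      by (auto intro: borel_measurable_continuous_onI gc bc)
    obtain G where G: "\<And>x. x \<in> {a0..b0} \<Longrightarrow> \<bar>g x\<bar> \<le> G" using continuous_bounded_on_Icc[OF gc, of a0 b0] by blast
    obtain B where B: "\<And>x. x \<in> {c0..d0} \<Longrightarrow> \<bar>b x\<bar> \<le> B" using continuous_bounded_on_Icc[OF bc, of c0 d0] by blast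
    have gB: "\<bar>g x * b t\<bar> \<le> \<bar>G\<bar> * \<bar>B\<bar>" if "x \<in> {a0..b0}" "t \<in> {c0..d0}" for x t
      unfolding abs_mult using G[OF that(1)] B[OF that(2)] by (intro mult_mono) auto
    have kB: "\<bar>k x * b t\<bar> \<le> \<bar>K\<bar> * \<bar>B\<bar>" if "x \<in> {a0..b0}" "t \<in> {c0..d0}" for x t
      unfolding abs_mult using K[OF that(1)] B[OF that(2)] by (intro mult_mono) auto
    define \<gamma> where "\<gamma> = (LINT x:{a0..b0}|lborel. g x)"
    have gi: "set_integrable lborel {a0..b0} g" and ki: "set_integrable lborel {a0..b0} k"
      by (auto intro: borel_integrable_atLeastAtMost' continuous_on_subset[OF gc] continuous_on_subset[OF k(1)])
    have "C1_supp a0 b0 (primitive (\<lambda>x. g x - \<gamma> * k x)) (\<lambda>x. g x - \<gamma> * k x)"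
    proof (rule C1_supp_primitive)
      show "continuous_on UNIV (\<lambda>x. g x - \<gamma> * k x)" by (intro continuous_intros gc k(1))
      show "(LINT s:{a0..b0}|lborel. g s - \<gamma> * k s) = 0"
        using gi ki k(3) by (subst set_integral_diff(2)) (auto simp: \<gamma>_def)
      fix x assume "x \<notin> {a0..b0}"
      then show "g x - \<gamma> * k x = 0" using k(2) g by (simp add: C1_supp_def)
    qed (rule a0)
    from test[OF this b]
    have 0: "(LINT z:R|lborel. W z * ((g (fst z) - \<gamma> * k (fst z)) * b (snd z))) = 0" .
    have Wg: "set_integrable lborel R (\<lambda>z. (g (fst z) * b (snd z)) * W z)"
      by (rule set_integrable_bounded_mult[OF W]) (auto simp: R_def intro: gB)
    have Wk: "set_integrable lborel R (\<lambda>z. (k (fst z) * b (snd z)) * W z)"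
      by (rule set_integrable_bounded_mult[OF W]) (auto simp: R_def intro: kB)
    have cg: "set_integrable lborel R (\<lambda>z. (g (fst z) * b (snd z)) * c (snd z))"
      by (rule set_integrable_bounded_mult[OF cR]) (auto simp: R_def intro: gB)
    have e1: "(LINT z:R|lborel. (k (fst z) * b (snd z)) * W z) = (LINT t:{c0..d0}|lborel. b t * c t)"
      unfolding R_def rect_integral_snd[OF Wk[unfolded R_def], symmetric] c_def
      by (simp add: mult.assoc mult.left_commute[of "k _"])
    have e2: "(LINT z:R|lborel. (g (fst z) * b (snd z)) * c (snd z)) = \<gamma> * (LINT t:{c0..d0}|lborel. b t * c t)"
      unfolding R_def rect_integral_snd[OF cg[unfolded R_def], symmetric] \<gamma>_def
      by (simp add: mult.assoc)
    have "(LINT z:R|lborel. (W z - c (snd z)) * (g (fst z) * b (snd z)))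
        = (LINT z:R|lborel. (g (fst z) * b (snd z)) * W z - (g (fst z) * b (snd z)) * c (snd z))"
      by (simp add: algebra_simps)
    also have "\<dots> = (LINT z:R|lborel. (g (fst z) * b (snd z)) * W z) - \<gamma> * (LINT z:R|lborel. (k (fst z) * b (snd z)) * W z)"
      unfolding set_integral_diff(2)[OF Wg cg] e2 e1 ..
    also have "\<dots> = (LINT z:R|lborel. (g (fst z) * b (snd z)) * W z) - (LINT z:R|lborel. \<gamma> * ((k (fst z) * b (snd z)) * W z))"
      by simp
    also have "\<dots> = (LINT z:R|lborel. (g (fst z) * b (snd z)) * W z - \<gamma> * ((k (fst z) * b (snd z)) * W z))"
      by (rule set_integral_diff(2)[OF Wg set_integrable_mult_right[OF Wk], symmetric])
    also have "\<dots> = 0" using 0 by (simp add: algebra_simps)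
    finally show "(LINT z:{a0..b0} \<times> {c0..d0}|lborel. (W z - c (snd z)) * (g (fst z) * b (snd z))) = 0"
      by (simp add: R_def)
  qed
  then show ?thesis by (simp add: c_def)
qed

section \<open>The weak formulation tested with products\<close>

text \<open>The statement is about Lebesgue measurable functions, whereas iterated integrals are taken of Borel
functions; this lemma and its analogues mediate between the two.\<close>

lemma lint_lebesgue_eq:
  fixes f g :: "'a::euclidean_space \<Rightarrow> real"
  assumes g: "g \<in> borel_measurable borel" and ae: "AE z in lborel. f z = g z"
  shows "(LINT z|lebesgue. f z) = (LINT z|lborel. g z)" "integrable lebesgue f \<longleftrightarrow> integrable lborel g"
proof -
  have gl: "g \<in> borel_measurable lebesgue" using g by (simp add: measurable_completion)
  have ael: "AE z in lebesgue. g z = f z" using ae by (intro AE_completion) auto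
  have fl: "f \<in> borel_measurable lebesgue" by (rule borel_measurable_AE[OF gl ael])
  have "(LINT z|lebesgue. f z) = (LINT z|lebesgue. g z)"
    by (rule integral_cong_AE[OF fl gl]) (use ael in auto)
  then show "(LINT z|lebesgue. f z) = (LINT z|lborel. g z)"
    using integral_completion[of g lborel] g by simp
  have "integrable lebesgue f \<longleftrightarrow> integrable lebesgue g"
    by (rule integrable_cong_AE[OF fl gl]) (use ael in auto)
  then show "integrable lebesgue f \<longleftrightarrow> integrable lborel g"
    using integrable_completion[of g lborel] g by simp
qed

lemma C1_supp_deriv_zero:
  assumes "C1_supp a b g g'" "x \<notin> {a..b}"
  shows "g' x = 0"
proof -
  have d: "(g has_real_derivative g' x) (at x)" using assms(1) by (simp add: C1_supp_def)
  have "((\<lambda>x. 0::real) has_real_derivative 0) (at x)" by simp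
  then have "(g has_real_derivative 0) (at x)"
  proof (rule has_field_derivative_transform_within_open[of _ _ _ "- {a..b}"])
    show "open (- {a..b})" by (intro open_Compl closed_atLeastAtMost)
    show "x \<in> - {a..b}" using assms(2) by simp
    fix y assume "y \<in> - {a..b}"
    then show "0 = g y" using assms(1) by (simp add: C1_supp_def)
  qed
  from DERIV_unique[OF d this] show ?thesis .
qed

lemma C1_supp_DERIV: "C1_supp a b g g' \<Longrightarrow> (g has_real_derivative g' x) (at x)"
  and C1_supp_deriv_continuous: "C1_supp a b g g' \<Longrightarrow> continuous_on UNIV g'"
  and C1_supp_outside: "C1_supp a b g g' \<Longrightarrow> x \<notin> {a..b} \<Longrightarrow> g x = 0"
  unfolding C1_supp_def by blast+

lemma C1_supp_measurable:
  assumes "C1_supp a b g g'"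
  shows "g \<in> borel_measurable borel" "g' \<in> borel_measurable borel"
  by (rule borel_measurable_continuous_onI[OF C1_supp_continuous[OF assms]]
      borel_measurable_continuous_onI[OF C1_supp_deriv_continuous[OF assms]])+

lemma C1_supp_endpoint:
  assumes "C1_supp a b g g'"
  shows "g b = 0"
proof -
  have "(\<lambda>n. g (b + inverse (real (Suc n)))) \<longlonglongrightarrow> g (b + 0)"
    by (intro continuous_on_tendsto_compose[OF C1_supp_continuous[OF assms]] tendsto_add tendsto_const
        LIMSEQ_inverse_real_of_nat) auto
  moreover have "g (b + inverse (real (Suc n))) = 0" for n
  proof -
    have "b + inverse (real (Suc n)) \<notin> {a..b}" by simp
    then show ?thesis using assms unfolding C1_supp_def by blast
  qed
  ultimately have "(\<lambda>n. 0) \<longlonglongrightarrow> g b" by simp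
  from LIMSEQ_unique[OF this tendsto_const] show ?thesis by simp
qed

lemma C1_test_product:
  assumes a: "\<And>x. (a has_real_derivative a' x) (at x)" "continuous_on UNIV a'"
    and b: "\<And>x. (b has_real_derivative b' x) (at x)" "continuous_on UNIV b'"
    and K: "compact K" "K \<subseteq> S" "\<And>z. z \<in> S - K \<Longrightarrow> a (fst z) * b (snd z) = 0"
  shows "C1_test S (\<lambda>z. a (fst z) * b (snd z)) (\<lambda>z. a' (fst z) * b (snd z)) (\<lambda>z. a (fst z) * b' (snd z))"
proof -
  have ac: "continuous_on UNIV a" and bc: "continuous_on UNIV b"
    using a(1) b(1) by (meson DERIV_isCont continuous_at_imp_continuous_on)+
  have cf: "continuous_on S (\<lambda>z. f (fst z))" and cs: "continuous_on S (\<lambda>z. f (snd z))"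
    if "continuous_on UNIV f" for f :: "real \<Rightarrow> real"
    by (rule continuous_on_compose2[OF that]; intro continuous_intros subset_UNIV)+
  show ?thesis
    unfolding C1_test_def
  proof (intro conjI ballI)
    show "continuous_on S (\<lambda>z. a' (fst z) * b (snd z))" "continuous_on S (\<lambda>z. a (fst z) * b' (snd z))"
      by (intro continuous_on_mult cf cs a(2) b(2) ac bc)+
    show "\<exists>K. compact K \<and> K \<subseteq> S \<and> (\<forall>z\<in>S - K. a (fst z) * b (snd z) = 0)" using K by blast
    fix z assume "z \<in> S"
    have "((\<lambda>z. a (fst z)) has_derivative (\<lambda>h. fst h * a' (fst z))) (at z within S)"
      "((\<lambda>z. b (snd z)) has_derivative (\<lambda>h. snd h * b' (snd z))) (at z within S)"
      by (rule DERIV_compose_FDERIV[OF a(1)] DERIV_compose_FDERIV[OF b(1)];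
          intro has_derivative_fst has_derivative_snd has_derivative_ident)+
    from has_derivative_mult[OF this]
    show "((\<lambda>z. a (fst z) * b (snd z)) has_derivative
       (\<lambda>h. a' (fst z) * b (snd z) * fst h + a (fst z) * b' (snd z) * snd h)) (at z within S)"
      by (simp add: algebra_simps)
  qed
qed

lemma interior_Q: "interior Q = {0<..<1} \<times> {0<..}"
proof -
  have "interior {0<..1::real} = {0<..<1}" by simp
  moreover have "interior {0<..} = {0::real<..}" by (simp add: interior_open)
  ultimately show ?thesis by (simp add: Q_def interior_Times)
qed

lemma Q_sets [measurable, simp]: "Q \<in> sets borel"
proof -
  have "{0<..1::real} \<times> {0::real<..} \<in> sets (borel \<Otimes>\<^sub>M borel)" by simp
  then show ?thesis unfolding Q_def by (simp only: borel_prod)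
qed

lemma set_integrable_mult_square:
  fixes f g :: "'a \<Rightarrow> real"
  assumes [measurable]: "f \<in> borel_measurable M" "g \<in> borel_measurable M" "S \<in> sets M"
    and "set_integrable M S (\<lambda>x. (f x)\<^sup>2)" "set_integrable M S (\<lambda>x. (g x)\<^sup>2)"
  shows "set_integrable M S (\<lambda>x. f x * g x)"
proof -
  have e: "(\<lambda>x. (indicator S x * u x)\<^sup>2) = (\<lambda>x. indicator S x *\<^sub>R (u x)\<^sup>2)" for u :: "'a \<Rightarrow> real"
    by (auto simp: fun_eq_iff indicator_def)
  have "integrable M (\<lambda>x. (indicator S x * f x) * (indicator S x * g x))"
    by (rule integrable_mult_square) (use assms(4,5) in \<open>simp_all only: e set_integrable_def, measurable\<close>)
  moreover have "(\<lambda>x. (indicator S x * f x) * (indicator S x * g x)) = (\<lambda>x. indicator S x *\<^sub>R (f x * g x))"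
    by (auto simp: fun_eq_iff indicator_def)
  ultimately show ?thesis by (simp only: set_integrable_def)
qed

lemma rect_integrable_const: "set_integrable lborel ({a..b::real} \<times> {c..d::real}) (\<lambda>z. k::real)"
  unfolding set_integrable_def
  by (intro integrable_scaleR_left integrable_real_indicator)
     (use emeasure_lborel_cbox_finite[of "(a, c)" "(b, d)"] in \<open>auto simp: cbox_Pair_eq\<close>)

lemma rect_integrable_of_square:
  fixes f :: "real \<times> real \<Rightarrow> real"
  assumes "f \<in> borel_measurable borel" "set_integrable lborel ({a..b} \<times> {c..d}) (\<lambda>x. (f x)\<^sup>2)"
  shows "set_integrable lborel ({a..b} \<times> {c..d}) f"
  using set_integrable_mult_square[of f lborel "\<lambda>_. 1" "{a..b} \<times> {c..d}"] assms rect_integrable_const[of a b c d 1]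
  by simp

text \<open>What a weak solution provides after passing to Borel representatives, with test functions
\<open>a(x) b(t)\<close>.  In \<open>weq\<close> the factor \<open>a\<close> is free at \<open>x = 1\<close>, and this freedom encodes the no-flux
condition there, while in \<open>dx\<close> it has compact support in the open interval.\<close>

locale weak_form =
  fixes n nx :: "real \<times> real \<Rightarrow> real"
  assumes n_meas [measurable]: "n \<in> borel_measurable borel"
    and nx_meas [measurable]: "nx \<in> borel_measurable borel"
    and n_sq: "\<And>\<alpha> \<sigma> T. 0 < \<alpha> \<Longrightarrow> 0 < \<sigma> \<Longrightarrow> set_integrable lborel ({\<alpha>..1} \<times> {\<sigma>..T}) (\<lambda>z. (n z)\<^sup>2)"
    and nx_sq: "\<And>\<alpha> \<sigma> T. 0 < \<alpha> \<Longrightarrow> 0 < \<sigma> \<Longrightarrow> set_integrable lborel ({\<alpha>..1} \<times> {\<sigma>..T}) (\<lambda>z. (nx z)\<^sup>2)"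
    and dx: "\<And>a0 b0 c0 d0 a a' b b'. C1_supp a0 b0 a a' \<Longrightarrow> C1_supp c0 d0 b b' \<Longrightarrow> 0 < a0 \<Longrightarrow> b0 < 1 \<Longrightarrow> 0 < c0 \<Longrightarrow>
      (LINT z:{a0..b0} \<times> {c0..d0}|lborel. n z * (a' (fst z) * b (snd z))) =
      - (LINT z:{a0..b0} \<times> {c0..d0}|lborel. nx z * (a (fst z) * b (snd z)))"
    and weq: "\<And>\<alpha> \<sigma> T a a' b b'. (\<And>x. (a has_real_derivative a' x) (at x)) \<Longrightarrow> continuous_on UNIV a' \<Longrightarrow>
      (\<And>x. x \<le> \<alpha> \<Longrightarrow> a x = 0) \<Longrightarrow> C1_supp \<sigma> T b b' \<Longrightarrow> 0 < \<alpha> \<Longrightarrow> 0 < \<sigma> \<Longrightarrow>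
      (LINT z:{\<alpha>..1} \<times> {\<sigma>..T}|lborel. n z * (a (fst z) * b' (snd z)) - flux n nx z * (a' (fst z) * b (snd z))) = 0"

lemma measurable_of_fst_snd [measurable]:
  fixes h :: "real \<Rightarrow> real"
  assumes "h \<in> borel_measurable borel"
  shows "(\<lambda>z. h (fst z)) \<in> borel_measurable (borel :: (real \<times> real) measure)"
    "(\<lambda>z. h (snd z)) \<in> borel_measurable (borel :: (real \<times> real) measure)"
  using assms by (auto simp: borel_prod[symmetric])

lemma measurable_flux [measurable]:
  assumes [measurable]: "n \<in> borel_measurable borel" "nx \<in> borel_measurable borel"
  shows "flux n nx \<in> borel_measurable borel"
proof -
  have [measurable]: "fst \<in> borel_measurable (borel :: (real \<times> real) measure)"
    using measurable_of_fst_snd(1)[of "\<lambda>x. x"] by simp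
  show ?thesis unfolding flux_def[abs_def] by measurable
qed

lemma borel_representative:
  fixes f :: "real \<times> real \<Rightarrow> real"
  assumes "set_borel_measurable lebesgue Q f"
  obtains g where "g \<in> borel_measurable borel" "AE z in lborel. z \<in> Q \<longrightarrow> f z = g z"
proof -
  from completion_ex_borel_measurable_real[OF assms[unfolded set_borel_measurable_def]]
  obtain g where g: "g \<in> borel_measurable lborel" "AE z in lborel. indicator Q z *\<^sub>R f z = g z"
    by blast
  from g(2) have "AE z in lborel. z \<in> Q \<longrightarrow> f z = g z" by eventually_elim auto
  then show ?thesis using that g(1) by simp
qed

lemma rect_subset_Q: "0 < \<alpha> \<Longrightarrow> 0 < \<sigma> \<Longrightarrow> {\<alpha>..1} \<times> {\<sigma>..T} \<subseteq> Q"
  by (auto simp: Q_def)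

lemma weak_solution_imp_weak_form:
  assumes "weak_solution_exp p ni n"
  obtains n0 nx0 where "weak_form n0 nx0" "AE z in lborel. z \<in> Q \<longrightarrow> n z = n0 z"
proof -
  obtain nx where wdx: "weak_dx (interior Q) n nx" and L: "Lloc 2 Q n" "Lloc 2 Q nx"
    and weak: "\<And>\<psi> \<psi>x \<psi>t. C1_test Q \<psi> \<psi>x \<psi>t \<Longrightarrow>
           (LINT z:Q|lebesgue. n z * \<psi>t z - flux n nx z * \<psi>x z) = 0"
    using assms unfolding weak_solution_exp_def by blast
  obtain n0 where n0[measurable]: "n0 \<in> borel_measurable borel" and an: "AE z in lborel. z \<in> Q \<longrightarrow> n z = n0 z"
    using L(1) unfolding Lloc_def by (blast intro: borel_representative)
  obtain nx0 where nx0[measurable]: "nx0 \<in> borel_measurable borel" and ax: "AE z in lborel. z \<in> Q \<longrightarrow> nx z = nx0 z"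
    using L(2) unfolding Lloc_def by (blast intro: borel_representative)
  have sq: "set_integrable lborel ({\<alpha>..1} \<times> {\<sigma>..T}) (\<lambda>z. (g z)\<^sup>2)"
    if "Lloc 2 Q f" "AE z in lborel. z \<in> Q \<longrightarrow> f z = g z" "g \<in> borel_measurable borel" "0 < \<alpha>" "0 < \<sigma>"
    for f g and \<alpha> \<sigma> T :: real
  proof -
    note [measurable] = that(3)
    have K: "compact ({\<alpha>..1} \<times> {\<sigma>..T})" by (intro compact_Times compact_Icc)
    note sub = rect_subset_Q[OF that(4,5), of T]
    have 1: "integrable lebesgue (\<lambda>z. indicator ({\<alpha>..1} \<times> {\<sigma>..T}) z *\<^sub>R \<bar>f z\<bar>\<^sup>2)"
      using that(1) K sub unfolding Lloc_def set_integrable_def by blast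
    have 2: "AE z in lborel. indicator ({\<alpha>..1} \<times> {\<sigma>..T}) z *\<^sub>R \<bar>f z\<bar>\<^sup>2 = indicator ({\<alpha>..1} \<times> {\<sigma>..T}) z *\<^sub>R (g z)\<^sup>2"
      using that(2) by eventually_elim (use sub in \<open>auto simp: indicator_def\<close>)
    have 3: "(\<lambda>z. indicator ({\<alpha>..1} \<times> {\<sigma>..T}) z *\<^sub>R (g z)\<^sup>2) \<in> borel_measurable borel" by measurable
    show ?thesis unfolding set_integrable_def by (rule iffD1[OF lint_lebesgue_eq(2)[OF 3 2] 1])
  qed
  have "weak_form n0 nx0"
  proof
    fix a0 b0 c0 d0 a a' b b'
    assume a: "C1_supp a0 b0 a a'" and b: "C1_supp c0 d0 b b'" and pos: "0 < a0" "b0 < 1" "0 < (c0::real)"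
    let ?R = "{a0..b0} \<times> {c0..d0}" and ?U = "interior Q"
    have RU: "?R \<subseteq> ?U" using pos by (auto simp: interior_Q)
    have UQ: "?U \<subseteq> Q" by (rule interior_subset)
    note mm = C1_supp_measurable(1)[OF a] C1_supp_measurable(1)[OF b] C1_supp_measurable(2)[OF a]
    note [measurable] = mm
    have "C1_test ?U (\<lambda>z. a (fst z) * b (snd z)) (\<lambda>z. a' (fst z) * b (snd z)) (\<lambda>z. a (fst z) * b' (snd z))"
    proof (rule C1_test_product)
      show "compact ?R" by (intro compact_Times compact_Icc)
      show "?R \<subseteq> ?U" by (rule RU)
      fix z assume "z \<in> ?U - ?R"
      then have "fst z \<notin> {a0..b0} \<or> snd z \<notin> {c0..d0}" by (auto simp: mem_Times_iff)
      then show "a (fst z) * b (snd z) = 0"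
        using C1_supp_outside[OF a, of "fst z"] C1_supp_outside[OF b, of "snd z"] by auto
    qed (rule C1_supp_DERIV[OF a] C1_supp_deriv_continuous[OF a] C1_supp_DERIV[OF b] C1_supp_deriv_continuous[OF b])+
    then have e: "(LINT z:?U|lebesgue. n z * (a' (fst z) * b (snd z))) = - (LINT z:?U|lebesgue. nx z * (a (fst z) * b (snd z)))"
      using wdx unfolding weak_dx_def by blast
    have out: "a' (fst z) * b (snd z) = 0" "a (fst z) * b (snd z) = 0" if "z \<notin> ?R" for z
    proof -
      have "fst z \<notin> {a0..b0} \<or> snd z \<notin> {c0..d0}" using that by (auto simp: mem_Times_iff)
      then show "a' (fst z) * b (snd z) = 0" "a (fst z) * b (snd z) = 0"
        using C1_supp_outside[OF a, of "fst z"] C1_supp_outside[OF b, of "snd z"] C1_supp_deriv_zero[OF a, of "fst z"]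
        by auto
    qed
    have tr: "(LINT z:?U|lebesgue. f z * w z) = (LINT z:?R|lborel. g z * w z)"
      if "AE z in lborel. z \<in> Q \<longrightarrow> f z = g z" "\<And>z. z \<notin> ?R \<Longrightarrow> w z = 0"
        "g \<in> borel_measurable borel" "w \<in> borel_measurable borel" for f g w :: "real \<times> real \<Rightarrow> real"
    proof -
      note [measurable] = that(3,4)
      have 1: "(\<lambda>z. indicator ?R z *\<^sub>R (g z * w z)) \<in> borel_measurable borel" by measurable
      have 2: "AE z in lborel. indicator ?U z *\<^sub>R (f z * w z) = indicator ?R z *\<^sub>R (g z * w z)"
        using that(1)
      proof eventually_elim
        case (elim z)
        then show ?case using that(2)[of z] RU UQ by (cases "z \<in> ?R") (auto simp: indicator_def)
      qed
      show ?thesis unfolding set_lebesgue_integral_def by (rule lint_lebesgue_eq(1)[OF 1 2])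
    qed
    show "(LINT z:?R|lborel. n0 z * (a' (fst z) * b (snd z))) = - (LINT z:?R|lborel. nx0 z * (a (fst z) * b (snd z)))"
    proof -
      have "(LINT z:?U|lebesgue. n z * (a' (fst z) * b (snd z))) = (LINT z:?R|lborel. n0 z * (a' (fst z) * b (snd z)))"
        by (rule tr[OF an out(1) n0]) measurable
      moreover have "(LINT z:?U|lebesgue. nx z * (a (fst z) * b (snd z))) = (LINT z:?R|lborel. nx0 z * (a (fst z) * b (snd z)))"
        by (rule tr[OF ax out(2) nx0]) measurable
      ultimately show ?thesis using e by simp
    qed
  next
    fix \<alpha> \<sigma> T a a' b b'
    assume a: "\<And>x. (a has_real_derivative a' x) (at x)" "continuous_on UNIV a'" "\<And>x. x \<le> \<alpha> \<Longrightarrow> a x = 0"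
      and b: "C1_supp \<sigma> T b b'" and pos: "0 < \<alpha>" "0 < (\<sigma>::real)"
    let ?R = "{\<alpha>..1} \<times> {\<sigma>..T}"
    have RQ: "?R \<subseteq> Q" by (rule rect_subset_Q[OF pos])
    have ac: "continuous_on UNIV a" using a(1) by (meson DERIV_isCont continuous_at_imp_continuous_on)
    note [measurable] = borel_measurable_continuous_onI[OF ac] borel_measurable_continuous_onI[OF a(2)]
      C1_supp_measurable[OF b]
    \<comment> \<open>The integrals over \<open>Q\<close> and over the rectangle agree: all factors vanish to the left of \<open>\<alpha>\<close>.\<close>
    have a'0: "a' x = 0" if "x < \<alpha>" for x
    proof -
      have "((\<lambda>x. 0::real) has_real_derivative 0) (at x)" by simp
      then have "(a has_real_derivative 0) (at x)"
      proof (rule has_field_derivative_transform_within_open[of _ _ _ "{..<\<alpha>}"])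
        fix y assume "y \<in> {..<\<alpha>}"
        then have "y \<le> \<alpha>" by simp
        from a(3)[OF this] show "0 = a y" by simp
      qed (use that in \<open>simp_all only: open_lessThan lessThan_iff\<close>)
      from DERIV_unique[OF a(1) this] show ?thesis .
    qed
    have out: "a (fst z) * b (snd z) = 0 \<and> a' (fst z) * b (snd z) = 0 \<and> a (fst z) * b' (snd z) = 0"
      if "z \<in> Q - ?R" for z
    proof -
      have "fst z < \<alpha> \<or> snd z \<notin> {\<sigma>..T}" using that by (auto simp: Q_def mem_Times_iff)
      then show ?thesis
      proof
        assume "fst z < \<alpha>"
        then show ?thesis using a(3)[of "fst z"] a'0[of "fst z"] by simp
      next
        assume "snd z \<notin> {\<sigma>..T}"
        then have "b (snd z) = 0" "b' (snd z) = 0"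
          by (rule C1_supp_outside[OF b] C1_supp_deriv_zero[OF b])+
        then show ?thesis by simp
      qed
    qed
    have "C1_test Q (\<lambda>z. a (fst z) * b (snd z)) (\<lambda>z. a' (fst z) * b (snd z)) (\<lambda>z. a (fst z) * b' (snd z))"
    proof (rule C1_test_product)
      show "compact ?R" by (intro compact_Times compact_Icc)
      show "?R \<subseteq> Q" by (rule RQ)
      show "a (fst z) * b (snd z) = 0" if "z \<in> Q - ?R" for z using out[OF that] by blast
    qed (rule a(1) a(2) C1_supp_DERIV[OF b] C1_supp_deriv_continuous[OF b])+
    from weak[OF this] have 0: "(LINT z:Q|lebesgue. n z * (a (fst z) * b' (snd z)) - flux n nx z * (a' (fst z) * b (snd z))) = 0" .
    have 1: "(\<lambda>z. indicator ?R z *\<^sub>R (n0 z * (a (fst z) * b' (snd z)) - flux n0 nx0 z * (a' (fst z) * b (snd z)))) \<in> borel_measurable borel"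
      by measurable
    have 2: "AE z in lborel. indicator Q z *\<^sub>R (n z * (a (fst z) * b' (snd z)) - flux n nx z * (a' (fst z) * b (snd z))) =
        indicator ?R z *\<^sub>R (n0 z * (a (fst z) * b' (snd z)) - flux n0 nx0 z * (a' (fst z) * b (snd z)))"
      using an ax
    proof eventually_elim
      case (elim z)
      consider "z \<notin> Q" | "z \<in> Q - ?R" | "z \<in> ?R" by blast
      then show ?case
      proof cases
        case 1
        then have "z \<notin> ?R" using RQ by blast
        then show ?thesis using 1 by simp
      next
        case 2
        then show ?thesis using out[OF 2] by auto
      next
        case 3
        then have "z \<in> Q" using RQ by blast
        then show ?thesis using elim 3 by (simp add: flux_def)
      qed
    qed
    show "(LINT z:?R|lborel. n0 z * (a (fst z) * b' (snd z)) - flux n0 nx0 z * (a' (fst z) * b (snd z))) = 0"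
      using 0 unfolding set_lebesgue_integral_def lint_lebesgue_eq(1)[OF 1 2] .
  qed (use n0 nx0 sq[OF L(1) an n0] sq[OF L(2) ax nx0] in auto)
  then show ?thesis using that an by blast
qed

lemma AE_rect_cong:
  fixes f g :: "'a::euclidean_space \<Rightarrow> real"
  assumes "AE z in lborel. z \<in> R \<longrightarrow> f z = g z" "R \<in> sets borel"
    "f \<in> borel_measurable borel" "g \<in> borel_measurable borel"
  shows "(LINT z:R|lborel. f z) = (LINT z:R|lborel. g z)"
    and "set_integrable lborel R f \<longleftrightarrow> set_integrable lborel R g"
proof -
  have 1: "(\<lambda>z. indicator R z *\<^sub>R f z) \<in> borel_measurable lborel" "(\<lambda>z. indicator R z *\<^sub>R g z) \<in> borel_measurable lborel"
    using assms by measurable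
  have 2: "AE z in lborel. indicator R z *\<^sub>R f z = indicator R z *\<^sub>R g z"
    using assms(1) by eventually_elim (auto simp: indicator_def)
  show "(LINT z:R|lborel. f z) = (LINT z:R|lborel. g z)"
    unfolding set_lebesgue_integral_def by (rule integral_cong_AE[OF 1 2])
  show "set_integrable lborel R f \<longleftrightarrow> set_integrable lborel R g"
    unfolding set_integrable_def by (rule integrable_cong_AE[OF 1 2])
qed

lemma weak_form_cong_AE:
  assumes "weak_form n nx" and n'[measurable]: "n' \<in> borel_measurable borel"
    and ae: "AE z in lborel. z \<in> Q \<longrightarrow> n z = n' z"
  shows "weak_form n' nx"
proof -
  interpret weak_form n nx by fact
  have ae': "AE z in lborel. z \<in> R \<longrightarrow> n z = n' z" if "R \<subseteq> Q" for R
    using ae by eventually_elim (use that in auto)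
  show ?thesis
  proof
    fix \<alpha> \<sigma> T :: real assume pos: "0 < \<alpha>" "0 < \<sigma>"
    have "set_integrable lborel ({\<alpha>..1} \<times> {\<sigma>..T}) (\<lambda>z. (n z)\<^sup>2) \<longleftrightarrow> set_integrable lborel ({\<alpha>..1} \<times> {\<sigma>..T}) (\<lambda>z. (n' z)\<^sup>2)"
      by (rule AE_rect_cong(2)) (use ae'[OF rect_subset_Q[OF pos, of T]] in \<open>auto elim!: eventually_mono\<close>)
    then show "set_integrable lborel ({\<alpha>..1} \<times> {\<sigma>..T}) (\<lambda>z. (n' z)\<^sup>2)" using n_sq[OF pos] by blast
  next
    fix a0 b0 c0 d0 a a' b b'
    assume a: "C1_supp a0 b0 a a'" and b: "C1_supp c0 d0 b b'" and pos: "0 < a0" "b0 < 1" "0 < (c0::real)"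
    note [measurable] = C1_supp_measurable(1)[OF b] C1_supp_measurable(2)[OF a]
    have sub: "{a0..b0} \<times> {c0..d0} \<subseteq> Q" using pos by (auto simp: Q_def)
    have "(LINT z:{a0..b0} \<times> {c0..d0}|lborel. n z * (a' (fst z) * b (snd z))) =
      (LINT z:{a0..b0} \<times> {c0..d0}|lborel. n' z * (a' (fst z) * b (snd z)))"
      by (rule AE_rect_cong(1)) (use ae'[OF sub] in \<open>auto elim!: eventually_mono\<close>)
    then show "(LINT z:{a0..b0} \<times> {c0..d0}|lborel. n' z * (a' (fst z) * b (snd z))) =
      - (LINT z:{a0..b0} \<times> {c0..d0}|lborel. nx z * (a (fst z) * b (snd z)))"
      using dx[OF a b pos] by simp
  next
    fix \<alpha> \<sigma> T a a' b b'
    assume a: "\<And>x. (a has_real_derivative a' x) (at x)" "continuous_on UNIV a'" "\<And>x. x \<le> \<alpha> \<Longrightarrow> a x = 0"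
      and b: "C1_supp \<sigma> T b b'" and pos: "0 < \<alpha>" "0 < (\<sigma>::real)"
    have ac: "continuous_on UNIV a" using a(1) by (meson DERIV_isCont continuous_at_imp_continuous_on)
    note [measurable] = borel_measurable_continuous_onI[OF ac] borel_measurable_continuous_onI[OF a(2)]
      C1_supp_measurable[OF b]
    have "(LINT z:{\<alpha>..1} \<times> {\<sigma>..T}|lborel. n z * (a (fst z) * b' (snd z)) - flux n nx z * (a' (fst z) * b (snd z))) =
      (LINT z:{\<alpha>..1} \<times> {\<sigma>..T}|lborel. n' z * (a (fst z) * b' (snd z)) - flux n' nx z * (a' (fst z) * b (snd z)))"
    proof (rule AE_rect_cong(1))
      show "AE z in lborel. z \<in> {\<alpha>..1} \<times> {\<sigma>..T} \<longrightarrow>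
        n z * (a (fst z) * b' (snd z)) - flux n nx z * (a' (fst z) * b (snd z)) =
        n' z * (a (fst z) * b' (snd z)) - flux n' nx z * (a' (fst z) * b (snd z))"
        using ae'[OF rect_subset_Q[OF pos, of T]] by eventually_elim (simp add: flux_def)
    qed measurable
    then show "(LINT z:{\<alpha>..1} \<times> {\<sigma>..T}|lborel. n' z * (a (fst z) * b' (snd z)) - flux n' nx z * (a' (fst z) * b (snd z))) = 0"
      using weq[OF a b pos] by simp
  qed (use nx_meas nx_sq n' in auto)
qed

section \<open>The integrated equation\<close>

text \<open>A continuous probability density supported in \<open>[a, b]\<close>; the factor normalises the parabola.\<close>

definition kern :: "real \<Rightarrow> real \<Rightarrow> real \<Rightarrow> real" where
  "kern a b x = 6 / (b - a) ^ 3 * max 0 ((x - a) * (b - x))"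

lemma kern_continuous: "continuous_on UNIV (kern a b)"
  unfolding kern_def[abs_def] by (intro continuous_intros)

lemma kern_outside:
  assumes "a < b" "x \<notin> {a..b}"
  shows "kern a b x = 0"
proof -
  have "(x - a) * (b - x) \<le> 0"
    using assms by (cases "x \<le> a") (auto intro: mult_nonneg_nonpos mult_nonpos_nonneg)
  then show ?thesis by (simp add: kern_def)
qed

lemma kern_integral:
  assumes "a < b"
  shows "(LINT x:{a..b}|lborel. kern a b x) = 1"
proof -
  let ?F = "\<lambda>x. 6 / (b - a) ^ 3 * ((b - a) * (x - a)\<^sup>2 / 2 - (x - a) ^ 3 / 3)"
  have "AC a b ?F (kern a b)"
  proof (rule AC_C1)
    show "continuous_on {a..b} (kern a b)" by (rule continuous_on_subset[OF kern_continuous]) simp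
    fix x assume x: "x \<in> {a..b}"
    then have "0 \<le> (x - a) * (b - x)" by simp
    then have "kern a b x = 6 / (b - a) ^ 3 * ((x - a) * (b - x))" by (simp only: kern_def max.absorb2)
    also have "(x - a) * (b - x) = (b - a) * (x - a) - (x - a)\<^sup>2"
      by (simp add: power2_eq_square algebra_simps)
    finally have k: "kern a b x = 6 / (b - a) ^ 3 * ((b - a) * (x - a) - (x - a)\<^sup>2)" .
    have "((\<lambda>x. (b - a) * (x - a)\<^sup>2 / 2 - (x - a) ^ 3 / 3) has_real_derivative
        (b - a) * (x - a) - (x - a)\<^sup>2) (at x within {a..b})"
      by (auto intro!: derivative_eq_intros simp: power2_eq_square)
    from DERIV_cmult[OF this] show "(?F has_real_derivative kern a b x) (at x within {a..b})"
      unfolding k .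
  qed
  from AC_endpoints[OF this] have "(LINT x:{a..b}|lborel. kern a b x) = ?F b - ?F a" using assms by simp
  also have "\<dots> = 1"
  proof -
    define L where "L = b - a"
    have "L \<noteq> 0" using assms by (simp add: L_def)
    then have "6 / L ^ 3 * (L * L\<^sup>2 / 2 - L ^ 3 / 3) = 1"
      by (simp add: field_simps power2_eq_square power3_eq_cube)
    then show ?thesis by (simp add: L_def)
  qed
  finally show ?thesis .
qed

lemma set_integrable_product_mult:
  fixes F :: "real \<times> real \<Rightarrow> real"
  assumes F: "set_integrable lborel ({a..b} \<times> {c..d}) F"
    and u: "continuous_on UNIV u" and v: "continuous_on UNIV v"
  shows "set_integrable lborel ({a..b} \<times> {c..d}) (\<lambda>z. (u (fst z) * v (snd z)) * F z)"
proof -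
  obtain C where C: "\<And>x. x \<in> {a..b} \<Longrightarrow> \<bar>u x\<bar> \<le> C" using continuous_bounded_on_Icc[OF u, of a b] by blast
  obtain C' where C': "\<And>x. x \<in> {c..d} \<Longrightarrow> \<bar>v x\<bar> \<le> C'" using continuous_bounded_on_Icc[OF v, of c d] by blast
  note [measurable] = borel_measurable_continuous_onI[OF u] borel_measurable_continuous_onI[OF v]
  show ?thesis
  proof (rule set_integrable_bounded_mult[OF F])
    show "(\<lambda>z. u (fst z) * v (snd z)) \<in> borel_measurable lborel" by measurable
    fix z assume "z \<in> {a..b} \<times> {c..d}"
    then have "fst z \<in> {a..b}" "snd z \<in> {c..d}" by (simp_all add: mem_Times_iff)
    then show "\<bar>u (fst z) * v (snd z)\<bar> \<le> C * C'"
      unfolding abs_mult using order_trans[OF abs_ge_zero C[OF \<open>fst z \<in> {a..b}\<close>]]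
      by (intro mult_mono C C') simp_all
  qed
qed

lemma AC_tail:
  assumes "set_integrable lborel {a..b} f" "a \<le> b"
  shows "AC a b (\<lambda>x. LINT y:{x..b}|lborel. f y) (\<lambda>x. - f x)"
proof (rule AC_from_right)
  show "set_integrable lborel {a..b} (\<lambda>x. - f x)"
    using set_integrable_mult_right[OF assms(1), of "-1"] by simp
  fix x assume x: "x \<in> {a..b}"
  have "set_integrable lborel {x..b} f" by (rule set_integrable_subset[OF assms(1)]) (use x in auto)
  then show "(LINT y:{x..b}|lborel. f y) = (LINT y:{b..b}|lborel. f y) - (LINT s:{x..b}|lborel. - f s)"
    by (simp add: set_integral_uminus)
qed (rule assms(2))

lemma AC_head:
  assumes "set_integrable lborel {a..b} f"
  shows "AC a b (\<lambda>x. LINT y:{a..x}|lborel. f y) f"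
  unfolding AC_def using assms by simp

context weak_form
begin

lemma n_int: "0 < \<alpha> \<Longrightarrow> 0 < \<sigma> \<Longrightarrow> set_integrable lborel ({\<alpha>..1} \<times> {\<sigma>..T}) n"
  by (rule rect_integrable_of_square[OF n_meas n_sq])

lemma nx_int: "0 < \<alpha> \<Longrightarrow> 0 < \<sigma> \<Longrightarrow> set_integrable lborel ({\<alpha>..1} \<times> {\<sigma>..T}) nx"
  by (rule rect_integrable_of_square[OF nx_meas nx_sq])

lemma flux_meas: "flux n nx \<in> borel_measurable borel"
  by (rule measurable_flux) measurable

lemma flux_int:
  assumes "0 < \<alpha>" "0 < \<sigma>"
  shows "set_integrable lborel ({\<alpha>..1} \<times> {\<sigma>..T}) (flux n nx)"
proof -
  have [measurable]: "fst \<in> borel_measurable (borel :: (real \<times> real) measure)"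
    using measurable_of_fst_snd(1)[of "\<lambda>x. x"] by simp
  have "set_integrable lborel ({\<alpha>..1} \<times> {\<sigma>..T}) (\<lambda>z. (fst z)\<^sup>2 * nx z)"
    by (rule set_integrable_bounded_mult[where C=1, OF nx_int[OF assms]])
       (use assms in \<open>auto simp: power2_eq_square abs_mult intro!: mult_le_one\<close>)
  moreover have "set_integrable lborel ({\<alpha>..1} \<times> {\<sigma>..T}) (\<lambda>z. (2 * fst z) * n z)"
    by (rule set_integrable_bounded_mult[where C=2, OF n_int[OF assms]]) (use assms in auto)
  ultimately show ?thesis
    unfolding flux_def[abs_def]
    by (intro set_integral_add(1) set_integral_diff(1) n_sq[OF assms])
qed

definition ntail :: "real \<times> real \<Rightarrow> real" where
  "ntail z = (LINT y:{fst z..1}|lborel. n (y, snd z))"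

definition nxtail :: "real \<times> real \<Rightarrow> real" where
  "nxtail z = (LINT y:{fst z..1}|lborel. nx (y, snd z))"

lemma ntail_meas [measurable]: "ntail \<in> borel_measurable borel"
  unfolding ntail_def[abs_def] by measurable

lemma nxtail_meas [measurable]: "nxtail \<in> borel_measurable borel"
  unfolding nxtail_def[abs_def] by measurable

text \<open>On almost every slice \<open>- nx\<close> is the density of the tail; integrate by parts in \<open>x\<close>.\<close>

lemma nxtail_test:
  assumes a: "C1_supp a0 b0 a a'" and b: "C1_supp c0 d0 b b'" and pos: "0 < a0" "a0 < b0" "b0 < 1" "0 < c0"
  shows "(LINT z:{a0..b0} \<times> {c0..d0}|lborel. nxtail z * (a' (fst z) * b (snd z))) =
    (LINT z:{a0..b0} \<times> {c0..d0}|lborel. nx z * (a (fst z) * b (snd z)))"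
proof -
  let ?R = "{a0..b0} \<times> {c0..d0}" and ?S = "{a0..1} \<times> {c0..d0}"
  note [measurable] = C1_supp_measurable[OF a] C1_supp_measurable[OF b]
  have ext: "(LINT z:?S|lborel. (g (fst z) * b (snd z)) * F z) = (LINT z:?R|lborel. (g (fst z) * b (snd z)) * F z)"
    if "\<And>x. x \<notin> {a0..b0} \<Longrightarrow> g x = 0" for g :: "real \<Rightarrow> real" and F :: "real \<times> real \<Rightarrow> real"
  proof (rule set_integral_cong_superset)
    show "?R \<subseteq> ?S" using pos by auto
    fix z assume "z \<notin> ?R"
    then have "fst z \<notin> {a0..b0} \<or> snd z \<notin> {c0..d0}" by (auto simp: mem_Times_iff)
    then show "g (fst z) * b (snd z) * F z = 0"
      using that[of "fst z"] C1_supp_outside[OF b, of "snd z"] by auto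
  qed
  have nxS: "set_integrable lborel ?S nx" by (rule nx_int[OF pos(1,4)])
  have tS: "set_integrable lborel ?S nxtail"
    unfolding nxtail_def[abs_def] by (rule rect_integrable_tail[OF nxS nx_meas])
  have i1: "set_integrable lborel ?S (\<lambda>z. (a' (fst z) * b (snd z)) * nxtail z)"
    by (rule set_integrable_product_mult[OF tS C1_supp_deriv_continuous[OF a] C1_supp_continuous[OF b]])
  have i2: "set_integrable lborel ?S (\<lambda>z. (a (fst z) * b (snd z)) * nx z)"
    by (rule set_integrable_product_mult[OF nxS C1_supp_continuous[OF a] C1_supp_continuous[OF b]])
  have ACa: "AC a0 1 a a'"
    by (rule AC_C1[OF has_field_derivative_at_within[OF C1_supp_DERIV[OF a]]
        continuous_on_subset[OF C1_supp_deriv_continuous[OF a] subset_UNIV]])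
  have aa0: "a a0 = 0"
  proof -
    have "(\<lambda>n. a (a0 - inverse (real (Suc n)))) \<longlonglongrightarrow> a (a0 - 0)"
      by (intro continuous_on_tendsto_compose[OF C1_supp_continuous[OF a]] tendsto_diff tendsto_const
          LIMSEQ_inverse_real_of_nat) auto
    moreover have "a (a0 - inverse (real (Suc n))) = 0" for n
      by (rule C1_supp_outside[OF a]) simp
    ultimately have "(\<lambda>n. 0) \<longlonglongrightarrow> a a0" by simp
    from LIMSEQ_unique[OF this tendsto_const] show ?thesis by simp
  qed
  have inner: "AE t in lborel. t \<in> {c0..d0} \<longrightarrow>
     (LINT x:{a0..1}|lborel. (a' x * b t) * nxtail (x, t)) = (LINT x:{a0..1}|lborel. (a x * b t) * nx (x, t))"
    using rect_slice_snd[OF nxS]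
  proof eventually_elim
    case (elim t)
    show ?case
    proof
      assume "t \<in> {c0..d0}"
      then have "set_integrable lborel {a0..1} (\<lambda>x. nx (x, t))" using elim by blast
      then have "AC a0 1 (\<lambda>x. nxtail (x, t)) (\<lambda>x. - nx (x, t))"
        unfolding nxtail_def fst_conv snd_conv by (rule AC_tail) (use pos in simp)
      from AC_parts[OF ACa this] pos aa0
      have "(LINT x:{a0..1}|lborel. a' x * nxtail (x, t)) + (LINT x:{a0..1}|lborel. a x * (- nx (x, t))) = 0"
        by (simp add: nxtail_def)
      then have e: "(LINT x:{a0..1}|lborel. a' x * nxtail (x, t)) = (LINT x:{a0..1}|lborel. a x * nx (x, t))"
        unfolding set_lebesgue_integral_def by simp
      have "(LINT x:{a0..1}|lborel. (a' x * b t) * nxtail (x, t)) = b t * (LINT x:{a0..1}|lborel. a' x * nxtail (x, t))"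
        by (simp add: mult.assoc mult.left_commute flip: set_integral_mult_right)
      also have "\<dots> = (LINT x:{a0..1}|lborel. (a x * b t) * nx (x, t))"
        unfolding e by (simp add: mult.assoc mult.left_commute flip: set_integral_mult_right)
      finally show "(LINT x:{a0..1}|lborel. (a' x * b t) * nxtail (x, t)) = (LINT x:{a0..1}|lborel. (a x * b t) * nx (x, t))" .
    qed
  qed
  have "(LINT z:?S|lborel. (a' (fst z) * b (snd z)) * nxtail z) = (LINT z:?S|lborel. (a (fst z) * b (snd z)) * nx z)"
    unfolding rect_integral_snd[OF i1, symmetric] rect_integral_snd[OF i2, symmetric]
  proof (rule AE_rect_cong(1))
    show "(\<lambda>t. LINT x:{a0..1}|lborel. a' (fst (x, t)) * b (snd (x, t)) * nxtail (x, t)) \<in> borel_measurable borel"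
      by (rule measurable_integral_snd[of "\<lambda>z. a' (fst z) * b (snd z) * nxtail z"]) measurable
    show "(\<lambda>t. LINT x:{a0..1}|lborel. a (fst (x, t)) * b (snd (x, t)) * nx (x, t)) \<in> borel_measurable borel"
      by (rule measurable_integral_snd[of "\<lambda>z. a (fst z) * b (snd z) * nx z"]) measurable
  qed (use inner in simp_all)
  moreover have "(LINT z:?S|lborel. (a' (fst z) * b (snd z)) * nxtail z) = (LINT z:?R|lborel. (a' (fst z) * b (snd z)) * nxtail z)"
    by (rule ext) (rule C1_supp_deriv_zero[OF a])
  moreover have "(LINT z:?S|lborel. (a (fst z) * b (snd z)) * nx z) = (LINT z:?R|lborel. (a (fst z) * b (snd z)) * nx z)"
    by (rule ext) (rule C1_supp_outside[OF a])
  ultimately have "(LINT z:?R|lborel. (a' (fst z) * b (snd z)) * nxtail z) = (LINT z:?R|lborel. (a (fst z) * b (snd z)) * nx z)"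
    by (simp only:)
  then show ?thesis by (simp only: mult.commute)
qed

text \<open>The function \<open>n + \<integral>\<^sub>x\<^sup>1 nx\<close> has weak \<open>x\<close>-derivative zero, so it depends on \<open>t\<close> only; its value \<open>c(t)\<close>
is the trace of \<open>n\<close> at \<open>x = 1\<close>.\<close>

lemma trace_exists:
  obtains c where "c \<in> borel_measurable borel" "AE z in lborel. z \<in> Q \<longrightarrow> n z = c (snd z) - nxtail z"
proof -
  define D where "D = (\<lambda>z. n z + nxtail z)"
  have Dm[measurable]: "D \<in> borel_measurable borel" unfolding D_def by measurable
  let ?k = "kern (1/4) (3/4)"
  have [measurable]: "?k \<in> borel_measurable borel" by (rule borel_measurable_continuous_onI[OF kern_continuous])
  define c where "c = (\<lambda>t. LINT x:{1/4..3/4}|lborel. ?k x * D (x, t))"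
  have cm: "c \<in> borel_measurable borel"
    unfolding c_def using measurable_integral_snd[of "\<lambda>z. ?k (fst z) * D z" "1/4" "3/4"] by simp
  \<comment> \<open>The averaging kernel is the same on all rectangles, so the functions \<open>c\<close> found on them coincide.\<close>
  have R: "AE z in lborel. z \<in> {a0..b0} \<times> {c0..d0} \<longrightarrow> D z = c (snd z)"
    if pos: "0 < a0" "a0 < 1/4" "3/4 < b0" "b0 < 1" "0 < c0" for a0 b0 c0 d0 :: real
  proof -
    let ?R = "{a0..b0} \<times> {c0..d0}"
    have sub: "?R \<subseteq> {a0..1} \<times> {c0..d0}" using pos by auto
    have nR: "set_integrable lborel ?R n" and tR: "set_integrable lborel ?R nxtail"
      using set_integrable_subset[OF n_int[OF pos(1,5), of d0] _ sub]
        set_integrable_subset[OF rect_integrable_tail[OF nx_int[OF pos(1,5), of d0] nx_meas] _ sub]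
      by (simp_all add: nxtail_def[abs_def])
    have "AE z in lborel. z \<in> ?R \<longrightarrow> D z = (LINT x:{a0..b0}|lborel. ?k x * D (x, snd z))"
    proof (rule du_Bois_Reymond)
      show "set_integrable lborel ?R D" unfolding D_def by (rule set_integral_add(1)[OF nR tR])
      show "?k x = 0" if "x \<notin> {a0..b0}" for x by (rule kern_outside) (use that pos in auto)
      have "(LINT x:{a0..b0}|lborel. ?k x) = (LINT x:{1/4..3/4}|lborel. ?k x)"
        by (rule set_integral_cong_superset) (use pos kern_outside in auto)
      then show "(LINT x:{a0..b0}|lborel. ?k x) = 1" using kern_integral[of "1/4" "3/4"] by simp
      fix a a' b b' assume a: "C1_supp a0 b0 a a'" and b: "C1_supp c0 d0 b b'"
      note [measurable] = C1_supp_measurable[OF a] C1_supp_measurable[OF b]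
      have i: "set_integrable lborel ?R (\<lambda>z. (a' (fst z) * b (snd z)) * F z)" if "set_integrable lborel ?R F" for F
        by (rule set_integrable_product_mult[OF that C1_supp_deriv_continuous[OF a] C1_supp_continuous[OF b]])
      have "(LINT z:?R|lborel. D z * (a' (fst z) * b (snd z))) =
         (LINT z:?R|lborel. (a' (fst z) * b (snd z)) * n z + (a' (fst z) * b (snd z)) * nxtail z)"
        by (simp add: D_def algebra_simps)
      also have "\<dots> = (LINT z:?R|lborel. n z * (a' (fst z) * b (snd z))) + (LINT z:?R|lborel. nxtail z * (a' (fst z) * b (snd z)))"
        unfolding set_integral_add(2)[OF i[OF nR] i[OF tR]] by (simp only: mult.commute)
      also have "\<dots> = 0"
        using dx[OF a b pos(1,4,5)] nxtail_test[OF a b pos(1) _ pos(4,5)] pos by simp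
      finally show "(LINT z:?R|lborel. D z * (a' (fst z) * b (snd z))) = 0" .
    qed (use pos kern_continuous Dm in auto)
    moreover have "(LINT x:{a0..b0}|lborel. ?k x * D (x, t)) = c t" for t
      unfolding c_def by (rule set_integral_cong_superset) (use pos kern_outside in auto)
    ultimately show ?thesis by simp
  qed
  have "AE z in lborel. \<forall>j::nat. z \<in> {1 / (real j + 5)..1 - 1 / (real j + 5)} \<times> {1 / (real j + 1)..real j + 1} \<longrightarrow> D z = c (snd z)"
    unfolding AE_all_countable
  proof
    fix j :: nat
    have "1 / (real j + 5) \<le> 1 / 5" by (simp add: field_simps)
    then show "AE z in lborel. z \<in> {1 / (real j + 5)..1 - 1 / (real j + 5)} \<times> {1 / (real j + 1)..real j + 1} \<longrightarrow> D z = c (snd z)"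
      by (intro R) auto
  qed
  \<comment> \<open>The weak derivative is tested inside \<open>(0, 1)\<close>; the line \<open>x = 1\<close> is a null set.\<close>
  moreover have "AE z in (lborel :: (real \<times> real) measure). fst z \<noteq> 1"
    by (rule AE_lborel_prodI) (use AE_lborel_singleton[of "1::real"] in \<open>auto simp: borel_prod[symmetric]\<close>)
  ultimately have "AE z in lborel. z \<in> Q \<longrightarrow> n z = c (snd z) - nxtail z"
  proof eventually_elim
    case (elim z)
    show ?case
    proof
      assume "z \<in> Q"
      then have z: "0 < fst z" "fst z < 1" "0 < snd z" using elim(2) by (auto simp: Q_def)
      define m where "m = min (min (fst z) (1 - fst z)) (snd z)"
      have m: "0 < m" "m \<le> fst z" "m \<le> 1 - fst z" "m \<le> snd z" using z by (auto simp: m_def)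
      obtain j :: nat where j: "1 / m + snd z < real j" using reals_Archimedean2 by blast
      have "1 / m < real j" using j z by linarith
      moreover have "0 < 1 / m" using m by simp
      ultimately have "1 / (real j + 1) \<le> m" "1 / (real j + 5) \<le> m" using m by (auto simp: field_simps)
      moreover have "snd z \<le> real j + 1" using j \<open>0 < 1 / m\<close> by linarith
      ultimately have "z \<in> {1 / (real j + 5)..1 - 1 / (real j + 5)} \<times> {1 / (real j + 1)..real j + 1}"
        using m by (auto simp: mem_Times_iff)
      then have "D z = c (snd z)" using elim(1) by blast
      then show "n z = c (snd z) - nxtail z" by (simp add: D_def)
    qed
  qed
  then show ?thesis using that cm by blast
qed

text \<open>Test with \<open>A(x) a(t)\<close>, where \<open>A\<close> is the primitive of \<open>g\<close> that vanishes near \<open>0\<close> and is unrestricted at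
\<open>x = 1\<close>.  Integration by parts in \<open>x\<close> exchanges \<open>A, n\<close> for \<open>g\<close> and the tail of \<open>n\<close>, without a
boundary term because the tail vanishes at \<open>x = 1\<close>; integration by parts in \<open>t\<close> exchanges \<open>a, J\<close>
for \<open>a'\<close> and the time integral of \<open>J\<close>.  The conclusion says that the tail of \<open>n\<close> plus the time integral of
\<open>J\<close> has weak time derivative zero.\<close>

lemma integrated_equation_test:
  assumes pos: "0 < a0" "a0 < 1" "0 < c0" "c0 < d0"
    and a: "C1_supp c0 d0 a a'" and g: "C1_supp a0 1 g g'"
  defines "V \<equiv> \<lambda>z. LINT s:{c0..snd z}|lborel. flux n nx (fst z, s)"
  shows "(LINT z:{a0..1} \<times> {c0..d0}|lborel. (ntail z + V z) * (a' (snd z) * g (fst z))) = 0"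
proof -
  let ?S = "{a0..1} \<times> {c0..d0}" and ?J = "flux n nx"
  note [measurable] = C1_supp_measurable[OF a] C1_supp_measurable[OF g] flux_meas
  have Vm[measurable]: "V \<in> borel_measurable borel" unfolding V_def by measurable
  have gc: "continuous_on UNIV g" by (rule C1_supp_continuous[OF g])
  have g0: "g x = 0" if "x < a0" for x by (rule C1_supp_outside[OF g]) (use that in auto)
  define A where "A = primitive g"
  have dA: "(A has_real_derivative g x) (at x)" for x
    unfolding A_def by (rule primitive_DERIV[OF gc pos(1) g0])
  have A0: "A x = 0" if "x \<le> a0" for x
    unfolding A_def by (rule primitive_zero[OF g0 that gc])
  have Ac: "continuous_on UNIV A" using dA by (meson DERIV_isCont continuous_at_imp_continuous_on)
  have [measurable]: "A \<in> borel_measurable borel" by (rule borel_measurable_continuous_onI[OF Ac])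
  have nS: "set_integrable lborel ?S n" by (rule n_int[OF pos(1,3)])
  have JS: "set_integrable lborel ?S ?J" by (rule flux_int[OF pos(1,3)])
  have NS: "set_integrable lborel ?S ntail"
    unfolding ntail_def[abs_def] by (rule rect_integrable_tail[OF nS n_meas])
  have VS: "set_integrable lborel ?S V"
    unfolding V_def by (rule rect_integrable_time[OF JS flux_meas])
  have i1: "set_integrable lborel ?S (\<lambda>z. (A (fst z) * a' (snd z)) * n z)" by (rule set_integrable_product_mult[OF nS Ac C1_supp_deriv_continuous[OF a]])
  have i2: "set_integrable lborel ?S (\<lambda>z. (g (fst z) * a (snd z)) * ?J z)" by (rule set_integrable_product_mult[OF JS gc C1_supp_continuous[OF a]])
  have i3: "set_integrable lborel ?S (\<lambda>z. (g (fst z) * a' (snd z)) * ntail z)" by (rule set_integrable_product_mult[OF NS gc C1_supp_deriv_continuous[OF a]])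
  have i4: "set_integrable lborel ?S (\<lambda>z. (g (fst z) * a' (snd z)) * V z)" by (rule set_integrable_product_mult[OF VS gc C1_supp_deriv_continuous[OF a]])
  have ACA: "AC a0 1 A g"
    by (rule AC_C1[OF has_field_derivative_at_within[OF dA] continuous_on_subset[OF gc subset_UNIV]])
  have ACa: "AC c0 d0 a a'"
    by (rule AC_C1[OF has_field_derivative_at_within[OF C1_supp_DERIV[OF a]]
        continuous_on_subset[OF C1_supp_deriv_continuous[OF a] subset_UNIV]])
  have e1: "(LINT z:?S|lborel. (A (fst z) * a' (snd z)) * n z) = (LINT z:?S|lborel. (g (fst z) * a' (snd z)) * ntail z)"
    unfolding rect_integral_snd[OF i1, symmetric] rect_integral_snd[OF i3, symmetric]
  proof (rule AE_rect_cong(1))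
    show "(\<lambda>t. LINT x:{a0..1}|lborel. A (fst (x, t)) * a' (snd (x, t)) * n (x, t)) \<in> borel_measurable borel"
      by (rule measurable_integral_snd[of "\<lambda>z. A (fst z) * a' (snd z) * n z"]) measurable
    show "(\<lambda>t. LINT x:{a0..1}|lborel. g (fst (x, t)) * a' (snd (x, t)) * ntail (x, t)) \<in> borel_measurable borel"
      by (rule measurable_integral_snd[of "\<lambda>z. g (fst z) * a' (snd z) * ntail z"]) measurable
    show "AE t in lborel. t \<in> {c0..d0} \<longrightarrow>
       (LINT x:{a0..1}|lborel. A (fst (x, t)) * a' (snd (x, t)) * n (x, t)) =
       (LINT x:{a0..1}|lborel. g (fst (x, t)) * a' (snd (x, t)) * ntail (x, t))"
      using rect_slice_snd[OF nS]
    proof eventually_elim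
      case (elim t)
      show ?case
      proof
        assume "t \<in> {c0..d0}"
        then have "set_integrable lborel {a0..1} (\<lambda>x. n (x, t))" using elim by blast
        then have "AC a0 1 (\<lambda>x. ntail (x, t)) (\<lambda>x. - n (x, t))"
          unfolding ntail_def fst_conv snd_conv by (rule AC_tail) (use pos in simp)
        from AC_parts[OF ACA this] pos A0[of a0]
        have "(LINT x:{a0..1}|lborel. g x * ntail (x, t)) + (LINT x:{a0..1}|lborel. A x * (- n (x, t))) = 0"
          by (simp add: ntail_def)
        then have e: "(LINT x:{a0..1}|lborel. g x * ntail (x, t)) = (LINT x:{a0..1}|lborel. A x * n (x, t))"
          unfolding set_lebesgue_integral_def by simp
        have "(LINT x:{a0..1}|lborel. A x * a' t * n (x, t)) = a' t * (LINT x:{a0..1}|lborel. A x * n (x, t))"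
          by (simp add: mult.assoc mult.left_commute flip: set_integral_mult_right)
        also have "\<dots> = (LINT x:{a0..1}|lborel. g x * a' t * ntail (x, t))"
          unfolding e[symmetric] by (simp add: mult.assoc mult.left_commute flip: set_integral_mult_right)
        finally show "(LINT x:{a0..1}|lborel. A (fst (x, t)) * a' (snd (x, t)) * n (x, t)) =
           (LINT x:{a0..1}|lborel. g (fst (x, t)) * a' (snd (x, t)) * ntail (x, t))" by simp
      qed
    qed
  qed simp
  have Jsw: "(\<lambda>x. LINT t:{c0..d0}|lborel. F (x, t)) \<in> borel_measurable borel"
    if "F \<in> borel_measurable borel" for F :: "real \<times> real \<Rightarrow> real"
  proof -
    have [measurable]: "F \<in> borel_measurable (borel \<Otimes>\<^sub>M borel)" using that by (simp add: borel_prod)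
    show ?thesis unfolding set_lebesgue_integral_def by measurable
  qed
  have e2: "(LINT z:?S|lborel. (g (fst z) * a (snd z)) * ?J z) = - (LINT z:?S|lborel. (g (fst z) * a' (snd z)) * V z)"
  proof -
    have "(LINT z:?S|lborel. (g (fst z) * a (snd z)) * ?J z) = (LINT z:?S|lborel. - ((g (fst z) * a' (snd z)) * V z))"
      unfolding rect_integral_fst[OF i2, symmetric]
        rect_integral_fst[OF set_integrable_mult_right[OF i4, of "-1", simplified], symmetric]
    proof (rule AE_rect_cong(1))
      show "(\<lambda>x. LINT t:{c0..d0}|lborel. g (fst (x, t)) * a (snd (x, t)) * ?J (x, t)) \<in> borel_measurable borel"
        by (rule Jsw[of "\<lambda>z. g (fst z) * a (snd z) * ?J z"]) measurable
      show "(\<lambda>x. LINT t:{c0..d0}|lborel. - (g (fst (x, t)) * a' (snd (x, t)) * V (x, t))) \<in> borel_measurable borel"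
        by (rule Jsw[of "\<lambda>z. - (g (fst z) * a' (snd z) * V z)"]) measurable
      show "AE x in lborel. x \<in> {a0..1} \<longrightarrow>
         (LINT t:{c0..d0}|lborel. g (fst (x, t)) * a (snd (x, t)) * ?J (x, t)) =
         (LINT t:{c0..d0}|lborel. - (g (fst (x, t)) * a' (snd (x, t)) * V (x, t)))"
        using rect_slice_fst[OF JS]
      proof eventually_elim
        case (elim x)
        show ?case
        proof
          assume "x \<in> {a0..1}"
          then have "set_integrable lborel {c0..d0} (\<lambda>t. ?J (x, t))" using elim by blast
          then have "AC c0 d0 (\<lambda>t. V (x, t)) (\<lambda>t. ?J (x, t))"
            unfolding V_def fst_conv snd_conv by (rule AC_head)
          from AC_parts[OF ACa this] pos C1_supp_endpoint[OF a]
          have "(LINT t:{c0..d0}|lborel. a' t * V (x, t)) + (LINT t:{c0..d0}|lborel. a t * ?J (x, t)) = 0"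
            by (simp add: V_def)
          then have e: "(LINT t:{c0..d0}|lborel. a t * ?J (x, t)) = (LINT t:{c0..d0}|lborel. - (a' t * V (x, t)))"
            unfolding set_lebesgue_integral_def by simp
          have "(LINT t:{c0..d0}|lborel. g x * a t * ?J (x, t)) = g x * (LINT t:{c0..d0}|lborel. a t * ?J (x, t))"
            by (simp add: mult.assoc flip: set_integral_mult_right)
          also have "\<dots> = (LINT t:{c0..d0}|lborel. - (g x * a' t * V (x, t)))"
            unfolding e by (simp add: mult.assoc flip: set_integral_mult_right)
          finally show "(LINT t:{c0..d0}|lborel. g (fst (x, t)) * a (snd (x, t)) * ?J (x, t)) =
             (LINT t:{c0..d0}|lborel. - (g (fst (x, t)) * a' (snd (x, t)) * V (x, t)))" by simp
        qed
      qed
    qed simp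
    then show ?thesis unfolding set_lebesgue_integral_def by simp
  qed
  have "(LINT z:?S|lborel. n z * (A (fst z) * a' (snd z)) - ?J z * (g (fst z) * a (snd z))) = 0"
    by (rule weq[OF dA gc A0 a pos(1,3)])
  then have "(LINT z:?S|lborel. (A (fst z) * a' (snd z)) * n z - (g (fst z) * a (snd z)) * ?J z) = 0"
    by (simp only: mult.commute)
  then have "(LINT z:?S|lborel. (g (fst z) * a' (snd z)) * ntail z) + (LINT z:?S|lborel. (g (fst z) * a' (snd z)) * V z) = 0"
    unfolding set_integral_diff(2)[OF i1 i2] e1 e2 by simp
  then have "(LINT z:?S|lborel. (g (fst z) * a' (snd z)) * ntail z + (g (fst z) * a' (snd z)) * V z) = 0"
    unfolding set_integral_add(2)[OF i3 i4] .
  then show ?thesis by (simp add: algebra_simps)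
qed

end

lemma pred_imp_diff_eq:
  fixes f g k :: "'a::euclidean_space \<Rightarrow> real"
  assumes [measurable]: "S \<in> sets borel" "f \<in> borel_measurable borel" "g \<in> borel_measurable borel"
    "k \<in> borel_measurable borel"
  shows "Measurable.pred borel (\<lambda>z. z \<in> S \<longrightarrow> f z - g z = k z)"
  by measurable

context weak_form
begin

text \<open>By the du Bois-Reymond lemma with the roles of \<open>x\<close> and \<open>t\<close> exchanged, \<open>\<integral>\<^sub>x\<^sup>1 n + \<integral> J ds\<close> does not depend on
\<open>t\<close>; compare its values at \<open>t\<close> and \<open>t - h\<close>.\<close>

lemma integrated_equation_rect:
  assumes pos: "0 < a0" "a0 < 1" "0 < c0" "c0 < d0" and h: "0 < h"
  shows "AE z in lborel. z \<in> {a0..1} \<times> {c0 + h..d0} \<longrightarrow>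
    ntail z - ntail (fst z, snd z - h) = - (h * time_avg h (flux n nx) z)"
proof -
  let ?S = "{a0..1} \<times> {c0..d0}" and ?J = "flux n nx"
  note [measurable] = flux_meas
  define V where "V = (\<lambda>z. LINT s:{c0..snd z}|lborel. ?J (fst z, s))"
  have Vm[measurable]: "V \<in> borel_measurable borel" unfolding V_def by measurable
  define W where "W = (\<lambda>z. ntail z + V z)"
  have Wm[measurable]: "W \<in> borel_measurable borel" unfolding W_def by measurable
  have JS: "set_integrable lborel ?S ?J" by (rule flux_int[OF pos(1,3)])
  have WS: "set_integrable lborel ?S W"
    unfolding W_def ntail_def[abs_def] V_def
    by (intro set_integral_add(1) rect_integrable_tail rect_integrable_time JS flux_meas n_meas n_int pos(1,3))
  let ?k = "kern c0 d0"
  define e where "e = (\<lambda>x. LINT \<tau>:{c0..d0}|lborel. ?k \<tau> * W (x, \<tau>))"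
  have swapm: "(\<lambda>z. W (snd z, fst z)) \<in> borel_measurable borel"
  proof -
    have [measurable]: "W \<in> borel_measurable (borel \<Otimes>\<^sub>M borel)" using Wm by (simp add: borel_prod)
    show ?thesis unfolding borel_prod[symmetric] by measurable
  qed
  have "AE z in lborel. z \<in> {c0..d0} \<times> {a0..1} \<longrightarrow>
     W (snd z, fst z) = (LINT x:{c0..d0}|lborel. ?k x * (\<lambda>z. W (snd z, fst z)) (x, snd z))"
  proof (rule du_Bois_Reymond)
    show "set_integrable lborel ({c0..d0} \<times> {a0..1}) (\<lambda>z. W (snd z, fst z))"
      by (rule set_integrable_swap[OF WS])
    show "(\<lambda>z. W (snd z, fst z)) \<in> borel_measurable borel" by (rule swapm)
    show "continuous_on UNIV ?k" by (rule kern_continuous)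
    show "?k x = 0" if "x \<notin> {c0..d0}" for x by (rule kern_outside[OF pos(4) that])
    show "(LINT x:{c0..d0}|lborel. ?k x) = 1" by (rule kern_integral[OF pos(4)])
    fix a a' g g' assume a: "C1_supp c0 d0 a a'" and g: "C1_supp a0 1 g g'"
    have i: "set_integrable lborel ?S (\<lambda>z. (g (fst z) * a' (snd z)) * W z)"
      by (rule set_integrable_product_mult[OF WS C1_supp_continuous[OF g] C1_supp_deriv_continuous[OF a]])
    have "(LINT z:{c0..d0} \<times> {a0..1}|lborel. W (snd z, fst z) * (a' (fst z) * g (snd z))) =
      (LINT z:?S|lborel. (g (fst z) * a' (snd z)) * W z)"
      using set_integral_swap[OF i] by (simp add: mult.commute)
    also have "\<dots> = 0"
      using integrated_equation_test[OF pos a g] by (simp add: W_def V_def mult.commute)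
    finally show "(LINT z:{c0..d0} \<times> {a0..1}|lborel. W (snd z, fst z) * (a' (fst z) * g (snd z))) = 0" .
  qed (rule pos(3))
  from AE_lborel_prodD2[OF this]
  have ae: "AE x in lborel. AE t in lborel. t \<in> {c0..d0} \<longrightarrow> x \<in> {a0..1} \<longrightarrow> W (x, t) = e x"
  proof eventually_elim
    case (elim x)
    then show ?case by eventually_elim (simp add: e_def)
  qed
  have pm: "Measurable.pred borel (\<lambda>z. z \<in> {a0..1} \<times> {c0 + h..d0} \<longrightarrow>
      ntail z - ntail (fst z, snd z - h) = - (h * time_avg h ?J z))"
  proof (rule pred_imp_diff_eq)
    show "(\<lambda>z. ntail (fst z, snd z - h)) \<in> borel_measurable borel"
      by (rule measurable_compose[OF _ ntail_meas]) (intro borel_measurable_continuous_onI continuous_intros)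
    show "(\<lambda>z. - (h * time_avg h ?J z)) \<in> borel_measurable borel"
      by (intro borel_measurable_uminus borel_measurable_times borel_measurable_const measurable_time_avg flux_meas)
  qed (rule rect_sets ntail_meas)+
  show ?thesis
  proof (rule AE_lborel_prodI)
    show "AE x in lborel. AE t in lborel. (x, t) \<in> {a0..1} \<times> {c0 + h..d0} \<longrightarrow>
      ntail (x, t) - ntail (fst (x, t), snd (x, t) - h) = - (h * time_avg h ?J (x, t))"
      using ae rect_slice_fst[OF JS]
    proof eventually_elim
      case (elim x)
      have [measurable]: "(\<lambda>t. W (x, t)) \<in> borel_measurable borel"
      proof -
        have [measurable]: "W \<in> borel_measurable (borel \<Otimes>\<^sub>M borel)" using Wm by (simp add: borel_prod)
        show ?thesis by measurable
      qed
      have "AE t in lborel. (- h + 1 * t) \<in> {c0..d0} \<longrightarrow> x \<in> {a0..1} \<longrightarrow> W (x, - h + 1 * t) = e x"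
        by (rule AE_borel_affine[OF _ _ elim(1)]) (simp, measurable)
      with elim(1) show ?case
      proof eventually_elim
        case (elim t)
        show ?case
        proof
          assume "(x, t) \<in> {a0..1} \<times> {c0 + h..d0}"
          then have xt: "x \<in> {a0..1}" "c0 + h \<le> t" "t \<le> d0" by auto
          then have "t \<in> {c0..d0}" "- h + 1 * t \<in> {c0..d0}" using h by auto
          then have W: "W (x, t) = W (x, t - h)" using elim xt(1) by simp
          have "set_integrable lborel {c0..d0} (\<lambda>t. ?J (x, t))"
            using \<open>x \<in> {a0..1} \<longrightarrow> set_integrable lborel {c0..d0} (\<lambda>t. ?J (x, t))\<close> xt(1) by blast
          then have "set_integrable lborel {c0..t} (\<lambda>t. ?J (x, t))"
            by (rule set_integrable_subset) (use xt in auto)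
          from set_integral_Icc_split[OF this, of "t - h"]
          have "V (x, t) = V (x, t - h) + (LINT s:{t - h..t}|lborel. ?J (x, s))"
            using xt h by (simp add: V_def)
          moreover have "h * time_avg h ?J (x, t) = (LINT s:{t - h..t}|lborel. ?J (x, s))"
            using h by (simp add: time_avg_def avg_def)
          ultimately show "ntail (x, t) - ntail (fst (x, t), snd (x, t) - h) = - (h * time_avg h ?J (x, t))"
            using W by (simp add: W_def)
        qed
      qed
    qed
    show "Measurable.pred borel (\<lambda>z. z \<in> {a0..1} \<times> {c0 + h..d0} \<longrightarrow>
      ntail z - ntail (fst z, snd z - h) = - (h * time_avg h ?J z))" by (rule pm)
  qed
qed

lemma integrated_equation:
  assumes h: "0 < h"
  shows "AE z in lborel. 0 < fst z \<and> fst z \<le> 1 \<and> h < snd z \<longrightarrow>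
    ntail z - ntail (fst z, snd z - h) = - (h * time_avg h (flux n nx) z)"
proof -
  have "AE z in lborel. \<forall>j::nat. z \<in> {1 / (real j + 2)..1} \<times> {1 / (real j + 2) + h..real j + 2} \<longrightarrow>
      ntail z - ntail (fst z, snd z - h) = - (h * time_avg h (flux n nx) z)"
    unfolding AE_all_countable
  proof
    fix j :: nat
    have "1 / (real j + 2) < 1" "0 < 1 / (real j + 2)" by simp_all
    then show "AE z in lborel. z \<in> {1 / (real j + 2)..1} \<times> {1 / (real j + 2) + h..real j + 2} \<longrightarrow>
      ntail z - ntail (fst z, snd z - h) = - (h * time_avg h (flux n nx) z)"
      by (intro integrated_equation_rect h) (assumption | linarith)+
  qed
  then show ?thesis
  proof eventually_elim
    case (elim z)
    show ?case
    proof
      assume z: "0 < fst z \<and> fst z \<le> 1 \<and> h < snd z"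
      define m where "m = min (fst z) (snd z - h)"
      have m: "0 < m" "m \<le> fst z" "m \<le> snd z - h" using z by (auto simp: m_def)
      obtain j :: nat where j: "1 / m + snd z < real j" using reals_Archimedean2 by blast
      have "1 / m < real j" using j z h by linarith
      moreover have "0 < 1 / m" using m by simp
      ultimately have "1 / (real j + 2) \<le> m" using m by (auto simp: field_simps)
      moreover have "snd z \<le> real j + 2" using j \<open>0 < 1 / m\<close> by linarith
      ultimately have "z \<in> {1 / (real j + 2)..1} \<times> {1 / (real j + 2) + h..real j + 2}"
        using m z by (auto simp: mem_Times_iff)
      then show "ntail z - ntail (fst z, snd z - h) = - (h * time_avg h (flux n nx) z)" using elim by blast
    qed
  qed
qed

end

text \<open>The form in which a solution is used below.  No flux through \<open>x = 1\<close> appears in \<open>integrated\<close>: this is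
the boundary condition.\<close>

locale mild =
  fixes n nx :: "real \<times> real \<Rightarrow> real"
  assumes n_meas [measurable]: "n \<in> borel_measurable borel"
    and nx_meas [measurable]: "nx \<in> borel_measurable borel"
    and n_sq: "\<And>\<alpha> \<sigma> T. 0 < \<alpha> \<Longrightarrow> 0 < \<sigma> \<Longrightarrow> set_integrable lborel ({\<alpha>..1} \<times> {\<sigma>..T}) (\<lambda>z. (n z)\<^sup>2)"
    and nx_sq: "\<And>\<alpha> \<sigma> T. 0 < \<alpha> \<Longrightarrow> 0 < \<sigma> \<Longrightarrow> set_integrable lborel ({\<alpha>..1} \<times> {\<sigma>..T}) (\<lambda>z. (nx z)\<^sup>2)"
    and ac: "AE t in lborel. 0 < t \<longrightarrow> (\<forall>\<alpha>. 0 < \<alpha> \<and> \<alpha> \<le> 1 \<longrightarrow> AC \<alpha> 1 (\<lambda>x. n (x, t)) (\<lambda>x. nx (x, t)))"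
    and integrated: "\<And>h. 0 < h \<Longrightarrow> AE z in lborel. 0 < fst z \<and> fst z \<le> 1 \<and> h < snd z \<longrightarrow>
      (LINT y:{fst z..1}|lborel. n (y, snd z)) - (LINT y:{fst z..1}|lborel. n (y, snd z - h)) =
      - (h * time_avg h (flux n nx) z)"

lemma (in weak_form) AE_slice_nx:
  "AE t in lborel. 0 < t \<longrightarrow> (\<forall>\<alpha>. 0 < \<alpha> \<longrightarrow> set_integrable lborel {\<alpha>..1} (\<lambda>x. nx (x, t)))"
proof -
  have "AE t in lborel. \<forall>j::nat. t \<in> {1 / (real j + 1)..real j + 1} \<longrightarrow>
     set_integrable lborel {1 / (real j + 1)..1} (\<lambda>x. nx (x, t))"
    unfolding AE_all_countable by (intro allI rect_slice_snd nx_int) auto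
  then show ?thesis
  proof eventually_elim
    case (elim t)
    show ?case
    proof (intro impI allI)
      fix \<alpha> :: real assume t: "0 < t" and \<alpha>: "0 < \<alpha>"
      define m where "m = min t \<alpha>"
      have m: "0 < m" "m \<le> t" "m \<le> \<alpha>" using t \<alpha> by (auto simp: m_def)
      obtain j :: nat where j: "1 / m + t < real j" using reals_Archimedean2 by blast
      have "1 / m < real j" using j t by linarith
      moreover have "0 < 1 / m" using m by simp
      ultimately have jm: "1 / (real j + 1) \<le> m" using m by (auto simp: field_simps)
      moreover have "t \<le> real j + 1" using j \<open>0 < 1 / m\<close> by linarith
      ultimately have "set_integrable lborel {1 / (real j + 1)..1} (\<lambda>x. nx (x, t))"
        using elim m by auto
      then show "set_integrable lborel {\<alpha>..1} (\<lambda>x. nx (x, t))"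
        by (rule set_integrable_subset) (use jm m in auto)
    qed
  qed
qed

text \<open>The representative is \<open>c(t) - \<integral>\<^sub>x\<^sup>1 nx\<close>, with the trace \<open>c\<close>: its slices are absolutely continuous up to
\<open>x = 1\<close> by construction.\<close>

lemma weak_solution_imp_mild:
  assumes "weak_solution_exp p ni n"
  obtains n' nx' where "mild n' nx'" "AE z in lborel. z \<in> Q \<longrightarrow> n z = n' z"
proof -
  obtain n0 nx where wf: "weak_form n0 nx" and ae0: "AE z in lborel. z \<in> Q \<longrightarrow> n z = n0 z"
    by (rule weak_solution_imp_weak_form[OF assms])
  interpret w0: weak_form n0 nx by (rule wf)
  obtain c where [measurable]: "c \<in> borel_measurable borel"
    and aec: "AE z in lborel. z \<in> Q \<longrightarrow> n0 z = c (snd z) - w0.nxtail z"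
    by (rule w0.trace_exists)
  define n' where "n' = (\<lambda>z. c (snd z) - w0.nxtail z)"
  have n'm: "n' \<in> borel_measurable borel" unfolding n'_def by measurable
  have ae1: "AE z in lborel. z \<in> Q \<longrightarrow> n0 z = n' z" using aec by (simp add: n'_def)
  interpret w: weak_form n' nx by (rule weak_form_cong_AE[OF wf n'm ae1])
  have "mild n' nx"
  proof
    show "AE t in lborel. 0 < t \<longrightarrow> (\<forall>\<alpha>. 0 < \<alpha> \<and> \<alpha> \<le> 1 \<longrightarrow> AC \<alpha> 1 (\<lambda>x. n' (x, t)) (\<lambda>x. nx (x, t)))"
      using w0.AE_slice_nx
    proof eventually_elim
      case (elim t)
      show ?case
      proof (intro impI allI)
        fix \<alpha> :: real assume t: "0 < t" and \<alpha>: "0 < \<alpha> \<and> \<alpha> \<le> 1"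
        then have "set_integrable lborel {\<alpha>..1} (\<lambda>x. nx (x, t))" using elim by blast
        then show "AC \<alpha> 1 (\<lambda>x. n' (x, t)) (\<lambda>x. nx (x, t))"
          by (rule AC_from_right) (use \<alpha> in \<open>auto simp: n'_def w0.nxtail_def\<close>)
      qed
    qed
    show "AE z in lborel. 0 < fst z \<and> fst z \<le> 1 \<and> h < snd z \<longrightarrow>
      (LINT y:{fst z..1}|lborel. n' (y, snd z)) - (LINT y:{fst z..1}|lborel. n' (y, snd z - h)) =
      - (h * time_avg h (flux n' nx) z)" if "0 < h" for h
      using w.integrated_equation[OF that] by (simp add: w.ntail_def)
  qed (use w.n_meas w.nx_meas w.n_sq w.nx_sq in auto)
  moreover have "AE z in lborel. z \<in> Q \<longrightarrow> n z = n' z"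
    using ae0 ae1 by eventually_elim auto
  ultimately show ?thesis using that by blast
qed

section \<open>Two solutions and a cut-off weight\<close>

lemma AE_lborel_shift:
  fixes P :: "real \<Rightarrow> bool"
  assumes "AE t in lborel. P t"
  shows "AE t in lborel. P (t - h)"
proof -
  from assms obtain N where N: "{t \<in> space lborel. \<not> P t} \<subseteq> N" "emeasure lborel N = 0" "N \<in> sets lborel"
    by (rule AE_E)
  have [measurable]: "N \<in> sets borel" using N(3) by simp
  have "AE t in lborel. t \<notin> N" using N(2,3) by (intro AE_not_in) auto
  then have "AE t in lborel. - h + 1 * t \<notin> N" by (rule AE_borel_affine[rotated 2]) (simp, measurable)
  then show ?thesis
  proof eventually_elim
    case (elim t)
    then have "t - h \<notin> N" by (simp add: add.commute)
    then show ?case using N(1) by auto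
  qed
qed

lemma slice_measurable:
  fixes f :: "real \<times> real \<Rightarrow> real"
  assumes "f \<in> borel_measurable borel"
  shows "(\<lambda>x. f (x, t)) \<in> borel_measurable borel" "(\<lambda>t. f (x, t)) \<in> borel_measurable borel"
proof -
  have [measurable]: "f \<in> borel_measurable (borel \<Otimes>\<^sub>M borel)" using assms by (simp add: borel_prod)
  show "(\<lambda>x. f (x, t)) \<in> borel_measurable borel" "(\<lambda>t. f (x, t)) \<in> borel_measurable borel" by measurable
qed

lemma AC_set_integrable:
  assumes "AC a b u u'"
  shows "set_integrable lborel {a..b} u"
  by (rule borel_integrable_atLeastAtMost'[OF AC_continuous_on[OF assms]])

lemma AC_tail_eq:
  assumes "AC a b u u'" "x \<in> {a..b}"
  shows "u x = u b - (LINT y:{x..b}|lborel. u' y)"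
  using AC_increment[OF assms(1), of x b] assms(2) by simp

text \<open>With \<open>V(y) = \<integral>\<^sub>y\<^sup>1 \<Delta>\<close>, which vanishes at \<open>1\<close>, integration by parts turns \<open>\<integral> \<zeta> \<Delta>\<close> into
\<open>\<integral> B V\<close>, and \<open>V\<close> is known from the equation.  The part \<open>Fh\<close> is then integrated by parts
back, which moves the derivative from \<open>\<zeta>\<close> to \<open>Fh\<close> and leaves a boundary term at \<open>x = 1\<close>.\<close>

lemma AC_test_increment:
  assumes \<zeta>: "AC a 1 \<zeta> B" "\<zeta> a = 0" and a1: "a \<le> 1"
    and \<Delta>: "set_integrable lborel {a..1} \<Delta>" and Fh: "AC a 1 Fh Fhx" and h: "0 < h"
    and m: "B \<in> borel_measurable borel" "Hh \<in> borel_measurable borel"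
    and eq: "AE y in lborel. y \<in> {a..1} \<longrightarrow> (LINT x:{y..1}|lborel. \<Delta> x) = - (h * (Hh y + Fh y))"
  shows "(LINT x:{a..1}|lborel. \<zeta> x * \<Delta> x) =
    - (h * ((LINT x:{a..1}|lborel. B x * Hh x) + \<zeta> 1 * Fh 1 - (LINT x:{a..1}|lborel. \<zeta> x * Fhx x)))"
proof -
  define V where "V = (\<lambda>y. LINT x:{y..1}|lborel. \<Delta> x)"
  have V: "AC a 1 V (\<lambda>y. - \<Delta> y)" unfolding V_def by (rule AC_tail[OF \<Delta> a1])
  have V1: "V 1 = 0" by (simp add: V_def)
  have eqV: "AE y in lborel. y \<in> {a..1} \<longrightarrow> V y = - (h * (Hh y + Fh y))" using eq by (simp add: V_def)
  have "(LINT x:{a..1}|lborel. B x * V x) + (LINT x:{a..1}|lborel. \<zeta> x * (- \<Delta> x)) = 0"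
    using AC_parts[OF \<zeta>(1) V a1] \<zeta>(2) V1 by simp
  then have 1: "(LINT x:{a..1}|lborel. \<zeta> x * \<Delta> x) = (LINT x:{a..1}|lborel. B x * V x)"
    unfolding set_lebesgue_integral_def by simp
  have 2: "(LINT x:{a..1}|lborel. B x * Fh x) + (LINT x:{a..1}|lborel. \<zeta> x * Fhx x) = \<zeta> 1 * Fh 1"
    using AC_parts[OF \<zeta>(1) Fh a1] \<zeta>(2) by simp
  have iV: "set_integrable lborel {a..1} (\<lambda>x. B x * V x)"
    by (rule set_integrable_mult_continuous[OF AC_integrable[OF \<zeta>(1)] AC_continuous_on[OF V]])
  have iF: "set_integrable lborel {a..1} (\<lambda>x. B x * Fh x)"
    by (rule set_integrable_mult_continuous[OF AC_integrable[OF \<zeta>(1)] AC_continuous_on[OF Fh]])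
  have iV': "set_integrable lborel {a..1} (\<lambda>x. (- 1 / h) * (B x * V x))"
    by (rule set_integrable_mult_right[OF iV])
  have "(LINT x:{a..1}|lborel. B x * Hh x) = (LINT x:{a..1}|lborel. (- 1 / h) * (B x * V x) - B x * Fh x)"
    unfolding set_lebesgue_integral_def
  proof (rule integral_cong_AE)
    show "(\<lambda>x. indicator {a..1} x *\<^sub>R (B x * Hh x)) \<in> borel_measurable lborel"
      using m by measurable
    show "(\<lambda>x. indicator {a..1} x *\<^sub>R ((- 1 / h) * (B x * V x) - B x * Fh x)) \<in> borel_measurable lborel"
      using set_integral_diff(1)[OF iV' iF] by (auto simp: set_integrable_def)
    show "AE x in lborel. indicator {a..1} x *\<^sub>R (B x * Hh x) =
       indicator {a..1} x *\<^sub>R ((- 1 / h) * (B x * V x) - B x * Fh x)"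
      using eqV
    proof eventually_elim
      case (elim x)
      show ?case
      proof (cases "x \<in> {a..1}")
        case True
        then have Vx: "V x = - (h * (Hh x + Fh x))" using elim by blast
        have "(- 1 / h) * (B x * V x) - B x * Fh x = B x * Hh x"
          unfolding Vx using h by (simp add: algebra_simps)
        then show ?thesis by (simp only:)
      qed simp
    qed
  qed
  also have "\<dots> = (- 1 / h) * (LINT x:{a..1}|lborel. B x * V x) - (LINT x:{a..1}|lborel. B x * Fh x)"
    unfolding set_integral_diff(2)[OF iV' iF] by (simp only: set_integral_mult_right)
  finally have 3: "(LINT x:{a..1}|lborel. B x * Hh x) =
     (- 1 / h) * (LINT x:{a..1}|lborel. B x * V x) - (LINT x:{a..1}|lborel. B x * Fh x)" .
  have 4: "q = - (h * (BH + zF - zFx))"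
    if "BH = (- 1 / h) * q - BF" "BF + zFx = zF" for q BH BF zF zFx :: real
  proof -
    have "BH + zF - zFx = (- 1 / h) * q" using that by linarith
    then show ?thesis using h by simp
  qed
  show ?thesis unfolding 1 by (rule 4[OF 3 2])
qed

text \<open>The weight \<open>\<eta>\<close> vanishes with its derivative at \<open>\<epsilon>\<close> and is nondecreasing; \<open>\<kappa>'\<close> is the derivative of
\<open>x\<^sup>2 \<eta>'\<close>.\<close>

locale comparison = N: mild n nx + M: mild m mx for n nx m mx +
  fixes \<epsilon> :: real and \<eta> \<eta>' \<kappa>' :: "real \<Rightarrow> real"
  assumes eps: "0 < \<epsilon>" "\<epsilon> < 1"
    and n_nonneg: "AE z in lborel. z \<in> Q \<longrightarrow> 0 \<le> n z"
    and m_nonneg: "AE z in lborel. z \<in> Q \<longrightarrow> 0 \<le> m z"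
    and eta_cont: "continuous_on UNIV \<eta>" "continuous_on UNIV \<eta>'" "continuous_on UNIV \<kappa>'"
    and eta_deriv: "\<And>x. x \<in> {\<epsilon>..1} \<Longrightarrow> (\<eta> has_real_derivative \<eta>' x) (at x within {\<epsilon>..1})"
    and kappa_deriv: "\<And>x. x \<in> {\<epsilon>..1} \<Longrightarrow> ((\<lambda>x. x\<^sup>2 * \<eta>' x) has_real_derivative \<kappa>' x) (at x within {\<epsilon>..1})"
    and eta_eps: "\<eta> \<epsilon> = 0" "\<eta>' \<epsilon> = 0"
    and eta_nonneg: "\<And>x. x \<in> {\<epsilon>..1} \<Longrightarrow> 0 \<le> \<eta> x"
    and eta'_nonneg: "\<And>x. x \<in> {\<epsilon>..1} \<Longrightarrow> 0 \<le> \<eta>' x"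
begin

definition w :: "real \<times> real \<Rightarrow> real" where "w z = n z - m z"
definition wx :: "real \<times> real \<Rightarrow> real" where "wx z = nx z - mx z"
text \<open>The difference of the fluxes is split into the linear part \<open>H\<close>, which is locally square integrable, and
the quadratic part \<open>F\<close>, which is only integrable but has the integrable derivative \<open>Fx\<close>.\<close>

definition H :: "real \<times> real \<Rightarrow> real" where "H z = (fst z)\<^sup>2 * wx z - 2 * fst z * w z"
definition F :: "real \<times> real \<Rightarrow> real" where "F z = (n z)\<^sup>2 - (m z)\<^sup>2"
definition Fx :: "real \<times> real \<Rightarrow> real" where "Fx z = 2 * n z * nx z - 2 * m z * mx z"

lemma fst_borel [measurable]: "fst \<in> borel_measurable (borel :: (real \<times> real) measure)"
  using measurable_of_fst_snd(1)[of "\<lambda>x. x"] by simp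

lemma meas [measurable]: "w \<in> borel_measurable borel" "wx \<in> borel_measurable borel"
  "H \<in> borel_measurable borel" "F \<in> borel_measurable borel" "Fx \<in> borel_measurable borel"
proof -
  show [measurable]: "w \<in> borel_measurable borel" unfolding w_def[abs_def] by measurable
  show [measurable]: "wx \<in> borel_measurable borel" unfolding wx_def[abs_def] by measurable
  show "H \<in> borel_measurable borel" unfolding H_def[abs_def] by measurable
  show "F \<in> borel_measurable borel" unfolding F_def[abs_def] by measurable
  show "Fx \<in> borel_measurable borel" unfolding Fx_def[abs_def] by measurable
qed

lemma flux_diff: "flux n nx z - flux m mx z = H z + F z"
  by (simp add: flux_def H_def F_def w_def wx_def algebra_simps)

lemma eta_meas [measurable]: "\<eta> \<in> borel_measurable borel" "\<eta>' \<in> borel_measurable borel" "\<kappa>' \<in> borel_measurable borel"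
  by (rule borel_measurable_continuous_onI eta_cont)+

lemma square_diff_int:
  fixes f g :: "real \<times> real \<Rightarrow> real"
  assumes [measurable]: "f \<in> borel_measurable borel" "g \<in> borel_measurable borel"
    and f: "set_integrable lborel ({a..b} \<times> {c..d}) (\<lambda>z. (f z)\<^sup>2)"
    and g: "set_integrable lborel ({a..b} \<times> {c..d}) (\<lambda>z. (g z)\<^sup>2)"
  shows "set_integrable lborel ({a..b} \<times> {c..d}) (\<lambda>z. (f z - g z)\<^sup>2)"
proof -
  have "set_integrable lborel ({a..b} \<times> {c..d}) (\<lambda>z. (2 * f z * g z))"
    using set_integrable_mult_right[OF set_integrable_mult_square[of f lborel g, OF _ _ _ f g], of 2]
    by (simp add: mult.assoc)
  then have "set_integrable lborel ({a..b} \<times> {c..d}) (\<lambda>z. (f z)\<^sup>2 + (g z)\<^sup>2 - 2 * f z * g z)"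
    by (intro set_integral_diff(1) set_integral_add(1) f g)
  then show ?thesis by (simp add: power2_diff)
qed

context
  fixes \<sigma> T :: real
  assumes sig: "0 < \<sigma>"
begin

lemma w_sq: "set_integrable lborel ({\<epsilon>..1} \<times> {\<sigma>..T}) (\<lambda>z. (w z)\<^sup>2)"
  unfolding w_def by (rule square_diff_int) (use N.n_sq M.n_sq eps sig in auto)

lemma wx_sq: "set_integrable lborel ({\<epsilon>..1} \<times> {\<sigma>..T}) (\<lambda>z. (wx z)\<^sup>2)"
  unfolding wx_def by (rule square_diff_int) (use N.nx_sq M.nx_sq eps sig in auto)

lemma H_sq: "set_integrable lborel ({\<epsilon>..1} \<times> {\<sigma>..T}) (\<lambda>z. (H z)\<^sup>2)"
  unfolding H_def
proof (rule square_diff_int)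
  have "set_integrable lborel ({\<epsilon>..1} \<times> {\<sigma>..T}) (\<lambda>z. (((fst z)\<^sup>2)\<^sup>2) * (wx z)\<^sup>2)"
    by (rule set_integrable_bounded_mult[where C=1, OF wx_sq])
       (use eps in \<open>auto simp: power_le_one abs_mult\<close>)
  then show "set_integrable lborel ({\<epsilon>..1} \<times> {\<sigma>..T}) (\<lambda>z. ((fst z)\<^sup>2 * wx z)\<^sup>2)"
    by (simp add: power_mult_distrib)
  have "set_integrable lborel ({\<epsilon>..1} \<times> {\<sigma>..T}) (\<lambda>z. (4 * (fst z)\<^sup>2) * (w z)\<^sup>2)"
    by (rule set_integrable_bounded_mult[where C=4, OF w_sq])
       (use eps in \<open>auto simp: power_le_one abs_mult\<close>)
  then show "set_integrable lborel ({\<epsilon>..1} \<times> {\<sigma>..T}) (\<lambda>z. (2 * fst z * w z)\<^sup>2)"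
    by (simp add: power_mult_distrib)
qed measurable

lemma H_int: "set_integrable lborel ({\<epsilon>..1} \<times> {\<sigma>..T}) H"
  by (rule rect_integrable_of_square[OF _ H_sq]) measurable

lemma F_int: "set_integrable lborel ({\<epsilon>..1} \<times> {\<sigma>..T}) F"
  unfolding F_def[abs_def] by (intro set_integral_diff(1) N.n_sq M.n_sq eps sig)

lemma Fx_int: "set_integrable lborel ({\<epsilon>..1} \<times> {\<sigma>..T}) Fx"
proof -
  have 1: "set_integrable lborel ({\<epsilon>..1} \<times> {\<sigma>..T}) (\<lambda>z. n z * nx z)"
    by (rule set_integrable_mult_square) (use N.n_sq N.nx_sq eps sig in auto)
  have 2: "set_integrable lborel ({\<epsilon>..1} \<times> {\<sigma>..T}) (\<lambda>z. m z * mx z)"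
    by (rule set_integrable_mult_square) (use M.n_sq M.nx_sq eps sig in auto)
  have "set_integrable lborel ({\<epsilon>..1} \<times> {\<sigma>..T}) (\<lambda>z. 2 * (n z * nx z) - 2 * (m z * mx z))"
    by (intro set_integral_diff(1) set_integrable_mult_right 1 2)
  then show ?thesis by (simp add: Fx_def[abs_def] mult.assoc)
qed

end

lemma AE_AC:
  "AE t in lborel. 0 < t \<longrightarrow> AC \<epsilon> 1 (\<lambda>x. n (x, t)) (\<lambda>x. nx (x, t)) \<and> AC \<epsilon> 1 (\<lambda>x. m (x, t)) (\<lambda>x. mx (x, t)) \<and>
     AC \<epsilon> 1 (\<lambda>x. w (x, t)) (\<lambda>x. wx (x, t)) \<and> AC \<epsilon> 1 (\<lambda>x. F (x, t)) (\<lambda>x. Fx (x, t))"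
  using N.ac M.ac
proof eventually_elim
  case (elim t)
  show ?case
  proof
    assume t: "0 < t"
    have 1: "AC \<epsilon> 1 (\<lambda>x. n (x, t)) (\<lambda>x. nx (x, t))" using elim(1) t eps by simp
    have 2: "AC \<epsilon> 1 (\<lambda>x. m (x, t)) (\<lambda>x. mx (x, t))" using elim(2) t eps by simp
    have sq: "AC \<epsilon> 1 (\<lambda>x. (f x)\<^sup>2) (\<lambda>x. 2 * f x * f' x)" if "AC \<epsilon> 1 f f'" for f f'
      by (rule AC_compose[OF that, of "\<lambda>y. y\<^sup>2" "\<lambda>y. 2 * y"]) (auto intro!: derivative_eq_intros continuous_intros)
    have 3: "AC \<epsilon> 1 (\<lambda>x. w (x, t)) (\<lambda>x. wx (x, t))" unfolding w_def wx_def by (rule AC_diff[OF 1 2])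
    have 4: "AC \<epsilon> 1 (\<lambda>x. F (x, t)) (\<lambda>x. Fx (x, t))" unfolding F_def Fx_def by (rule AC_diff[OF sq[OF 1] sq[OF 2]])
    show "AC \<epsilon> 1 (\<lambda>x. n (x, t)) (\<lambda>x. nx (x, t)) \<and> AC \<epsilon> 1 (\<lambda>x. m (x, t)) (\<lambda>x. mx (x, t)) \<and>
     AC \<epsilon> 1 (\<lambda>x. w (x, t)) (\<lambda>x. wx (x, t)) \<and> AC \<epsilon> 1 (\<lambda>x. F (x, t)) (\<lambda>x. Fx (x, t))"
      by (intro conjI 1 2 3 4)
  qed
qed

text \<open>On each slice \<open>F(1, s) = F(x, s) + \<integral>\<^sub>x\<^sup>1 Fx\<close>; average over \<open>x\<close>.\<close>

lemma F_trace_int: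
  assumes "0 < \<sigma>"
  shows "set_integrable lborel {\<sigma>..T} (\<lambda>s. F (1, s))"
proof -
  let ?tail = "\<lambda>z. LINT y:{fst z..1}|lborel. Fx (y, snd z)"
  have it: "set_integrable lborel ({\<epsilon>..1} \<times> {\<sigma>..T}) (\<lambda>z. F z + ?tail z)"
    by (intro set_integral_add(1) F_int[OF assms] rect_integrable_tail Fx_int[OF assms] meas)
  have mt: "(\<lambda>z. F z + ?tail z) \<in> borel_measurable borel" by measurable
  have "set_integrable lborel {\<sigma>..T} (\<lambda>s. (1 / (1 - \<epsilon>)) * (LINT x:{\<epsilon>..1}|lborel. F (x, s) + ?tail (x, s)))"
    by (rule set_integrable_mult_right[OF rect_integrable_snd[OF it]])
  moreover have "set_integrable lborel {\<sigma>..T} (\<lambda>s. F (1, s)) \<longleftrightarrow>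
     set_integrable lborel {\<sigma>..T} (\<lambda>s. (1 / (1 - \<epsilon>)) * (LINT x:{\<epsilon>..1}|lborel. F (x, s) + ?tail (x, s)))"
  proof (rule AE_rect_cong(2))
    show "(\<lambda>s. F (1, s)) \<in> borel_measurable borel" by (rule slice_measurable(2)[OF meas(4)])
    show "(\<lambda>s. (1 / (1 - \<epsilon>)) * (LINT x:{\<epsilon>..1}|lborel. F (x, s) + ?tail (x, s))) \<in> borel_measurable borel"
      by (rule borel_measurable_times[OF borel_measurable_const measurable_integral_snd[OF mt]])
    show "AE s in lborel. s \<in> {\<sigma>..T} \<longrightarrow>
       F (1, s) = (1 / (1 - \<epsilon>)) * (LINT x:{\<epsilon>..1}|lborel. F (x, s) + ?tail (x, s))"
      using AE_AC
    proof eventually_elim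
      case (elim s)
      show ?case
      proof
        assume "s \<in> {\<sigma>..T}"
        then have "AC \<epsilon> 1 (\<lambda>x. F (x, s)) (\<lambda>x. Fx (x, s))" using elim assms by auto
        then have "F (x, s) + ?tail (x, s) = F (1, s)" if "x \<in> {\<epsilon>..1}" for x
          using AC_tail_eq[of \<epsilon> 1 "\<lambda>x. F (x, s)" "\<lambda>x. Fx (x, s)" x] that by simp
        then have "(LINT x:{\<epsilon>..1}|lborel. F (x, s) + ?tail (x, s)) = (LINT x:{\<epsilon>..1}|lborel. F (1, s))"
          by (intro set_lebesgue_integral_cong) auto
        also have "\<dots> = (1 - \<epsilon>) * F (1, s)" using eps by (simp add: set_lebesgue_integral_def)
        finally show "F (1, s) = (1 / (1 - \<epsilon>)) * (LINT x:{\<epsilon>..1}|lborel. F (x, s) + ?tail (x, s))"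
          using eps by simp
      qed
    qed
  qed simp
  ultimately show ?thesis by blast
qed

text \<open>Average the identity \<open>F(y, s) = F(1, s) - \<integral>\<^sub>y\<^sup>1 Fx\<close> over \<open>s\<close> and interchange the integrals.\<close>

lemma time_avg_F_AC:
  assumes "0 < \<sigma>" "0 < h" "\<sigma> + h \<le> \<tau>"
  shows "AC \<epsilon> 1 (\<lambda>y. time_avg h F (y, \<tau>)) (\<lambda>y. time_avg h Fx (y, \<tau>))"
proof -
  let ?I = "{\<tau> - h..\<tau>}"
  have pos: "0 < \<tau> - h" using assms by simp
  have ta: "time_avg h f (y, \<tau>) = (1 / h) * (LINT s:?I|lborel. f (y, s))" for f y
    by (simp add: time_avg_def avg_def)
  have I: "set_integrable lborel ({\<epsilon>..1} \<times> ?I) Fx" by (rule Fx_int[OF pos])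
  have F1: "set_integrable lborel ?I (\<lambda>s. F (1, s))" by (rule F_trace_int[OF pos])
  have "AC \<epsilon> 1 (\<lambda>y. LINT s:?I|lborel. F (y, s)) (\<lambda>y. LINT s:?I|lborel. Fx (y, s))"
  proof (rule AC_from_right)
    show "set_integrable lborel {\<epsilon>..1} (\<lambda>y. LINT s:?I|lborel. Fx (y, s))" by (rule rect_integrable_fst[OF I])
    fix y assume y: "y \<in> {\<epsilon>..1}"
    have Iy: "set_integrable lborel ({y..1} \<times> ?I) Fx"
      by (rule set_integrable_subset[OF I]) (use y in auto)
    have "(LINT s:?I|lborel. F (y, s)) = (LINT s:?I|lborel. F (1, s) - (LINT x:{y..1}|lborel. Fx (x, s)))"
    proof (rule AE_rect_cong(1))
      show "(\<lambda>s. F (y, s)) \<in> borel_measurable borel" by (rule slice_measurable(2)[OF meas(4)])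
      show "(\<lambda>s. F (1, s) - (LINT x:{y..1}|lborel. Fx (x, s))) \<in> borel_measurable borel"
        by (intro borel_measurable_diff slice_measurable(2) measurable_integral_snd meas)
      show "AE s in lborel. s \<in> ?I \<longrightarrow> F (y, s) = F (1, s) - (LINT x:{y..1}|lborel. Fx (x, s))"
        using AE_AC
      proof eventually_elim
        case (elim s)
        show ?case
        proof
          assume "s \<in> ?I"
          then have "0 < s" using pos by simp
          then have "AC \<epsilon> 1 (\<lambda>x. F (x, s)) (\<lambda>x. Fx (x, s))" using elim by blast
          from AC_tail_eq[OF this y] show "F (y, s) = F (1, s) - (LINT x:{y..1}|lborel. Fx (x, s))" .
        qed
      qed
    qed simp
    also have "\<dots> = (LINT s:?I|lborel. F (1, s)) - (LINT s:?I|lborel. LINT x:{y..1}|lborel. Fx (x, s))"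
      by (rule set_integral_diff(2)[OF F1 rect_integrable_snd[OF Iy]])
    also have "(LINT s:?I|lborel. LINT x:{y..1}|lborel. Fx (x, s)) = (LINT x:{y..1}|lborel. LINT s:?I|lborel. Fx (x, s))"
      unfolding rect_integral_snd[OF Iy] rect_integral_fst[OF Iy] ..
    finally show "(LINT s:?I|lborel. F (y, s)) = (LINT s:?I|lborel. F (1, s)) - (LINT x:{y..1}|lborel. LINT s:?I|lborel. Fx (x, s))" .
  qed (use eps in simp)
  from AC_cmult[OF this, of "1 / h"] show ?thesis unfolding ta .
qed

text \<open>The exceptional set of points \<open>y\<close> is the same for all times \<open>\<tau>\<close>, so that the identity can be used on
a single slice in time.\<close>

lemma time_avg_flux_diff:
  assumes "0 < \<sigma>" "0 < h"
  shows "AE y in lborel. y \<in> {\<epsilon>..1} \<longrightarrow> (\<forall>\<tau>\<in>{\<sigma> + h..T}.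
    time_avg h (flux n nx) (y, \<tau>) - time_avg h (flux m mx) (y, \<tau>) = time_avg h H (y, \<tau>) + time_avg h F (y, \<tau>))"
proof -
  have Jn: "set_integrable lborel ({\<epsilon>..1} \<times> {\<sigma>..T}) (flux n nx)" if "mild n nx" for n nx
  proof -
    interpret mild n nx by fact
    have 1: "set_integrable lborel ({\<epsilon>..1} \<times> {\<sigma>..T}) n"
      by (rule rect_integrable_of_square[OF n_meas n_sq[OF eps(1) assms(1)]])
    have 2: "set_integrable lborel ({\<epsilon>..1} \<times> {\<sigma>..T}) nx"
      by (rule rect_integrable_of_square[OF nx_meas nx_sq[OF eps(1) assms(1)]])
    have "set_integrable lborel ({\<epsilon>..1} \<times> {\<sigma>..T}) (\<lambda>z. (fst z)\<^sup>2 * nx z)"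
      by (rule set_integrable_bounded_mult[where C=1, OF 2])
         (use eps in \<open>auto simp: power_le_one\<close>)
    moreover have "set_integrable lborel ({\<epsilon>..1} \<times> {\<sigma>..T}) (\<lambda>z. (2 * fst z) * n z)"
      by (rule set_integrable_bounded_mult[where C=2, OF 1]) (use eps in auto)
    ultimately show ?thesis
      unfolding flux_def[abs_def]
      by (intro set_integral_add(1) set_integral_diff(1) n_sq[OF eps(1) assms(1)])
  qed
  show ?thesis
    using rect_slice_fst[OF Jn[OF N.mild_axioms]] rect_slice_fst[OF Jn[OF M.mild_axioms]]
      rect_slice_fst[OF H_int[OF assms(1), of T]] rect_slice_fst[OF F_int[OF assms(1), of T]]
  proof eventually_elim
    case (elim y)
    show ?case
    proof (intro impI ballI)
      fix \<tau> assume y: "y \<in> {\<epsilon>..1}" and \<tau>: "\<tau> \<in> {\<sigma> + h..T}"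
      have sub: "set_integrable lborel {\<tau> - h..\<tau>} f" if "set_integrable lborel {\<sigma>..T} f" for f :: "real \<Rightarrow> real"
        by (rule set_integrable_subset[OF that]) (use \<tau> assms in auto)
      have i: "set_integrable lborel {\<tau> - h..\<tau>} (\<lambda>s. flux n nx (y, s))"
          "set_integrable lborel {\<tau> - h..\<tau>} (\<lambda>s. flux m mx (y, s))"
          "set_integrable lborel {\<tau> - h..\<tau>} (\<lambda>s. H (y, s))" "set_integrable lborel {\<tau> - h..\<tau>} (\<lambda>s. F (y, s))"
        using elim y by (blast intro: sub)+
      have "(LINT s:{\<tau> - h..\<tau>}|lborel. flux n nx (y, s)) - (LINT s:{\<tau> - h..\<tau>}|lborel. flux m mx (y, s)) =
         (LINT s:{\<tau> - h..\<tau>}|lborel. H (y, s)) + (LINT s:{\<tau> - h..\<tau>}|lborel. F (y, s))"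
        unfolding set_integral_diff(2)[OF i(1,2), symmetric] set_integral_add(2)[OF i(3,4), symmetric] flux_diff ..
      then show "time_avg h (flux n nx) (y, \<tau>) - time_avg h (flux m mx) (y, \<tau>) = time_avg h H (y, \<tau>) + time_avg h F (y, \<tau>)"
        by (simp add: time_avg_def avg_def diff_divide_distrib[symmetric] add_divide_distrib[symmetric])
    qed
  qed
qed

end

section \<open>The entropy inequality for backward differences\<close>

lemma integral_shift_Icc:
  fixes f :: "real \<Rightarrow> real"
  shows "(LINT t:{a..b}|lborel. f (t - h)) = (LINT t:{a - h..b - h}|lborel. f t)"
proof -
  have "(LINT t:{a - h..b - h}|lborel. f t) = (LINT t|lborel. indicator {a - h..b - h} (- h + 1 * t) * f (- h + 1 * t))"
    unfolding set_lebesgue_integral_def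
    using lborel_integral_real_affine[of 1 "\<lambda>t. indicator {a - h..b - h} t * f t" "- h"] by simp
  also have "\<dots> = (LINT t:{a..b}|lborel. f (t - h))"
    unfolding set_lebesgue_integral_def
    by (intro Bochner_Integration.integral_cong) (auto simp: indicator_def add.commute)
  finally show ?thesis ..
qed

lemma set_integrable_shift_Icc:
  fixes f :: "real \<Rightarrow> real"
  assumes "set_integrable lborel {a - h..b - h} f"
  shows "set_integrable lborel {a..b} (\<lambda>t. f (t - h))"
proof -
  have "integrable lborel (\<lambda>t. indicator {a - h..b - h} (- h + 1 * t) *\<^sub>R f (- h + 1 * t))"
    by (rule lborel_integrable_real_affine) (use assms in \<open>simp_all add: set_integrable_def\<close>)
  moreover have "(\<lambda>t. indicator {a - h..b - h} (- h + 1 * t) *\<^sub>R f (- h + 1 * t)) = (\<lambda>t. indicator {a..b} t *\<^sub>R f (t - h))"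
    by (auto simp: fun_eq_iff indicator_def add.commute)
  ultimately show ?thesis by (simp only: set_integrable_def)
qed

text \<open>A convex entropy \<open>\<beta>\<close> that stands for a smoothing of the modulus: its derivatives have the signs of
those of the modulus, and \<open>|s \<beta>''(s)|\<close> is bounded by a constant that will not depend on the smoothing.\<close>

locale comparison_smooth = comparison n nx m mx \<epsilon> \<eta> \<eta>' \<kappa>'
  for n nx m mx \<epsilon> \<eta> \<eta>' \<kappa>' +
  fixes \<beta> \<beta>' \<beta>'' :: "real \<Rightarrow> real" and C :: real
  assumes beta1: "\<And>s. (\<beta> has_real_derivative \<beta>' s) (at s)"
    and beta2: "\<And>s. (\<beta>' has_real_derivative \<beta>'' s) (at s)"
    and beta2_cont: "continuous_on UNIV \<beta>''"
    and beta'_le: "\<And>s. \<bar>\<beta>' s\<bar> \<le> 1"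
    and beta''_nonneg: "\<And>s. 0 \<le> \<beta>'' s"
    and beta''_le: "\<And>s. \<beta>'' s \<le> C"
    and beta_sgn: "\<And>s. 0 \<le> \<beta>' s * s"
    and beta_nonneg: "\<And>s. 0 \<le> \<beta> s"
    and beta_convex: "\<And>a b. \<beta> a - \<beta> b \<le> \<beta>' a * (a - b)"
    and beta_mix: "\<And>s. \<bar>s * \<beta>'' s\<bar> \<le> 1"
begin

definition zeta :: "real \<times> real \<Rightarrow> real" where "zeta z = \<eta> (fst z) * \<beta>' (w z)"
text \<open>The \<open>x\<close>-derivative of \<open>zeta\<close>.\<close>

definition B :: "real \<times> real \<Rightarrow> real" where
  "B z = \<eta>' (fst z) * \<beta>' (w z) + \<eta> (fst z) * (\<beta>'' (w z) * wx z)"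
definition e :: "real \<Rightarrow> real" where "e t = (LINT x:{\<epsilon>..1}|lborel. \<eta> x * \<beta> (w (x, t)))"

lemma beta_cont: "continuous_on UNIV \<beta>" "continuous_on UNIV \<beta>'"
  using beta1 beta2 by (meson DERIV_isCont continuous_at_imp_continuous_on)+

lemma beta_meas [measurable]: "\<beta> \<in> borel_measurable borel" "\<beta>' \<in> borel_measurable borel" "\<beta>'' \<in> borel_measurable borel"
  by (rule borel_measurable_continuous_onI beta_cont beta2_cont)+

lemma zeta_meas [measurable]: "zeta \<in> borel_measurable borel"
  unfolding zeta_def[abs_def] by measurable

lemma B_meas [measurable]: "B \<in> borel_measurable borel"
  unfolding B_def[abs_def] by measurable

lemma eta_bound:
  obtains K where "0 \<le> K" "\<And>x. x \<in> {\<epsilon>..1} \<Longrightarrow> \<bar>\<eta> x\<bar> \<le> K" "\<And>x. x \<in> {\<epsilon>..1} \<Longrightarrow> \<bar>\<eta>' x\<bar> \<le> K"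
    "\<And>x. x \<in> {\<epsilon>..1} \<Longrightarrow> \<bar>\<kappa>' x\<bar> \<le> K"
proof -
  obtain K1 where K1: "\<And>x. x \<in> {\<epsilon>..1} \<Longrightarrow> \<bar>\<eta> x\<bar> \<le> K1" using continuous_bounded_on_Icc[OF eta_cont(1), of \<epsilon> 1] by blast
  obtain K2 where K2: "\<And>x. x \<in> {\<epsilon>..1} \<Longrightarrow> \<bar>\<eta>' x\<bar> \<le> K2" using continuous_bounded_on_Icc[OF eta_cont(2), of \<epsilon> 1] by blast
  obtain K3 where K3: "\<And>x. x \<in> {\<epsilon>..1} \<Longrightarrow> \<bar>\<kappa>' x\<bar> \<le> K3" using continuous_bounded_on_Icc[OF eta_cont(3), of \<epsilon> 1] by blast
  define K where "K = \<bar>K1\<bar> + \<bar>K2\<bar> + \<bar>K3\<bar>"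
  show ?thesis
  proof (rule that[of K])
    show "0 \<le> K" by (simp add: K_def)
    fix x assume x: "x \<in> {\<epsilon>..1}"
    show "\<bar>\<eta> x\<bar> \<le> K" "\<bar>\<eta>' x\<bar> \<le> K" "\<bar>\<kappa>' x\<bar> \<le> K"
      using K1[OF x] K2[OF x] K3[OF x] unfolding K_def by linarith+
  qed
qed

lemma AC_eta: "AC \<epsilon> 1 \<eta> \<eta>'"
  by (rule AC_C1[OF eta_deriv continuous_on_subset[OF eta_cont(2) subset_UNIV]])

lemma AE_AC_beta:
  "AE t in lborel. 0 < t \<longrightarrow> AC \<epsilon> 1 (\<lambda>x. zeta (x, t)) (\<lambda>x. B (x, t)) \<and>
     AC \<epsilon> 1 (\<lambda>x. \<beta> (w (x, t))) (\<lambda>x. \<beta>' (w (x, t)) * wx (x, t))"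
  using AE_AC
proof eventually_elim
  case (elim t)
  show ?case
  proof
    assume "0 < t"
    then have W: "AC \<epsilon> 1 (\<lambda>x. w (x, t)) (\<lambda>x. wx (x, t))" using elim by blast
    have 1: "AC \<epsilon> 1 (\<lambda>x. \<beta> (w (x, t))) (\<lambda>x. \<beta>' (w (x, t)) * wx (x, t))"
      by (rule AC_compose[OF W beta1 beta_cont(2)])
    have "AC \<epsilon> 1 (\<lambda>x. \<beta>' (w (x, t))) (\<lambda>x. \<beta>'' (w (x, t)) * wx (x, t))"
      by (rule AC_compose[OF W beta2 beta2_cont])
    from AC_mult[OF AC_eta this] have "AC \<epsilon> 1 (\<lambda>x. zeta (x, t)) (\<lambda>x. B (x, t))"
      by (simp add: zeta_def B_def)
    with 1 show "AC \<epsilon> 1 (\<lambda>x. zeta (x, t)) (\<lambda>x. B (x, t)) \<and>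
     AC \<epsilon> 1 (\<lambda>x. \<beta> (w (x, t))) (\<lambda>x. \<beta>' (w (x, t)) * wx (x, t))" by blast
  qed
qed

lemma zeta_eps: "zeta (\<epsilon>, t) = 0"
  by (simp add: zeta_def eta_eps)

text \<open>Convexity gives \<open>\<beta>(w(\<tau>)) - \<beta>(w(\<tau> - h)) \<le> \<beta>'(w(\<tau>)) (w(\<tau>) - w(\<tau> - h))\<close>; the right-hand side times \<open>\<eta>\<close>
is the increment of \<open>w\<close> tested with \<open>zeta\<close> at the fixed time \<open>\<tau>\<close>, which \<open>AC_test_increment\<close> evaluates by
means of the integrated equation.\<close>

lemma discrete_inequality:
  assumes "0 < \<sigma>" "0 < h"
  shows "AE \<tau> in lborel. \<tau> \<in> {\<sigma> + h..T} \<longrightarrow> e \<tau> - e (\<tau> - h) \<le>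
    - (h * ((LINT x:{\<epsilon>..1}|lborel. B (x, \<tau>) * time_avg h H (x, \<tau>)) + zeta (1, \<tau>) * time_avg h F (1, \<tau>)
       - (LINT x:{\<epsilon>..1}|lborel. zeta (x, \<tau>) * time_avg h Fx (x, \<tau>))))"
  using AE_AC AE_lborel_shift[OF AE_AC, of h] AE_AC_beta AE_lborel_shift[OF AE_AC_beta, of h]
    AE_lborel_prodD2[OF N.integrated[OF assms(2)]] AE_lborel_prodD2[OF M.integrated[OF assms(2)]]
proof eventually_elim
  case (elim \<tau>)
  show ?case
  proof
    assume \<tau>: "\<tau> \<in> {\<sigma> + h..T}"
    have pos: "0 < \<tau>" "0 < \<tau> - h" "h < \<tau>" using \<tau> assms by auto
    have n1: "AC \<epsilon> 1 (\<lambda>x. n (x, \<tau>)) (\<lambda>x. nx (x, \<tau>))" and m1: "AC \<epsilon> 1 (\<lambda>x. m (x, \<tau>)) (\<lambda>x. mx (x, \<tau>))"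
      and w1: "AC \<epsilon> 1 (\<lambda>x. w (x, \<tau>)) (\<lambda>x. wx (x, \<tau>))" using elim(1) pos by blast+
    have n0: "AC \<epsilon> 1 (\<lambda>x. n (x, \<tau> - h)) (\<lambda>x. nx (x, \<tau> - h))" and m0: "AC \<epsilon> 1 (\<lambda>x. m (x, \<tau> - h)) (\<lambda>x. mx (x, \<tau> - h))"
      and w0: "AC \<epsilon> 1 (\<lambda>x. w (x, \<tau> - h)) (\<lambda>x. wx (x, \<tau> - h))" using elim(2) pos by blast+
    have z1: "AC \<epsilon> 1 (\<lambda>x. zeta (x, \<tau>)) (\<lambda>x. B (x, \<tau>))"
      and b1: "AC \<epsilon> 1 (\<lambda>x. \<beta> (w (x, \<tau>))) (\<lambda>x. \<beta>' (w (x, \<tau>)) * wx (x, \<tau>))" using elim(3) pos by blast+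
    have b0: "AC \<epsilon> 1 (\<lambda>x. \<beta> (w (x, \<tau> - h))) (\<lambda>x. \<beta>' (w (x, \<tau> - h)) * wx (x, \<tau> - h))" using elim(4) pos by blast
    let ?\<Delta> = "\<lambda>x. w (x, \<tau>) - w (x, \<tau> - h)"
    have \<Delta>: "set_integrable lborel {\<epsilon>..1} ?\<Delta>"
      by (rule set_integral_diff(1)[OF AC_set_integrable[OF w1] AC_set_integrable[OF w0]])
    have eq: "AE y in lborel. y \<in> {\<epsilon>..1} \<longrightarrow>
      (LINT x:{y..1}|lborel. ?\<Delta> x) = - (h * (time_avg h H (y, \<tau>) + time_avg h F (y, \<tau>)))"
      using elim(5,6) time_avg_flux_diff[OF assms, of T]
    proof eventually_elim
      case (elim y)
      show ?case
      proof
        assume y: "y \<in> {\<epsilon>..1}"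
        have sub: "set_integrable lborel {y..1} u" if "AC \<epsilon> 1 u u'" for u u'
          by (rule set_integrable_subset[OF AC_set_integrable[OF that]]) (use y in auto)
        have "0 < y \<and> y \<le> 1 \<and> h < \<tau>" using y eps pos by auto
        then have N1: "(LINT x:{y..1}|lborel. n (x, \<tau>)) - (LINT x:{y..1}|lborel. n (x, \<tau> - h)) = - (h * time_avg h (flux n nx) (y, \<tau>))"
          and M1: "(LINT x:{y..1}|lborel. m (x, \<tau>)) - (LINT x:{y..1}|lborel. m (x, \<tau> - h)) = - (h * time_avg h (flux m mx) (y, \<tau>))"
          using elim(1,2) by auto
        have "(LINT x:{y..1}|lborel. ?\<Delta> x) = (LINT x:{y..1}|lborel. w (x, \<tau>)) - (LINT x:{y..1}|lborel. w (x, \<tau> - h))"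
          by (rule set_integral_diff(2)[OF sub[OF w1] sub[OF w0]])
        also have "(LINT x:{y..1}|lborel. w (x, \<tau>)) = (LINT x:{y..1}|lborel. n (x, \<tau>)) - (LINT x:{y..1}|lborel. m (x, \<tau>))"
          unfolding w_def by (rule set_integral_diff(2)[OF sub[OF n1] sub[OF m1]])
        also have "(LINT x:{y..1}|lborel. w (x, \<tau> - h)) = (LINT x:{y..1}|lborel. n (x, \<tau> - h)) - (LINT x:{y..1}|lborel. m (x, \<tau> - h))"
          unfolding w_def by (rule set_integral_diff(2)[OF sub[OF n0] sub[OF m0]])
        finally have "(LINT x:{y..1}|lborel. ?\<Delta> x) = - (h * (time_avg h (flux n nx) (y, \<tau>) - time_avg h (flux m mx) (y, \<tau>)))"
          using N1 M1 unfolding right_diff_distrib by linarith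
        also have "time_avg h (flux n nx) (y, \<tau>) - time_avg h (flux m mx) (y, \<tau>) = time_avg h H (y, \<tau>) + time_avg h F (y, \<tau>)"
          using elim(3) y \<tau> by blast
        finally show "(LINT x:{y..1}|lborel. ?\<Delta> x) = - (h * (time_avg h H (y, \<tau>) + time_avg h F (y, \<tau>)))" .
      qed
    qed
    have \<sigma>\<tau>: "\<sigma> + h \<le> \<tau>" using \<tau> by simp
    have key: "(LINT x:{\<epsilon>..1}|lborel. zeta (x, \<tau>) * ?\<Delta> x) =
      - (h * ((LINT x:{\<epsilon>..1}|lborel. B (x, \<tau>) * time_avg h H (x, \<tau>)) + zeta (1, \<tau>) * time_avg h F (1, \<tau>)
       - (LINT x:{\<epsilon>..1}|lborel. zeta (x, \<tau>) * time_avg h Fx (x, \<tau>))))"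
      by (rule AC_test_increment[OF z1 zeta_eps _ \<Delta> time_avg_F_AC[OF assms \<sigma>\<tau>] assms(2)
           slice_measurable(1)[OF B_meas] slice_measurable(1)[OF measurable_time_avg[OF meas(3)]] eq])
         (use eps in simp)
    have c\<eta>: "continuous_on {\<epsilon>..1} \<eta>" by (rule continuous_on_subset[OF eta_cont(1) subset_UNIV])
    have i1: "set_integrable lborel {\<epsilon>..1} (\<lambda>x. \<eta> x * \<beta> (w (x, \<tau>)))"
      and i0: "set_integrable lborel {\<epsilon>..1} (\<lambda>x. \<eta> x * \<beta> (w (x, \<tau> - h)))"
      by (rule borel_integrable_atLeastAtMost' continuous_on_mult c\<eta> AC_continuous_on[OF b1] AC_continuous_on[OF b0])+
    have iz: "set_integrable lborel {\<epsilon>..1} (\<lambda>x. zeta (x, \<tau>) * ?\<Delta> x)"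
      by (rule set_integrable_continuous_mult[OF \<Delta> AC_continuous_on[OF z1]])
    have "e \<tau> - e (\<tau> - h) = (LINT x:{\<epsilon>..1}|lborel. \<eta> x * \<beta> (w (x, \<tau>)) - \<eta> x * \<beta> (w (x, \<tau> - h)))"
      unfolding e_def by (rule set_integral_diff(2)[OF i1 i0, symmetric])
    also have "\<dots> \<le> (LINT x:{\<epsilon>..1}|lborel. zeta (x, \<tau>) * ?\<Delta> x)"
    proof (rule set_integral_mono[OF set_integral_diff(1)[OF i1 i0] iz])
      fix x assume "x \<in> {\<epsilon>..1}"
      then have "\<eta> x * (\<beta> (w (x, \<tau>)) - \<beta> (w (x, \<tau> - h))) \<le> \<eta> x * (\<beta>' (w (x, \<tau>)) * ?\<Delta> x)"
        by (intro mult_left_mono beta_convex eta_nonneg)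
      then show "\<eta> x * \<beta> (w (x, \<tau>)) - \<eta> x * \<beta> (w (x, \<tau> - h)) \<le> zeta (x, \<tau>) * ?\<Delta> x"
        by (simp add: zeta_def right_diff_distrib mult.assoc)
    qed
    finally show "e \<tau> - e (\<tau> - h) \<le>
      - (h * ((LINT x:{\<epsilon>..1}|lborel. B (x, \<tau>) * time_avg h H (x, \<tau>)) + zeta (1, \<tau>) * time_avg h F (1, \<tau>)
       - (LINT x:{\<epsilon>..1}|lborel. zeta (x, \<tau>) * time_avg h Fx (x, \<tau>))))" unfolding key .
  qed
qed

lemma beta_bound: "\<beta> s \<le> \<beta> 0 + \<bar>s\<bar>"
proof -
  have "\<beta> s - \<beta> 0 \<le> \<beta>' s * (s - 0)" by (rule beta_convex)
  also have "\<dots> \<le> \<bar>\<beta>' s * s\<bar>" by simp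
  also have "\<dots> \<le> 1 * \<bar>s\<bar>" unfolding abs_mult by (intro mult_right_mono beta'_le) simp
  finally show ?thesis by simp
qed

context
  fixes \<sigma> T :: real
  assumes sig: "0 < \<sigma>"
begin

lemma w_int: "set_integrable lborel ({\<epsilon>..1} \<times> {\<sigma>..T}) w"
  by (rule rect_integrable_of_square[OF meas(1) w_sq[OF sig]])

lemma beta_w_int: "set_integrable lborel ({\<epsilon>..1} \<times> {\<sigma>..T}) (\<lambda>z. \<beta> (w z))"
proof (rule set_integrable_dominated)
  show "set_integrable lborel ({\<epsilon>..1} \<times> {\<sigma>..T}) (\<lambda>z. \<beta> 0 + \<bar>w z\<bar>)"
    by (intro set_integral_add(1) rect_integrable_const set_integrable_abs w_int)
  show "AE z in lborel. z \<in> {\<epsilon>..1} \<times> {\<sigma>..T} \<longrightarrow> \<bar>\<beta> (w z)\<bar> \<le> \<beta> 0 + \<bar>w z\<bar>"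
    using beta_bound beta_nonneg by simp
qed measurable

lemma e_int: "set_integrable lborel {\<sigma>..T} e"
proof -
  obtain K where K: "\<And>x. x \<in> {\<epsilon>..1} \<Longrightarrow> \<bar>\<eta> x\<bar> \<le> K" by (rule eta_bound) blast
  have "set_integrable lborel ({\<epsilon>..1} \<times> {\<sigma>..T}) (\<lambda>z. \<eta> (fst z) * \<beta> (w z))"
    by (rule set_integrable_bounded_mult[where C=K, OF beta_w_int]) (measurable, use K in auto)
  from rect_integrable_snd[OF this] show ?thesis by (simp add: e_def[abs_def])
qed

lemma B_sq: "set_integrable lborel ({\<epsilon>..1} \<times> {\<sigma>..T}) (\<lambda>z. (B z)\<^sup>2)"
proof -
  obtain K where K0: "0 \<le> K" and K: "\<And>x. x \<in> {\<epsilon>..1} \<Longrightarrow> \<bar>\<eta> x\<bar> \<le> K" "\<And>x. x \<in> {\<epsilon>..1} \<Longrightarrow> \<bar>\<eta>' x\<bar> \<le> K"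
    by (rule eta_bound) blast
  have C0: "0 \<le> C" using beta''_nonneg[of 0] beta''_le[of 0] by linarith
  have "set_integrable lborel ({\<epsilon>..1} \<times> {\<sigma>..T})
     (\<lambda>z. (\<eta>' (fst z) * \<beta>' (w z) - (- (\<eta> (fst z) * (\<beta>'' (w z) * wx z))))\<^sup>2)"
  proof (rule square_diff_int)
    have "set_integrable lborel ({\<epsilon>..1} \<times> {\<sigma>..T}) (\<lambda>z. (\<eta>' (fst z) * \<beta>' (w z))\<^sup>2 * 1)"
    proof (rule set_integrable_bounded_mult[where C="K\<^sup>2", OF rect_integrable_const])
      fix z assume "z \<in> {\<epsilon>..1} \<times> {\<sigma>..T}"
      then have "\<bar>\<eta>' (fst z) * \<beta>' (w z)\<bar> \<le> K * 1"
        unfolding abs_mult using K0 by (intro mult_mono K(2) beta'_le) auto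
      then have "\<bar>\<eta>' (fst z) * \<beta>' (w z)\<bar>\<^sup>2 \<le> K\<^sup>2" by (intro power_mono) auto
      then show "\<bar>(\<eta>' (fst z) * \<beta>' (w z))\<^sup>2\<bar> \<le> K\<^sup>2" by simp
    qed measurable
    then show "set_integrable lborel ({\<epsilon>..1} \<times> {\<sigma>..T}) (\<lambda>z. (\<eta>' (fst z) * \<beta>' (w z))\<^sup>2)" by simp
    have "set_integrable lborel ({\<epsilon>..1} \<times> {\<sigma>..T}) (\<lambda>z. (\<eta> (fst z) * \<beta>'' (w z))\<^sup>2 * (wx z)\<^sup>2)"
    proof (rule set_integrable_bounded_mult[where C="(K * C)\<^sup>2", OF wx_sq[OF sig]])
      fix z assume "z \<in> {\<epsilon>..1} \<times> {\<sigma>..T}"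
      then have "\<bar>\<eta> (fst z) * \<beta>'' (w z)\<bar> \<le> K * C"
        unfolding abs_mult using K0 C0 beta''_nonneg[of "w z"] beta''_le[of "w z"] by (intro mult_mono K(1)) auto
      then have "\<bar>\<eta> (fst z) * \<beta>'' (w z)\<bar>\<^sup>2 \<le> (K * C)\<^sup>2" by (intro power_mono) auto
      then show "\<bar>(\<eta> (fst z) * \<beta>'' (w z))\<^sup>2\<bar> \<le> (K * C)\<^sup>2" by simp
    qed measurable
    then show "set_integrable lborel ({\<epsilon>..1} \<times> {\<sigma>..T}) (\<lambda>z. (- (\<eta> (fst z) * (\<beta>'' (w z) * wx z)))\<^sup>2)"
      by (simp add: power_mult_distrib mult.assoc)
  qed measurable
  then show ?thesis by (simp add: B_def)
qed

end

end

section \<open>The entropy inequality in continuous time\<close>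

context comparison_smooth
begin

text \<open>The formal dissipation rate: \<open>d/dt \<integral> \<eta> \<beta>(w) = - R\<close> for smooth solutions.\<close>

definition R :: "real \<Rightarrow> real" where
  "R \<tau> = (LINT x:{\<epsilon>..1}|lborel. B (x, \<tau>) * H (x, \<tau>)) + (LINT x:{\<epsilon>..1}|lborel. B (x, \<tau>) * F (x, \<tau>))"

lemma time_avg_cong:
  assumes "\<And>s. s \<in> {\<tau> - h..\<tau>} \<Longrightarrow> f (x, s) = g (y, s)"
  shows "time_avg h f (x, \<tau>) = time_avg h g (y, \<tau>)"
proof -
  have "(LINT s:{\<tau> - h..\<tau>}|lborel. f (x, s)) = (LINT s:{\<tau> - h..\<tau>}|lborel. g (y, s))"
    by (rule set_lebesgue_integral_cong) (use assms in auto)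
  then show ?thesis by (simp add: time_avg_def avg_def)
qed

lemma cut_integrable:
  fixes f :: "real \<times> real \<Rightarrow> real"
  assumes "set_integrable lborel S f"
  shows "integrable lborel (\<lambda>z. indicator S z * f z)"
  using assms by (simp add: set_integrable_def)

text \<open>Integrate the discrete inequality over \<open>[t1, t2]\<close> and divide by \<open>h\<close>.  The left-hand side telescopes to
the difference of two averages of \<open>e\<close>, which converge because \<open>t1\<close> and \<open>t2\<close> are assumed to be Lebesgue points.  On
the right \<open>h \<rightarrow> 0\<close> is justified term by term: \<open>B\<close> and \<open>H\<close> are square integrable, while
\<open>zeta\<close> is bounded and \<open>F(1, \<cdot>)\<close> and \<open>Fx\<close> are integrable.  In the limit the integration by parts
is undone, which recovers \<open>R\<close>.\<close>

lemma limit_inequality: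
  assumes t: "0 < \<sigma>" "\<sigma> < t1" "t1 < t2" "t2 \<le> T"
    and L: "(\<lambda>k. avg (step k) (\<lambda>t. indicator {\<sigma>..T} t * e t) t1) \<longlonglongrightarrow> e t1"
      "(\<lambda>k. avg (step k) (\<lambda>t. indicator {\<sigma>..T} t * e t) t2) \<longlonglongrightarrow> e t2"
  shows "set_integrable lborel {t1..t2} R" "e t2 - e t1 \<le> - (LINT \<tau>:{t1..t2}|lborel. R \<tau>)"
proof -
  let ?S = "{\<epsilon>..1} \<times> {\<sigma>..T}" and ?S2 = "{\<epsilon>..1} \<times> {t1..t2}" and ?U = "{0..1::real} \<times> {\<sigma>..T}" and ?U2 = "{0..1::real} \<times> {t1..t2}"
  have t1: "0 < t1" using t by simp
  obtain K where K0: "0 \<le> K" and K: "\<And>x. x \<in> {\<epsilon>..1} \<Longrightarrow> \<bar>\<eta> x\<bar> \<le> K" by (rule eta_bound) blast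
  have zK: "\<bar>zeta (x, s)\<bar> \<le> K" if "x \<in> {\<epsilon>..1}" for x s
  proof -
    have "\<bar>zeta (x, s)\<bar> \<le> K * 1"
      unfolding zeta_def abs_mult using K0 that by (intro mult_mono K beta'_le) auto
    then show ?thesis by simp
  qed
  \<comment> \<open>Functions cut off to rectangles.  The averaged ones are cut off at the earlier time \<open>\<sigma>\<close>, so that the
    average at a time in \<open>[t1, t2]\<close> sees no cut-off once \<open>h \<le> t1 - \<sigma>\<close>.  The boundary term depends on time only; it is
    spread over a strip of width one so that the convergence lemma in the plane applies.\<close>
  define HS FxS A2 B1 B2 B3 where "HS = (\<lambda>z. indicator ?S z * H z)" and "FxS = (\<lambda>z. indicator ?S z * Fx z)"
    and "A2 = (\<lambda>z. indicator ?U z * F (1, snd z))"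
    and "B1 = (\<lambda>z. indicator ?S2 z * B z)" and "B2 = (\<lambda>z. indicator ?U2 z * zeta (1, snd z))"
    and "B3 = (\<lambda>z. indicator ?S2 z * zeta z)"
  have F1m[measurable]: "(\<lambda>z. F (1, snd z)) \<in> borel_measurable (borel :: (real \<times> real) measure)"
    by (rule measurable_of_fst_snd(2)[OF slice_measurable(2)[OF meas(4)]])
  have z1m[measurable]: "(\<lambda>z. zeta (1, snd z)) \<in> borel_measurable (borel :: (real \<times> real) measure)"
    by (rule measurable_of_fst_snd(2)[OF slice_measurable(2)[OF zeta_meas]])
  have iHS: "integrable lborel HS" unfolding HS_def by (rule cut_integrable[OF H_int[OF t(1)]])
  have iFxS: "integrable lborel FxS" unfolding FxS_def by (rule cut_integrable[OF Fx_int[OF t(1)]])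
  have iA2: "integrable lborel A2"
    unfolding A2_def
    by (rule cut_integrable[OF rect_integrable_of_snd[OF F_trace_int[OF t(1)] slice_measurable(2)[OF meas(4)]]])
  have sq: "(\<lambda>z. (indicator S z * f z)\<^sup>2) = (\<lambda>z. indicator S z * (f z)\<^sup>2)" for S and f :: "real \<times> real \<Rightarrow> real"
    by (auto simp: fun_eq_iff indicator_def)
  have iHS2: "integrable lborel (\<lambda>z. (HS z)\<^sup>2)" unfolding HS_def sq by (rule cut_integrable[OF H_sq[OF t(1)]])
  have iB12: "integrable lborel (\<lambda>z. (B1 z)\<^sup>2)" unfolding B1_def sq by (rule cut_integrable[OF B_sq[OF t1]])
  have mB1: "B1 \<in> borel_measurable borel" unfolding B1_def by measurable
  have mB2: "B2 \<in> borel_measurable borel" unfolding B2_def by measurable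
  have mB3: "B3 \<in> borel_measurable borel" unfolding B3_def by measurable
  have bB2: "\<bar>B2 z\<bar> \<le> K" for z using zK[of 1 "snd z"] eps K0 by (auto simp: B2_def indicator_def)
  have bB3: "\<bar>B3 z\<bar> \<le> K" for z using zK[of "fst z" "snd z"] K0 by (auto simp: B3_def indicator_def)
  note lim1 = time_avg_mult_square_tendsto[OF iHS iHS2 mB1 iB12]
  note lim2 = time_avg_mult_bounded_tendsto[OF iA2 mB2 bB2]
  note lim3 = time_avg_mult_bounded_tendsto[OF iFxS mB3 bB3]
  have tos: "(\<lambda>z. B1 z * f z) = (\<lambda>z. indicator ?S2 z *\<^sub>R (B z * f z))"
    "(\<lambda>z. B2 z * f z) = (\<lambda>z. indicator ?U2 z *\<^sub>R (zeta (1, snd z) * f z))"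
    "(\<lambda>z. B3 z * f z) = (\<lambda>z. indicator ?S2 z *\<^sub>R (zeta z * f z))" for f
    by (simp_all add: fun_eq_iff B1_def B2_def B3_def mult.assoc)
  have step_small: "\<forall>\<^sub>F k in sequentially. step k \<le> t1 - \<sigma>"
    using order_tendstoD(2)[OF step_tendsto, of "t1 - \<sigma>"] t by (auto elim: eventually_mono)
  have ineq: "\<forall>\<^sub>F k in sequentially.
     avg (step k) (\<lambda>t. indicator {\<sigma>..T} t * e t) t2 - avg (step k) (\<lambda>t. indicator {\<sigma>..T} t * e t) t1 \<le>
     - ((LINT z|lborel. B1 z * time_avg (step k) HS z) + (LINT z|lborel. B2 z * time_avg (step k) A2 z)
        - (LINT z|lborel. B3 z * time_avg (step k) FxS z))"
    using step_small lim1(2)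
  proof eventually_elim
    case (elim k)
    define h where "h = step k"
    have h: "0 < h" "\<sigma> + h \<le> t1" using elim(1) step_pos by (auto simp: h_def)
    have S1: "set_integrable lborel ?S2 (\<lambda>z. B z * time_avg h HS z)"
      using elim(2) unfolding tos set_integrable_def h_def .
    have S2: "set_integrable lborel ?U2 (\<lambda>z. zeta (1, snd z) * time_avg h A2 z)"
      using lim2(2)[of k] unfolding tos set_integrable_def h_def .
    have S3: "set_integrable lborel ?S2 (\<lambda>z. zeta z * time_avg h FxS z)"
      using lim3(2)[of k] unfolding tos set_integrable_def h_def .
    let ?G1 = "\<lambda>\<tau>. LINT x:{\<epsilon>..1}|lborel. B (x, \<tau>) * time_avg h HS (x, \<tau>)"
    let ?G2 = "\<lambda>\<tau>. LINT y:{0..1}|lborel. zeta (1, snd (y, \<tau>)) * time_avg h A2 (y, \<tau>)"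
    let ?G3 = "\<lambda>\<tau>. LINT x:{\<epsilon>..1}|lborel. zeta (x, \<tau>) * time_avg h FxS (x, \<tau>)"
    have I: "(LINT z|lborel. B1 z * time_avg h HS z) = (LINT \<tau>:{t1..t2}|lborel. ?G1 \<tau>)"
      "(LINT z|lborel. B2 z * time_avg h A2 z) = (LINT \<tau>:{t1..t2}|lborel. ?G2 \<tau>)"
      "(LINT z|lborel. B3 z * time_avg h FxS z) = (LINT \<tau>:{t1..t2}|lborel. ?G3 \<tau>)"
      unfolding rect_integral_snd[OF S1] rect_integral_snd[OF S2] rect_integral_snd[OF S3] tos
      by (simp_all only: set_lebesgue_integral_def)
    have iG: "set_integrable lborel {t1..t2} ?G1" "set_integrable lborel {t1..t2} ?G2" "set_integrable lborel {t1..t2} ?G3"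
      by (rule rect_integrable_snd[OF S1] rect_integrable_snd[OF S2] rect_integrable_snd[OF S3])+
    have iG': "set_integrable lborel {t1..t2} (\<lambda>\<tau>. (- h) * (?G1 \<tau> + ?G2 \<tau> - ?G3 \<tau>))"
      by (intro set_integrable_mult_right set_integral_diff(1) set_integral_add(1) iG)
    have Tt: "{t1 - h..t2} \<subseteq> {\<sigma>..T}" using h t by auto
    have ei: "set_integrable lborel {a..b} e" if "{a..b} \<subseteq> {t1 - h..t2}" for a b
      by (rule set_integrable_subset[OF e_int[OF t(1), of T]]) (use that Tt in auto)
    have ie1: "set_integrable lborel {t1..t2} e" by (rule ei) (use h in auto)
    have ie0: "set_integrable lborel {t1..t2} (\<lambda>\<tau>. e (\<tau> - h))"
      by (rule set_integrable_shift_Icc) (rule ei, use h t in auto)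
    have "(LINT \<tau>:{t1..t2}|lborel. e \<tau> - e (\<tau> - h)) \<le> (LINT \<tau>:{t1..t2}|lborel. (- h) * (?G1 \<tau> + ?G2 \<tau> - ?G3 \<tau>))"
      unfolding set_lebesgue_integral_def[of lborel "{t1..t2}"]
    proof (rule integral_mono_AE)
      show "integrable lborel (\<lambda>\<tau>. indicator {t1..t2} \<tau> *\<^sub>R (e \<tau> - e (\<tau> - h)))"
        using set_integral_diff(1)[OF ie1 ie0] by (simp add: set_integrable_def)
      show "integrable lborel (\<lambda>\<tau>. indicator {t1..t2} \<tau> *\<^sub>R ((- h) * (?G1 \<tau> + ?G2 \<tau> - ?G3 \<tau>)))"
        using iG' by (simp only: set_integrable_def)
      show "AE \<tau> in lborel. indicator {t1..t2} \<tau> *\<^sub>R (e \<tau> - e (\<tau> - h)) \<le> indicator {t1..t2} \<tau> *\<^sub>R ((- h) * (?G1 \<tau> + ?G2 \<tau> - ?G3 \<tau>))"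
        using discrete_inequality[OF t(1) h(1), of T]
      proof eventually_elim
        case (elim \<tau>)
        show ?case
        proof (cases "\<tau> \<in> {t1..t2}")
          case True
          have \<tau>: "\<tau> \<in> {\<sigma> + h..T}" "{\<tau> - h..\<tau>} \<subseteq> {\<sigma>..T}" using True h t by auto
          have c1: "time_avg h HS (x, \<tau>) = time_avg h H (x, \<tau>)" if "x \<in> {\<epsilon>..1}" for x
            by (rule time_avg_cong) (use \<tau>(2) that in \<open>auto simp: HS_def\<close>)
          have c2: "time_avg h A2 (y, \<tau>) = time_avg h F (1, \<tau>)" if "y \<in> {0..1}" for y
            by (rule time_avg_cong) (use \<tau>(2) that in \<open>auto simp: A2_def\<close>)
          have c3: "time_avg h FxS (x, \<tau>) = time_avg h Fx (x, \<tau>)" if "x \<in> {\<epsilon>..1}" for x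
            by (rule time_avg_cong) (use \<tau>(2) that in \<open>auto simp: FxS_def\<close>)
          have g1: "?G1 \<tau> = (LINT x:{\<epsilon>..1}|lborel. B (x, \<tau>) * time_avg h H (x, \<tau>))"
            by (rule set_lebesgue_integral_cong) (auto simp: c1)
          have g3: "?G3 \<tau> = (LINT x:{\<epsilon>..1}|lborel. zeta (x, \<tau>) * time_avg h Fx (x, \<tau>))"
            by (rule set_lebesgue_integral_cong) (auto simp: c3)
          have "?G2 \<tau> = (LINT y:{0..1::real}|lborel. zeta (1, \<tau>) * time_avg h F (1, \<tau>))"
            by (rule set_lebesgue_integral_cong) (auto simp: c2)
          also have "\<dots> = zeta (1, \<tau>) * time_avg h F (1, \<tau>)" by (simp add: set_lebesgue_integral_def)
          finally have g2: "?G2 \<tau> = zeta (1, \<tau>) * time_avg h F (1, \<tau>)" .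
          have "e \<tau> - e (\<tau> - h) \<le> (- h) * (?G1 \<tau> + ?G2 \<tau> - ?G3 \<tau>)"
            using elim \<tau>(1) unfolding g1 g2 g3 by simp
          then show ?thesis using True by simp
        qed simp
      qed
    qed
    also have "(LINT \<tau>:{t1..t2}|lborel. (- h) * (?G1 \<tau> + ?G2 \<tau> - ?G3 \<tau>)) =
       (- h) * ((LINT \<tau>:{t1..t2}|lborel. ?G1 \<tau>) + (LINT \<tau>:{t1..t2}|lborel. ?G2 \<tau>) - (LINT \<tau>:{t1..t2}|lborel. ?G3 \<tau>))"
      unfolding set_integral_mult_right set_integral_diff(2)[OF set_integral_add(1)[OF iG(1,2)] iG(3)]
        set_integral_add(2)[OF iG(1,2)] ..
    finally have A: "(LINT \<tau>:{t1..t2}|lborel. e \<tau> - e (\<tau> - h)) \<le>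
       (- h) * ((LINT z|lborel. B1 z * time_avg h HS z) + (LINT z|lborel. B2 z * time_avg h A2 z)
        - (LINT z|lborel. B3 z * time_avg h FxS z))"
      unfolding I .
    \<comment> \<open>Telescoping: the integrals over \<open>[t1, t2]\<close> and \<open>[t1 - h, t2 - h]\<close> differ by two short pieces.\<close>
    have i: "set_integrable lborel {t1 - h..t2} e" by (rule ei) simp
    have "(LINT s:{t1 - h..t2}|lborel. e s) = (LINT s:{t1 - h..t1}|lborel. e s) + (LINT s:{t1..t2}|lborel. e s)"
      "(LINT s:{t1 - h..t2}|lborel. e s) = (LINT s:{t1 - h..t2 - h}|lborel. e s) + (LINT s:{t2 - h..t2}|lborel. e s)"
      by (rule set_integral_Icc_split[OF i]; use h t in simp)+
    moreover have "(LINT \<tau>:{t1..t2}|lborel. e \<tau> - e (\<tau> - h)) = (LINT s:{t1..t2}|lborel. e s) - (LINT s:{t1 - h..t2 - h}|lborel. e s)"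
      unfolding set_integral_diff(2)[OF ie1 ie0] integral_shift_Icc ..
    ultimately have D: "(LINT \<tau>:{t1..t2}|lborel. e \<tau> - e (\<tau> - h)) = (LINT s:{t2 - h..t2}|lborel. e s) - (LINT s:{t1 - h..t1}|lborel. e s)"
      by linarith
    have av: "(LINT s:{r - h..r}|lborel. e s) = h * avg h (\<lambda>t. indicator {\<sigma>..T} t * e t) r" if "{r - h..r} \<subseteq> {t1 - h..t2}" for r
    proof -
      have "(LINT s:{r - h..r}|lborel. indicator {\<sigma>..T} s * e s) = (LINT s:{r - h..r}|lborel. e s)"
        by (rule set_lebesgue_integral_cong) (use that Tt in auto)
      then show ?thesis using h by (simp add: avg_def)
    qed
    have a2: "(LINT s:{t2 - h..t2}|lborel. e s) = h * avg h (\<lambda>t. indicator {\<sigma>..T} t * e t) t2"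
      by (rule av) (use h t in auto)
    have a1: "(LINT s:{t1 - h..t1}|lborel. e s) = h * avg h (\<lambda>t. indicator {\<sigma>..T} t * e t) t1"
      by (rule av) (use h t in auto)
    have "h * (avg h (\<lambda>t. indicator {\<sigma>..T} t * e t) t2 - avg h (\<lambda>t. indicator {\<sigma>..T} t * e t) t1) \<le>
      h * (- ((LINT z|lborel. B1 z * time_avg h HS z) + (LINT z|lborel. B2 z * time_avg h A2 z)
        - (LINT z|lborel. B3 z * time_avg h FxS z)))"
      using A unfolding D a1 a2 by (simp add: algebra_simps)
    then show ?case using h(1) unfolding h_def[symmetric] by (simp only: mult_le_cancel_left_pos)
  qed
  have lim: "e t2 - e t1 \<le> - ((LINT z|lborel. B1 z * HS z) + (LINT z|lborel. B2 z * A2 z) - (LINT z|lborel. B3 z * FxS z))"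
    by (rule tendsto_le[OF _ _ _ ineq]) (intro tendsto_intros L lim1(1) lim2(1) lim3(1) trivial_limit_sequentially)+
  have tos': "(\<lambda>z. B1 z * HS z) = (\<lambda>z. indicator ?S2 z *\<^sub>R (B z * H z))"
    "(\<lambda>z. B2 z * A2 z) = (\<lambda>z. indicator ?U2 z *\<^sub>R (zeta (1, snd z) * F (1, snd z)))"
    "(\<lambda>z. B3 z * FxS z) = (\<lambda>z. indicator ?S2 z *\<^sub>R (zeta z * Fx z))"
    using t by (auto simp: fun_eq_iff B1_def B2_def B3_def HS_def A2_def FxS_def indicator_def)
  have S1: "set_integrable lborel ?S2 (\<lambda>z. B z * H z)" using lim1(3) unfolding tos' set_integrable_def .
  have S2: "set_integrable lborel ?U2 (\<lambda>z. zeta (1, snd z) * F (1, snd z))" using lim2(3) unfolding tos' set_integrable_def .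
  have S3: "set_integrable lborel ?S2 (\<lambda>z. zeta z * Fx z)" using lim3(3) unfolding tos' set_integrable_def .
  let ?G1 = "\<lambda>\<tau>. LINT x:{\<epsilon>..1}|lborel. B (x, \<tau>) * H (x, \<tau>)"
  let ?G2 = "\<lambda>\<tau>. LINT y:{0..1}|lborel. zeta (1, snd (y::real, \<tau>)) * F (1, snd (y, \<tau>))"
  let ?G3 = "\<lambda>\<tau>. LINT x:{\<epsilon>..1}|lborel. zeta (x, \<tau>) * Fx (x, \<tau>)"
  have I: "(LINT z|lborel. B1 z * HS z) = (LINT \<tau>:{t1..t2}|lborel. ?G1 \<tau>)"
    "(LINT z|lborel. B2 z * A2 z) = (LINT \<tau>:{t1..t2}|lborel. ?G2 \<tau>)"
    "(LINT z|lborel. B3 z * FxS z) = (LINT \<tau>:{t1..t2}|lborel. ?G3 \<tau>)"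
    unfolding rect_integral_snd[OF S1] rect_integral_snd[OF S2] rect_integral_snd[OF S3] tos'
    by (simp_all only: set_lebesgue_integral_def)
  have iG: "set_integrable lborel {t1..t2} ?G1" "set_integrable lborel {t1..t2} ?G2" "set_integrable lborel {t1..t2} ?G3"
    by (rule rect_integrable_snd[OF S1] rect_integrable_snd[OF S2] rect_integrable_snd[OF S3])+
  have iG': "set_integrable lborel {t1..t2} (\<lambda>\<tau>. ?G1 \<tau> + ?G2 \<tau> - ?G3 \<tau>)"
    by (intro set_integral_diff(1) set_integral_add(1) iG)
  have mR: "R \<in> borel_measurable borel"
    unfolding R_def[abs_def]
    using measurable_integral_snd[of "\<lambda>z. B z * H z" \<epsilon> 1] measurable_integral_snd[of "\<lambda>z. B z * F z" \<epsilon> 1] by simp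
  have "?G1 \<in> borel_measurable borel" by (rule measurable_integral_snd[of "\<lambda>z. B z * H z"]) measurable
  moreover have "?G2 \<in> borel_measurable borel"
    by (rule measurable_integral_snd[of "\<lambda>z. zeta (1, snd z) * F (1, snd z)"]) measurable
  moreover have "?G3 \<in> borel_measurable borel" by (rule measurable_integral_snd[of "\<lambda>z. zeta z * Fx z"]) measurable
  ultimately have mG: "(\<lambda>\<tau>. ?G1 \<tau> + ?G2 \<tau> - ?G3 \<tau>) \<in> borel_measurable borel"
    by (intro borel_measurable_add borel_measurable_diff)
  have ae: "AE \<tau> in lborel. \<tau> \<in> {t1..t2} \<longrightarrow> ?G1 \<tau> + ?G2 \<tau> - ?G3 \<tau> = R \<tau>"
    using AE_AC AE_AC_beta
  proof eventually_elim
    case (elim \<tau>)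
    show ?case
    proof
      assume "\<tau> \<in> {t1..t2}"
      then have "0 < \<tau>" using t1 by simp
      then have F: "AC \<epsilon> 1 (\<lambda>x. F (x, \<tau>)) (\<lambda>x. Fx (x, \<tau>))" and Z: "AC \<epsilon> 1 (\<lambda>x. zeta (x, \<tau>)) (\<lambda>x. B (x, \<tau>))"
        using elim by blast+
      have "?G2 \<tau> = zeta (1, \<tau>) * F (1, \<tau>)" by (simp add: set_lebesgue_integral_def)
      moreover have "(LINT x:{\<epsilon>..1}|lborel. B (x, \<tau>) * F (x, \<tau>)) + ?G3 \<tau> = zeta (1, \<tau>) * F (1, \<tau>)"
        using AC_parts[OF Z F] eps zeta_eps[of \<tau>] by simp
      ultimately show "?G1 \<tau> + ?G2 \<tau> - ?G3 \<tau> = R \<tau>" unfolding R_def by linarith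
    qed
  qed
  show "set_integrable lborel {t1..t2} R" using AE_rect_cong(2)[OF ae _ mG mR] iG' by simp
  have "(LINT \<tau>:{t1..t2}|lborel. ?G1 \<tau> + ?G2 \<tau> - ?G3 \<tau>) = (LINT \<tau>:{t1..t2}|lborel. R \<tau>)"
    using AE_rect_cong(1)[OF ae _ mG mR] by simp
  then show "e t2 - e t1 \<le> - (LINT \<tau>:{t1..t2}|lborel. R \<tau>)"
    using lim unfolding I set_integral_diff(2)[OF set_integral_add(1)[OF iG(1,2)] iG(3)]
        set_integral_add(2)[OF iG(1,2)] by simp
qed

end

section \<open>Signs in the entropy dissipation\<close>

lemma (in comparison) sum_sq:
  assumes "0 < \<sigma>"
  shows "set_integrable lborel ({\<epsilon>..1} \<times> {\<sigma>..T}) (\<lambda>z. (n z + m z - 2 * fst z)\<^sup>2)"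
proof -
  have "set_integrable lborel ({\<epsilon>..1} \<times> {\<sigma>..T}) (\<lambda>z. (2 * fst z)\<^sup>2 * 1)"
    by (rule set_integrable_bounded_mult[where C=4, OF rect_integrable_const])
       (use eps in \<open>auto simp: power_mult_distrib power_le_one\<close>)
  then have 2: "set_integrable lborel ({\<epsilon>..1} \<times> {\<sigma>..T}) (\<lambda>z. (2 * fst z)\<^sup>2)" by simp
  have 1: "set_integrable lborel ({\<epsilon>..1} \<times> {\<sigma>..T}) (\<lambda>z. (2 * fst z - m z)\<^sup>2)"
    by (rule square_diff_int[OF _ _ 2 M.n_sq[OF eps(1) assms]]) measurable
  have "set_integrable lborel ({\<epsilon>..1} \<times> {\<sigma>..T}) (\<lambda>z. (n z - (2 * fst z - m z))\<^sup>2)"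
    by (rule square_diff_int[OF _ _ N.n_sq[OF eps(1) assms] 1]) measurable
  then show ?thesis by (simp add: algebra_simps)
qed

context comparison_smooth
begin

definition q :: "real \<times> real \<Rightarrow> real" where
  "q z = \<eta> (fst z) * (\<bar>w z * \<beta>'' (w z)\<bar> * (\<bar>n z + m z - 2 * fst z\<bar> * \<bar>wx z\<bar>))"

definition r :: "real \<times> real \<Rightarrow> real" where
  "r z = \<kappa>' (fst z) * \<beta> (w z) + 2 * fst z * \<eta>' (fst z) * \<bar>w z\<bar> + q z"

lemma q_meas [measurable]: "q \<in> borel_measurable borel"
  unfolding q_def[abs_def] by measurable

lemma r_meas [measurable]: "r \<in> borel_measurable borel"
  unfolding r_def[abs_def] by measurable

lemma product_int:
  assumes "0 < \<sigma>"
  shows "set_integrable lborel ({\<epsilon>..1} \<times> {\<sigma>..T}) (\<lambda>z. \<bar>n z + m z - 2 * fst z\<bar> * \<bar>wx z\<bar>)"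
  by (rule set_integrable_mult_square) (use sum_sq[OF assms] wx_sq[OF assms] in auto)

lemma q_int:
  assumes "0 < \<sigma>"
  shows "set_integrable lborel ({\<epsilon>..1} \<times> {\<sigma>..T}) q"
proof -
  obtain K where K0: "0 \<le> K" and K: "\<And>x. x \<in> {\<epsilon>..1} \<Longrightarrow> \<bar>\<eta> x\<bar> \<le> K" by (rule eta_bound) blast
  have "set_integrable lborel ({\<epsilon>..1} \<times> {\<sigma>..T}) (\<lambda>z. (\<eta> (fst z) * \<bar>w z * \<beta>'' (w z)\<bar>) * (\<bar>n z + m z - 2 * fst z\<bar> * \<bar>wx z\<bar>))"
  proof (rule set_integrable_bounded_mult[where C="K * 1", OF product_int[OF assms]])
    fix z assume "z \<in> {\<epsilon>..1} \<times> {\<sigma>..T}"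
    then show "\<bar>\<eta> (fst z) * \<bar>w z * \<beta>'' (w z)\<bar>\<bar> \<le> K * 1"
      unfolding abs_mult[of "\<eta> (fst z)"] abs_abs using K0 by (intro mult_mono K beta_mix) auto
  qed measurable
  then show ?thesis by (simp add: q_def[abs_def] mult.assoc)
qed

lemma r_int:
  assumes "0 < \<sigma>"
  shows "set_integrable lborel ({\<epsilon>..1} \<times> {\<sigma>..T}) r"
proof -
  obtain K where K0: "0 \<le> K" and K: "\<And>x. x \<in> {\<epsilon>..1} \<Longrightarrow> \<bar>\<eta>' x\<bar> \<le> K" "\<And>x. x \<in> {\<epsilon>..1} \<Longrightarrow> \<bar>\<kappa>' x\<bar> \<le> K"
    by (rule eta_bound) blast
  have 1: "set_integrable lborel ({\<epsilon>..1} \<times> {\<sigma>..T}) (\<lambda>z. \<kappa>' (fst z) * \<beta> (w z))"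
    by (rule set_integrable_bounded_mult[where C=K, OF beta_w_int[OF assms]]) (measurable, use K(2) in auto)
  have 2: "set_integrable lborel ({\<epsilon>..1} \<times> {\<sigma>..T}) (\<lambda>z. (2 * fst z * \<eta>' (fst z)) * \<bar>w z\<bar>)"
  proof (rule set_integrable_bounded_mult[where C="2 * K", OF set_integrable_abs[OF w_int[OF assms]]])
    fix z assume "z \<in> {\<epsilon>..1} \<times> {\<sigma>..T}"
    then have "\<bar>2 * fst z\<bar> * \<bar>\<eta>' (fst z)\<bar> \<le> 2 * K" using K0 eps by (intro mult_mono K) auto
    then show "\<bar>2 * fst z * \<eta>' (fst z)\<bar> \<le> 2 * K" by (simp add: abs_mult)
  qed measurable
  show ?thesis unfolding r_def[abs_def] by (intro set_integral_add(1) 1 2 q_int assms)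
qed

text \<open>Expand the product.  The terms \<open>\<eta>' (n + m) \<beta>'(w) w\<close> and \<open>\<eta> \<beta>''(w) (x wx)\<^sup>2\<close> are nonnegative and are dropped;
here the nonnegativity of both solutions enters.  The remaining term with \<open>\<beta>''\<close> is \<open>q\<close>: it contains the
factor \<open>w \<beta>''(w)\<close>, which disappears when the smoothing is removed.\<close>

lemma pointwise_estimate:
  assumes x: "x \<in> {\<epsilon>..1}" and nn: "0 \<le> n (x, t)" "0 \<le> m (x, t)"
  shows "- (B (x, t) * H (x, t)) - B (x, t) * F (x, t) \<le>
    - (x\<^sup>2 * \<eta>' x * (\<beta>' (w (x, t)) * wx (x, t))) + 2 * x * \<eta>' x * \<bar>w (x, t)\<bar> + q (x, t)"
proof -
  define W WX S b1 b2 where "W = w (x, t)" and "WX = wx (x, t)" and "S = n (x, t) + m (x, t)"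
    and "b1 = \<beta>' W" and "b2 = \<beta>'' W"
  have F: "F (x, t) = S * W" by (simp add: F_def S_def W_def w_def power2_eq_square algebra_simps)
  have H: "H (x, t) = x\<^sup>2 * WX - 2 * x * W" by (simp add: H_def W_def WX_def)
  have B: "B (x, t) = \<eta>' x * b1 + \<eta> x * (b2 * WX)" by (simp add: B_def W_def WX_def b1_def b2_def)
  have x0: "0 < x" using x eps by auto
  have e0: "0 \<le> \<eta> x" "0 \<le> \<eta>' x" using eta_nonneg[OF x] eta'_nonneg[OF x] by auto
  have b: "0 \<le> b1 * W" "0 \<le> b2" using beta_sgn[of W] beta''_nonneg[of W] by (auto simp: b1_def b2_def)
  have bW: "b1 * W \<le> \<bar>W\<bar>"
  proof -
    have "b1 * W \<le> \<bar>b1\<bar> * \<bar>W\<bar>" by (metis abs_ge_self abs_mult)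
    also have "\<dots> \<le> 1 * \<bar>W\<bar>" unfolding b1_def by (intro mult_right_mono beta'_le) simp
    finally show ?thesis by simp
  qed
  have S0: "0 \<le> S" using nn by (simp add: S_def)
  have "- (B (x, t) * H (x, t)) - B (x, t) * F (x, t) =
     - (x\<^sup>2 * \<eta>' x * (b1 * WX)) + 2 * x * \<eta>' x * (b1 * W) - \<eta>' x * S * (b1 * W)
     - \<eta> x * b2 * (x * WX)\<^sup>2 - \<eta> x * ((W * b2) * ((S - 2 * x) * WX))"
    unfolding F H B by (simp add: power2_eq_square algebra_simps)
  also have "\<dots> \<le> - (x\<^sup>2 * \<eta>' x * (b1 * WX)) + 2 * x * \<eta>' x * \<bar>W\<bar> - 0 - 0 + q (x, t)"
  proof -
    have 1: "2 * x * \<eta>' x * (b1 * W) \<le> 2 * x * \<eta>' x * \<bar>W\<bar>" by (intro mult_left_mono bW) (use x0 e0 in simp)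
    have 2: "0 \<le> \<eta>' x * S * (b1 * W)" using e0 S0 b by simp
    have 3: "0 \<le> \<eta> x * b2 * (x * WX)\<^sup>2" using e0 b by simp
    have "- ((W * b2) * ((S - 2 * x) * WX)) \<le> \<bar>(W * b2) * ((S - 2 * x) * WX)\<bar>" by simp
    also have "\<dots> = \<bar>W * b2\<bar> * (\<bar>S - 2 * x\<bar> * \<bar>WX\<bar>)" by (simp add: abs_mult)
    finally have "\<eta> x * (- ((W * b2) * ((S - 2 * x) * WX))) \<le> \<eta> x * (\<bar>W * b2\<bar> * (\<bar>S - 2 * x\<bar> * \<bar>WX\<bar>))"
      by (rule mult_left_mono[OF _ e0(1)])
    also have "\<dots> = q (x, t)" by (simp add: q_def W_def WX_def S_def b2_def)
    finally have 4: "- (\<eta> x * ((W * b2) * ((S - 2 * x) * WX))) \<le> q (x, t)" by simp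
    from 1 2 3 4 show ?thesis by linarith
  qed
  finally show ?thesis by (simp add: W_def WX_def b1_def)
qed

text \<open>The only term of the pointwise estimate that still contains \<open>wx\<close> in an essential way is
\<open>x\<^sup>2 \<eta>' \<partial>\<^sub>x \<beta>(w)\<close>.  Integration by parts produces \<open>\<kappa>' \<beta>(w)\<close> and the boundary term
\<open>- \<eta>'(1) \<beta>(w(1)) \<le> 0\<close>.\<close>

lemma slice_estimate:
  assumes sig: "0 < \<sigma>"
  shows "AE t in lborel. t \<in> {\<sigma>..T} \<longrightarrow> - R t \<le> (LINT x:{\<epsilon>..1}|lborel. r (x, t))"
proof -
  have BH: "set_integrable lborel ({\<epsilon>..1} \<times> {\<sigma>..T}) (\<lambda>z. B z * H z)"
    by (rule set_integrable_mult_square) (use B_sq[OF sig] H_sq[OF sig] in auto)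
  show ?thesis
    using AE_AC AE_AC_beta rect_slice_snd[OF BH] rect_slice_snd[OF q_int[OF sig, of T]]
      AE_lborel_prodD2[OF n_nonneg] AE_lborel_prodD2[OF m_nonneg]
  proof eventually_elim
    case (elim t)
    show ?case
    proof
      assume t: "t \<in> {\<sigma>..T}"
      then have t0: "0 < t" using sig by simp
      have W: "AC \<epsilon> 1 (\<lambda>x. w (x, t)) (\<lambda>x. wx (x, t))" and F: "AC \<epsilon> 1 (\<lambda>x. F (x, t)) (\<lambda>x. Fx (x, t))"
        using elim(1) t0 by blast+
      have Z: "AC \<epsilon> 1 (\<lambda>x. zeta (x, t)) (\<lambda>x. B (x, t))"
        and b: "AC \<epsilon> 1 (\<lambda>x. \<beta> (w (x, t))) (\<lambda>x. \<beta>' (w (x, t)) * wx (x, t))" using elim(2) t0 by blast+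
      have i1: "set_integrable lborel {\<epsilon>..1} (\<lambda>x. B (x, t) * H (x, t))" using elim(3) t by blast
      have i2: "set_integrable lborel {\<epsilon>..1} (\<lambda>x. B (x, t) * F (x, t))"
        by (rule set_integrable_mult_continuous[OF AC_integrable[OF Z] AC_continuous_on[OF F]])
      have i5: "set_integrable lborel {\<epsilon>..1} (\<lambda>x. q (x, t))" using elim(4) t by blast
      have k: "AC \<epsilon> 1 (\<lambda>x. x\<^sup>2 * \<eta>' x) \<kappa>'"
        by (rule AC_C1[OF kappa_deriv continuous_on_subset[OF eta_cont(3) subset_UNIV]])
      have i3: "set_integrable lborel {\<epsilon>..1} (\<lambda>x. x\<^sup>2 * \<eta>' x * (\<beta>' (w (x, t)) * wx (x, t)))"
        by (rule set_integrable_continuous_mult[OF AC_integrable[OF b] AC_continuous_on[OF k]])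
      have i3': "set_integrable lborel {\<epsilon>..1} (\<lambda>x. \<kappa>' x * \<beta> (w (x, t)))"
        by (rule set_integrable_mult_continuous[OF AC_integrable[OF k] AC_continuous_on[OF b]])
      have i4: "set_integrable lborel {\<epsilon>..1} (\<lambda>x. 2 * x * \<eta>' x * \<bar>w (x, t)\<bar>)"
        by (intro borel_integrable_atLeastAtMost' continuous_intros AC_continuous_on[OF W]
            continuous_on_subset[OF eta_cont(2) subset_UNIV])
      have parts: "(LINT x:{\<epsilon>..1}|lborel. \<kappa>' x * \<beta> (w (x, t))) + (LINT x:{\<epsilon>..1}|lborel. x\<^sup>2 * \<eta>' x * (\<beta>' (w (x, t)) * wx (x, t)))
          = \<eta>' 1 * \<beta> (w (1, t))"
        using AC_parts[OF k b] eps eta_eps by simp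
      have bd: "0 \<le> \<eta>' 1 * \<beta> (w (1, t))" using eta'_nonneg[of 1] eps beta_nonneg by simp
      have im: "set_integrable lborel {\<epsilon>..1} (\<lambda>x. - (B (x, t) * H (x, t)))"
        using set_integrable_mult_right[OF i1, of "-1"] by simp
      have im3: "set_integrable lborel {\<epsilon>..1} (\<lambda>x. - (x\<^sup>2 * \<eta>' x * (\<beta>' (w (x, t)) * wx (x, t))))"
        using set_integrable_mult_right[OF i3, of "-1"] by simp
      have "- R t = (LINT x:{\<epsilon>..1}|lborel. - (B (x, t) * H (x, t)) - B (x, t) * F (x, t))"
        unfolding set_integral_diff(2)[OF im i2] R_def set_integral_uminus[OF i1] by simp
      also have "\<dots> \<le> (LINT x:{\<epsilon>..1}|lborel. - (x\<^sup>2 * \<eta>' x * (\<beta>' (w (x, t)) * wx (x, t)))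
          + 2 * x * \<eta>' x * \<bar>w (x, t)\<bar> + q (x, t))"
        unfolding set_lebesgue_integral_def
      proof (rule integral_mono_AE)
        show "integrable lborel (\<lambda>x. indicator {\<epsilon>..1} x *\<^sub>R (- (B (x, t) * H (x, t)) - B (x, t) * F (x, t)))"
          using set_integral_diff(1)[OF im i2] by (simp only: set_integrable_def)
        show "integrable lborel (\<lambda>x. indicator {\<epsilon>..1} x *\<^sub>R (- (x\<^sup>2 * \<eta>' x * (\<beta>' (w (x, t)) * wx (x, t)))
          + 2 * x * \<eta>' x * \<bar>w (x, t)\<bar> + q (x, t)))"
          using set_integral_add(1)[OF set_integral_add(1)[OF im3 i4] i5] by (simp only: set_integrable_def)
        show "AE x in lborel. indicator {\<epsilon>..1} x *\<^sub>R (- (B (x, t) * H (x, t)) - B (x, t) * F (x, t)) \<le>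
          indicator {\<epsilon>..1} x *\<^sub>R (- (x\<^sup>2 * \<eta>' x * (\<beta>' (w (x, t)) * wx (x, t)))
          + 2 * x * \<eta>' x * \<bar>w (x, t)\<bar> + q (x, t))"
          using elim(5,6)
        proof eventually_elim
          case (elim x)
          show ?case
          proof (cases "x \<in> {\<epsilon>..1}")
            case True
            then have "(x, t) \<in> Q" using eps t0 by (auto simp: Q_def)
            then show ?thesis using pointwise_estimate[OF True, of t] elim True by simp
          qed simp
        qed
      qed
      also have "\<dots> = - (LINT x:{\<epsilon>..1}|lborel. x\<^sup>2 * \<eta>' x * (\<beta>' (w (x, t)) * wx (x, t)))
          + (LINT x:{\<epsilon>..1}|lborel. 2 * x * \<eta>' x * \<bar>w (x, t)\<bar>) + (LINT x:{\<epsilon>..1}|lborel. q (x, t))"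
        unfolding set_integral_add(2)[OF set_integral_add(1)[OF im3 i4] i5] set_integral_add(2)[OF im3 i4]
          set_integral_uminus[OF i3] ..
      also have "\<dots> \<le> (LINT x:{\<epsilon>..1}|lborel. \<kappa>' x * \<beta> (w (x, t)))
          + (LINT x:{\<epsilon>..1}|lborel. 2 * x * \<eta>' x * \<bar>w (x, t)\<bar>) + (LINT x:{\<epsilon>..1}|lborel. q (x, t))"
        using parts bd by linarith
      also have "\<dots> = (LINT x:{\<epsilon>..1}|lborel. r (x, t))"
        unfolding r_def fst_conv set_integral_add(2)[OF set_integral_add(1)[OF i3' i4] i5] set_integral_add(2)[OF i3' i4] ..
      finally show "- R t \<le> (LINT x:{\<epsilon>..1}|lborel. r (x, t))" .
    qed
  qed
qed

lemma smooth_inequality: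
  assumes t: "0 < \<sigma>" "\<sigma> < t1" "t1 < t2" "t2 \<le> T"
    and L: "(\<lambda>k. avg (step k) (\<lambda>t. indicator {\<sigma>..T} t * e t) t1) \<longlonglongrightarrow> e t1"
      "(\<lambda>k. avg (step k) (\<lambda>t. indicator {\<sigma>..T} t * e t) t2) \<longlonglongrightarrow> e t2"
  shows "e t2 - e t1 \<le> (LINT z:{\<epsilon>..1} \<times> {t1..t2}|lborel. r z)"
proof -
  have t1: "0 < t1" using t by simp
  note l = limit_inequality[OF assms]
  have iR: "set_integrable lborel {t1..t2} (\<lambda>\<tau>. - R \<tau>)"
    using set_integrable_mult_right[OF l(1), of "-1"] by simp
  have "e t2 - e t1 \<le> (LINT \<tau>:{t1..t2}|lborel. - R \<tau>)"
    using l(2) by (simp add: set_integral_uminus[OF l(1)])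
  also have "\<dots> \<le> (LINT \<tau>:{t1..t2}|lborel. LINT x:{\<epsilon>..1}|lborel. r (x, \<tau>))"
    unfolding set_lebesgue_integral_def[of lborel "{t1..t2}"]
  proof (rule integral_mono_AE)
    show "integrable lborel (\<lambda>\<tau>. indicator {t1..t2} \<tau> *\<^sub>R (- R \<tau>))" using iR by (simp only: set_integrable_def)
    show "integrable lborel (\<lambda>\<tau>. indicator {t1..t2} \<tau> *\<^sub>R (LINT x:{\<epsilon>..1}|lborel. r (x, \<tau>)))"
      using rect_integrable_snd[OF r_int[OF t1]] by (simp only: set_integrable_def)
    show "AE \<tau> in lborel. indicator {t1..t2} \<tau> *\<^sub>R (- R \<tau>) \<le> indicator {t1..t2} \<tau> *\<^sub>R (LINT x:{\<epsilon>..1}|lborel. r (x, \<tau>))"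
      using slice_estimate[OF t1, of t2]
    proof eventually_elim
      case (elim \<tau>)
      then show ?case by (cases "\<tau> \<in> {t1..t2}") simp_all
    qed
  qed
  also have "\<dots> = (LINT z:{\<epsilon>..1} \<times> {t1..t2}|lborel. r z)" by (rule rect_integral_snd[OF r_int[OF t1]])
  finally show ?thesis .
qed

end

section \<open>Smooth approximations of the absolute value\<close>

text \<open>For \<open>\<beta> = sabs \<delta>\<close> the bound \<open>|s \<beta>''(s)| \<le> 1\<close> holds uniformly in \<open>\<delta>\<close>, and
\<open>s \<beta>''(s) \<rightarrow> 0\<close> for every \<open>s\<close> as \<open>\<delta> \<rightarrow> 0\<close>.\<close>

definition sabs :: "real \<Rightarrow> real \<Rightarrow> real" where "sabs \<delta> s = sqrt (s\<^sup>2 + \<delta>\<^sup>2)"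

lemma sabs_pos: "0 < \<delta> \<Longrightarrow> 0 < sabs \<delta> s"
  by (simp add: sabs_def add_nonneg_pos)

lemma sabs_sq: "(sabs \<delta> s)\<^sup>2 = s\<^sup>2 + \<delta>\<^sup>2"
  by (simp add: sabs_def)

lemma sabs_ge: "\<bar>s\<bar> \<le> sabs \<delta> s" "0 < \<delta> \<Longrightarrow> \<delta> \<le> sabs \<delta> s"
  by (simp_all add: sabs_def real_le_rsqrt)

lemma sabs_le:
  assumes "0 < \<delta>" shows "sabs \<delta> s \<le> \<bar>s\<bar> + \<delta>"
  unfolding sabs_def using assms by (intro real_le_lsqrt) (auto simp: power2_sum)

lemma sabs_DERIV:
  assumes "0 < \<delta>"
  shows "(sabs \<delta> has_real_derivative s / sabs \<delta> s) (at s)"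
    "((\<lambda>s. s / sabs \<delta> s) has_real_derivative \<delta>\<^sup>2 / (sabs \<delta> s) ^ 3) (at s)"
proof -
  have p: "0 < s\<^sup>2 + \<delta>\<^sup>2" for s using assms by (simp add: add_nonneg_pos)
  show 1: "(sabs \<delta> has_real_derivative s / sabs \<delta> s) (at s)" for s
  proof -
    have "((\<lambda>s. s\<^sup>2 + \<delta>\<^sup>2) has_real_derivative 2 * s) (at s)" by (auto intro!: derivative_eq_intros)
    from DERIV_chain2[OF DERIV_real_sqrt[OF p] this]
    show ?thesis by (simp add: sabs_def[abs_def] inverse_eq_divide)
  qed
  have n: "sabs \<delta> s \<noteq> 0" using sabs_pos[OF assms, of s] by simp
  have "((\<lambda>s. s / sabs \<delta> s) has_real_derivative (1 * sabs \<delta> s - s * (s / sabs \<delta> s)) / (sabs \<delta> s * sabs \<delta> s)) (at s)"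
    by (rule DERIV_divide[OF DERIV_ident 1 n])
  also have "(1 * sabs \<delta> s - s * (s / sabs \<delta> s)) / (sabs \<delta> s * sabs \<delta> s) = \<delta>\<^sup>2 / (sabs \<delta> s) ^ 3"
  proof -
    define S where "S = sabs \<delta> s"
    have "S \<noteq> 0" using n by (simp add: S_def)
    then have "(1 * S - s * (s / S)) / (S * S) = (S * S - s * s) / S ^ 3"
      by (simp add: divide_simps power3_eq_cube)
    also have "S * S - s * s = \<delta>\<^sup>2" using sabs_sq[of \<delta> s] by (simp add: S_def power2_eq_square)
    finally show ?thesis by (simp add: S_def)
  qed
  finally show "((\<lambda>s. s / sabs \<delta> s) has_real_derivative \<delta>\<^sup>2 / (sabs \<delta> s) ^ 3) (at s)" .
qed

lemma sabs_continuous: "continuous_on UNIV (sabs \<delta>)"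
  unfolding sabs_def[abs_def] by (intro continuous_intros)

lemma (in comparison) comparison_smooth_sabs:
  assumes d: "0 < \<delta>"
  shows "comparison_smooth n nx m mx \<epsilon> \<eta> \<eta>' \<kappa>' (sabs \<delta>) (\<lambda>s. s / sabs \<delta> s) (\<lambda>s. \<delta>\<^sup>2 / (sabs \<delta> s) ^ 3) (1 / \<delta>)"
proof
  fix s a b :: real
  note p = sabs_pos[OF d, of s]
  show "(sabs \<delta> has_real_derivative s / sabs \<delta> s) (at s)"
    "((\<lambda>s. s / sabs \<delta> s) has_real_derivative \<delta>\<^sup>2 / (sabs \<delta> s) ^ 3) (at s)" by (rule sabs_DERIV[OF d])+
  show "continuous_on UNIV (\<lambda>s. \<delta>\<^sup>2 / (sabs \<delta> s) ^ 3)"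
    by (intro continuous_intros sabs_continuous) (use sabs_pos[OF d] in \<open>auto simp: less_imp_neq[symmetric]\<close>)
  show "\<bar>s / sabs \<delta> s\<bar> \<le> 1" using sabs_ge(1)[of s \<delta>] p by simp
  show "0 \<le> \<delta>\<^sup>2 / (sabs \<delta> s) ^ 3" using p by simp
  have "\<delta>\<^sup>2 * \<delta> \<le> (sabs \<delta> s)\<^sup>2 * sabs \<delta> s"
    using sabs_ge(2)[OF d, of s] d by (intro mult_mono power_mono) auto
  then show "\<delta>\<^sup>2 / (sabs \<delta> s) ^ 3 \<le> 1 / \<delta>"
    using p d by (simp add: field_simps power2_eq_square power3_eq_cube)
  show "0 \<le> s / sabs \<delta> s * s" using p by simp
  show "0 \<le> sabs \<delta> s" using p by simp
  have "\<bar>s\<bar> * \<delta>\<^sup>2 \<le> sabs \<delta> s * (sabs \<delta> s)\<^sup>2"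
    using sabs_ge(2)[OF d, of s] sabs_ge(1)[of s \<delta>] d by (intro mult_mono power_mono) auto
  then show "\<bar>s * (\<delta>\<^sup>2 / (sabs \<delta> s) ^ 3)\<bar> \<le> 1"
    using p by (simp add: abs_mult power2_eq_square power3_eq_cube)
  show "sabs \<delta> a - sabs \<delta> b \<le> a / sabs \<delta> a * (a - b)"
  proof -
    note pa = sabs_pos[OF d, of a] and pb = sabs_pos[OF d, of b]
    \<comment> \<open>Convexity is the Cauchy-Schwarz inequality for the vectors \<open>(a, \<delta>)\<close> and \<open>(b, \<delta>)\<close>.\<close>
    have "(\<delta>\<^sup>2 + a * b)\<^sup>2 \<le> (sabs \<delta> a * sabs \<delta> b)\<^sup>2"
    proof -
      have "(sabs \<delta> a * sabs \<delta> b)\<^sup>2 - (\<delta>\<^sup>2 + a * b)\<^sup>2 = (\<delta> * (a - b))\<^sup>2"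
        unfolding power_mult_distrib sabs_sq by (simp add: power2_eq_square algebra_simps)
      then show ?thesis using zero_le_power2[of "\<delta> * (a - b)"] by linarith
    qed
    then have "\<delta>\<^sup>2 + a * b \<le> sabs \<delta> a * sabs \<delta> b"
      by (rule power2_le_imp_le) (use pa pb in simp)
    then have "sabs \<delta> a * sabs \<delta> a - a * (a - b) \<le> sabs \<delta> a * sabs \<delta> b"
      using sabs_sq[of \<delta> a] by (simp add: power2_eq_square algebra_simps)
    then show ?thesis using pa by (simp add: field_simps)
  qed
qed

lemma sabs_tendsto: "(\<lambda>k. sabs (step k) s) \<longlonglongrightarrow> \<bar>s\<bar>"
proof (rule tendsto_sandwich[OF _ _ tendsto_const])
  show "(\<lambda>k. \<bar>s\<bar> + step k) \<longlonglongrightarrow> \<bar>s\<bar>" using tendsto_add[OF tendsto_const step_tendsto, of "\<bar>s\<bar>"] by simp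
qed (use sabs_ge(1) sabs_le[OF step_pos] in auto)

lemma sabs_second_deriv_tendsto: "(\<lambda>k. \<bar>s * ((step k)\<^sup>2 / (sabs (step k) s) ^ 3)\<bar>) \<longlonglongrightarrow> 0"
proof (cases "s = 0")
  case False
  show ?thesis
  proof (rule tendsto_sandwich[OF _ _ tendsto_const])
    have "(\<lambda>k. (step k)\<^sup>2 / s\<^sup>2) \<longlonglongrightarrow> 0\<^sup>2 / s\<^sup>2" by (intro tendsto_intros step_tendsto) (use False in simp)
    then show "(\<lambda>k. (step k)\<^sup>2 / s\<^sup>2) \<longlonglongrightarrow> 0" by simp
    have "\<bar>s * ((step k)\<^sup>2 / (sabs (step k) s) ^ 3)\<bar> \<le> (step k)\<^sup>2 / s\<^sup>2" for k
    proof -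
      have p: "0 < sabs (step k) s" by (rule sabs_pos[OF step_pos])
      have "\<bar>s\<bar> ^ 3 \<le> sabs (step k) s ^ 3" by (intro power_mono sabs_ge) simp
      then have "(step k)\<^sup>2 / (sabs (step k) s) ^ 3 \<le> (step k)\<^sup>2 / \<bar>s\<bar> ^ 3"
        using False p by (intro divide_left_mono) auto
      then have "\<bar>s\<bar> * ((step k)\<^sup>2 / (sabs (step k) s) ^ 3) \<le> \<bar>s\<bar> * ((step k)\<^sup>2 / \<bar>s\<bar> ^ 3)"
        by (rule mult_left_mono) simp
      also have "\<dots> = (step k)\<^sup>2 / \<bar>s\<bar>\<^sup>2" using False by (simp add: power2_eq_square power3_eq_cube)
      finally show ?thesis using p by (simp add: abs_mult)
    qed
    then show "\<forall>\<^sub>F k in sequentially. \<bar>s * ((step k)\<^sup>2 / (sabs (step k) s) ^ 3)\<bar> \<le> (step k)\<^sup>2 / s\<^sup>2" by simp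
  qed simp
qed simp

lemma step_le_1: "step k \<le> 1"
  by (simp add: step_def)

context comparison
begin

definition E :: "real \<Rightarrow> real" where "E t = (LINT x:{\<epsilon>..1}|lborel. \<eta> x * \<bar>w (x, t)\<bar>)"

definition ek :: "nat \<Rightarrow> real \<Rightarrow> real" where "ek k t = (LINT x:{\<epsilon>..1}|lborel. \<eta> x * sabs (step k) (w (x, t)))"

definition qk :: "nat \<Rightarrow> real \<times> real \<Rightarrow> real" where
  "qk k z = \<eta> (fst z) * (\<bar>w z * ((step k)\<^sup>2 / (sabs (step k) (w z)) ^ 3)\<bar> * (\<bar>n z + m z - 2 * fst z\<bar> * \<bar>wx z\<bar>))"

definition rk :: "nat \<Rightarrow> real \<times> real \<Rightarrow> real" where
  "rk k z = \<kappa>' (fst z) * sabs (step k) (w z) + 2 * fst z * \<eta>' (fst z) * \<bar>w z\<bar> + qk k z"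

text \<open>The results for a smooth entropy, specialised to \<open>sabs (step k)\<close>.\<close>

lemma
  shows rk_inequality: "0 < \<sigma> \<Longrightarrow> \<sigma> < t1 \<Longrightarrow> t1 < t2 \<Longrightarrow> t2 \<le> T \<Longrightarrow>
      (\<lambda>i. avg (step i) (\<lambda>t. indicator {\<sigma>..T} t * ek k t) t1) \<longlonglongrightarrow> ek k t1 \<Longrightarrow>
      (\<lambda>i. avg (step i) (\<lambda>t. indicator {\<sigma>..T} t * ek k t) t2) \<longlonglongrightarrow> ek k t2 \<Longrightarrow>
      ek k t2 - ek k t1 \<le> (LINT z:{\<epsilon>..1} \<times> {t1..t2}|lborel. rk k z)"
    and ek_int: "0 < \<sigma> \<Longrightarrow> set_integrable lborel {\<sigma>..T} (ek k)"
    and rk_meas: "rk k \<in> borel_measurable borel"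
    and rk_mix: "\<bar>s * ((step k)\<^sup>2 / (sabs (step k) s) ^ 3)\<bar> \<le> 1"
    and product_int': "0 < \<sigma> \<Longrightarrow> set_integrable lborel ({\<epsilon>..1} \<times> {\<sigma>..T}) (\<lambda>z. \<bar>n z + m z - 2 * fst z\<bar> * \<bar>wx z\<bar>)"
proof -
  interpret S: comparison_smooth n nx m mx \<epsilon> \<eta> \<eta>' \<kappa>' "sabs (step k)" "\<lambda>s. s / sabs (step k) s"
      "\<lambda>s. (step k)\<^sup>2 / (sabs (step k) s) ^ 3" "1 / step k"
    by (rule comparison_smooth_sabs[OF step_pos])
  have e: "ek k = S.e" by (simp add: fun_eq_iff ek_def S.e_def)
  have r: "rk k = S.r" by (simp add: fun_eq_iff rk_def qk_def S.r_def S.q_def)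
  show "0 < \<sigma> \<Longrightarrow> \<sigma> < t1 \<Longrightarrow> t1 < t2 \<Longrightarrow> t2 \<le> T \<Longrightarrow>
      (\<lambda>i. avg (step i) (\<lambda>t. indicator {\<sigma>..T} t * ek k t) t1) \<longlonglongrightarrow> ek k t1 \<Longrightarrow>
      (\<lambda>i. avg (step i) (\<lambda>t. indicator {\<sigma>..T} t * ek k t) t2) \<longlonglongrightarrow> ek k t2 \<Longrightarrow>
      ek k t2 - ek k t1 \<le> (LINT z:{\<epsilon>..1} \<times> {t1..t2}|lborel. rk k z)"
    unfolding e r by (rule S.smooth_inequality)
  show "0 < \<sigma> \<Longrightarrow> set_integrable lborel {\<sigma>..T} (ek k)" unfolding e by (rule S.e_int)
  show "rk k \<in> borel_measurable borel" unfolding r by (rule S.r_meas)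
  show "\<bar>s * ((step k)\<^sup>2 / (sabs (step k) s) ^ 3)\<bar> \<le> 1" by (rule S.beta_mix)
  show "0 < \<sigma> \<Longrightarrow> set_integrable lborel ({\<epsilon>..1} \<times> {\<sigma>..T}) (\<lambda>z. \<bar>n z + m z - 2 * fst z\<bar> * \<bar>wx z\<bar>)"
    by (rule S.product_int)
qed

lemma eta_bounds:
  obtains K where "0 \<le> K" "\<And>x. x \<in> {\<epsilon>..1} \<Longrightarrow> \<bar>\<eta> x\<bar> \<le> K" "\<And>x. x \<in> {\<epsilon>..1} \<Longrightarrow> \<bar>\<eta>' x\<bar> \<le> K"
    "\<And>x. x \<in> {\<epsilon>..1} \<Longrightarrow> \<bar>\<kappa>' x\<bar> \<le> K"
proof -
  interpret S: comparison_smooth n nx m mx \<epsilon> \<eta> \<eta>' \<kappa>' "sabs (step 0)" "\<lambda>s. s / sabs (step 0) s"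
      "\<lambda>s. (step 0)\<^sup>2 / (sabs (step 0) s) ^ 3" "1 / step 0"
    by (rule comparison_smooth_sabs[OF step_pos])
  show ?thesis by (rule S.eta_bound[OF that])
qed

lemma ek_tendsto:
  assumes "AC \<epsilon> 1 (\<lambda>x. w (x, t)) (\<lambda>x. wx (x, t))"
  shows "(\<lambda>k. ek k t) \<longlonglongrightarrow> E t"
proof -
  obtain K where K0: "0 \<le> K" and K: "\<And>x. x \<in> {\<epsilon>..1} \<Longrightarrow> \<bar>\<eta> x\<bar> \<le> K" by (rule eta_bounds) blast
  have wm[measurable]: "(\<lambda>x. w (x, t)) \<in> borel_measurable borel" by (rule slice_measurable(1)[OF meas(1)])
  have sm[measurable]: "sabs d \<in> borel_measurable borel" for d by (rule borel_measurable_continuous_onI[OF sabs_continuous])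
  show ?thesis
    unfolding ek_def E_def set_lebesgue_integral_def
  proof (rule integral_dominated_convergence[where w="\<lambda>x. indicator {\<epsilon>..1} x *\<^sub>R (K * (\<bar>w (x, t)\<bar> + 1))"])
    have "set_integrable lborel {\<epsilon>..1} (\<lambda>x. K * (\<bar>w (x, t)\<bar> + 1))"
      by (intro borel_integrable_atLeastAtMost' continuous_intros AC_continuous_on[OF assms])
    then show "integrable lborel (\<lambda>x. indicator {\<epsilon>..1} x *\<^sub>R (K * (\<bar>w (x, t)\<bar> + 1)))" by (simp only: set_integrable_def)
    show "AE x in lborel. (\<lambda>k. indicator {\<epsilon>..1} x *\<^sub>R (\<eta> x * sabs (step k) (w (x, t)))) \<longlonglongrightarrow>
      indicator {\<epsilon>..1} x *\<^sub>R (\<eta> x * \<bar>w (x, t)\<bar>)"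
      by (intro AE_I2 tendsto_intros sabs_tendsto)
    show "AE x in lborel. norm (indicator {\<epsilon>..1} x *\<^sub>R (\<eta> x * sabs (step k) (w (x, t)))) \<le>
      indicator {\<epsilon>..1} x *\<^sub>R (K * (\<bar>w (x, t)\<bar> + 1))" for k
    proof (intro AE_I2)
      fix x
      show "norm (indicator {\<epsilon>..1} x *\<^sub>R (\<eta> x * sabs (step k) (w (x, t)))) \<le>
        indicator {\<epsilon>..1} x *\<^sub>R (K * (\<bar>w (x, t)\<bar> + 1))"
      proof (cases "x \<in> {\<epsilon>..1}")
        case True
        have "\<bar>sabs (step k) (w (x, t))\<bar> \<le> \<bar>w (x, t)\<bar> + 1"
          using sabs_le[OF step_pos, of k "w (x, t)"] sabs_pos[OF step_pos, of k "w (x, t)"] step_le_1[of k] by linarith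
        then have "\<bar>\<eta> x * sabs (step k) (w (x, t))\<bar> \<le> K * (\<bar>w (x, t)\<bar> + 1)"
          unfolding abs_mult using K0 by (intro mult_mono K[OF True]) auto
        then show ?thesis using True by simp
      qed simp
    qed
  qed measurable
qed

text \<open>Dominated convergence; the mixed term is dominated by \<open>|n + m - 2 x| |wx|\<close>, a product of two square
integrable functions.\<close>

lemma rk_tendsto:
  assumes t1: "0 < t1"
  shows "(\<lambda>k. LINT z:{\<epsilon>..1} \<times> {t1..t2}|lborel. rk k z) \<longlonglongrightarrow>
    (LINT z:{\<epsilon>..1} \<times> {t1..t2}|lborel. (\<kappa>' (fst z) + 2 * fst z * \<eta>' (fst z)) * \<bar>w z\<bar>)"
proof -
  let ?S = "{\<epsilon>..1} \<times> {t1..t2}"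
  obtain K where K0: "0 \<le> K" and K: "\<And>x. x \<in> {\<epsilon>..1} \<Longrightarrow> \<bar>\<eta> x\<bar> \<le> K" "\<And>x. x \<in> {\<epsilon>..1} \<Longrightarrow> \<bar>\<eta>' x\<bar> \<le> K"
      "\<And>x. x \<in> {\<epsilon>..1} \<Longrightarrow> \<bar>\<kappa>' x\<bar> \<le> K" by (rule eta_bounds) blast
  note [measurable] = rk_meas
  let ?P = "\<lambda>z. \<bar>n z + m z - 2 * fst z\<bar> * \<bar>wx z\<bar>"
  let ?b = "\<lambda>z. K * (\<bar>w z\<bar> + 1) + 2 * K * \<bar>w z\<bar> + K * ?P z"
  show ?thesis
    unfolding set_lebesgue_integral_def
  proof (rule integral_dominated_convergence[where w="\<lambda>z. indicator ?S z *\<^sub>R ?b z"])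
    have wi: "set_integrable lborel ?S (\<lambda>z. \<bar>w z\<bar>)"
      by (intro set_integrable_abs rect_integrable_of_square[OF meas(1) w_sq[OF t1]])
    have "set_integrable lborel ?S ?b"
      by (intro set_integral_add(1) set_integrable_mult_right wi rect_integrable_const product_int'[OF t1])
    then show "integrable lborel (\<lambda>z. indicator ?S z *\<^sub>R ?b z)" by (simp only: set_integrable_def)
    show "AE z in lborel. (\<lambda>k. indicator ?S z *\<^sub>R rk k z) \<longlonglongrightarrow>
       indicator ?S z *\<^sub>R ((\<kappa>' (fst z) + 2 * fst z * \<eta>' (fst z)) * \<bar>w z\<bar>)"
    proof (intro AE_I2)
      fix z
      have "(\<lambda>k. rk k z) \<longlonglongrightarrow> \<kappa>' (fst z) * \<bar>w z\<bar> + 2 * fst z * \<eta>' (fst z) * \<bar>w z\<bar> + \<eta> (fst z) * (0 * ?P z)"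
        unfolding rk_def qk_def by (intro tendsto_intros sabs_tendsto sabs_second_deriv_tendsto)
      then have "(\<lambda>k. rk k z) \<longlonglongrightarrow> (\<kappa>' (fst z) + 2 * fst z * \<eta>' (fst z)) * \<bar>w z\<bar>"
        by (simp add: algebra_simps)
      then show "(\<lambda>k. indicator ?S z *\<^sub>R rk k z) \<longlonglongrightarrow>
       indicator ?S z *\<^sub>R ((\<kappa>' (fst z) + 2 * fst z * \<eta>' (fst z)) * \<bar>w z\<bar>)" by (intro tendsto_intros)
    qed
    show "AE z in lborel. norm (indicator ?S z *\<^sub>R rk k z) \<le> indicator ?S z *\<^sub>R ?b z" for k
    proof (intro AE_I2)
      fix z :: "real \<times> real"
      show "norm (indicator ?S z *\<^sub>R rk k z) \<le> indicator ?S z *\<^sub>R ?b z"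
      proof (cases "z \<in> ?S")
        case True
        then have x: "fst z \<in> {\<epsilon>..1}" by (simp add: mem_Times_iff)
        have "\<bar>sabs (step k) (w z)\<bar> \<le> \<bar>w z\<bar> + 1"
          using sabs_le[OF step_pos, of k "w z"] sabs_pos[OF step_pos, of k "w z"] step_le_1[of k] by linarith
        then have 1: "\<bar>\<kappa>' (fst z) * sabs (step k) (w z)\<bar> \<le> K * (\<bar>w z\<bar> + 1)"
          unfolding abs_mult using K0 by (intro mult_mono K(3)[OF x]) auto
        have "\<bar>2 * fst z\<bar> * \<bar>\<eta>' (fst z)\<bar> \<le> 2 * K" using x eps K0 by (intro mult_mono K(2)) auto
        then have 2: "\<bar>2 * fst z * \<eta>' (fst z) * \<bar>w z\<bar>\<bar> \<le> 2 * K * \<bar>w z\<bar>"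
          unfolding abs_mult[of "2 * fst z * \<eta>' (fst z)"] abs_abs by (intro mult_right_mono) (simp_all add: abs_mult)
        have "\<bar>w z * ((step k)\<^sup>2 / (sabs (step k) (w z)) ^ 3)\<bar> * ?P z \<le> 1 * ?P z"
          by (intro mult_right_mono rk_mix) simp
        then have 3: "\<bar>qk k z\<bar> \<le> K * ?P z"
          unfolding qk_def abs_mult[of "\<eta> (fst z)"] using K0 by (intro mult_mono K(1)[OF x]) (auto simp: abs_mult)
        have "\<bar>rk k z\<bar> \<le> ?b z" unfolding rk_def using 1 2 3 by linarith
        then show ?thesis using True by simp
      qed simp
    qed
  qed measurable
qed

text \<open>All times outside one null set are Lebesgue points for all the smoothed entropies at once, so the same
set \<open>G\<close> of good times serves every pair \<open>t1 < t2\<close>; later \<open>t1\<close> tends to \<open>0\<close> while \<open>t2\<close> stays fixed.\<close>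

lemma contraction_cutoff:
  obtains G where "AE t in lborel. 0 < t \<longrightarrow> t \<in> G"
    "\<And>t1 t2. t1 \<in> G \<Longrightarrow> t2 \<in> G \<Longrightarrow> 0 < t1 \<Longrightarrow> t1 < t2 \<Longrightarrow>
      E t2 - E t1 \<le> (LINT z:{\<epsilon>..1} \<times> {t1..t2}|lborel. (\<kappa>' (fst z) + 2 * fst z * \<eta>' (fst z)) * \<bar>w z\<bar>)"
proof -
  \<comment> \<open>The smoothed entropies are integrable on compact time intervals only, whence the exhaustion.\<close>
  let ?I = "\<lambda>j::nat. {1 / (real j + 1)..real j + 1}"
  define P where "P = (\<lambda>k j t. t \<in> ?I j \<longrightarrow> (\<lambda>i. avg (step i) (\<lambda>t. indicator (?I j) t * ek k t) t) \<longlonglongrightarrow> ek k t)"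
  define G where "G = {t. AC \<epsilon> 1 (\<lambda>x. w (x, t)) (\<lambda>x. wx (x, t)) \<and> (\<forall>k j. P k j t)}"
  have "AE t in lborel. P k j t" for k j
  proof -
    have "integrable lborel (\<lambda>t. indicator (?I j) t * ek k t)"
      using ek_int[of "1 / (real j + 1)" "real j + 1" k] by (simp add: set_integrable_def)
    from avg_tendsto_AE[OF this] show ?thesis
      unfolding P_def by eventually_elim auto
  qed
  then have "AE t in lborel. \<forall>k j. P k j t" by (simp add: AE_all_countable)
  with AE_AC have "AE t in lborel. 0 < t \<longrightarrow> t \<in> G"
    unfolding G_def by eventually_elim auto
  moreover have "E t2 - E t1 \<le> (LINT z:{\<epsilon>..1} \<times> {t1..t2}|lborel. (\<kappa>' (fst z) + 2 * fst z * \<eta>' (fst z)) * \<bar>w z\<bar>)"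
    if g: "t1 \<in> G" "t2 \<in> G" "0 < t1" "t1 < t2" for t1 t2
  proof -
    obtain j :: nat where j: "1 / t1 + t2 < real j" using reals_Archimedean2 by blast
    have p: "0 < 1 / t1" "0 < t2" using g by auto
    have "1 / t1 < real j + 1" using j p by linarith
    then have j1: "1 / (real j + 1) < t1" using g by (simp add: field_simps)
    have j2: "t2 \<le> real j + 1" using j p by linarith
    have in_I: "t1 \<in> ?I j" "t2 \<in> ?I j" using j1 j2 g by auto
    have P1: "P k j t1" and P2: "P k j t2" for k using g by (auto simp: G_def)
    have ineq: "ek k t2 - ek k t1 \<le> (LINT z:{\<epsilon>..1} \<times> {t1..t2}|lborel. rk k z)" for k
    proof (rule rk_inequality[OF _ j1 g(4) j2])
      show "(\<lambda>i. avg (step i) (\<lambda>t. indicator (?I j) t * ek k t) t1) \<longlonglongrightarrow> ek k t1" using P1[of k] in_I(1) unfolding P_def by blast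
      show "(\<lambda>i. avg (step i) (\<lambda>t. indicator (?I j) t * ek k t) t2) \<longlonglongrightarrow> ek k t2" using P2[of k] in_I(2) unfolding P_def by blast
    qed simp
    have "(\<lambda>k. ek k t2 - ek k t1) \<longlonglongrightarrow> E t2 - E t1"
      by (intro tendsto_intros ek_tendsto) (use g in \<open>auto simp: G_def\<close>)
    then show ?thesis
      by (rule tendsto_le[OF trivial_limit_sequentially rk_tendsto[OF g(3)]]) (simp add: ineq)
  qed
  ultimately show ?thesis using that by blast
qed

end

section \<open>The weights\<close>

text \<open>Freezing \<open>x\<close> at the ends of \<open>[\<epsilon>, 1]\<close> makes the weight and its derivatives continuous on the whole line.\<close>

definition clip :: "real \<Rightarrow> real \<Rightarrow> real" where "clip \<epsilon> x = max \<epsilon> (min 1 x)"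

text \<open>The cubic factor makes the weight vanish at \<open>\<epsilon>\<close> together with its first two derivatives.\<close>

definition wt :: "real \<Rightarrow> real \<Rightarrow> real \<Rightarrow> real" where
  "wt p \<epsilon> x = (let c = clip \<epsilon> x in c powr p * (1 - \<epsilon> / c) ^ 3)"

text \<open>The derivative of the weight on \<open>[\<epsilon>, 1]\<close>; the derivative of \<open>x\<^sup>2\<close> times this function is \<open>wt_k\<close>.\<close>

definition wt_d :: "real \<Rightarrow> real \<Rightarrow> real \<Rightarrow> real" where
  "wt_d p \<epsilon> x = (let c = clip \<epsilon> x in c powr p * (p / c * (1 - \<epsilon> / c) ^ 3 + 3 * (1 - \<epsilon> / c)\<^sup>2 * (\<epsilon> / c\<^sup>2)))"

definition wt_k :: "real \<Rightarrow> real \<Rightarrow> real \<Rightarrow> real" where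
  "wt_k p \<epsilon> x = (let c = clip \<epsilon> x; v = \<epsilon> / c; u = 1 - v in
     c powr p * (p * (p + 1) * u ^ 3 + 6 * p * v * u\<^sup>2 + 6 * v\<^sup>2 * u))"

text \<open>The growth rate \<open>((x\<^sup>2 \<eta>')' + 2 x \<eta>') / x\<^sup>p\<close> of the weight, as a function of \<open>v = \<epsilon> / x\<close>; see \<open>wt_rate\<close>.\<close>

definition rate :: "real \<Rightarrow> real \<Rightarrow> real" where
  "rate p v = p * (p + 3) * (1 - v) ^ 3 + 6 * (p + 1) * v * (1 - v)\<^sup>2 + 6 * v\<^sup>2 * (1 - v)"

lemma clip_id: "x \<in> {\<epsilon>..1} \<Longrightarrow> clip \<epsilon> x = x"
  by (simp add: clip_def)

lemma clip_continuous: "continuous_on UNIV (clip \<epsilon>)"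
  unfolding clip_def[abs_def] by (intro continuous_intros)

lemma clip_pos: "0 < \<epsilon> \<Longrightarrow> clip \<epsilon> x \<noteq> 0"
  unfolding clip_def by linarith

lemma powr_DERIV: "0 < x \<Longrightarrow> ((\<lambda>x. x powr p) has_real_derivative x powr p * (p / x)) (at x)" for x :: real
  using has_real_derivative_powr[of x p] by (simp add: powr_diff mult.commute)

lemma wt_DERIV:
  assumes e: "0 < \<epsilon>" and x: "x \<in> {\<epsilon>..1}"
  shows "(wt p \<epsilon> has_real_derivative wt_d p \<epsilon> x) (at x within {\<epsilon>..1})"
    "((\<lambda>x. x\<^sup>2 * wt_d p \<epsilon> x) has_real_derivative wt_k p \<epsilon> x) (at x within {\<epsilon>..1})"
proof -
  have x0: "0 < x" using assms by auto
  define u where "u = 1 - \<epsilon> / x"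
  have du: "((\<lambda>x. 1 - \<epsilon> / x) has_real_derivative \<epsilon> / x\<^sup>2) (at x)"
    using x0 by (auto intro!: derivative_eq_intros simp: power2_eq_square)
  note dp = powr_DERIV[OF x0, of p]
  have "((\<lambda>x. x powr p * (1 - \<epsilon> / x) ^ 3) has_real_derivative
     x powr p * (p / x) * u ^ 3 + (3 * u\<^sup>2 * (\<epsilon> / x\<^sup>2)) * x powr p) (at x)"
    unfolding u_def by (rule DERIV_mult[OF dp]) (use DERIV_power[OF du, of 3] in \<open>simp add: mult.commute mult.left_commute\<close>)
  moreover have "x powr p * (p / x) * u ^ 3 + (3 * u\<^sup>2 * (\<epsilon> / x\<^sup>2)) * x powr p = wt_d p \<epsilon> x"
  proof -
    have "X * a * b + c * X = X * (a * b + c)" for X a b c :: real by (simp add: algebra_simps)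
    then show ?thesis by (simp only: wt_d_def Let_def clip_id[OF x] u_def)
  qed
  ultimately have 1: "((\<lambda>x. x powr p * (1 - \<epsilon> / x) ^ 3) has_real_derivative wt_d p \<epsilon> x) (at x within {\<epsilon>..1})"
    by (simp only: has_field_derivative_at_within)
  show "(wt p \<epsilon> has_real_derivative wt_d p \<epsilon> x) (at x within {\<epsilon>..1})"
    by (rule has_field_derivative_transform_within[OF 1 zero_less_one x]) (simp add: wt_def Let_def clip_id)
  have 2: "((\<lambda>x. p * x * (1 - \<epsilon> / x) ^ 3 + 3 * \<epsilon> * (1 - \<epsilon> / x)\<^sup>2) has_real_derivative
     p * u ^ 3 + p * x * (3 * u\<^sup>2 * (\<epsilon> / x\<^sup>2)) + 3 * \<epsilon> * (2 * u * (\<epsilon> / x\<^sup>2))) (at x)"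
  proof -
    have d3: "((\<lambda>x. (1 - \<epsilon> / x) ^ 3) has_real_derivative 3 * u\<^sup>2 * (\<epsilon> / x\<^sup>2)) (at x)"
      using DERIV_power[OF du, of 3] by (simp add: u_def mult.commute mult.left_commute)
    have d2: "((\<lambda>x. (1 - \<epsilon> / x)\<^sup>2) has_real_derivative 2 * u * (\<epsilon> / x\<^sup>2)) (at x)"
      using DERIV_power[OF du, of 2] by (simp add: u_def mult.commute mult.left_commute)
    have dx: "((\<lambda>x. p * x) has_real_derivative p) (at x)" by (auto intro!: derivative_eq_intros)
    from DERIV_add[OF DERIV_mult[OF dx d3] DERIV_cmult[OF d2, of "3 * \<epsilon>"]]
    show ?thesis by (simp add: u_def mult.commute)
  qed
  have "((\<lambda>x. x powr p * (p * x * (1 - \<epsilon> / x) ^ 3 + 3 * \<epsilon> * (1 - \<epsilon> / x)\<^sup>2)) has_real_derivative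
     x powr p * (p / x) * (p * x * u ^ 3 + 3 * \<epsilon> * u\<^sup>2) +
     (p * u ^ 3 + p * x * (3 * u\<^sup>2 * (\<epsilon> / x\<^sup>2)) + 3 * \<epsilon> * (2 * u * (\<epsilon> / x\<^sup>2))) * x powr p) (at x)"
    unfolding u_def by (rule DERIV_mult[OF dp 2[unfolded u_def]])
  also have "x powr p * (p / x) * (p * x * u ^ 3 + 3 * \<epsilon> * u\<^sup>2) +
     (p * u ^ 3 + p * x * (3 * u\<^sup>2 * (\<epsilon> / x\<^sup>2)) + 3 * \<epsilon> * (2 * u * (\<epsilon> / x\<^sup>2))) * x powr p = wt_k p \<epsilon> x"
  proof -
    have v: "\<epsilon> / x\<^sup>2 * x = \<epsilon> / x" "\<epsilon> * (\<epsilon> / x\<^sup>2) = (\<epsilon> / x)\<^sup>2" "p / x * x = p" "p / x * \<epsilon> = p * (\<epsilon> / x)"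
      using x0 by (simp_all add: power2_eq_square)
    have "p / x * (p * x * u ^ 3 + 3 * \<epsilon> * u\<^sup>2) + (p * u ^ 3 + p * x * (3 * u\<^sup>2 * (\<epsilon> / x\<^sup>2)) + 3 * \<epsilon> * (2 * u * (\<epsilon> / x\<^sup>2)))
      = (p / x * x) * p * u ^ 3 + 3 * (p / x * \<epsilon>) * u\<^sup>2 + p * u ^ 3 + 3 * p * (\<epsilon> / x\<^sup>2 * x) * u\<^sup>2 + 6 * (\<epsilon> * (\<epsilon> / x\<^sup>2)) * u"
      by (simp add: algebra_simps)
    also have "\<dots> = p * (p + 1) * u ^ 3 + 6 * p * (\<epsilon> / x) * u\<^sup>2 + 6 * (\<epsilon> / x)\<^sup>2 * u"
      unfolding v by (simp add: algebra_simps)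
    finally have "x powr p * (p / x * (p * x * u ^ 3 + 3 * \<epsilon> * u\<^sup>2) + (p * u ^ 3 + p * x * (3 * u\<^sup>2 * (\<epsilon> / x\<^sup>2)) + 3 * \<epsilon> * (2 * u * (\<epsilon> / x\<^sup>2))))
      = wt_k p \<epsilon> x" by (simp add: wt_k_def Let_def clip_id[OF x] u_def)
    moreover have "X * a * A + B * X = X * (a * A + B)" for X a A B :: real by (simp add: algebra_simps)
    ultimately show ?thesis by (simp only:)
  qed
  finally have 3: "((\<lambda>x. x powr p * (p * x * (1 - \<epsilon> / x) ^ 3 + 3 * \<epsilon> * (1 - \<epsilon> / x)\<^sup>2)) has_real_derivative wt_k p \<epsilon> x)
     (at x within {\<epsilon>..1})" by (rule has_field_derivative_at_within)
  show "((\<lambda>x. x\<^sup>2 * wt_d p \<epsilon> x) has_real_derivative wt_k p \<epsilon> x) (at x within {\<epsilon>..1})"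
  proof (rule has_field_derivative_transform_within[OF 3 zero_less_one x])
    fix y assume y: "y \<in> {\<epsilon>..1}"
    then have y0: "y \<noteq> 0" using e by auto
    define U where "U = 1 - \<epsilon> / y"
    have "y\<^sup>2 * (p / y * U ^ 3 + 3 * U\<^sup>2 * (\<epsilon> / y\<^sup>2)) = p * y * U ^ 3 + 3 * \<epsilon> * U\<^sup>2"
      using y0 by (simp add: field_simps power2_eq_square)
    then have "y powr p * (p * y * U ^ 3 + 3 * \<epsilon> * U\<^sup>2) = y\<^sup>2 * (y powr p * (p / y * U ^ 3 + 3 * U\<^sup>2 * (\<epsilon> / y\<^sup>2)))"
      by (simp only: mult.left_commute)
    then show "y powr p * (p * y * (1 - \<epsilon> / y) ^ 3 + 3 * \<epsilon> * (1 - \<epsilon> / y)\<^sup>2) = y\<^sup>2 * wt_d p \<epsilon> y"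
      by (simp add: wt_d_def Let_def clip_id[OF y] U_def)
  qed
qed

lemma wt_continuous:
  assumes "0 < \<epsilon>"
  shows "continuous_on UNIV (wt p \<epsilon>)" "continuous_on UNIV (wt_d p \<epsilon>)" "continuous_on UNIV (wt_k p \<epsilon>)"
  unfolding wt_def[abs_def] wt_d_def[abs_def] wt_k_def[abs_def] Let_def
  using clip_pos[OF assms] by (intro continuous_intros clip_continuous; simp)+

lemma rate_bounds:
  assumes p: "0 \<le> p" and v: "0 \<le> v" "v \<le> 1"
  shows "0 \<le> rate p v" "rate p v \<le> p * (p + 3) + 6 * (p + 1) + 6"
proof -
  have u: "0 \<le> 1 - v" "1 - v \<le> 1" using v by auto
  have 1: "p * (p + 3) * (1 - v) ^ 3 \<le> p * (p + 3) * 1" using p u by (intro mult_left_mono power_le_one) auto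
  have "v * (1 - v)\<^sup>2 \<le> 1 * 1" using v u by (intro mult_mono power_le_one) auto
  then have 2: "6 * (p + 1) * (v * (1 - v)\<^sup>2) \<le> 6 * (p + 1) * 1" using p by (intro mult_left_mono) auto
  have 3: "v\<^sup>2 * (1 - v) \<le> 1 * 1" using v u by (intro mult_mono power_le_one) auto
  show "rate p v \<le> p * (p + 3) + 6 * (p + 1) + 6" unfolding rate_def using 1 2 3 by (simp add: mult.assoc)
  show "0 \<le> rate p v" unfolding rate_def using p v u by simp
qed

lemma wt_rate:
  assumes "0 < \<epsilon>" "x \<in> {\<epsilon>..1}"
  shows "wt_k p \<epsilon> x + 2 * x * wt_d p \<epsilon> x = x powr p * rate p (\<epsilon> / x)"
proof -
  have x0: "x \<noteq> 0" using assms by auto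
  define U where "U = 1 - \<epsilon> / x"
  have "2 * x * (p / x * U ^ 3 + 3 * U\<^sup>2 * (\<epsilon> / x\<^sup>2)) = 2 * p * U ^ 3 + 6 * U\<^sup>2 * (\<epsilon> / x)"
    using x0 by (simp add: field_simps power2_eq_square)
  then have "2 * x * wt_d p \<epsilon> x = x powr p * (2 * p * U ^ 3 + 6 * U\<^sup>2 * (\<epsilon> / x))"
    by (simp add: wt_d_def Let_def clip_id[OF assms(2)] U_def mult.left_commute)
  moreover have "wt_k p \<epsilon> x = x powr p * (p * (p + 1) * U ^ 3 + 6 * p * (\<epsilon> / x) * U\<^sup>2 + 6 * (\<epsilon> / x)\<^sup>2 * U)"
    by (simp add: wt_k_def Let_def clip_id[OF assms(2)] U_def)
  ultimately have "wt_k p \<epsilon> x + 2 * x * wt_d p \<epsilon> x = x powr p *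
     ((p * (p + 1) * U ^ 3 + 6 * p * (\<epsilon> / x) * U\<^sup>2 + 6 * (\<epsilon> / x)\<^sup>2 * U) + (2 * p * U ^ 3 + 6 * U\<^sup>2 * (\<epsilon> / x)))"
    by (simp only: distrib_left)
  also have "(p * (p + 1) * U ^ 3 + 6 * p * (\<epsilon> / x) * U\<^sup>2 + 6 * (\<epsilon> / x)\<^sup>2 * U) + (2 * p * U ^ 3 + 6 * U\<^sup>2 * (\<epsilon> / x)) = rate p (\<epsilon> / x)"
    unfolding rate_def U_def[symmetric] by (simp add: algebra_simps)
  finally show ?thesis .
qed

lemma comparison_wt:
  assumes "mild n nx" "mild m mx" "AE z in lborel. z \<in> Q \<longrightarrow> 0 \<le> n z" "AE z in lborel. z \<in> Q \<longrightarrow> 0 \<le> m z"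
    and p: "0 \<le> p" and e: "0 < \<epsilon>" "\<epsilon> < 1"
  shows "comparison n nx m mx \<epsilon> (wt p \<epsilon>) (wt_d p \<epsilon>) (wt_k p \<epsilon>)"
proof -
  interpret N: mild n nx by fact
  interpret M: mild m mx by fact
  show ?thesis
  proof
    show "wt p \<epsilon> \<epsilon> = 0" "wt_d p \<epsilon> \<epsilon> = 0" using e by (simp_all add: wt_def wt_d_def Let_def clip_def)
    fix x assume x: "x \<in> {\<epsilon>..1}"
    then have "0 < x" "\<epsilon> / x \<le> 1" using e by auto
    then show "0 \<le> wt p \<epsilon> x" "0 \<le> wt_d p \<epsilon> x"
      using p e by (simp_all add: wt_def wt_d_def Let_def clip_id[OF x])
  qed (use assms wt_continuous[OF e(1)] wt_DERIV[OF e(1)] in auto)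
qed

section \<open>Removing the cutoff\<close>

lemma ennreal_set_integral_le:
  assumes "\<And>x. x \<in> S \<Longrightarrow> 0 \<le> f x"
  shows "ennreal (LINT x:S|M. f x) \<le> (\<integral>\<^sup>+x. ennreal (indicator S x * f x) \<partial>M)"
proof (cases "integrable M (\<lambda>x. indicator S x * f x)")
  case True
  then show ?thesis
    unfolding set_lebesgue_integral_def
    by (subst nn_integral_eq_integral) (use assms in \<open>auto simp: indicator_def\<close>)
next
  case False
  then show ?thesis unfolding set_lebesgue_integral_def by (simp add: not_integrable_integral_eq)
qed

lemma AE_positive_near_0:
  fixes P :: "real \<Rightarrow> bool"
  assumes "AE t in lborel. 0 < t \<longrightarrow> P t" "0 < d"
  shows "\<exists>s. 0 < s \<and> s < d \<and> P s"
proof (rule ccontr)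
  assume no: "\<nexists>s. 0 < s \<and> s < d \<and> P s"
  have "AE t in lborel. t \<notin> {0<..<d}"
    using assms(1) by eventually_elim (use no in auto)
  then have "emeasure lborel {0<..<d} = 0"
    by (subst (asm) AE_iff_measurable[of "{0<..<d}"]) auto
  then show False using assms(2) by simp
qed

text \<open>The initial condition for Borel representatives, on the exhausting intervals \<open>[\<epsilon>, 1]\<close>.\<close>

definition attains :: "(real \<times> real \<Rightarrow> real) \<Rightarrow> (real \<Rightarrow> real) \<Rightarrow> bool" where
  "attains n ni \<longleftrightarrow> (\<exists>N. (AE t in lborel. t \<notin> N) \<and> (\<forall>\<epsilon>. 0 < \<epsilon> \<longrightarrow> \<epsilon> < 1 \<longrightarrow>
     ((\<lambda>t. \<integral>\<^sup>+x. ennreal (indicator {\<epsilon>..1} x * \<bar>n (x, t) - ni x\<bar>) \<partial>lborel) \<longlongrightarrow> 0) (at 0 within {0<..} - N)))"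

text \<open>Almost every small time avoids both exceptional sets and satisfies \<open>P\<close>, so such times accumulate at \<open>0\<close>.\<close>

lemma attains_along_sequence:
  assumes "attains n ni" "attains m mi" "0 < \<epsilon>" "\<epsilon> < 1" "AE t in lborel. 0 < t \<longrightarrow> P t" "0 < d"
  obtains s where "\<And>i::nat. 0 < s i" "\<And>i. s i < d" "\<And>i. P (s i)"
    "(\<lambda>i. \<integral>\<^sup>+x. ennreal (indicator {\<epsilon>..1} x * \<bar>n (x, s i) - ni x\<bar>) \<partial>lborel) \<longlonglongrightarrow> 0"
    "(\<lambda>i. \<integral>\<^sup>+x. ennreal (indicator {\<epsilon>..1} x * \<bar>m (x, s i) - mi x\<bar>) \<partial>lborel) \<longlonglongrightarrow> 0"
proof -
  obtain N where N: "AE t in lborel. t \<notin> N"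
    "((\<lambda>t. \<integral>\<^sup>+x. ennreal (indicator {\<epsilon>..1} x * \<bar>n (x, t) - ni x\<bar>) \<partial>lborel) \<longlongrightarrow> 0) (at 0 within {0<..} - N)"
    using assms(1,3,4) unfolding attains_def by blast
  obtain M where M: "AE t in lborel. t \<notin> M"
    "((\<lambda>t. \<integral>\<^sup>+x. ennreal (indicator {\<epsilon>..1} x * \<bar>m (x, t) - mi x\<bar>) \<partial>lborel) \<longlongrightarrow> 0) (at 0 within {0<..} - M)"
    using assms(2,3,4) unfolding attains_def by blast
  have ae: "AE t in lborel. 0 < t \<longrightarrow> t \<notin> N \<and> t \<notin> M \<and> P t"
    using N(1) M(1) assms(5) by eventually_elim auto
  have "\<forall>i::nat. \<exists>s. 0 < s \<and> s < min d (step i) \<and> (s \<notin> N \<and> s \<notin> M \<and> P s)"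
    by (intro allI AE_positive_near_0[OF ae]) (simp add: assms(6) step_pos)
  from choice[OF this] obtain s where "\<forall>i. 0 < s i \<and> s i < min d (step i) \<and> (s i \<notin> N \<and> s i \<notin> M \<and> P (s i))" by blast
  then have s: "0 < s i" "s i < d" "s i < step i" "s i \<notin> N" "s i \<notin> M" "P (s i)" for i by auto
  have s0: "s \<longlonglongrightarrow> 0"
    by (rule tendsto_sandwich[OF _ _ tendsto_const step_tendsto]) (use s(1,3) in \<open>auto intro!: always_eventually less_imp_le\<close>)
  have "filterlim s (at 0 within {0<..} - N) sequentially" "filterlim s (at 0 within {0<..} - M) sequentially"
    unfolding filterlim_at using s0 s by (auto simp: less_imp_neq[symmetric])
  then show ?thesis
    using that[of s] s(1,2,6) filterlim_compose[OF N(2)] filterlim_compose[OF M(2)] by blast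
qed

text \<open>Let the earlier time in \<open>contraction_cutoff\<close> tend to \<open>0\<close> along good times.  The weight is supported in \<open>[\<epsilon>, 1]\<close> and
bounded by \<open>x\<^sup>p \<le> 1\<close>, so that convergence of the solutions to their data on \<open>[\<epsilon>, 1]\<close> controls the
initial term.  From here on integrals are taken in \<open>[0, \<infinity>]\<close>, which allows monotone arguments before finiteness is used.\<close>

lemma cutoff_estimate:
  assumes mild: "mild n nx" "mild m mx"
    and nonneg: "AE z in lborel. z \<in> Q \<longrightarrow> 0 \<le> n z" "AE z in lborel. z \<in> Q \<longrightarrow> 0 \<le> m z"
    and att: "attains n ni" "attains m mi" and data: "ni \<in> borel_measurable borel" "mi \<in> borel_measurable borel"
    and p: "0 \<le> p" and e: "0 < \<epsilon>" "\<epsilon> < 1"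
  shows "AE t in lborel. 0 < t \<longrightarrow>
    (\<integral>\<^sup>+x. ennreal (indicator {\<epsilon>..1} x * (x powr p * (1 - \<epsilon> / x) ^ 3 * \<bar>n (x, t) - m (x, t)\<bar>)) \<partial>lborel) \<le>
    (\<integral>\<^sup>+x. ennreal (indicator {0<..1} x * (x powr p * \<bar>ni x - mi x\<bar>)) \<partial>lborel) +
    (\<integral>\<^sup>+z. ennreal (indicator ({\<epsilon>..1} \<times> {0<..t}) z * (fst z powr p * rate p (\<epsilon> / fst z) * \<bar>n z - m z\<bar>)) \<partial>lborel)"
proof -
  interpret C: comparison n nx m mx \<epsilon> "wt p \<epsilon>" "wt_d p \<epsilon>" "wt_k p \<epsilon>"
    by (rule comparison_wt[OF mild nonneg p e])
  note [measurable] = data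
  obtain G where G: "AE t in lborel. 0 < t \<longrightarrow> t \<in> G" and
    con: "\<And>t1 t2. t1 \<in> G \<Longrightarrow> t2 \<in> G \<Longrightarrow> 0 < t1 \<Longrightarrow> t1 < t2 \<Longrightarrow>
      C.E t2 - C.E t1 \<le> (LINT z:{\<epsilon>..1} \<times> {t1..t2}|lborel. (wt_k p \<epsilon> (fst z) + 2 * fst z * wt_d p \<epsilon> (fst z)) * \<bar>C.w z\<bar>)"
    by (rule C.contraction_cutoff) blast
  let ?good = "\<lambda>t. t \<in> G \<and> AC \<epsilon> 1 (\<lambda>x. C.w (x, t)) (\<lambda>x. C.wx (x, t))"
  have good: "AE t in lborel. 0 < t \<longrightarrow> ?good t" using G C.AE_AC by eventually_elim auto
  let ?I0 = "\<integral>\<^sup>+x. ennreal (indicator {0<..1} x * (x powr p * \<bar>ni x - mi x\<bar>)) \<partial>lborel"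
  let ?J = "\<lambda>t. \<integral>\<^sup>+z. ennreal (indicator ({\<epsilon>..1} \<times> {0<..t}) z * (fst z powr p * rate p (\<epsilon> / fst z) * \<bar>n z - m z\<bar>)) \<partial>lborel"
  have wt_eq: "wt p \<epsilon> x = x powr p * (1 - \<epsilon> / x) ^ 3" if "x \<in> {\<epsilon>..1}" for x
    by (simp add: wt_def Let_def clip_id[OF that])
  have wt_le: "x powr p * (1 - \<epsilon> / x) ^ 3 \<le> x powr p" "0 \<le> x powr p * (1 - \<epsilon> / x) ^ 3" "x powr p \<le> 1"
    if "x \<in> {\<epsilon>..1}" for x
  proof -
    have x: "0 < x" "\<epsilon> / x \<le> 1" "0 \<le> \<epsilon> / x" "x \<le> 1" using that e by auto
    then have "(1 - \<epsilon> / x) ^ 3 \<le> 1" by (intro power_le_one) auto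
    then show "x powr p * (1 - \<epsilon> / x) ^ 3 \<le> x powr p" by (rule mult_left_le) simp
    show "0 \<le> x powr p * (1 - \<epsilon> / x) ^ 3" using x by simp
    show "x powr p \<le> 1" using powr_mono2[OF p, of x 1] x by simp
  qed
  have E_eq: "ennreal (C.E t) = (\<integral>\<^sup>+x. ennreal (indicator {\<epsilon>..1} x * (x powr p * (1 - \<epsilon> / x) ^ 3 * \<bar>n (x, t) - m (x, t)\<bar>)) \<partial>lborel)"
    if "?good t" for t
  proof -
    have i: "set_integrable lborel {\<epsilon>..1} (\<lambda>x. wt p \<epsilon> x * \<bar>C.w (x, t)\<bar>)"
      using that by (intro borel_integrable_atLeastAtMost' continuous_intros AC_continuous_on
          continuous_on_subset[OF C.eta_cont(1) subset_UNIV]) auto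
    have "ennreal (C.E t) = (\<integral>\<^sup>+x. ennreal (indicator {\<epsilon>..1} x *\<^sub>R (wt p \<epsilon> x * \<bar>C.w (x, t)\<bar>)) \<partial>lborel)"
      unfolding C.E_def set_lebesgue_integral_def
      by (rule nn_integral_eq_integral[symmetric])
         (use i C.eta_nonneg in \<open>auto simp: set_integrable_def indicator_def\<close>)
    also have "\<dots> = (\<integral>\<^sup>+x. ennreal (indicator {\<epsilon>..1} x * (x powr p * (1 - \<epsilon> / x) ^ 3 * \<bar>n (x, t) - m (x, t)\<bar>)) \<partial>lborel)"
      by (intro nn_integral_cong) (auto simp: indicator_def wt_eq C.w_def)
    finally show ?thesis .
  qed
  show ?thesis
    using good
  proof eventually_elim
    case (elim t)
    show ?case
    proof
      assume t: "0 < t"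
      then have gt: "?good t" using elim by blast
      obtain s where s: "\<And>i::nat. 0 < s i" "\<And>i. s i < t" "\<And>i. ?good (s i)"
        and ln: "(\<lambda>i. \<integral>\<^sup>+x. ennreal (indicator {\<epsilon>..1} x * \<bar>n (x, s i) - ni x\<bar>) \<partial>lborel) \<longlonglongrightarrow> 0"
        and lm: "(\<lambda>i. \<integral>\<^sup>+x. ennreal (indicator {\<epsilon>..1} x * \<bar>m (x, s i) - mi x\<bar>) \<partial>lborel) \<longlonglongrightarrow> 0"
        by (rule attains_along_sequence[OF att e good t]) blast
      let ?a = "\<lambda>i. \<integral>\<^sup>+x. ennreal (indicator {\<epsilon>..1} x * \<bar>n (x, s i) - ni x\<bar>) \<partial>lborel"
      let ?b = "\<lambda>i. \<integral>\<^sup>+x. ennreal (indicator {\<epsilon>..1} x * \<bar>m (x, s i) - mi x\<bar>) \<partial>lborel"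
      have "ennreal (C.E t) \<le> ?I0 + ?a i + ?b i + ?J t" for i
      proof -
        have nm[measurable]: "(\<lambda>x. n (x, s i)) \<in> borel_measurable borel" "(\<lambda>x. m (x, s i)) \<in> borel_measurable borel"
          by (rule slice_measurable(1)[OF C.N.n_meas] slice_measurable(1)[OF C.M.n_meas])+
        have "ennreal (C.E (s i)) \<le> (\<integral>\<^sup>+x. ennreal (indicator {0<..1} x * (x powr p * \<bar>ni x - mi x\<bar>)) +
            (ennreal (indicator {\<epsilon>..1} x * \<bar>n (x, s i) - ni x\<bar>) + ennreal (indicator {\<epsilon>..1} x * \<bar>m (x, s i) - mi x\<bar>)) \<partial>lborel)"
          unfolding E_eq[OF s(3)]
        proof (intro nn_integral_mono)
          fix x
          show "ennreal (indicator {\<epsilon>..1} x * (x powr p * (1 - \<epsilon> / x) ^ 3 * \<bar>n (x, s i) - m (x, s i)\<bar>)) \<le>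
            ennreal (indicator {0<..1} x * (x powr p * \<bar>ni x - mi x\<bar>)) +
            (ennreal (indicator {\<epsilon>..1} x * \<bar>n (x, s i) - ni x\<bar>) + ennreal (indicator {\<epsilon>..1} x * \<bar>m (x, s i) - mi x\<bar>))"
          proof (cases "x \<in> {\<epsilon>..1}")
            case True
            note wl = wt_le[OF True]
            define a b c where "a = \<bar>ni x - mi x\<bar>" and "b = \<bar>n (x, s i) - ni x\<bar>" and "c = \<bar>m (x, s i) - mi x\<bar>"
            have abc: "0 \<le> a" "0 \<le> b" "0 \<le> c" by (simp_all add: a_def b_def c_def)
            have tri: "\<bar>n (x, s i) - m (x, s i)\<bar> \<le> a + (b + c)" by (simp add: a_def b_def c_def)
            have "x powr p * (1 - \<epsilon> / x) ^ 3 * \<bar>n (x, s i) - m (x, s i)\<bar> \<le> x powr p * (a + (b + c))"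
              by (intro mult_mono wl tri) auto
            also have "\<dots> \<le> x powr p * a + 1 * (b + c)"
              unfolding distrib_left[of _ a] using abc by (intro add_left_mono mult_right_mono wl) auto
            finally have "x powr p * (1 - \<epsilon> / x) ^ 3 * \<bar>n (x, s i) - m (x, s i)\<bar> \<le> x powr p * a + (b + c)" by simp
            then have "ennreal (x powr p * (1 - \<epsilon> / x) ^ 3 * \<bar>n (x, s i) - m (x, s i)\<bar>) \<le>
               ennreal (x powr p * a) + (ennreal b + ennreal c)"
              using abc by (simp add: ennreal_leI flip: ennreal_plus)
            then show ?thesis using True e by (simp add: a_def b_def c_def)
          qed simp
        qed
        also have "\<dots> = ?I0 + (?a i + ?b i)"
          by (subst nn_integral_add; (subst nn_integral_add)?) measurable
        finally have 1: "ennreal (C.E (s i)) \<le> ?I0 + (?a i + ?b i)" .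
        let ?f = "\<lambda>z. (wt_k p \<epsilon> (fst z) + 2 * fst z * wt_d p \<epsilon> (fst z)) * \<bar>C.w z\<bar>"
        have feq: "?f z = fst z powr p * rate p (\<epsilon> / fst z) * \<bar>n z - m z\<bar>" if "z \<in> {\<epsilon>..1} \<times> T" for z T
          using that wt_rate[OF e(1), of "fst z" p] by (simp add: C.w_def mem_Times_iff)
        have fnn: "0 \<le> ?f z" if "z \<in> {\<epsilon>..1} \<times> T" for z T
        proof -
          have "0 < fst z" "\<epsilon> / fst z \<le> 1" using that e by (auto simp: mem_Times_iff)
          then have "0 \<le> rate p (\<epsilon> / fst z)" using rate_bounds(1)[OF p, of "\<epsilon> / fst z"] e by simp
          then show ?thesis unfolding feq[OF that] by simp
        qed
        have "ennreal (LINT z:{\<epsilon>..1} \<times> {s i..t}|lborel. ?f z) \<le> (\<integral>\<^sup>+z. ennreal (indicator ({\<epsilon>..1} \<times> {s i..t}) z * ?f z) \<partial>lborel)"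
          by (rule ennreal_set_integral_le) (rule fnn)
        also have "\<dots> \<le> ?J t"
        proof (intro nn_integral_mono ennreal_leI)
          fix z :: "real \<times> real"
          show "indicator ({\<epsilon>..1} \<times> {s i..t}) z * ?f z \<le>
            indicator ({\<epsilon>..1} \<times> {0<..t}) z * (fst z powr p * rate p (\<epsilon> / fst z) * \<bar>n z - m z\<bar>)"
          proof (cases "z \<in> {\<epsilon>..1} \<times> {0<..t}")
            case True
            show ?thesis using True feq[OF True] fnn[OF True] by (simp add: indicator_def)
          next
            case False
            then have "z \<notin> {\<epsilon>..1} \<times> {s i..t}" using s(1)[of i] by (auto simp: mem_Times_iff)
            then show ?thesis using False by simp
          qed
        qed
        finally have 2: "ennreal (LINT z:{\<epsilon>..1} \<times> {s i..t}|lborel. ?f z) \<le> ?J t" .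
        have Enn: "0 \<le> C.E r" for r
          unfolding C.E_def set_lebesgue_integral_def
          by (rule Bochner_Integration.integral_nonneg) (use C.eta_nonneg in \<open>auto simp: indicator_def\<close>)
        have "ennreal (C.E t) \<le> ennreal (C.E (s i) + \<bar>LINT z:{\<epsilon>..1} \<times> {s i..t}|lborel. ?f z\<bar>)"
          using con[of "s i" t] s(1,2,3)[of i] gt by (intro ennreal_leI) auto
        also have "\<dots> = ennreal (C.E (s i)) + ennreal (LINT z:{\<epsilon>..1} \<times> {s i..t}|lborel. ?f z)"
        proof -
          have "0 \<le> (LINT z:{\<epsilon>..1} \<times> {s i..t}|lborel. ?f z)"
            unfolding set_lebesgue_integral_def
          proof (rule Bochner_Integration.integral_nonneg)
            fix z
            show "0 \<le> indicator ({\<epsilon>..1} \<times> {s i..t}) z *\<^sub>R ?f z"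
              using fnn[of z "{s i..t}"] by (cases "z \<in> {\<epsilon>..1} \<times> {s i..t}") simp_all
          qed
          then show ?thesis using Enn by (simp add: ennreal_plus)
        qed
        also have "\<dots> \<le> (?I0 + (?a i + ?b i)) + ?J t" by (rule add_mono[OF 1 2])
        finally show ?thesis by (simp add: add.assoc)
      qed
      moreover have "(\<lambda>i. ?I0 + ?a i + ?b i + ?J t) \<longlonglongrightarrow> ?I0 + 0 + 0 + ?J t"
        by (intro tendsto_add tendsto_const ln lm)
      ultimately have "ennreal (C.E t) \<le> ?I0 + 0 + 0 + ?J t"
        by (intro LIMSEQ_le_const) auto
      then show "(\<integral>\<^sup>+x. ennreal (indicator {\<epsilon>..1} x * (x powr p * (1 - \<epsilon> / x) ^ 3 * \<bar>n (x, t) - m (x, t)\<bar>)) \<partial>lborel) \<le> ?I0 + ?J t"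
        unfolding E_eq[OF gt] by simp
    qed
  qed
qed

lemma rate_0: "rate p 0 = p * (p + 3)"
  by (simp add: rate_def)

lemma rate_continuous: "continuous_on UNIV (rate p)"
  unfolding rate_def[abs_def] by (intro continuous_intros)

text \<open>Let \<open>\<epsilon> \<rightarrow> 0\<close>: Fatou's lemma on the left, dominated convergence on the right, where the rate is bounded and
converges to \<open>rate p 0\<close>.\<close>

lemma integral_inequality:
  assumes mild: "mild n nx" "mild m mx"
    and nonneg: "AE z in lborel. z \<in> Q \<longrightarrow> 0 \<le> n z" "AE z in lborel. z \<in> Q \<longrightarrow> 0 \<le> m z"
    and att: "attains n ni" "attains m mi" and data: "ni \<in> borel_measurable borel" "mi \<in> borel_measurable borel"
    and p: "0 \<le> p"
    and fin: "\<And>T. 0 < T \<Longrightarrow> (\<integral>\<^sup>+z. ennreal (indicator ({0<..1} \<times> {0<..T}) z * (fst z powr p * \<bar>n z - m z\<bar>)) \<partial>lborel) < \<infinity>"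
  shows "AE t in lborel. 0 < t \<longrightarrow>
    (\<integral>\<^sup>+x. ennreal (indicator {0<..1} x * (x powr p * \<bar>n (x, t) - m (x, t)\<bar>)) \<partial>lborel) \<le>
    (\<integral>\<^sup>+x. ennreal (indicator {0<..1} x * (x powr p * \<bar>ni x - mi x\<bar>)) \<partial>lborel) +
    ennreal (p * (p + 3)) * (\<integral>\<^sup>+z. ennreal (indicator ({0<..1} \<times> {0<..t}) z * (fst z powr p * \<bar>n z - m z\<bar>)) \<partial>lborel)"
proof -
  interpret N: mild n nx by (rule mild(1))
  interpret M: mild m mx by (rule mild(2))
  define \<epsilon> where "\<epsilon> = (\<lambda>j::nat. 1 / (real j + 2))"
  have eps: "0 < \<epsilon> j" "\<epsilon> j < 1" for j by (simp_all add: \<epsilon>_def)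
  have eps0: "\<epsilon> \<longlonglongrightarrow> 0"
  proof (rule tendsto_sandwich[OF _ _ tendsto_const step_tendsto])
    show "\<forall>\<^sub>F j in sequentially. \<epsilon> j \<le> step j" by (simp add: \<epsilon>_def step_def divide_simps)
  qed (use eps(1) in \<open>simp add: less_imp_le\<close>)
  let ?I0 = "\<integral>\<^sup>+x. ennreal (indicator {0<..1} x * (x powr p * \<bar>ni x - mi x\<bar>)) \<partial>lborel"
  let ?J = "\<lambda>j t. \<integral>\<^sup>+z. ennreal (indicator ({\<epsilon> j..1} \<times> {0<..t}) z * (fst z powr p * rate p (\<epsilon> j / fst z) * \<bar>n z - m z\<bar>)) \<partial>lborel"
  let ?J' = "\<lambda>t. \<integral>\<^sup>+z. ennreal (indicator ({0<..1} \<times> {0<..t}) z * (fst z powr p * \<bar>n z - m z\<bar>)) \<partial>lborel"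
  have [measurable]: "rate p \<in> borel_measurable borel" by (rule borel_measurable_continuous_onI[OF rate_continuous])
  have mfst[measurable]: "(\<lambda>z. h (fst z)) \<in> borel_measurable (borel :: (real \<times> real) measure)"
    if "h \<in> borel_measurable borel" for h :: "real \<Rightarrow> real" by (rule measurable_of_fst_snd(1)[OF that])
  have sQ: "{a..b} \<times> {0<..t} \<in> sets borel" "{0<..b} \<times> {0<..t} \<in> sets borel" for a b t :: real
  proof -
    have "{a..b} \<times> {0<..t} \<in> sets (borel \<Otimes>\<^sub>M borel)" "{0<..b} \<times> {0<..t} \<in> sets (borel \<Otimes>\<^sub>M borel)" by simp_all
    then show "{a..b} \<times> {0<..t} \<in> sets borel" "{0<..b} \<times> {0<..t} \<in> sets borel" by (simp_all only: borel_prod)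
  qed
  have fJ: "(\<lambda>z. fst z powr p * \<bar>n z - m z\<bar>) \<in> borel_measurable borel"
    by (intro borel_measurable_times mfst) (measurable, measurable)
  have mE: "(\<lambda>z. ennreal (indicator S z * h z)) \<in> borel_measurable lborel"
    if "S \<in> sets borel" "h \<in> borel_measurable borel" for S and h :: "real \<times> real \<Rightarrow> real"
  proof -
    have "(\<lambda>z. indicator S z * h z) \<in> borel_measurable borel"
      by (intro borel_measurable_times borel_measurable_indicator that)
    then have "(\<lambda>z. ennreal (indicator S z * h z)) \<in> borel_measurable borel"
      by (rule measurable_compose) (rule measurable_ennreal)
    then show ?thesis by simp
  qed
  have limJ: "(\<lambda>j. ?J j t) \<longlonglongrightarrow> ennreal (p * (p + 3)) * ?J' t" if t: "0 < t" for t
  proof -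
    define C where "C = p * (p + 3) + 6 * (p + 1) + 6"
    have C0: "0 \<le> C" using p by (simp add: C_def)
    let ?S = "{0<..1::real} \<times> {0<..t}"
    let ?f = "\<lambda>z. fst z powr p * \<bar>n z - m z\<bar>"
    have "(\<lambda>j. \<integral>\<^sup>+z. ennreal (indicator ({\<epsilon> j..1} \<times> {0<..t}) z * (fst z powr p * rate p (\<epsilon> j / fst z) * \<bar>n z - m z\<bar>)) \<partial>lborel)
      \<longlonglongrightarrow> (\<integral>\<^sup>+z. ennreal (p * (p + 3)) * ennreal (indicator ?S z * ?f z) \<partial>lborel)"
    proof (rule nn_integral_dominated_convergence[where w="\<lambda>z. ennreal C * ennreal (indicator ?S z * ?f z)"])
      have mr: "(\<lambda>z. rate p (\<epsilon> j / fst z)) \<in> borel_measurable (borel :: (real \<times> real) measure)" for j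
        by (rule mfst[of "\<lambda>x. rate p (\<epsilon> j / x)"]) measurable
      have mp: "(\<lambda>z. fst z powr p) \<in> borel_measurable (borel :: (real \<times> real) measure)"
        by (rule mfst[of "\<lambda>x. x powr p"]) measurable
      have mw: "(\<lambda>z. \<bar>n z - m z\<bar>) \<in> borel_measurable borel" by measurable
      show "(\<lambda>z. ennreal (indicator ({\<epsilon> j..1} \<times> {0<..t}) z * (fst z powr p * rate p (\<epsilon> j / fst z) * \<bar>n z - m z\<bar>))) \<in> borel_measurable lborel" for j
        by (intro mE sQ borel_measurable_times mr mp mw)
      have ms: "(\<lambda>z. ennreal (indicator ?S z * ?f z)) \<in> borel_measurable lborel"
        by (rule mE[OF sQ(2) fJ])
      show "(\<lambda>z. ennreal (p * (p + 3)) * ennreal (indicator ?S z * ?f z)) \<in> borel_measurable lborel"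
        "(\<lambda>z. ennreal C * ennreal (indicator ?S z * ?f z)) \<in> borel_measurable lborel"
        using ms by measurable
      show "(\<integral>\<^sup>+z. ennreal C * ennreal (indicator ?S z * ?f z) \<partial>lborel) < \<infinity>"
        using fin[OF t] by (subst nn_integral_cmult[OF ms]) (simp add: ennreal_mult_less_top)
      show "AE z in lborel. ennreal (indicator ({\<epsilon> j..1} \<times> {0<..t}) z * (fst z powr p * rate p (\<epsilon> j / fst z) * \<bar>n z - m z\<bar>)) \<le>
          ennreal C * ennreal (indicator ?S z * ?f z)" for j
      proof (intro AE_I2)
        fix z :: "real \<times> real"
        show "ennreal (indicator ({\<epsilon> j..1} \<times> {0<..t}) z * (fst z powr p * rate p (\<epsilon> j / fst z) * \<bar>n z - m z\<bar>)) \<le>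
          ennreal C * ennreal (indicator ?S z * ?f z)"
        proof (cases "z \<in> {\<epsilon> j..1} \<times> {0<..t}")
          case True
          then have z: "\<epsilon> j \<le> fst z" "0 < fst z" using eps(1)[of j] by (auto simp: mem_Times_iff)
          have zS: "z \<in> ?S" using True z by (auto simp: mem_Times_iff)
          have "0 \<le> \<epsilon> j / fst z" "\<epsilon> j / fst z \<le> 1" using z eps(1)[of j] by auto
          then have "rate p (\<epsilon> j / fst z) \<le> C" unfolding C_def by (rule rate_bounds(2)[OF p])
          then have "rate p (\<epsilon> j / fst z) * ?f z \<le> C * ?f z" by (rule mult_right_mono) simp
          then have "fst z powr p * rate p (\<epsilon> j / fst z) * \<bar>n z - m z\<bar> \<le> C * ?f z" by (simp add: algebra_simps)
          then show ?thesis using True zS C0 by (simp add: ennreal_leI flip: ennreal_mult)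
        qed simp
      qed
      show "AE z in lborel. (\<lambda>j. ennreal (indicator ({\<epsilon> j..1} \<times> {0<..t}) z * (fst z powr p * rate p (\<epsilon> j / fst z) * \<bar>n z - m z\<bar>)))
          \<longlonglongrightarrow> ennreal (p * (p + 3)) * ennreal (indicator ?S z * ?f z)"
      proof (intro AE_I2)
        fix z :: "real \<times> real"
        show "(\<lambda>j. ennreal (indicator ({\<epsilon> j..1} \<times> {0<..t}) z * (fst z powr p * rate p (\<epsilon> j / fst z) * \<bar>n z - m z\<bar>)))
          \<longlonglongrightarrow> ennreal (p * (p + 3)) * ennreal (indicator ?S z * ?f z)"
        proof (cases "z \<in> ?S")
          case True
          then have z: "0 < fst z" by (auto simp: mem_Times_iff)
          have "(\<lambda>j. rate p (\<epsilon> j / fst z)) \<longlonglongrightarrow> rate p (0 / fst z)"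
            by (intro continuous_on_tendsto_compose[OF rate_continuous] tendsto_divide eps0 tendsto_const) (use z in auto)
          then have "(\<lambda>j. ennreal (fst z powr p * rate p (\<epsilon> j / fst z) * \<bar>n z - m z\<bar>)) \<longlonglongrightarrow>
             ennreal (fst z powr p * rate p (0 / fst z) * \<bar>n z - m z\<bar>)"
            by (intro tendsto_ennrealI tendsto_intros)
          moreover have "\<forall>\<^sub>F j in sequentially. ennreal (fst z powr p * rate p (\<epsilon> j / fst z) * \<bar>n z - m z\<bar>) =
             ennreal (indicator ({\<epsilon> j..1} \<times> {0<..t}) z * (fst z powr p * rate p (\<epsilon> j / fst z) * \<bar>n z - m z\<bar>))"
            using order_tendstoD(2)[OF eps0 z]
          proof eventually_elim
            case (elim j)
            then have "z \<in> {\<epsilon> j..1} \<times> {0<..t}" using True by (auto simp: mem_Times_iff)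
            then show ?case by simp
          qed
          ultimately have "(\<lambda>j. ennreal (indicator ({\<epsilon> j..1} \<times> {0<..t}) z * (fst z powr p * rate p (\<epsilon> j / fst z) * \<bar>n z - m z\<bar>)))
             \<longlonglongrightarrow> ennreal (fst z powr p * rate p (0 / fst z) * \<bar>n z - m z\<bar>)"
            by (rule Lim_transform_eventually)
          moreover have "ennreal (fst z powr p * rate p (0 / fst z) * \<bar>n z - m z\<bar>) = ennreal (p * (p + 3)) * ennreal (indicator ?S z * ?f z)"
            using True p by (simp add: rate_0 algebra_simps flip: ennreal_mult)
          ultimately show ?thesis by simp
        next
          case False
          then have "z \<notin> {\<epsilon> j..1} \<times> {0<..t}" for j using eps(1)[of j] by (auto simp: mem_Times_iff)
          then show ?thesis using False by simp
        qed
      qed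
    qed
    also have "(\<integral>\<^sup>+z. ennreal (p * (p + 3)) * ennreal (indicator ?S z * ?f z) \<partial>lborel) = ennreal (p * (p + 3)) * ?J' t"
      by (rule nn_integral_cmult[OF mE[OF sQ(2) fJ]])
    finally show ?thesis .
  qed
  have "AE t in lborel. \<forall>j. 0 < t \<longrightarrow>
    (\<integral>\<^sup>+x. ennreal (indicator {\<epsilon> j..1} x * (x powr p * (1 - \<epsilon> j / x) ^ 3 * \<bar>n (x, t) - m (x, t)\<bar>)) \<partial>lborel) \<le> ?I0 + ?J j t"
    unfolding AE_all_countable by (intro allI cutoff_estimate[OF mild nonneg att data p eps])
  then show ?thesis
  proof eventually_elim
    case (elim t)
    show ?case
    proof
      assume t: "0 < t"
      have nm[measurable]: "(\<lambda>x. n (x, t)) \<in> borel_measurable borel" "(\<lambda>x. m (x, t)) \<in> borel_measurable borel"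
        by (rule slice_measurable(1)[OF N.n_meas] slice_measurable(1)[OF M.n_meas])+
      let ?g = "\<lambda>j x. ennreal (indicator {\<epsilon> j..1} x * (x powr p * (1 - \<epsilon> j / x) ^ 3 * \<bar>n (x, t) - m (x, t)\<bar>))"
      have lim: "(\<lambda>j. ?g j x) \<longlonglongrightarrow> ennreal (indicator {0<..1} x * (x powr p * \<bar>n (x, t) - m (x, t)\<bar>))" for x
      proof (cases "x \<in> {0<..1}")
        case True
        then have x: "0 < x" by simp
        have "(\<lambda>j. ennreal (x powr p * (1 - \<epsilon> j / x) ^ 3 * \<bar>n (x, t) - m (x, t)\<bar>)) \<longlonglongrightarrow>
            ennreal (x powr p * (1 - 0 / x) ^ 3 * \<bar>n (x, t) - m (x, t)\<bar>)"
          by (intro tendsto_ennrealI tendsto_intros eps0) (use x in auto)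
        moreover have "\<forall>\<^sub>F j in sequentially. ennreal (x powr p * (1 - \<epsilon> j / x) ^ 3 * \<bar>n (x, t) - m (x, t)\<bar>) = ?g j x"
          using order_tendstoD(2)[OF eps0 x]
        proof eventually_elim
          case (elim j)
          then have "x \<in> {\<epsilon> j..1}" using True by auto
          then show ?case by simp
        qed
        ultimately have "(\<lambda>j. ?g j x) \<longlonglongrightarrow> ennreal (x powr p * (1 - 0 / x) ^ 3 * \<bar>n (x, t) - m (x, t)\<bar>)"
          by (rule Lim_transform_eventually)
        then show ?thesis using True by simp
      next
        case False
        then have "x \<notin> {\<epsilon> j..1}" for j using eps(1)[of j] by auto
        then show ?thesis using False by simp
      qed
      have "(\<integral>\<^sup>+x. ennreal (indicator {0<..1} x * (x powr p * \<bar>n (x, t) - m (x, t)\<bar>)) \<partial>lborel) =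
        (\<integral>\<^sup>+x. liminf (\<lambda>j. ?g j x) \<partial>lborel)"
        by (intro nn_integral_cong) (simp add: lim_imp_Liminf[OF trivial_limit_sequentially lim])
      also have "\<dots> \<le> liminf (\<lambda>j. \<integral>\<^sup>+x. ?g j x \<partial>lborel)"
        by (rule nn_integral_liminf) measurable
      also have "\<dots> \<le> liminf (\<lambda>j. ?I0 + ?J j t)"
        by (rule Liminf_mono) (use elim t in simp)
      also have "\<dots> = ?I0 + ennreal (p * (p + 3)) * ?J' t"
        by (rule lim_imp_Liminf[OF trivial_limit_sequentially]) (intro tendsto_add tendsto_const limJ t)
      finally show "(\<integral>\<^sup>+x. ennreal (indicator {0<..1} x * (x powr p * \<bar>n (x, t) - m (x, t)\<bar>)) \<partial>lborel)
        \<le> ?I0 + ennreal (p * (p + 3)) * ?J' t" .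
    qed
  qed
qed

section \<open>Gronwall's inequality\<close>

text \<open>The hypothesis holds only almost everywhere and \<open>y\<close> is only integrable.  But \<open>g = a + c \<integral> y\<close> is continuous and
dominates \<open>y\<close>, so \<open>\<integral> y\<close> is dominated by the continuously differentiable function \<open>X = \<integral> g\<close>, for which
\<open>exp (- c t) (a + c X)\<close> is nonincreasing.\<close>

lemma Gronwall_AE:
  fixes y :: "real \<Rightarrow> real"
  assumes y: "set_integrable lborel {0..T} y" and ac: "0 \<le> a" "0 \<le> c"
    and le: "AE t in lborel. t \<in> {0..T} \<longrightarrow> y t \<le> a + c * (LINT s:{0..t}|lborel. y s)"
  shows "AE t in lborel. t \<in> {0..T} \<longrightarrow> y t \<le> a * exp (c * t)"
proof -
  define Z where "Z = (\<lambda>t. LINT s:{0..t}|lborel. y s)"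
  define g where "g = (\<lambda>t. a + c * Z t)"
  have Zc: "continuous_on {0..T} Z" unfolding Z_def by (rule continuous_on_indefinite_integral[OF y])
  have gc: "continuous_on {0..T} g" unfolding g_def by (intro continuous_intros Zc)
  have gi: "set_integrable lborel {0..T} g" by (rule borel_integrable_atLeastAtMost'[OF gc])
  define X where "X = (\<lambda>t. integral {0..t} g)"
  have Xeq: "X t = (LINT s:{0..t}|lborel. g s)" if "t \<in> {0..T}" for t
    unfolding X_def by (rule set_borel_integral_eq_integral(2)[symmetric, OF set_integrable_subset[OF gi]]) (use that in auto)
  have ZX: "Z t \<le> X t" if t: "t \<in> {0..T}" for t
    unfolding Xeq[OF t] Z_def set_lebesgue_integral_def
  proof (rule integral_mono_AE)
    have "set_integrable lborel {0..t} y" "set_integrable lborel {0..t} g"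
      by (rule set_integrable_subset[OF y] set_integrable_subset[OF gi]; use t in auto)+
    then show "integrable lborel (\<lambda>s. indicator {0..t} s *\<^sub>R y s)" "integrable lborel (\<lambda>s. indicator {0..t} s *\<^sub>R g s)"
      by (simp_all only: set_integrable_def)
    show "AE s in lborel. indicator {0..t} s *\<^sub>R y s \<le> indicator {0..t} s *\<^sub>R g s"
      using le
    proof eventually_elim
      case (elim s)
      then show ?case using t by (cases "s \<in> {0..t}") (simp_all add: g_def Z_def)
    qed
  qed
  define \<Psi> where "\<Psi> = (\<lambda>t. exp (- c * t) * (a + c * X t))"
  have \<Psi>: "\<Psi> t \<le> a" if t: "t \<in> {0..T}" for t
  proof -
    let ?d = "\<lambda>s. exp (- c * s) * (c * g s) + (- c * exp (- c * s)) * (a + c * X s)"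
    have Xd: "(X has_real_derivative g s) (at s within {0..T})" if "s \<in> {0..T}" for s
      unfolding X_def by (rule integral_has_real_derivative[OF gc that])
    have sub: "{0..t} \<subseteq> {0..T}" using t by auto
    have Xc: "continuous_on {0..t} X" using Xd sub by (intro continuous_on_subset[OF DERIV_continuous_on sub]) auto
    have "AC 0 t \<Psi> ?d"
    proof (rule AC_C1)
      fix s assume s: "s \<in> {0..t}"
      then have sT: "s \<in> {0..T}" using sub by blast
      have "((\<lambda>t. exp (- c * t)) has_real_derivative - c * exp (- c * s)) (at s within {0..t})"
        by (auto intro!: derivative_eq_intros)
      moreover have "((\<lambda>t. a + c * X t) has_real_derivative 0 + c * g s) (at s within {0..t})"
        by (intro DERIV_add DERIV_const DERIV_cmult DERIV_subset[OF Xd[OF sT] sub])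
      ultimately have "(\<Psi> has_real_derivative (- c * exp (- c * s)) * (a + c * X s) + (0 + c * g s) * exp (- c * s)) (at s within {0..t})"
        unfolding \<Psi>_def by (rule DERIV_mult)
      then show "(\<Psi> has_real_derivative ?d s) (at s within {0..t})" by (simp add: algebra_simps)
    next
      show "continuous_on {0..t} ?d"
        by (intro continuous_intros Xc continuous_on_subset[OF gc sub])
    qed
    from AC_endpoints[OF this] t have "(LINT s:{0..t}|lborel. ?d s) = \<Psi> t - \<Psi> 0" by simp
    moreover have "0 \<le> (LINT s:{0..t}|lborel. - ?d s)"
      unfolding set_lebesgue_integral_def
    proof (rule Bochner_Integration.integral_nonneg)
      fix s
      show "0 \<le> indicator {0..t} s *\<^sub>R (- ?d s)"
      proof (cases "s \<in> {0..t}")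
        case True
        then have "Z s \<le> X s" using ZX[of s] t by simp
        then have "c * Z s \<le> c * X s" using ac by (intro mult_left_mono)
        then have "c * (g s - (a + c * X s)) \<le> 0"
          using ac by (intro mult_nonneg_nonpos) (simp_all add: g_def)
        then have "exp (- c * s) * (c * (g s - (a + c * X s))) \<le> 0" by (rule mult_nonneg_nonpos[OF exp_ge_zero])
        then show ?thesis using True by (simp add: algebra_simps)
      qed simp
    qed
    moreover have "(LINT s:{0..t}|lborel. - ?d s) = - (LINT s:{0..t}|lborel. ?d s)"
      unfolding set_lebesgue_integral_def by (simp only: scaleR_minus_right Bochner_Integration.integral_minus)
    ultimately have "\<Psi> t \<le> \<Psi> 0" by linarith
    also have "\<Psi> 0 = a" by (simp add: \<Psi>_def X_def)
    finally show ?thesis .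
  qed
  show ?thesis
    using le
  proof eventually_elim
    case (elim t)
    show ?case
    proof
      assume t: "t \<in> {0..T}"
      then have "y t \<le> a + c * Z t" using elim by (simp add: Z_def)
      also have "\<dots> \<le> a + c * X t" using ac ZX[OF t] by (simp add: mult_left_mono)
      also have "\<dots> = \<Psi> t * exp (c * t)" by (simp add: \<Psi>_def exp_minus)
      also have "\<dots> \<le> a * exp (c * t)" using \<Psi>[OF t] by (intro mult_right_mono) simp_all
      finally show "y t \<le> a * exp (c * t)" .
    qed
  qed
qed

text \<open>Finiteness of the space-time integral makes the weighted distance finite for almost every time and integrable in time,
as Gronwall's inequality requires.\<close>

lemma weighted_stability:
  assumes mild: "mild n nx" "mild m mx"
    and nonneg: "AE z in lborel. z \<in> Q \<longrightarrow> 0 \<le> n z" "AE z in lborel. z \<in> Q \<longrightarrow> 0 \<le> m z"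
    and att: "attains n ni" "attains m mi" and data: "ni \<in> borel_measurable borel" "mi \<in> borel_measurable borel"
    and p: "0 \<le> p"
    and fin: "\<And>T. 0 < T \<Longrightarrow> (\<integral>\<^sup>+z. ennreal (indicator ({0<..1} \<times> {0<..T}) z * (fst z powr p * \<bar>n z - m z\<bar>)) \<partial>lborel) < \<infinity>"
    and fin0: "(\<integral>\<^sup>+x. ennreal (indicator {0<..1} x * (x powr p * \<bar>ni x - mi x\<bar>)) \<partial>lborel) < \<infinity>"
  shows "AE t in lborel. 0 < t \<longrightarrow>
    (\<integral>\<^sup>+x. ennreal (indicator {0<..1} x * (x powr p * \<bar>n (x, t) - m (x, t)\<bar>)) \<partial>lborel) \<le>
    ennreal (exp (p * (p + 3) * t)) * (\<integral>\<^sup>+x. ennreal (indicator {0<..1} x * (x powr p * \<bar>ni x - mi x\<bar>)) \<partial>lborel)"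
proof -
  interpret N: mild n nx by (rule mild(1))
  interpret M: mild m mx by (rule mild(2))
  define f where "f = (\<lambda>z. indicator {0<..1::real} (fst z) * (fst z powr p * \<bar>n z - m z\<bar>))"
  define Y where "Y = (\<lambda>t. \<integral>\<^sup>+x. ennreal (f (x, t)) \<partial>lborel)"
  define I0 where "I0 = (\<integral>\<^sup>+x. ennreal (indicator {0<..1} x * (x powr p * \<bar>ni x - mi x\<bar>)) \<partial>lborel)"
  let ?c = "p * (p + 3)"
  have c0: "0 \<le> ?c" using p by simp
  have fm: "f \<in> borel_measurable borel"
  proof -
    have "(\<lambda>z. indicator {0<..1::real} (fst z) * fst z powr p) \<in> borel_measurable (borel :: (real \<times> real) measure)"
      by (rule measurable_of_fst_snd(1)[of "\<lambda>x. indicator {0<..1::real} x * x powr p"]) measurable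
    moreover have "(\<lambda>z. \<bar>n z - m z\<bar>) \<in> borel_measurable borel" by measurable
    ultimately have "(\<lambda>z. (indicator {0<..1::real} (fst z) * fst z powr p) * \<bar>n z - m z\<bar>) \<in> borel_measurable borel"
      by (rule borel_measurable_times)
    then show ?thesis by (simp add: f_def mult.assoc)
  qed
  have f0: "0 \<le> f z" for z by (simp add: f_def)
  have fm2[measurable]: "f \<in> borel_measurable (borel \<Otimes>\<^sub>M borel)" using fm by (simp add: borel_prod)
  have Ym[measurable]: "Y \<in> borel_measurable borel" unfolding Y_def by measurable
  have Yint: "(\<integral>\<^sup>+z. ennreal (indicator ({0<..1} \<times> {0<..t}) z * (fst z powr p * \<bar>n z - m z\<bar>)) \<partial>lborel) =
      (\<integral>\<^sup>+s. indicator {0<..t} s * Y s \<partial>lborel)" for t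
  proof -
    have "(\<integral>\<^sup>+z. ennreal (indicator ({0<..1} \<times> {0<..t}) z * (fst z powr p * \<bar>n z - m z\<bar>)) \<partial>lborel) =
       (\<integral>\<^sup>+z. indicator {0<..t} (snd z) * ennreal (f z) \<partial>(lborel \<Otimes>\<^sub>M lborel))"
      unfolding lborel_prod by (intro nn_integral_cong) (auto simp: f_def indicator_def)
    also have "\<dots> = (\<integral>\<^sup>+s. \<integral>\<^sup>+x. indicator {0<..t} (snd (x, s)) * ennreal (f (x, s)) \<partial>lborel \<partial>lborel)"
      by (rule lborel_pair.nn_integral_snd[symmetric]) measurable
    also have "\<dots> = (\<integral>\<^sup>+s. indicator {0<..t} s * Y s \<partial>lborel)"
      unfolding Y_def snd_conv by (intro nn_integral_cong nn_integral_cmult) measurable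
    finally show ?thesis .
  qed
  have main: "AE t in lborel. 0 < t \<longrightarrow> Y t \<le> I0 + ennreal ?c * (\<integral>\<^sup>+s. indicator {0<..t} s * Y s \<partial>lborel)"
    using integral_inequality[OF mild nonneg att data p fin]
    unfolding Yint by (simp add: Y_def f_def I0_def)
  have I0fin: "I0 < \<infinity>" using fin0 by (simp add: I0_def)
  define y where "y = (\<lambda>t. enn2real (Y t))"
  have [measurable]: "y \<in> borel_measurable borel" unfolding y_def by measurable
  have y0: "0 \<le> y t" for t by (simp add: y_def)
  have est: "AE t in lborel. 0 < t \<and> t \<le> T \<longrightarrow> Y t \<le> ennreal (exp (?c * t)) * I0" if T: "0 < T" for T
  proof -
    have fT: "(\<integral>\<^sup>+s. indicator {0<..T} s * Y s \<partial>lborel) < \<infinity>" using fin[OF T] unfolding Yint .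
    have "AE s in lborel. indicator {0<..T} s * Y s \<noteq> \<infinity>"
      by (rule nn_integral_PInf_AE) (use fT in auto)
    then have Yf: "AE s in lborel. s \<in> {0<..T} \<longrightarrow> Y s = ennreal (y s)"
      by eventually_elim (auto simp: y_def less_top)
    have Yeq: "(\<integral>\<^sup>+s. indicator {0<..t} s * Y s \<partial>lborel) = (\<integral>\<^sup>+s. ennreal (indicator {0..t} s *\<^sub>R y s) \<partial>lborel)" if "t \<le> T" for t
    proof (rule nn_integral_cong_AE)
      show "AE s in lborel. indicator {0<..t} s * Y s = ennreal (indicator {0..t} s *\<^sub>R y s)"
        using Yf AE_lborel_singleton[of "0::real"]
      proof eventually_elim
        case (elim s)
        then show ?case using that by (auto simp: indicator_def)
      qed
    qed
    have yi: "set_integrable lborel {0..T} y"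
      unfolding set_integrable_def
    proof (rule integrableI_nonneg)
      show "(\<integral>\<^sup>+s. ennreal (indicator {0..T} s *\<^sub>R y s) \<partial>lborel) < \<infinity>" using fT unfolding Yeq[OF order_refl] .
    qed (use y0 in auto)
    have yint: "(\<integral>\<^sup>+s. indicator {0<..t} s * Y s \<partial>lborel) = ennreal (LINT s:{0..t}|lborel. y s)" if t: "t \<in> {0..T}" for t
    proof -
      have "set_integrable lborel {0..t} y" by (rule set_integrable_subset[OF yi]) (use t in auto)
      then show ?thesis
        unfolding Yeq[of t, OF atLeastAtMost_iff[THEN iffD1, OF t, THEN conjunct2]] set_lebesgue_integral_def
        by (intro nn_integral_eq_integral) (use y0 in \<open>auto simp: set_integrable_def\<close>)
    qed
    have "AE t in lborel. t \<in> {0..T} \<longrightarrow> y t \<le> enn2real I0 + ?c * (LINT s:{0..t}|lborel. y s)"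
      using main AE_lborel_singleton[of "0::real"]
    proof eventually_elim
      case (elim t)
      show ?case
      proof
        assume t: "t \<in> {0..T}"
        then have "0 < t" using elim(2) by auto
        have L0: "0 \<le> (LINT s:{0..t}|lborel. y s)"
          unfolding set_lebesgue_integral_def by (rule Bochner_Integration.integral_nonneg) (simp add: y0)
        have "Y t \<le> I0 + ennreal ?c * ennreal (LINT s:{0..t}|lborel. y s)"
          using elim(1) \<open>0 < t\<close> unfolding yint[OF t] by blast
        also have "\<dots> = ennreal (enn2real I0 + ?c * (LINT s:{0..t}|lborel. y s))"
          using I0fin L0 c0 by (simp add: ennreal_plus ennreal_mult less_top)
        finally have "enn2real (Y t) \<le> enn2real I0 + ?c * (LINT s:{0..t}|lborel. y s)"
          by (rule enn2real_leI[rotated]) (intro add_nonneg_nonneg mult_nonneg_nonneg c0 L0 enn2real_nonneg)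
        then show "y t \<le> enn2real I0 + ?c * (LINT s:{0..t}|lborel. y s)" by (simp only: y_def)
      qed
    qed
    from Gronwall_AE[OF yi enn2real_nonneg c0 this] Yf
    show ?thesis
    proof eventually_elim
      case (elim t)
      show ?case
      proof
        assume t: "0 < t \<and> t \<le> T"
        then have "Y t = ennreal (y t)" using elim(2) by simp
        also have "\<dots> \<le> ennreal (enn2real I0 * exp (?c * t))" using elim(1) t by (intro ennreal_leI) simp
        also have "\<dots> = ennreal (exp (?c * t)) * I0"
          using I0fin by (simp add: ennreal_mult less_top mult.commute)
        finally show "Y t \<le> ennreal (exp (?c * t)) * I0" .
      qed
    qed
  qed
  \<comment> \<open>Exhaust the half-line by bounded intervals.\<close>
  have "AE t in lborel. \<forall>k::nat. 0 < t \<and> t \<le> real k + 1 \<longrightarrow> Y t \<le> ennreal (exp (?c * t)) * I0"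
    unfolding AE_all_countable by (intro allI est) simp
  then have "AE t in lborel. 0 < t \<longrightarrow> Y t \<le> ennreal (exp (?c * t)) * I0"
  proof eventually_elim
    case (elim t)
    obtain k :: nat where "t < real k" using reals_Archimedean2 by blast
    then have "t \<le> real k + 1" by simp
    then show ?case using elim by blast
  qed
  then show ?thesis by (simp add: Y_def f_def I0_def)
qed

section \<open>Representatives\<close>

lemma AE_lebesgue_iff:
  fixes P :: "'a::euclidean_space \<Rightarrow> bool"
  shows "(AE x in lebesgue. P x) \<longleftrightarrow> (AE x in lborel. P x)"
  by (rule AE_completion_iff)

lemma nn_integral_lebesgue_eq:
  fixes f g :: "'a::euclidean_space \<Rightarrow> ennreal"
  assumes "g \<in> borel_measurable borel" "AE x in lborel. f x = g x"
  shows "(\<integral>\<^sup>+x. f x \<partial>lebesgue) = (\<integral>\<^sup>+x. g x \<partial>lborel)"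
proof -
  have "(\<integral>\<^sup>+x. f x \<partial>lebesgue) = (\<integral>\<^sup>+x. g x \<partial>lebesgue)"
    by (rule nn_integral_cong_AE) (simp add: AE_lebesgue_iff assms)
  then show ?thesis using assms(1) by (simp add: nn_integral_completion)
qed

lemma datum_representative:
  assumes "initial_datum p ni"
  obtains ni' where "ni' \<in> borel_measurable borel" "AE x in lborel. x \<in> {0<..1} \<longrightarrow> ni x = ni' x"
    "(\<integral>\<^sup>+x. ennreal (indicator {0<..1} x * (x powr p * \<bar>ni' x\<bar>)) \<partial>lborel) < \<infinity>"
proof -
  have i: "integrable lebesgue (\<lambda>x. indicator {0<..1} x *\<^sub>R (x powr p * ni x))"
    using assms by (simp add: initial_datum_def set_integrable_def)
  obtain g where g: "g \<in> borel_measurable lborel" "AE x in lborel. indicator {0<..1} x *\<^sub>R (x powr p * ni x) = g x"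
    using completion_ex_borel_measurable_real[OF borel_measurable_integrable[OF i]] by blast
  have [measurable]: "g \<in> borel_measurable borel" using g(1) by simp
  have gi: "integrable lborel g" by (rule iffD1[OF lint_lebesgue_eq(2)[OF _ g(2)] i]) measurable
  define ni' where "ni' = (\<lambda>x. g x / x powr p)"
  show ?thesis
  proof (rule that)
    show "ni' \<in> borel_measurable borel" unfolding ni'_def by measurable
    show "AE x in lborel. x \<in> {0<..1} \<longrightarrow> ni x = ni' x"
      using g(2) by eventually_elim (auto simp: ni'_def eq_divide_eq mult.commute)
    have "(\<integral>\<^sup>+x. ennreal (indicator {0<..1} x * (x powr p * \<bar>ni' x\<bar>)) \<partial>lborel) \<le> (\<integral>\<^sup>+x. ennreal (norm (g x)) \<partial>lborel)"
      by (intro nn_integral_mono ennreal_leI) (auto simp: ni'_def indicator_def)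
    also have "\<dots> < \<infinity>" using gi by (simp add: integrable_iff_bounded)
    finally show "(\<integral>\<^sup>+x. ennreal (indicator {0<..1} x * (x powr p * \<bar>ni' x\<bar>)) \<partial>lborel) < \<infinity>" .
  qed
qed

text \<open>The exceptional set is enlarged by the null set of times at which the slices of \<open>n\<close> and of its representative
differ on a set of positive measure.\<close>

lemma attains_initial_imp_attains:
  assumes att: "attains_initial n ni" and n': "n' \<in> borel_measurable borel" "AE z in lborel. z \<in> Q \<longrightarrow> n z = n' z"
    and ni': "ni' \<in> borel_measurable borel" "AE x in lborel. x \<in> {0<..1} \<longrightarrow> ni x = ni' x"
  shows "attains n' ni'"
proof -
  obtain N where N: "negligible N" and
    lim: "\<And>K. compact K \<Longrightarrow> K \<subseteq> {0<..1} \<Longrightarrow>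
      ((\<lambda>t. \<integral>\<^sup>+x\<in>K. ennreal \<bar>n (x, t) - ni x\<bar> \<partial>lebesgue) \<longlongrightarrow> 0) (at 0 within {0<..} - N)"
    using att unfolding attains_initial_def by blast
  define N' where "N' = N \<union> {t. \<not> (AE x in lborel. (x, t) \<in> Q \<longrightarrow> n (x, t) = n' (x, t))}"
  have "AE t in lebesgue. t \<notin> N" using N by (intro AE_not_in) (simp add: negligible_iff_null_sets)
  then have "AE t in lborel. t \<notin> N" by (simp add: AE_lebesgue_iff)
  then have "AE t in lborel. t \<notin> N'"
    using AE_lborel_prodD2[OF n'(2)] by eventually_elim (auto simp: N'_def)
  moreover have "((\<lambda>t. \<integral>\<^sup>+x. ennreal (indicator {\<epsilon>..1} x * \<bar>n' (x, t) - ni' x\<bar>) \<partial>lborel) \<longlongrightarrow> 0) (at 0 within {0<..} - N')"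
    if e: "0 < \<epsilon>" "\<epsilon> < 1" for \<epsilon>
  proof -
    have "((\<lambda>t. \<integral>\<^sup>+x\<in>{\<epsilon>..1}. ennreal \<bar>n (x, t) - ni x\<bar> \<partial>lebesgue) \<longlongrightarrow> 0) (at 0 within {0<..} - N)"
      by (rule lim) (use e in auto)
    then have "((\<lambda>t. \<integral>\<^sup>+x\<in>{\<epsilon>..1}. ennreal \<bar>n (x, t) - ni x\<bar> \<partial>lebesgue) \<longlongrightarrow> 0) (at 0 within {0<..} - N')"
      by (rule tendsto_within_subset) (auto simp: N'_def)
    moreover have "\<forall>\<^sub>F t in at 0 within {0<..} - N'. (\<integral>\<^sup>+x\<in>{\<epsilon>..1}. ennreal \<bar>n (x, t) - ni x\<bar> \<partial>lebesgue) =
        (\<integral>\<^sup>+x. ennreal (indicator {\<epsilon>..1} x * \<bar>n' (x, t) - ni' x\<bar>) \<partial>lborel)"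
      unfolding eventually_at_filter
    proof (intro always_eventually allI impI)
      fix t :: real
      assume t: "t \<in> {0<..} - N'"
      have [measurable]: "(\<lambda>x. n' (x, t)) \<in> borel_measurable borel" by (rule slice_measurable(1)[OF n'(1)])
      note [measurable] = ni'(1)
      have "AE x in lborel. (x, t) \<in> Q \<longrightarrow> n (x, t) = n' (x, t)" using t by (simp add: N'_def)
      then have "AE x in lborel. ennreal \<bar>n (x, t) - ni x\<bar> * indicator {\<epsilon>..1} x = ennreal (indicator {\<epsilon>..1} x * \<bar>n' (x, t) - ni' x\<bar>)"
        using ni'(2)
      proof eventually_elim
        case (elim x)
        then show ?case using e t by (cases "x \<in> {\<epsilon>..1}") (auto simp: Q_def)
      qed
      then show "(\<integral>\<^sup>+x\<in>{\<epsilon>..1}. ennreal \<bar>n (x, t) - ni x\<bar> \<partial>lebesgue) =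
        (\<integral>\<^sup>+x. ennreal (indicator {\<epsilon>..1} x * \<bar>n' (x, t) - ni' x\<bar>) \<partial>lborel)"
        by (intro nn_integral_lebesgue_eq) measurable
    qed
    ultimately show ?thesis by (rule Lim_transform_eventually)
  qed
  ultimately show ?thesis unfolding attains_def by blast
qed

text \<open>The half-open time interval of the definition is exchanged for a closed one by enlarging \<open>T\<close>.\<close>

lemma weak_solution_weighted_finite:
  assumes ws: "weak_solution_exp p ni n" and n': "n' \<in> borel_measurable borel" "AE z in lborel. z \<in> Q \<longrightarrow> n z = n' z"
    and T: "0 < T"
  shows "(\<integral>\<^sup>+z. ennreal (indicator ({0<..1} \<times> {0<..T}) z * (fst z powr p * \<bar>n' z\<bar>)) \<partial>lborel) < \<infinity>"
proof -
  let ?S = "{0<..1::real} \<times> {0<..<T + 1}"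
  have sm: "?S \<in> sets borel"
  proof -
    have "?S \<in> sets (borel \<Otimes>\<^sub>M borel)" by simp
    then show ?thesis by (simp only: borel_prod)
  qed
  have wm: "(\<lambda>z. fst z powr p) \<in> borel_measurable (borel :: (real \<times> real) measure)"
    by (rule measurable_of_fst_snd(1)[of "\<lambda>x. x powr p"]) measurable
  have "set_integrable lebesgue ?S (\<lambda>z. fst z powr p * n z)"
    using ws T by (simp add: weak_solution_exp_def)
  then have i: "integrable lebesgue (\<lambda>z. indicator ?S z *\<^sub>R (fst z powr p * n z))"
    by (simp only: set_integrable_def)
  have "integrable lborel (\<lambda>z. indicator ?S z * (fst z powr p * n' z))"
  proof (rule iffD1[OF lint_lebesgue_eq(2) i])
    show "(\<lambda>z. indicator ?S z * (fst z powr p * n' z)) \<in> borel_measurable borel"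
      by (intro borel_measurable_times borel_measurable_indicator sm wm n'(1))
    show "AE z in lborel. indicator ?S z *\<^sub>R (fst z powr p * n z) = indicator ?S z * (fst z powr p * n' z)"
      using n'(2)
    proof eventually_elim
      case (elim z)
      have "z \<in> Q" if "z \<in> ?S" using that by (auto simp: Q_def)
      then show ?case using elim by (cases "z \<in> ?S") simp_all
    qed
  qed
  then have fin: "(\<integral>\<^sup>+z. ennreal (norm (indicator ?S z * (fst z powr p * n' z))) \<partial>lborel) < \<infinity>"
    by (simp only: integrable_iff_bounded)
  have "(\<integral>\<^sup>+z. ennreal (indicator ({0<..1} \<times> {0<..T}) z * (fst z powr p * \<bar>n' z\<bar>)) \<partial>lborel) \<le>
    (\<integral>\<^sup>+z. ennreal (norm (indicator ?S z * (fst z powr p * n' z))) \<partial>lborel)"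
    by (intro nn_integral_mono ennreal_leI) (auto simp: indicator_def abs_mult)
  then show ?thesis using fin by (rule le_less_trans)
qed

lemma nn_integral_abs_diff_finite:
  fixes f g k :: "'a \<Rightarrow> real"
  assumes "(\<lambda>z. ennreal (k z * \<bar>f z\<bar>)) \<in> borel_measurable M" "(\<lambda>z. ennreal (k z * \<bar>g z\<bar>)) \<in> borel_measurable M"
    and "\<And>z. 0 \<le> k z"
    and "(\<integral>\<^sup>+z. ennreal (k z * \<bar>f z\<bar>) \<partial>M) < \<infinity>" "(\<integral>\<^sup>+z. ennreal (k z * \<bar>g z\<bar>) \<partial>M) < \<infinity>"
  shows "(\<integral>\<^sup>+z. ennreal (k z * \<bar>f z - g z\<bar>) \<partial>M) < \<infinity>"
proof -
  have "(\<integral>\<^sup>+z. ennreal (k z * \<bar>f z - g z\<bar>) \<partial>M) \<le> (\<integral>\<^sup>+z. ennreal (k z * \<bar>f z\<bar>) + ennreal (k z * \<bar>g z\<bar>) \<partial>M)"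
  proof (rule nn_integral_mono)
    fix z
    have "k z * \<bar>f z - g z\<bar> \<le> k z * (\<bar>f z\<bar> + \<bar>g z\<bar>)" using assms(3) by (intro mult_left_mono) simp_all
    then show "ennreal (k z * \<bar>f z - g z\<bar>) \<le> ennreal (k z * \<bar>f z\<bar>) + ennreal (k z * \<bar>g z\<bar>)"
      using assms(3)[of z] by (simp add: distrib_left ennreal_leI flip: ennreal_plus)
  qed
  also have "\<dots> < \<infinity>" using assms(4,5) by (simp add: nn_integral_add[OF assms(1,2)])
  finally show ?thesis .
qed

section \<open>Stability and uniqueness\<close>

text \<open>Apply the estimate to representatives; for almost every \<open>t\<close> the slices agree almost everywhere, so neither side
changes.\<close>

lemma weak_solution_stability:
  assumes p: "0 \<le> p" and data: "initial_datum p ni" "initial_datum p mi"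
    and sol: "weak_solution_exp p ni n" "weak_solution_exp p mi m"
  shows "AE t in lebesgue. 0 < t \<longrightarrow>
    (\<integral>\<^sup>+x\<in>{0<..1}. ennreal (x powr p * \<bar>n (x, t) - m (x, t)\<bar>) \<partial>lebesgue)
      \<le> ennreal (exp (p * (p + 3) * t)) * (\<integral>\<^sup>+x\<in>{0<..1}. ennreal (x powr p * \<bar>ni x - mi x\<bar>) \<partial>lebesgue)"
proof -
  obtain n' nx where N: "mild n' nx" and aen: "AE z in lborel. z \<in> Q \<longrightarrow> n z = n' z"
    by (rule weak_solution_imp_mild[OF sol(1)])
  obtain m' mx where M: "mild m' mx" and aem: "AE z in lborel. z \<in> Q \<longrightarrow> m z = m' z"
    by (rule weak_solution_imp_mild[OF sol(2)])
  obtain ni' where ni': "ni' \<in> borel_measurable borel" "AE x in lborel. x \<in> {0<..1} \<longrightarrow> ni x = ni' x"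
    "(\<integral>\<^sup>+x. ennreal (indicator {0<..1} x * (x powr p * \<bar>ni' x\<bar>)) \<partial>lborel) < \<infinity>"
    by (rule datum_representative[OF data(1)])
  obtain mi' where mi': "mi' \<in> borel_measurable borel" "AE x in lborel. x \<in> {0<..1} \<longrightarrow> mi x = mi' x"
    "(\<integral>\<^sup>+x. ennreal (indicator {0<..1} x * (x powr p * \<bar>mi' x\<bar>)) \<partial>lborel) < \<infinity>"
    by (rule datum_representative[OF data(2)])
  note nm = mild.n_meas[OF N] and mm = mild.n_meas[OF M]
  note [measurable] = ni'(1) mi'(1)
  have att: "attains n' ni'" "attains m' mi'"
    using sol unfolding weak_solution_exp_def
    by (blast intro: attains_initial_imp_attains[OF _ nm aen ni'(1,2)] attains_initial_imp_attains[OF _ mm aem mi'(1,2)])+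
  have "AE z in lborel. z \<in> Q \<longrightarrow> 0 \<le> n z" "AE z in lborel. z \<in> Q \<longrightarrow> 0 \<le> m z"
    using sol by (simp_all add: weak_solution_exp_def AE_lebesgue_iff)
  then have nn: "AE z in lborel. z \<in> Q \<longrightarrow> 0 \<le> n' z" "AE z in lborel. z \<in> Q \<longrightarrow> 0 \<le> m' z"
    using aen aem by (eventually_elim, simp)+
  have sQ: "{0<..1::real} \<times> {0<..T} \<in> sets borel" for T :: real
  proof -
    have "{0<..1::real} \<times> {0<..T} \<in> sets (borel \<Otimes>\<^sub>M borel)" by simp
    then show ?thesis by (simp only: borel_prod)
  qed
  have mE: "(\<lambda>z. ennreal (indicator ({0<..1} \<times> {0<..T}) z * fst z powr p * \<bar>h z\<bar>)) \<in> borel_measurable lborel"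
    if [measurable]: "h \<in> borel_measurable borel" for h and T :: real
  proof -
    have "(\<lambda>z. fst z powr p) \<in> borel_measurable (borel :: (real \<times> real) measure)"
      by (rule measurable_of_fst_snd(1)[of "\<lambda>x. x powr p"]) measurable
    moreover have "(\<lambda>z. \<bar>h z\<bar>) \<in> borel_measurable borel" by measurable
    ultimately have "(\<lambda>z. indicator ({0<..1} \<times> {0<..T}) z * fst z powr p * \<bar>h z\<bar>) \<in> borel_measurable borel"
      by (intro borel_measurable_times borel_measurable_indicator sQ)
    then have "(\<lambda>z. ennreal (indicator ({0<..1} \<times> {0<..T}) z * fst z powr p * \<bar>h z\<bar>)) \<in> borel_measurable borel"
      by (rule measurable_compose) (rule measurable_ennreal)
    then show ?thesis by simp
  qed
  have fin: "(\<integral>\<^sup>+z. ennreal (indicator ({0<..1} \<times> {0<..T}) z * (fst z powr p * \<bar>n' z - m' z\<bar>)) \<partial>lborel) < \<infinity>"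
    if T: "0 < T" for T
    using nn_integral_abs_diff_finite[OF mE[OF nm] mE[OF mm] _
        weak_solution_weighted_finite[OF sol(1) nm aen T, folded mult.assoc]
        weak_solution_weighted_finite[OF sol(2) mm aem T, folded mult.assoc]]
    by (simp add: mult.assoc)
  have fin0: "(\<integral>\<^sup>+x. ennreal (indicator {0<..1} x * (x powr p * \<bar>ni' x - mi' x\<bar>)) \<partial>lborel) < \<infinity>"
  proof -
    have "(\<integral>\<^sup>+x. ennreal (indicator {0<..1} x * x powr p * \<bar>ni' x - mi' x\<bar>) \<partial>lborel) < \<infinity>"
    proof (rule nn_integral_abs_diff_finite)
      show "(\<integral>\<^sup>+x. ennreal (indicator {0<..1} x * x powr p * \<bar>ni' x\<bar>) \<partial>lborel) < \<infinity>"
        "(\<integral>\<^sup>+x. ennreal (indicator {0<..1} x * x powr p * \<bar>mi' x\<bar>) \<partial>lborel) < \<infinity>"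
        using ni'(3) mi'(3) by (simp_all only: mult.assoc)
    qed (simp_all, measurable)
    then show ?thesis by (simp only: mult.assoc)
  qed
  have I0: "(\<integral>\<^sup>+x\<in>{0<..1}. ennreal (x powr p * \<bar>ni x - mi x\<bar>) \<partial>lebesgue) =
    (\<integral>\<^sup>+x. ennreal (indicator {0<..1} x * (x powr p * \<bar>ni' x - mi' x\<bar>)) \<partial>lborel)"
  proof (rule nn_integral_lebesgue_eq)
    show "AE x in lborel. ennreal (x powr p * \<bar>ni x - mi x\<bar>) * indicator {0<..1} x =
      ennreal (indicator {0<..1} x * (x powr p * \<bar>ni' x - mi' x\<bar>))"
      using ni'(2) mi'(2) by eventually_elim (auto simp: indicator_def)
  qed measurable
  have "AE t in lborel. AE x in lborel. (x, t) \<in> Q \<longrightarrow> n (x, t) = n' (x, t)"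
    "AE t in lborel. AE x in lborel. (x, t) \<in> Q \<longrightarrow> m (x, t) = m' (x, t)"
    by (rule AE_lborel_prodD2[OF aen] AE_lborel_prodD2[OF aem])+
  moreover have "AE t in lborel. 0 < t \<longrightarrow>
    (\<integral>\<^sup>+x. ennreal (indicator {0<..1} x * (x powr p * \<bar>n' (x, t) - m' (x, t)\<bar>)) \<partial>lborel) \<le>
    ennreal (exp (p * (p + 3) * t)) * (\<integral>\<^sup>+x. ennreal (indicator {0<..1} x * (x powr p * \<bar>ni' x - mi' x\<bar>)) \<partial>lborel)"
    by (rule weighted_stability[OF N M nn att ni'(1) mi'(1) p fin fin0])
  ultimately have "AE t in lborel. 0 < t \<longrightarrow>
    (\<integral>\<^sup>+x\<in>{0<..1}. ennreal (x powr p * \<bar>n (x, t) - m (x, t)\<bar>) \<partial>lebesgue)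
      \<le> ennreal (exp (p * (p + 3) * t)) * (\<integral>\<^sup>+x\<in>{0<..1}. ennreal (x powr p * \<bar>ni x - mi x\<bar>) \<partial>lebesgue)"
  proof eventually_elim
    case (elim t)
    show ?case
    proof
      assume t: "0 < t"
      have [measurable]: "(\<lambda>x. n' (x, t)) \<in> borel_measurable borel" "(\<lambda>x. m' (x, t)) \<in> borel_measurable borel"
        by (rule slice_measurable(1)[OF nm] slice_measurable(1)[OF mm])+
      have "(\<integral>\<^sup>+x\<in>{0<..1}. ennreal (x powr p * \<bar>n (x, t) - m (x, t)\<bar>) \<partial>lebesgue) =
        (\<integral>\<^sup>+x. ennreal (indicator {0<..1} x * (x powr p * \<bar>n' (x, t) - m' (x, t)\<bar>)) \<partial>lborel)"
      proof (rule nn_integral_lebesgue_eq)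
        show "AE x in lborel. ennreal (x powr p * \<bar>n (x, t) - m (x, t)\<bar>) * indicator {0<..1} x =
          ennreal (indicator {0<..1} x * (x powr p * \<bar>n' (x, t) - m' (x, t)\<bar>))"
          using elim(1,2)
        proof eventually_elim
          case (elim x)
          then show ?case using t by (cases "x \<in> {0<..1}") (auto simp: Q_def)
        qed
      qed measurable
      then show "(\<integral>\<^sup>+x\<in>{0<..1}. ennreal (x powr p * \<bar>n (x, t) - m (x, t)\<bar>) \<partial>lebesgue)
        \<le> ennreal (exp (p * (p + 3) * t)) * (\<integral>\<^sup>+x\<in>{0<..1}. ennreal (x powr p * \<bar>ni x - mi x\<bar>) \<partial>lebesgue)"
        using elim(3) t unfolding I0 by simp
    qed
  qed
  then show ?thesis by (simp only: AE_lebesgue_iff)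
qed

text \<open>The factor \<open>k powr (q - p)\<close> is at most \<open>1\<close>.\<close>

lemma set_integrable_larger_power:
  fixes f :: "'a::euclidean_space \<Rightarrow> real" and k :: "'a \<Rightarrow> real"
  assumes f: "set_integrable lebesgue S (\<lambda>z. k z powr p * f z)" and k: "k \<in> borel_measurable borel"
    and S: "\<And>z. z \<in> S \<Longrightarrow> 0 < k z \<and> k z \<le> 1" and pq: "p \<le> q"
  shows "set_integrable lebesgue S (\<lambda>z. k z powr q * f z)"
proof -
  have "(\<lambda>z. k z powr (q - p)) \<in> borel_measurable lborel" using k by measurable
  then have m: "(\<lambda>z. k z powr (q - p)) \<in> borel_measurable lebesgue" by (rule measurable_completion)
  have "set_integrable lebesgue S (\<lambda>z. k z powr (q - p) * (k z powr p * f z))"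
  proof (rule set_integrable_bounded_mult[OF f m, where C=1])
    show "\<bar>k z powr (q - p)\<bar> \<le> 1" if "z \<in> S" for z
      using S[OF that] pq by (simp add: powr_le1)
  qed
  moreover have "k z powr (q - p) * (k z powr p * f z) = k z powr q * f z" for z
    using powr_add[of "k z" "q - p" p] by simp
  ultimately show ?thesis by simp
qed

lemma initial_datum_mono: "initial_datum p ni \<Longrightarrow> p \<le> q \<Longrightarrow> initial_datum q ni"
  unfolding initial_datum_def by (auto intro!: set_integrable_larger_power[where k="\<lambda>x. x" and p=p])

lemma weak_solution_exp_mono:
  assumes "weak_solution_exp p ni n" "p \<le> q"
  shows "weak_solution_exp q ni n"
proof -
  have "set_integrable lebesgue ({0<..1} \<times> {0<..<T}) (\<lambda>z. fst z powr q * n z)" if "0 < T" for T :: real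
  proof (rule set_integrable_larger_power[where k=fst, OF _ _ _ assms(2)])
    show "set_integrable lebesgue ({0<..1} \<times> {0<..<T}) (\<lambda>z. fst z powr p * n z)"
      using assms(1) that by (simp add: weak_solution_exp_def)
    show "(fst :: real \<times> real \<Rightarrow> real) \<in> borel_measurable borel"
      by (intro borel_measurable_continuous_onI continuous_intros)
  qed auto
  then show ?thesis using assms(1) unfolding weak_solution_exp_def by blast
qed

text \<open>With the larger of the two exponents both functions satisfy the hypotheses of the stability estimate, whose
right-hand side is zero.\<close>

lemma weak_solution_unique:
  assumes "weak_solution ni n" "weak_solution ni m"
  shows "AE z in lebesgue. z \<in> Q \<longrightarrow> n z = m z"
proof -
  obtain p p' where p: "0 \<le> p" "initial_datum p ni" "weak_solution_exp p ni n" "weak_solution_exp p' ni m"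
    using assms unfolding weak_solution_def by blast
  define q where "q = max p p'"
  have q: "0 \<le> q" "initial_datum q ni" "weak_solution_exp q ni n" "weak_solution_exp q ni m"
    using p by (auto simp: q_def intro: initial_datum_mono weak_solution_exp_mono)
  obtain n' nx where N: "mild n' nx" and aen: "AE z in lborel. z \<in> Q \<longrightarrow> n z = n' z"
    by (rule weak_solution_imp_mild[OF q(3)])
  obtain m' mx where M: "mild m' mx" and aem: "AE z in lborel. z \<in> Q \<longrightarrow> m z = m' z"
    by (rule weak_solution_imp_mild[OF q(4)])
  have [measurable]: "n' \<in> borel_measurable borel" "m' \<in> borel_measurable borel"
    by (rule mild.n_meas[OF N] mild.n_meas[OF M])+
  let ?P = "\<lambda>z. z \<in> Q \<longrightarrow> n' z = m' z"
  have "AE t in lborel. 0 < t \<longrightarrow>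
      (\<integral>\<^sup>+x\<in>{0<..1}. ennreal (x powr q * \<bar>n (x, t) - m (x, t)\<bar>) \<partial>lebesgue) \<le> 0"
    using weak_solution_stability[OF q(1,2,2,3,4)] by (simp add: AE_lebesgue_iff)
  then have "AE t in lborel. AE x in lborel. ?P (x, t)"
    using AE_lborel_prodD2[OF aen] AE_lborel_prodD2[OF aem]
  proof eventually_elim
    case (elim t)
    show ?case
    proof (cases "0 < t")
      case True
      have [measurable]: "(\<lambda>x. n' (x, t)) \<in> borel_measurable borel" "(\<lambda>x. m' (x, t)) \<in> borel_measurable borel"
        by (rule slice_measurable(1); measurable)+
      have "(\<integral>\<^sup>+x\<in>{0<..1}. ennreal (x powr q * \<bar>n (x, t) - m (x, t)\<bar>) \<partial>lebesgue) =
        (\<integral>\<^sup>+x. ennreal (indicator {0<..1} x * (x powr q * \<bar>n' (x, t) - m' (x, t)\<bar>)) \<partial>lborel)"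
      proof (rule nn_integral_lebesgue_eq)
        show "AE x in lborel. ennreal (x powr q * \<bar>n (x, t) - m (x, t)\<bar>) * indicator {0<..1} x =
          ennreal (indicator {0<..1} x * (x powr q * \<bar>n' (x, t) - m' (x, t)\<bar>))"
          using elim(2,3)
        proof eventually_elim
          case (elim x)
          then show ?case using True by (cases "x \<in> {0<..1}") (auto simp: Q_def)
        qed
      qed measurable
      then have "(\<integral>\<^sup>+x. ennreal (indicator {0<..1} x * (x powr q * \<bar>n' (x, t) - m' (x, t)\<bar>)) \<partial>lborel) = 0"
        using elim(1) True by simp
      then have "AE x in lborel. ennreal (indicator {0<..1} x * (x powr q * \<bar>n' (x, t) - m' (x, t)\<bar>)) = 0"
        by (subst (asm) nn_integral_0_iff_AE) measurable
      then show ?thesis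
      proof eventually_elim
        case (elim x)
        show ?case
        proof
          assume "(x, t) \<in> Q"
          then have x: "x \<in> {0<..1}" by (simp add: Q_def)
          then have "x powr q * \<bar>n' (x, t) - m' (x, t)\<bar> \<le> 0" using elim by simp
          then show "n' (x, t) = m' (x, t)" using x by (simp add: mult_le_0_iff)
        qed
      qed
    qed (simp add: Q_def)
  qed
  moreover have "Measurable.pred borel ?P" using Q_sets by measurable
  ultimately have "AE z in lborel. ?P z"
    by (rule AE_lborel_prodI2)
  then have "AE z in lborel. z \<in> Q \<longrightarrow> n z = m z"
    using aen aem by eventually_elim simp
  then show ?thesis by (simp only: AE_lebesgue_iff)
qed

theorem corollary2p2:
  "(\<forall>(p::real) n\<^sub>i m\<^sub>i n m.
      0 \<le> p \<and> initial_datum p n\<^sub>i \<and> initial_datum p m\<^sub>i \<and>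
      weak_solution_exp p n\<^sub>i n \<and> weak_solution_exp p m\<^sub>i m \<longrightarrow>
      (AE t in lebesgue. 0 < t \<longrightarrow>
         (\<integral>\<^sup>+x\<in>{0<..1}. ennreal (x powr p * \<bar>n (x, t) - m (x, t)\<bar>) \<partial>lebesgue)
           \<le> ennreal (exp (p * (p + 3) * t)) *
             (\<integral>\<^sup>+x\<in>{0<..1}. ennreal (x powr p * \<bar>n\<^sub>i x - m\<^sub>i x\<bar>) \<partial>lebesgue))) \<and>
   (\<forall>n\<^sub>i. (\<exists>p\<ge>0. initial_datum p n\<^sub>i) \<longrightarrow>
      (\<forall>n m. weak_solution n\<^sub>i n \<and> weak_solution n\<^sub>i m \<longrightarrow>
         (AE z in lebesgue. z \<in> Q \<longrightarrow> n z = m z)))"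
  by (intro conjI allI impI) (blast intro: weak_solution_stability weak_solution_unique)+

end
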